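(* Consider a kernel-based spatial random graph (KSRG) on a unit-intensity Poisson point process with power-law marks, $\tau\in(2,\infty)$. Suppose that either the model is supercritical with $\zeta_{\mathrm{long}}>0$, or $\theta=0$. For $\rho\in(\theta,1)$ let $I(\rho):=(\tau-2)\lceil\mathrm{hubs}(\rho)\rceil$. Then for all $\rho\in(\theta,1)$, $$-\inf_{r\in(\rho,1)}I(r)\le\liminf_{n\to\infty}\frac{1}{\log n}\log\mathbb{P}\big(|\mathcal{C}_n^{(1)}|>\rho n\big)\le\limsup_{n\to\infty}\frac{1}{\log n}\log\mathbb{P}\big(|\mathcal{C}_n^{(1)}|>\rho n\big)\le-\inf_{r\in[\rho,1)}I(r).$$
   Context: KSRG model. Fix $d\ge1$ and parameters $\beta>0$, $p\in(0,1]$, $\alpha\in(1,\infty]$, $\tau\in(2,\infty)$, $\sigma\ge0$. Vertex locations form a unit-intensity Poisson point process on $\mathbb{R}^d$. Each vertex $u$, at location $x_u$, has an independent mark $w_u\ge1$ with $\mathbb{P}(w_u\ge w)=w^{-(\tau-1)}$ for $w\ge1$. The kernel $\kappa$ is either $\kappa_\sigma(w_1,w_2)=\max(w_1,w_2)\min(w_1,w_2)^\sigma$ or $\kappa_{\mathrm{sum}}(w_1,w_2)=(w_1^{1/d}+w_2^{1/d})^d$; in the latter case set $\sigma:=0$ in all formulas. Conditionally on the marked vertices, each pair $u\ne v$ is joined by an edge independently with probability $p\min\{1,\beta\kappa(w_u,w_v)/\|x_u-x_v\|^d\}^\alpha$ if $\alpha<\infty$, and $p\,\mathbf{1}\{\beta\kappa(w_u,w_v)\ge\|x_u-x_v\|^d\}$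 if $\alpha=\infty$ (Euclidean norm). $\Lambda_n=[-n^{1/d}/2,n^{1/d}/2]^d$; $\mathcal{C}_n^{(1)}$ is a largest connected component of the subgraph induced by the vertices located in $\Lambda_n$; $|\cdot|$ counts vertices. $\mathbb{P}^0$ (expectation $\mathbb{E}^0$) is the Palm measure under which the point process has a vertex at the origin, with random mark of the same law; $\mathcal{C}(0)$ is the component of that vertex in the infinite graph. $\theta=\theta(\beta):=\mathbb{P}^0(|\mathcal{C}(0)|=\infty)$, $\beta_c:=\inf\{\beta\ge0:\theta(\beta)>0\}$ (other parameters fixed); the model is supercritical if $\beta>\beta_c$. $\mathrm{hubs}$: let $H_{\mathcal{C}}(z):=\mathbb{E}^0[z^{|\mathcal{C}(0)|}\mathbf{1}\{|\mathcal{C}(0)|<\infty\}]$, $z\in(0,1]$, which is continuous, increasing, with range $(0,1-\theta]$, and let $H_{\mathcal{C}}^{(-1)}$ be its inverse. For $\rho\in(\theta,1)$, $$\mathrm{hubs}(\rho):=\frac{\log H_{\mathcal{C}}^{(-1)}(1-\rho)}{\log(1-p)}\ \text{ if }p<1,\qquad \mathrm{hubs}(\rho):=1\ \text{ if }p=1.$$ Exponents: $\zeta_{\mathrm{ll}}:=2-\alpha$, $\zeta_{\mathrm{hl}}:=(\tau-1)/\alpha-(\tau-2)$, $\zeta_{\mathrm{hh}}:=\frac{\sigma+2-\tau}{\sigma+1-(\tau-1)/\alpha}$ if $\tau\le\sigma+2$ and $\zeta_{\mathrm{hh}}:=\frac{\sigma+2-\tau}{\sigma+1}$ if $\tau>\sigma+2$,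 with the limit $\alpha\to\infty$ taken when $\alpha=\infty$ (so $\zeta_{\mathrm{ll}}=-\infty$, $\zeta_{\mathrm{hl}}=-(\tau-2)$). $\zeta_{\mathrm{long}}:=\max(0,\zeta_{\mathrm{ll}},\zeta_{\mathrm{hl}},\zeta_{\mathrm{hh}})$. *)

theory Defs
  imports "HOL-Probability.Probability"
begin

section \<open>Kernels and connection probabilities\<close>

datatype kernel = Kernel_prod real | Kernel_sum

fun kernel_sigma :: "kernel \<Rightarrow> real" where
  "kernel_sigma (Kernel_prod \<sigma>) = \<sigma>"
| "kernel_sigma Kernel_sum = 0"

fun kernel_fun :: "nat \<Rightarrow> kernel \<Rightarrow> real \<Rightarrow> real \<Rightarrow> real" where
  "kernel_fun d (Kernel_prod \<sigma>) w1 w2 = max w1 w2 * (min w1 w2) powr \<sigma>"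
| "kernel_fun d Kernel_sum w1 w2 = (w1 powr (1 / real d) + w2 powr (1 / real d)) ^ d"

text \<open>
  The value at \<open>x = y\<close> (where the division below yields \<open>0\<close>) is irrelevant: almost surely no
  two vertices have the same location.
\<close>

definition connection_prob ::
  "kernel \<Rightarrow> real \<Rightarrow> ereal \<Rightarrow> real \<Rightarrow> real ^ 'd \<Rightarrow> real \<Rightarrow> real ^ 'd \<Rightarrow> real \<Rightarrow> real" where
  "connection_prob K p \<alpha> \<beta> x w y v =
     (let \<kappa> = kernel_fun CARD('d) K w v; D = dist x y ^ CARD('d) in
      if \<alpha> = \<infinity> then p * (if \<beta> * \<kappa> \<ge> D then 1 else 0)
      else p * (min 1 (\<beta> * \<kappa> / D)) powr (real_of_ereal \<alpha>))"

section \<open>Marked Poisson environment\<close>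

text \<open>
  The Poisson points are enumerated as \<open>Point 0\<close>, \<open>Point 1\<close>, \dots; the label \<open>Root\<close> is reserved
  for the additional vertex at the origin that is present under the Palm measure only.
\<close>

datatype vertex = Root | Point nat

text \<open>
  Counts are taken over indices, so multiplicities are counted. Local finiteness is required
  because \<open>card\<close> of an infinite set is \<open>0\<close>.
\<close>

definition unit_poisson_process :: "'w measure \<Rightarrow> (nat \<Rightarrow> 'w \<Rightarrow> real ^ 'd) \<Rightarrow> bool" where
  "unit_poisson_process M X \<longleftrightarrow>
     (\<forall>i. X i \<in> borel_measurable M) \<and>
     (AE \<omega> in M. \<forall>B. bounded B \<longrightarrow> finite {i. X i \<omega> \<in> B}) \<and>
     (\<forall>B. B \<in> sets borel \<longrightarrow> bounded B \<longrightarrow>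
        (\<forall>k. measure M {\<omega> \<in> space M. card {i. X i \<omega> \<in> B} = k}
              = exp (- measure lborel B) * measure lborel B ^ k / fact k)) \<and>
     (\<forall>\<B>. finite \<B> \<longrightarrow> disjoint \<B> \<longrightarrow> (\<forall>B\<in>\<B>. B \<in> sets borel \<and> bounded B) \<longrightarrow>
        prob_space.indep_vars M (\<lambda>_. count_space UNIV) (\<lambda>B \<omega>. card {i. X i \<omega> \<in> B}) \<B>)"

text \<open>
  The variables \<open>U {u, v}\<close> are independent uniform labels of the unordered pairs of vertices.
  The pair is joined iff its label is at most the connection probability, which makes the
  edges conditionally independent with the prescribed probabilities given the locations and
  marks. Neither \<open>\<beta>\<close> nor the other kernel parameters enter the environment.
  The last conjunct says that locations, marks and pair labels are mutually independent:
  their joint law is the product of their laws (\<open>indep_var\<close> would force equal value types).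
\<close>

abbreviation vertex_pairs :: "vertex set set" where
  "vertex_pairs \<equiv> {e. card e = 2}"

definition ksrg_environment ::
  "real \<Rightarrow> 'w measure \<Rightarrow> (nat \<Rightarrow> 'w \<Rightarrow> real ^ 'd) \<Rightarrow> (vertex \<Rightarrow> 'w \<Rightarrow> real) \<Rightarrow>
   (vertex set \<Rightarrow> 'w \<Rightarrow> real) \<Rightarrow> bool" where
  "ksrg_environment \<tau> M X W U \<longleftrightarrow>
     prob_space M \<and>
     unit_poisson_process M X \<and>
     prob_space.indep_vars M (\<lambda>_. borel) W UNIV \<and>
     (\<forall>v. \<forall>w\<ge>1. measure M {\<omega> \<in> space M. W v \<omega> \<ge> w} = w powr (- (\<tau> - 1))) \<and>
     prob_space.indep_vars M (\<lambda>_. borel) U vertex_pairs \<and>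
     (\<forall>e\<in>vertex_pairs. distr M lborel (U e) = uniform_measure lborel {0..1}) \<and>
     (let \<X> = PiM UNIV (\<lambda>_. borel); \<W> = PiM UNIV (\<lambda>_. borel); \<U> = PiM vertex_pairs (\<lambda>_. borel);
          x = (\<lambda>\<omega> i. X i \<omega>); w = (\<lambda>\<omega> v. W v \<omega>); u = (\<lambda>\<omega>. \<lambda>e\<in>vertex_pairs. U e \<omega>)
      in distr M (\<X> \<Otimes>\<^sub>M (\<W> \<Otimes>\<^sub>M \<U>)) (\<lambda>\<omega>. (x \<omega>, w \<omega>, u \<omega>))
           = distr M \<X> x \<Otimes>\<^sub>M (distr M \<W> w \<Otimes>\<^sub>M distr M \<U> u))"

section \<open>The random graph\<close>

fun location :: "(nat \<Rightarrow> 'w \<Rightarrow> real ^ 'd) \<Rightarrow> 'w \<Rightarrow> vertex \<Rightarrow> real ^ 'd" where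
  "location X \<omega> Root = 0"
| "location X \<omega> (Point i) = X i \<omega>"

definition ksrg_edges ::
  "(nat \<Rightarrow> 'w \<Rightarrow> real ^ 'd) \<Rightarrow> (vertex \<Rightarrow> 'w \<Rightarrow> real) \<Rightarrow> (vertex set \<Rightarrow> 'w \<Rightarrow> real) \<Rightarrow>
   kernel \<Rightarrow> real \<Rightarrow> ereal \<Rightarrow> real \<Rightarrow> vertex set \<Rightarrow> 'w \<Rightarrow> (vertex \<times> vertex) set" where
  "ksrg_edges X W U K p \<alpha> \<beta> V \<omega> =
     {(u, v). u \<in> V \<and> v \<in> V \<and> u \<noteq> v \<and>
        U {u, v} \<omega> \<le> connection_prob K p \<alpha> \<beta> (location X \<omega> u) (W u \<omega>) (location X \<omega> v) (W v \<omega>)}"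

definition graph_component :: "(vertex \<times> vertex) set \<Rightarrow> vertex \<Rightarrow> vertex set" where
  "graph_component E u = {v. (u, v) \<in> E\<^sup>*}"

definition volume_box :: "real \<Rightarrow> (real ^ 'd) set" where
  "volume_box n = {x. \<forall>i. \<bar>x $ i\<bar> \<le> n powr (1 / real CARD('d)) / 2}"

definition box_vertices :: "(nat \<Rightarrow> 'w \<Rightarrow> real ^ 'd) \<Rightarrow> real \<Rightarrow> 'w \<Rightarrow> vertex set" where
  "box_vertices X n \<omega> = {v \<in> range Point. location X \<omega> v \<in> volume_box n}"

definition ecard :: "'a set \<Rightarrow> enat" where
  "ecard A = (if finite A then enat (card A) else \<infinity>)"

definition largest_component_size ::
  "(nat \<Rightarrow> 'w \<Rightarrow> real ^ 'd) \<Rightarrow> (vertex \<Rightarrow> 'w \<Rightarrow> real) \<Rightarrow> (vertex set \<Rightarrow> 'w \<Rightarrow> real) \<Rightarrow>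
   kernel \<Rightarrow> real \<Rightarrow> ereal \<Rightarrow> real \<Rightarrow> real \<Rightarrow> 'w \<Rightarrow> enat" where
  "largest_component_size X W U K p \<alpha> \<beta> n \<omega> =
     (let V = box_vertices X n \<omega>
      in SUP u\<in>V. ecard (graph_component (ksrg_edges X W U K p \<alpha> \<beta> V \<omega>) u))"

section \<open>Palm measure and percolation\<close>

text \<open>
  The Palm version of a Poisson process is obtained by adding a vertex at the origin
  (Slivnyak--Mecke). Hence the graph under the Palm measure has vertex set \<open>UNIV\<close>,
  in which \<open>Root\<close> carries an independent mark and independent pair labels.
\<close>

definition root_component ::
  "(nat \<Rightarrow> 'w \<Rightarrow> real ^ 'd) \<Rightarrow> (vertex \<Rightarrow> 'w \<Rightarrow> real) \<Rightarrow> (vertex set \<Rightarrow> 'w \<Rightarrow> real) \<Rightarrow>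
   kernel \<Rightarrow> real \<Rightarrow> ereal \<Rightarrow> real \<Rightarrow> 'w \<Rightarrow> vertex set" where
  "root_component X W U K p \<alpha> \<beta> \<omega> = graph_component (ksrg_edges X W U K p \<alpha> \<beta> UNIV \<omega>) Root"

definition theta ::
  "'w measure \<Rightarrow> (nat \<Rightarrow> 'w \<Rightarrow> real ^ 'd) \<Rightarrow> (vertex \<Rightarrow> 'w \<Rightarrow> real) \<Rightarrow> (vertex set \<Rightarrow> 'w \<Rightarrow> real) \<Rightarrow>
   kernel \<Rightarrow> real \<Rightarrow> ereal \<Rightarrow> real \<Rightarrow> real" where
  "theta M X W U K p \<alpha> \<beta> =
     measure M {\<omega> \<in> space M. infinite (root_component X W U K p \<alpha> \<beta> \<omega>)}"

text \<open>Extended-real valued, so that the infimum of the empty set is \<open>\<infinity>\<close>.\<close>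

definition beta_c ::
  "'w measure \<Rightarrow> (nat \<Rightarrow> 'w \<Rightarrow> real ^ 'd) \<Rightarrow> (vertex \<Rightarrow> 'w \<Rightarrow> real) \<Rightarrow> (vertex set \<Rightarrow> 'w \<Rightarrow> real) \<Rightarrow>
   kernel \<Rightarrow> real \<Rightarrow> ereal \<Rightarrow> ereal" where
  "beta_c M X W U K p \<alpha> = (INF \<beta>\<in>{\<beta>. 0 \<le> \<beta> \<and> theta M X W U K p \<alpha> \<beta> > 0}. ereal \<beta>)"

definition size_gen_fun ::
  "'w measure \<Rightarrow> (nat \<Rightarrow> 'w \<Rightarrow> real ^ 'd) \<Rightarrow> (vertex \<Rightarrow> 'w \<Rightarrow> real) \<Rightarrow> (vertex set \<Rightarrow> 'w \<Rightarrow> real) \<Rightarrow>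
   kernel \<Rightarrow> real \<Rightarrow> ereal \<Rightarrow> real \<Rightarrow> real \<Rightarrow> real" where
  "size_gen_fun M X W U K p \<alpha> \<beta> z =
     (\<integral>\<omega>. (let C = root_component X W U K p \<alpha> \<beta> \<omega> in if finite C then z ^ card C else 0) \<partial>M)"

definition hubs ::
  "'w measure \<Rightarrow> (nat \<Rightarrow> 'w \<Rightarrow> real ^ 'd) \<Rightarrow> (vertex \<Rightarrow> 'w \<Rightarrow> real) \<Rightarrow> (vertex set \<Rightarrow> 'w \<Rightarrow> real) \<Rightarrow>
   kernel \<Rightarrow> real \<Rightarrow> ereal \<Rightarrow> real \<Rightarrow> real \<Rightarrow> real" where
  "hubs M X W U K p \<alpha> \<beta> \<rho> =
     (if p < 1
      then ln (the_inv_into {0<..1} (size_gen_fun M X W U K p \<alpha> \<beta>) (1 - \<rho>)) / ln (1 - p)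
      else 1)"

definition rate ::
  "real \<Rightarrow> 'w measure \<Rightarrow> (nat \<Rightarrow> 'w \<Rightarrow> real ^ 'd) \<Rightarrow> (vertex \<Rightarrow> 'w \<Rightarrow> real) \<Rightarrow>
   (vertex set \<Rightarrow> 'w \<Rightarrow> real) \<Rightarrow> kernel \<Rightarrow> real \<Rightarrow> ereal \<Rightarrow> real \<Rightarrow> real \<Rightarrow> real" where
  "rate \<tau> M X W U K p \<alpha> \<beta> \<rho> = (\<tau> - 2) * of_int \<lceil>hubs M X W U K p \<alpha> \<beta> \<rho>\<rceil>"

section \<open>Exponents\<close>

text \<open>
  In extended-real arithmetic \<open>x / \<infinity> = 0\<close> for real \<open>x\<close>, so the formulas below
  evaluate at \<open>\<alpha> = \<infinity>\<close> to their limits as \<open>\<alpha>\<close> tends to infinity.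
\<close>

definition zeta_ll :: "ereal \<Rightarrow> ereal" where
  "zeta_ll \<alpha> = 2 - \<alpha>"

definition zeta_hl :: "ereal \<Rightarrow> real \<Rightarrow> ereal" where
  "zeta_hl \<alpha> \<tau> = ereal (\<tau> - 1) / \<alpha> - ereal (\<tau> - 2)"

definition zeta_hh :: "ereal \<Rightarrow> real \<Rightarrow> real \<Rightarrow> ereal" where
  "zeta_hh \<alpha> \<tau> \<sigma> =
     (if \<tau> \<le> \<sigma> + 2 then ereal (\<sigma> + 2 - \<tau>) / (ereal (\<sigma> + 1) - ereal (\<tau> - 1) / \<alpha>)
      else ereal ((\<sigma> + 2 - \<tau>) / (\<sigma> + 1)))"

definition zeta_long :: "ereal \<Rightarrow> real \<Rightarrow> real \<Rightarrow> ereal" where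
  "zeta_long \<alpha> \<tau> \<sigma> = Max {0, zeta_ll \<alpha>, zeta_hl \<alpha> \<tau>, zeta_hh \<alpha> \<tau> \<sigma>}"

section \<open>Logarithm of a probability\<close>

text \<open>The library's \<open>ln 0\<close> is \<open>0\<close>; here the logarithm of \<open>0\<close> is \<open>-\<infinity>\<close>.\<close>

definition log_prob :: "real \<Rightarrow> ereal" where
  "log_prob q = (if q > 0 then ereal (ln q) else - \<infinity>)"

definition scaled_log_prob ::
  "'w measure \<Rightarrow> (nat \<Rightarrow> 'w \<Rightarrow> real ^ 'd) \<Rightarrow> (vertex \<Rightarrow> 'w \<Rightarrow> real) \<Rightarrow> (vertex set \<Rightarrow> 'w \<Rightarrow> real) \<Rightarrow>
   kernel \<Rightarrow> real \<Rightarrow> ereal \<Rightarrow> real \<Rightarrow> real \<Rightarrow> real \<Rightarrow> ereal" where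
  "scaled_log_prob M X W U K p \<alpha> \<beta> \<rho> n =
     log_prob (measure M {\<omega> \<in> space M.
        ereal_of_enat (largest_component_size X W U K p \<alpha> \<beta> n \<omega>) > ereal (\<rho> * n)}) / ereal (ln n)"

end

theory Submission
 imports Defs "HOL-Real_Asymp.Real_Asymp"
begin

text \<open>
 Write \<open>H\<close> for the generating function of the cluster size. A vertex whose mark exceeds a multiple of the volume \<open>n\<close>
 is joined to each vertex of the box with probability \<open>p\<close>. Given \<open>j\<close> such hubs, a vertex is missed by the giant iff
 none of the vertices of its own cluster is joined to a hub, so the giant has density about \<open>1 - H ((1 - p) ^ j)\<close>, and
 \<open>j\<close> hubs have probability of order \<open>n powr (- (\<tau> - 2) * j)\<close>. Both bounds replace the clusters by components inside cubes
 of a fixed side length. For the lower bound Markov's inequality bounds the mass of the vertices that the hubs miss. For the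
 upper bound marks above \<open>n powr (1 - \<epsilon>)\<close> count as hubs: given that there are at most \<open>j\<close> of them, the number of small
 cube components that avoid the hubs is concentrated by Chernoff bounds, and the edges between cubes spoil few of these,
 because the connection probability decays faster than the inverse volume. The generating function enters the
 cubes by the Mecke formula, which follows from the finite-dimensional (Janossy) form of the Poisson process.
\<close>

section \<open>Chernoff bounds\<close>

text \<open>Two asymmetries shape the proof. The functions of the component size that occur,
  \<open>z ^ k\<close> and its truncation to \<open>k <= m\<close>, decrease in \<open>k\<close>,
  and cutting the graph down to a cube shrinks components. So a cube never carries less expected
  weight than the Palm value predicts; only the reverse bound, for the lower half, has to discard a
  boundary layer. The errors differ too: the lower half needs a set of locations of probability
  bounded below, which Markov's inequality gives, while the upper half needs every error except an
  excess of hubs to be superpolynomially small, hence sums of bounded independent terms.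

  The cap \<open>m\<close> is fixed before the side \<open>L\<close>: an endpoint of an edge between
  cubes spoils at most \<open>m\<close> counted vertices, and the density of such edges vanishes as
  \<open>L\<close> grows, because \<open>\<alpha> > 1\<close> and \<open>\<tau> > 2\<close> leave
  room for a decay exponent \<open>d * (1 + \<eta>)\<close> together with a finite mark moment of
  order \<open>1 + \<eta>\<close>.

  The open range of one infimum comes from strictness: the lower half needs a missed density
  strictly below \<open>1 - \<rho>\<close>.\<close>

context prob_space
begin

lemma expectation_exp_sum_indep:
 fixes Z :: "'i => 'a => real"
 assumes "finite I" "indep_vars (%_. borel) Z I"
  and b: "!!i om. i \<in> I ==> om \<in> space M ==> \<bar>Z i om\<bar> <= b"
 shows "integrable M (%om. exp (t * (\<Sum>i\<in>I. Z i om)))"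
  and "expectation (%om. exp (t * (\<Sum>i\<in>I. Z i om))) = (\<Prod>i\<in>I. expectation (%om. exp (t * Z i om)))"
proof -
 have meas: "random_variable borel (Z i)" if "i \<in> I" for i
  using assms(2) that unfolding indep_vars_def by auto
 have ind: "indep_vars (%_. borel) (%i om. exp (t * Z i om)) I"
  by (rule indep_vars_compose2[OF assms(2)]) measurable
 have int: "integrable M (%om. exp (t * Z i om))" if "i \<in> I" for i
 proof (rule integrable_const_bound[of _ "exp (\<bar>t\<bar> * b)"])
  show "AE om in M. norm (exp (t * Z i om)) <= exp (\<bar>t\<bar> * b)"
  proof (rule AE_I2)
   fix om assume "om \<in> space M"
   have "t * Z i om <= \<bar>t\<bar> * \<bar>Z i om\<bar>" by (metis abs_ge_self abs_mult)
   also have "... <= \<bar>t\<bar> * b" using b[OF that \<open>om \<in> space M\<close>] by (intro mult_left_mono) auto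
   finally show "norm (exp (t * Z i om)) <= exp (\<bar>t\<bar> * b)" by simp
  qed
 qed (use meas[OF that] in measurable)
 have eq: "exp (t * (\<Sum>i\<in>I. Z i om)) = (\<Prod>i\<in>I. exp (t * Z i om))" for om
  using assms(1) by (simp add: sum_distrib_left exp_sum)
 show "integrable M (%om. exp (t * (\<Sum>i\<in>I. Z i om)))"
  unfolding eq by (rule indep_vars_integrable[OF assms(1) ind int])
 show "expectation (%om. exp (t * (\<Sum>i\<in>I. Z i om))) = (\<Prod>i\<in>I. expectation (%om. exp (t * Z i om)))"
  unfolding eq by (rule indep_vars_lebesgue_integral[OF assms(1) ind int])
qed

text \<open>The bound involves only the range \<open>b\<close> and the slack \<open>s\<close>, not
  the number or the variances of the summands: the tilt \<open>t = d / b\<close> keeps every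
  exponent below \<open>d <= 1\<close>, where the quadratic term of the exponential is at most
  \<open>d\<close> times the linear one and becomes an extra factor \<open>1 + d\<close> on the
  mean.\<close>

lemma chernoff_upper:
 fixes Z :: "'i => 'a => real"
 assumes "finite I" "indep_vars (%_. borel) Z I"
  and Z: "!!i om. i \<in> I ==> om \<in> space M ==> 0 <= Z i om & Z i om <= b"
  and "b > 0" "0 < d" "d <= 1" and m: "(\<Sum>i\<in>I. expectation (Z i)) <= m"
 shows "prob {om \<in> space M. (\<Sum>i\<in>I. Z i om) \<ge> (1 + d) * m + s} <= exp (- (d * s / b))"
proof -
 define t where "t = d / b"
 have t: "t > 0" using assms by (simp add: t_def)
 have meas: "random_variable borel (Z i)" if "i \<in> I" for i
  using assms(2) that unfolding indep_vars_def by auto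
 have Zb: "\<bar>Z i om\<bar> <= b" if "i \<in> I" "om \<in> space M" for i om
  using Z[OF that] by auto
 have E: "integrable M (%om. exp (t * (\<Sum>i\<in>I. Z i om)))"
  "expectation (%om. exp (t * (\<Sum>i\<in>I. Z i om))) = (\<Prod>i\<in>I. expectation (%om. exp (t * Z i om)))"
  by (rule expectation_exp_sum_indep[OF assms(1,2)]; use Zb in blast)+
 have int: "integrable M (Z i)" if "i \<in> I" for i
  by (rule integrable_const_bound[of _ b]) (use Zb[OF that] meas[OF that] in auto)
 have intexp: "integrable M (%om. exp (t * Z i om))" if "i \<in> I" for i
 proof (rule integrable_const_bound[of _ "exp (t * b)"])
  show "AE om in M. norm (exp (t * Z i om)) <= exp (t * b)"
   using Z[OF that] t by (intro AE_I2) (auto intro!: mult_left_mono)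
 qed (use meas[OF that] in measurable)
 have one: "expectation (%om. exp (t * Z i om)) <= exp (t * (1 + d) * expectation (Z i))" if i: "i \<in> I" for i
 proof -
  have "expectation (%om. exp (t * Z i om)) <= expectation (%om. 1 + t * (1 + d) * Z i om)"
  proof (rule integral_mono[OF intexp[OF i]])
   fix om assume w: "om \<in> space M"
   have 1: "0 <= t * Z i om" "t * Z i om <= d"
    using Z[OF i w] t \<open>b > 0\<close> \<open>0 < d\<close> by (auto simp: t_def field_simps)
   have "exp (t * Z i om) <= 1 + t * Z i om + (t * Z i om)\<^sup>2"
    using 1 \<open>d <= 1\<close> by (intro exp_bound) auto
   also have "(t * Z i om)\<^sup>2 <= d * (t * Z i om)"
    unfolding power2_eq_square using 1 by (intro mult_right_mono) auto
   finally show "exp (t * Z i om) <= 1 + t * (1 + d) * Z i om"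
    by (simp add: algebra_simps)
  qed (use int[OF i] in simp)
  also have "... = 1 + t * (1 + d) * expectation (Z i)"
   using int[OF i] by (simp add: prob_space)
  also have "... <= exp (t * (1 + d) * expectation (Z i))"
   by (rule exp_ge_add_one_self)
  finally show ?thesis .
 qed
 have "prob {om \<in> space M. (\<Sum>i\<in>I. Z i om) \<ge> (1 + d) * m + s}
   = prob {om \<in> space M. exp (t * (\<Sum>i\<in>I. Z i om)) \<ge> exp (t * ((1 + d) * m + s))}"
  using t by (intro arg_cong[where f=prob]) auto
 also have "... <= expectation (%om. exp (t * (\<Sum>i\<in>I. Z i om))) / exp (t * ((1 + d) * m + s))"
  by (rule integral_Markov_inequality_measure[OF E(1), where A="{}"]) auto
 also have "expectation (%om. exp (t * (\<Sum>i\<in>I. Z i om))) <= (\<Prod>i\<in>I. exp (t * (1 + d) * expectation (Z i)))"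
  unfolding E(2) by (intro prod_mono conjI one integral_nonneg) auto
 also have "... = exp (t * (1 + d) * (\<Sum>i\<in>I. expectation (Z i)))"
  using assms(1) by (simp add: exp_sum sum_distrib_left)
 also have "... <= exp (t * (1 + d) * m)"
  using m t \<open>0 < d\<close> by simp
 also have "exp (t * (1 + d) * m) / exp (t * ((1 + d) * m + s)) = exp (- (d * s / b))"
  by (simp add: exp_diff[symmetric] t_def algebra_simps add_divide_distrib diff_divide_distrib)
 finally show ?thesis by (simp add: divide_right_mono)
qed

lemma chernoff_lower:
 fixes Z :: "'i => 'a => real"
 assumes "finite I" "indep_vars (%_. borel) Z I"
  and Z: "!!i om. i \<in> I ==> om \<in> space M ==> 0 <= Z i om & Z i om <= b"
  and "b > 0" "0 < d" "d <= 1" and m: "m <= (\<Sum>i\<in>I. expectation (Z i))"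
 shows "prob {om \<in> space M. (\<Sum>i\<in>I. Z i om) <= (1 - d) * m - s} <= exp (- (d * s / b))"
proof -
 define t where "t = d / b"
 have t: "t > 0" using assms by (simp add: t_def)
 have meas: "random_variable borel (Z i)" if "i \<in> I" for i
  using assms(2) that unfolding indep_vars_def by auto
 have Zb: "\<bar>Z i om\<bar> <= b" if "i \<in> I" "om \<in> space M" for i om
  using Z[OF that] by auto
 have E: "integrable M (%om. exp (-t * (\<Sum>i\<in>I. Z i om)))"
  "expectation (%om. exp (-t * (\<Sum>i\<in>I. Z i om))) = (\<Prod>i\<in>I. expectation (%om. exp (-t * Z i om)))"
  by (rule expectation_exp_sum_indep[OF assms(1,2)]; use Zb in blast)+
 have int: "integrable M (Z i)" if "i \<in> I" for i
  by (rule integrable_const_bound[of _ b]) (use Zb[OF that] meas[OF that] in auto)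
 have intexp: "integrable M (%om. exp (-t * Z i om))" if "i \<in> I" for i
 proof (rule integrable_const_bound[of _ 1])
  show "AE om in M. norm (exp (-t * Z i om)) <= 1"
   using Z[OF that] t by (intro AE_I2) (auto intro!: mult_nonneg_nonneg)
 qed (use meas[OF that] in measurable)
 have one: "expectation (%om. exp (-t * Z i om)) <= exp (- t * (1 - d) * expectation (Z i))" if i: "i \<in> I" for i
 proof -
  have "expectation (%om. exp (-t * Z i om)) <= expectation (%om. 1 - t * (1 - d) * Z i om)"
  proof (rule integral_mono[OF intexp[OF i]])
   fix om assume w: "om \<in> space M"
   define q where "q = t * Z i om"
   have 1: "0 <= q" "q <= d"
    using Z[OF i w] t \<open>b > 0\<close> \<open>0 < d\<close> by (auto simp: t_def field_simps q_def)
   \<comment> \<open>The exponent is negative here, so the quadratic estimate goes through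
     \<open>exp (- q) <= 1 / (1 + q) <= 1 - q + q\<^sup>2\<close>.\<close>
   have "(1 - q + q\<^sup>2) * (1 + q) = 1 + q ^ 3"
    by (simp add: algebra_simps power2_eq_square power3_eq_cube)
   hence a: "1 / (1 + q) <= 1 - q + q\<^sup>2"
    using 1 by (simp add: field_simps)
   have "exp (- q) <= 1 / (1 + q)"
    using 1 exp_ge_add_one_self[of q] by (simp add: exp_minus inverse_eq_divide frac_le)
   also note a
   also have "q\<^sup>2 <= d * q"
    unfolding power2_eq_square using 1 by (intro mult_right_mono) auto
   finally show "exp (-t * Z i om) <= 1 - t * (1 - d) * Z i om"
    by (simp add: algebra_simps q_def)
  qed (use int[OF i] in simp)
  also have "... = 1 + (- t * (1 - d) * expectation (Z i))"
   using int[OF i] by (simp add: prob_space)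
  also have "... <= exp (- t * (1 - d) * expectation (Z i))"
   by (rule exp_ge_add_one_self)
  finally show ?thesis .
 qed
 have "prob {om \<in> space M. (\<Sum>i\<in>I. Z i om) <= (1 - d) * m - s}
   = prob {om \<in> space M. exp (-t * (\<Sum>i\<in>I. Z i om)) \<ge> exp (-t * ((1 - d) * m - s))}"
  using t by (intro arg_cong[where f=prob]) auto
 also have "... <= expectation (%om. exp (-t * (\<Sum>i\<in>I. Z i om))) / exp (-t * ((1 - d) * m - s))"
  by (rule integral_Markov_inequality_measure[OF E(1), where A="{}"]) auto
 also have "expectation (%om. exp (-t * (\<Sum>i\<in>I. Z i om))) <= (\<Prod>i\<in>I. exp (-t * (1 - d) * expectation (Z i)))"
  unfolding E(2) by (intro prod_mono conjI one integral_nonneg) auto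
 also have "... = exp (-t * (1 - d) * (\<Sum>i\<in>I. expectation (Z i)))"
  using assms(1) by (simp add: exp_sum sum_distrib_left)
 also have "... <= exp (-t * (1 - d) * m)"
  using m t \<open>d <= 1\<close> by (simp add: mult_left_mono)
 also have "exp (-t * (1 - d) * m) / exp (-t * ((1 - d) * m - s)) = exp (- (d * s / b))"
  by (simp add: exp_diff[symmetric] t_def algebra_simps add_divide_distrib diff_divide_distrib)
 finally show ?thesis by (simp add: divide_right_mono)
qed

end

section \<open>Graphs with labelled edges\<close>

text \<open>Locations, marks and labels are plain functions and the connection probability
  \<open>c\<close> is arbitrary, so that the labels can be integrated out while the locations are
  frozen, and the cut-off \<open>conn\<close> can later replace
  \<open>connection_prob\<close>.\<close>

definition label_edges ::
 "('e => real => 'e => real => real) => (vertex => 'e) => (vertex => real) => (vertex set => real) =>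
 vertex set => (vertex \<times> vertex) set" where
 "label_edges c y w u V = {(a, b). a \<in> V & b \<in> V & a ~= b & u {a, b} <= c (y a) (w a) (y b) (w b)}"

abbreviation comp_of where
 "comp_of c y w u V v \<equiv> graph_component (label_edges c y w u V) v"

lemma ksrg_edges_eq_label_edges:
 "ksrg_edges X W U K p \<alpha> \<beta> V om =
  label_edges (connection_prob K p \<alpha> \<beta>) (location X om) (%v. W v om) (%e. U e om) V"
 by (simp add: ksrg_edges_def label_edges_def)

lemma graph_component_self: "v \<in> graph_component E v"
 by (simp add: graph_component_def)

lemma graph_component_subset:
 assumes "E \<subseteq> V \<times> V" "v \<in> V"
 shows "graph_component E v \<subseteq> V"
 using assms by (auto simp: graph_component_def elim: rtranclE)

lemma comp_of_subset: "v \<in> V ==> comp_of c y w u V v \<subseteq> V"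
 by (rule graph_component_subset) (auto simp: label_edges_def)

lemma graph_component_mono: "E \<subseteq> E' ==> graph_component E v \<subseteq> graph_component E' v"
 unfolding graph_component_def using rtrancl_mono by blast

lemma label_edges_mono: "V \<subseteq> V' ==> label_edges c y w u V \<subseteq> label_edges c y w u V'"
 by (auto simp: label_edges_def)

lemma comp_of_mono: "V \<subseteq> V' ==> comp_of c y w u V v \<subseteq> comp_of c y w u V' v"
 by (intro graph_component_mono label_edges_mono)

lemma label_edges_cong:
 assumes "!!a. a \<in> V ==> y a = y' a" "!!a. a \<in> V ==> w a = w' a"
  "!!a b. a \<in> V ==> b \<in> V ==> a ~= b ==> u {a, b} = u' {a, b}"
 shows "label_edges c y w u V = label_edges c y' w' u' V"
 unfolding label_edges_def using assms by auto

lemma graph_component_closed: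
 assumes "S \<subseteq> graph_component E v" "v \<in> S" "!!a b. a \<in> S ==> (a, b) \<in> E ==> b \<in> S"
 shows "graph_component E v = S"
proof -
 have "b \<in> S" if "(v, b) \<in> E\<^sup>*" for b
  using that by (induction) (use assms in auto)
 thus ?thesis using assms(1) by (auto simp: graph_component_def)
qed

lemma graph_component_sym_eq:
 assumes "sym E" "a \<in> graph_component E v"
 shows "graph_component E a = graph_component E v"
proof -
 have "sym (E\<^sup>*)" using assms(1) by (rule sym_rtrancl)
 thus ?thesis using assms(2) unfolding graph_component_def
  by (auto dest: symD intro: rtrancl_trans)
qed

lemma sym_label_edges:
 assumes "!!y w y' w'. c y w y' w' = c y' w' y w"
 shows "sym (label_edges c y w u V)"
 by (rule symI) (auto simp: label_edges_def insert_commute assms)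

lemma label_edges_reindex:
 assumes "inj_on f V" "!!a. a \<in> V ==> y' (f a) = y a"
 shows "label_edges c y' w u (f ` V) = map_prod f f ` label_edges c y (w \<circ> f) (%e. u (f ` e)) V"
proof (intro equalityI subsetI)
 fix e assume "e \<in> label_edges c y' w u (f ` V)"
 then obtain a b where e: "e = (f a, f b)" "a \<in> V" "b \<in> V" "f a ~= f b"
   "u {f a, f b} <= c (y' (f a)) (w (f a)) (y' (f b)) (w (f b))"
  by (auto simp: label_edges_def)
 hence "(a, b) \<in> label_edges c y (w \<circ> f) (%e. u (f ` e)) V"
  using assms(2) by (auto simp: label_edges_def)
 thus "e \<in> map_prod f f ` label_edges c y (w \<circ> f) (%e. u (f ` e)) V"
  using e(1) by force
next
 fix e assume "e \<in> map_prod f f ` label_edges c y (w \<circ> f) (%e. u (f ` e)) V"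
 thus "e \<in> label_edges c y' w u (f ` V)"
  using assms by (auto simp: label_edges_def dest: inj_onD)
qed

lemma comp_of_reindex:
 assumes inj: "inj_on f V" and y: "!!a. a \<in> V ==> y' (f a) = y a" and v: "v \<in> V"
 shows "comp_of c y' w u (f ` V) (f v) = f ` comp_of c y (w \<circ> f) (%e. u (f ` e)) V v"
proof (rule graph_component_closed)
 let ?E = "label_edges c y (w \<circ> f) (%e. u (f ` e)) V"
 let ?E' = "label_edges c y' w u (f ` V)"
 have E': "?E' = map_prod f f ` ?E" by (rule label_edges_reindex) (use assms in auto)
 have "(f v, f b) \<in> ?E'\<^sup>*" if "(v, b) \<in> ?E\<^sup>*" for b
  using that
 proof induction
  case (step b b')
  hence "(f b, f b') \<in> ?E'" by (auto simp: E')
  with step show ?case by auto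
 qed auto
 thus "f ` graph_component ?E v \<subseteq> graph_component ?E' (f v)"
  by (auto simp: graph_component_def)
 show "f v \<in> f ` graph_component ?E v" by (auto intro: graph_component_self)
 fix a b assume "a \<in> f ` graph_component ?E v" "(a, b) \<in> ?E'"
 then obtain a' a'' b'' where *: "a = f a'" "(v, a') \<in> ?E\<^sup>*" "(a'', b'') \<in> ?E" "a = f a''" "b = f b''"
  unfolding E' graph_component_def by (elim imageE) (auto simp: map_prod_def)
 have "a' \<in> V" using comp_of_subset[OF v, of c y "w \<circ> f" "%e. u (f ` e)"] *(2)
  unfolding graph_component_def by blast
 moreover have "a'' \<in> V" using *(3) by (auto simp: label_edges_def)
 ultimately have "a' = a''" using inj * by (auto dest: inj_onD)
 hence "(v, b'') \<in> ?E\<^sup>*" using * by auto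
 thus "b \<in> f ` graph_component ?E v" using * by (auto simp: graph_component_def)
qed

text \<open>The indices carried by the Poisson points of a region are arbitrary, while the formulas
  for finitely many points use a fixed index set; component sizes do not see the renaming
  \<open>f\<close>.\<close>

lemma card_comp_of_reindex:
 assumes inj: "inj_on f V" and y: "!!a. a \<in> V ==> y' (f a) = y a" and v: "v \<in> V"
 shows "card (comp_of c y' w u (f ` V) (f v)) = card (comp_of c y (w \<circ> f) (%e. u (f ` e)) V v)"
proof -
 have "comp_of c y' w u (f ` V) (f v) = f ` comp_of c y (w \<circ> f) (%e. u (f ` e)) V v"
  by (rule comp_of_reindex) (use assms in auto)
 thus ?thesis using comp_of_subset[OF v] inj by (metis card_image inj_on_subset)
qed

section \<open>Measurability\<close>

instance vertex :: countable
 by countable_datatype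

text \<open>A walk has finitely many steps and the vertices are countable, so reachability is a
  countable union of measurable events.\<close>

lemma measurable_rtrancl_pred:
 fixes E :: "'a => ('b::countable \<times> 'b) set"
 assumes "!!a b. Measurable.pred N (%om. (a, b) \<in> E om)"
 shows "Measurable.pred N (%om. (a, b) \<in> (E om)\<^sup>*)"
proof -
 have "Measurable.pred N (%om. (a, b) \<in> (E om) ^^ n)" for n b
 proof (induction n arbitrary: b)
  case (Suc n)
  have "(%om. (a, b) \<in> (E om) ^^ Suc n) = (%om. \<exists>c. (a, c) \<in> (E om) ^^ n & (c, b) \<in> E om)"
   by auto
  thus ?case using Suc assms by (simp only:) measurable
 qed (auto simp: )
 hence "Measurable.pred N (%om. \<exists>n. (a, b) \<in> (E om) ^^ n)" by measurable
 thus ?thesis by (simp add: rtrancl_is_UN_relpow)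
qed

text \<open>Finiteness means that some list enumerates the set; lists over a countable type are
  countable, so this quantifier is a countable union.\<close>

lemma measurable_card_countable:
 fixes S :: "'a => 'b::countable set"
 assumes S: "!!a. Measurable.pred N (%om. a \<in> S om)"
 shows "Measurable.pred N (%om. finite (S om))"
  and "(%om. card (S om)) \<in> measurable N (count_space UNIV)"
  and "Measurable.pred N (%om. P (S om) & finite (S om))"
proof -
 have 1: "finite (S om) \<longleftrightarrow> (\<exists>xs::'b list. \<forall>a. a \<in> S om \<longleftrightarrow> a \<in> set xs)" for om
  by (metis finite_list List.finite_set set_eqI)
 show fin: "Measurable.pred N (%om. finite (S om))"
  unfolding 1 using S by measurable
 have 2: "(P (S om) & finite (S om)) \<longleftrightarrow> (\<exists>xs\<in>{xs::'b list. P (set xs)}. \<forall>a. a \<in> S om \<longleftrightarrow> a \<in> set xs)" for om P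
  by (auto, metis finite_list, metis set_eqI, metis List.finite_set finite_subset subsetI)
 show P: "Measurable.pred N (%om. P (S om) & finite (S om))" for P
  unfolding 2 using S by measurable
 have "{om \<in> space N. card (S om) = k} \<in> sets N" for k
 proof -
  \<comment> \<open>\<open>card\<close> of an infinite set is 0, so the level \<open>k = 0\<close>
    also collects the infinite sets.\<close>
  have "{om \<in> space N. card (S om) = k} =
   {om \<in> space N. card (S om) = k & finite (S om)} \<union> {om \<in> space N. \<not> finite (S om) & k = 0}"
   by (auto intro: card_ge_0_finite)
  moreover have "{om \<in> space N. card (S om) = k & finite (S om)} \<in> sets N"
   using P[of "%A. card A = k"] by measurable
  moreover have "{om \<in> space N. \<not> finite (S om) & k = 0} \<in> sets N"
   using fin by measurable
  ultimately show ?thesis by simp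
 qed
 thus "(%om. card (S om)) \<in> measurable N (count_space UNIV)"
  by (auto simp: measurable_count_space_eq2_countable vimage_def Int_def conj_commute)
qed

lemma measurable_label_edges:
 fixes c :: "(real ^ 'd) => real => (real ^ 'd) => real => real"
 assumes c: "(%(y, w, y', w'). c y w y' w') \<in> borel_measurable (borel \<Otimes>\<^sub>M borel \<Otimes>\<^sub>M borel \<Otimes>\<^sub>M borel)"
  and "!!a. (%om. y om a) \<in> borel_measurable N" "!!a. (%om. w om a) \<in> borel_measurable N"
   "!!e. e \<in> vertex_pairs ==> (%om. u om e) \<in> borel_measurable N"
   "!!a. Measurable.pred N (%om. a \<in> V om)"
 shows "Measurable.pred N (%om. (a, b) \<in> label_edges c (y om) (w om) (u om) (V om))"
proof (cases "a = b")
 case False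
 hence "{a, b} \<in> vertex_pairs" by simp
 hence [measurable]: "(%om. u om {a, b}) \<in> borel_measurable N" using assms by blast
 have [measurable]: "(%om. y om a) \<in> borel_measurable N" "(%om. w om a) \<in> borel_measurable N"
  "Measurable.pred N (%om. a \<in> V om)" for a using assms by auto
 have [measurable]: "(%om. c (y om a) (w om a) (y om b) (w om b)) \<in> borel_measurable N"
  using measurable_compose[OF _ c, of "%om. (y om a, w om a, y om b, w om b)" N] by simp
 show ?thesis using False unfolding label_edges_def by simp
qed (simp add: label_edges_def)

lemma measurable_comp_of:
 fixes c :: "(real ^ 'd) => real => (real ^ 'd) => real => real"
 assumes "(%(y, w, y', w'). c y w y' w') \<in> borel_measurable (borel \<Otimes>\<^sub>M borel \<Otimes>\<^sub>M borel \<Otimes>\<^sub>M borel)"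
  and "!!a. (%om. y om a) \<in> borel_measurable N" "!!a. (%om. w om a) \<in> borel_measurable N"
   "!!e. e \<in> vertex_pairs ==> (%om. u om e) \<in> borel_measurable N"
   "!!a. Measurable.pred N (%om. a \<in> V om)"
 shows "Measurable.pred N (%om. b \<in> comp_of c (y om) (w om) (u om) (V om) a)"
 unfolding graph_component_def mem_Collect_eq
 by (rule measurable_rtrancl_pred, rule measurable_label_edges[OF assms])

section \<open>The space of marks and pair labels\<close>

abbreviation unit_uniform :: "real measure" where
 "unit_uniform \<equiv> uniform_measure lborel {0..1}"

definition label_space :: "real measure => ((vertex => real) \<times> (vertex set => real)) measure" where
 "label_space \<mu> = PiM UNIV (%_. \<mu>) \<Otimes>\<^sub>M PiM vertex_pairs (%_. unit_uniform)"

text \<open>Marks and pair labels share one sum type of indices, so that independence of blocks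
  containing both kinds is a single statement about disjoint index sets.\<close>

definition label :: "vertex + vertex set => (vertex => real) \<times> (vertex set => real) => real" where
 "label i r = (case i of Inl v => fst r v | Inr e => snd r e)"

lemma label_simps[simp]: "label (Inl v) r = fst r v" "label (Inr e) r = snd r e"
 by (simp_all add: label_def)

definition label_index :: "(vertex + vertex set) set" where
 "label_index = Inl ` UNIV \<union> Inr ` vertex_pairs"

lemma label_index_simps[simp]: "Inl v \<in> label_index" "Inr e \<in> label_index \<longleftrightarrow> card e = 2"
 by (auto simp: label_index_def)

definition pairs_in :: "vertex set => vertex set set" where
 "pairs_in V = {e \<in> vertex_pairs. e \<subseteq> V}"

definition labels_on :: "(vertex + vertex set) set => (vertex => real) \<times> (vertex set => real) => vertex + vertex set => real" where
 "labels_on K r = (\<lambda>i\<in>K. label i r)"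

text \<open>Reading a partial assignment with default 0 makes a component a function of the labels
  in \<open>K\<close> alone, hence measurable on that block; \<open>comp_of_labels_on\<close> shows
  that the default is never met when \<open>K\<close> covers the marks and pairs of
  \<open>V\<close>.\<close>

definition mark_of :: "(vertex + vertex set) set => (vertex + vertex set => real) => vertex => real" where
 "mark_of K z v = (if Inl v \<in> K then z (Inl v) else 0)"

definition pair_of :: "(vertex + vertex set) set => (vertex + vertex set => real) => vertex set => real" where
 "pair_of K z e = (if Inr e \<in> K then z (Inr e) else 0)"

lemma prob_space_unit_uniform: "prob_space unit_uniform"
 by (rule prob_space_uniform_measure) auto

lemma measure_unit_uniform_greater:
 assumes "0 <= q" "q <= 1"
 shows "measure unit_uniform {q<..} = 1 - q"
proof -
 have "{0..1} \<inter> {q<..} = {q<..(1::real)}" using assms by auto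
 thus ?thesis using assms by (simp add: measure_uniform_measure)
qed

lemma measure_unit_uniform_atMost:
 assumes "0 <= q" "q <= 1"
 shows "measure unit_uniform {..q} = q"
proof -
 have "{0..1} \<inter> {..q} = {0..q}" using assms by auto
 thus ?thesis using assms by (simp add: measure_uniform_measure)
qed

lemma measurable_mark_of: "(%z. mark_of K z v) \<in> borel_measurable (PiM K (%_. borel))"
 by (cases "Inl v \<in> K") (auto simp: mark_of_def)

lemma measurable_pair_of: "(%z. pair_of K z e) \<in> borel_measurable (PiM K (%_. borel))"
 by (cases "Inr e \<in> K") (auto simp: pair_of_def)

lemma comp_of_labels_on:
 assumes "Inl ` V \<union> Inr ` pairs_in V \<subseteq> K"
 shows "comp_of c y (mark_of K (labels_on K r)) (pair_of K (labels_on K r)) V v = comp_of c y (fst r) (snd r) V v"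
proof -
 have "label_edges c y (mark_of K (labels_on K r)) (pair_of K (labels_on K r)) V = label_edges c y (fst r) (snd r) V"
 proof (rule label_edges_cong)
  fix a b assume "a \<in> V" "b \<in> V" "a ~= b"
  hence "{a, b} \<in> pairs_in V" by (auto simp: pairs_in_def)
  hence "Inr {a, b} \<in> K" using assms by blast
  thus "pair_of K (labels_on K r) {a, b} = snd r {a, b}"
   by (simp add: pair_of_def labels_on_def)
 qed (use assms in \<open>auto simp: mark_of_def labels_on_def\<close>)
 thus ?thesis by simp
qed

section \<open>Independence of marks and pair labels\<close>

locale mark_law =
 fixes \<mu> :: "real measure"
 assumes prob_space_mark: "prob_space \<mu>" and sets_mark: "sets \<mu> = sets borel"
begin

abbreviation "R \<equiv> label_space \<mu>"
abbreviation "PW \<equiv> PiM (UNIV :: vertex set) (%_. \<mu>)"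
abbreviation "PU \<equiv> PiM vertex_pairs (%_. unit_uniform)"

sublocale mark: prob_space \<mu> by (rule prob_space_mark)

sublocale PW: product_prob_space "%_. \<mu>" "UNIV :: vertex set"
 by standard

sublocale PU: product_prob_space "%_. unit_uniform" "vertex_pairs"
 by (intro product_prob_spaceI prob_space_unit_uniform)

sublocale R: pair_prob_space PW PU ..

lemma prob_space_R: "prob_space R"
 unfolding label_space_def by (rule R.P.prob_space_axioms)

sublocale labels: prob_space R by (rule prob_space_R)

lemma space_mark: "space \<mu> = UNIV"
 using sets_eq_imp_space_eq[OF sets_mark] by simp

lemma measurable_into_mark: "f \<in> measurable N \<mu> ==> f \<in> borel_measurable N"
 by (simp add: measurable_cong_sets[OF refl sets_mark])

lemma space_R: "space R = UNIV \<times> (vertex_pairs \<rightarrow>\<^sub>E UNIV)"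
 by (auto simp: label_space_def space_pair_measure space_PiM space_mark)

lemma measurable_mark[measurable]: "(%r. fst r v) \<in> borel_measurable R"
proof -
 have "(%w. w v) \<in> measurable PW \<mu>" by measurable
 hence "(%w. w v) \<in> borel_measurable PW" by (rule measurable_into_mark)
 hence "(%r. (fst r) v) \<in> borel_measurable (PW \<Otimes>\<^sub>M PU)"
  by (rule measurable_compose[OF measurable_fst])
 thus ?thesis by (simp add: label_space_def)
qed

lemma measurable_pair_label:
 assumes "e \<in> vertex_pairs" shows "(%r. snd r e) \<in> borel_measurable R"
proof -
 have "(%u. u e) \<in> measurable PU unit_uniform" using assms by measurable
 hence "(%u. u e) \<in> borel_measurable PU" by (simp cong: measurable_cong_sets)
 hence "(%r. (snd r) e) \<in> borel_measurable (PW \<Otimes>\<^sub>M PU)"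
  by (rule measurable_compose[OF measurable_snd])
 thus ?thesis by (simp add: label_space_def)
qed

lemma measurable_label: "i \<in> label_index ==> label i \<in> borel_measurable R"
 using measurable_mark measurable_pair_label by (cases i) (auto simp: label_def[abs_def])

lemma prob_labels:
 assumes "finite J" "finite F" "F \<subseteq> vertex_pairs"
  "!!v. v \<in> J ==> A v \<in> sets borel" "!!e. e \<in> F ==> B e \<in> sets borel"
 shows "labels.prob {r \<in> space R. (\<forall>v\<in>J. fst r v \<in> A v) & (\<forall>e\<in>F. snd r e \<in> B e)} =
  (\<Prod>v\<in>J. measure \<mu> (A v)) * (\<Prod>e\<in>F. measure unit_uniform (B e))"
proof -
 let ?A = "prod_emb UNIV (%_. \<mu>) J (Pi\<^sub>E J A)" and ?B = "prod_emb vertex_pairs (%_. unit_uniform) F (Pi\<^sub>E F B)"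
 have "{r \<in> space R. (\<forall>v\<in>J. fst r v \<in> A v) & (\<forall>e\<in>F. snd r e \<in> B e)} = ?A \<times> ?B"
  using assms(3) by (auto simp: space_R prod_emb_def space_mark PiE_iff restrict_def)
 moreover have "?A \<in> sets PW" "?B \<in> sets PU"
  using assms by (auto intro!: sets_PiM_I simp: sets_mark)
 moreover have "measure PW ?A = (\<Prod>v\<in>J. measure \<mu> (A v))"
  using assms by (intro PW.measure_PiM_emb) (auto simp: sets_mark)
 moreover have "measure PU ?B = (\<Prod>e\<in>F. measure unit_uniform (B e))"
  using assms by (intro PU.measure_PiM_emb) (auto)
 ultimately show ?thesis
  by (simp add: label_space_def measure_def sigma_finite_measure.emeasure_pair_measure_Times[OF prob_space_imp_sigma_finite[OF PU.prob_space_axioms]] enn2real_mult)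
qed

lemma indep_labels: "labels.indep_vars (%_. borel) label label_index"
 unfolding labels.indep_vars_def2
proof (intro conjI ballI measurable_label labels.indep_setsI)
 fix A J assume J: "J ~= {}" "J \<subseteq> label_index" "finite J"
  and A: "\<forall>j\<in>J. A j \<in> {label j -` A \<inter> space R |A. A \<in> sets borel}"
 then obtain B where B: "!!j. j \<in> J ==> A j = label j -` B j \<inter> space R & B j \<in> sets borel"
  by (simp only: mem_Collect_eq) metis
 define J1 J2 where "J1 = Inl -` J" and "J2 = Inr -` J"
 have fin: "finite J1" "finite J2" "J2 \<subseteq> vertex_pairs"
  using J by (auto simp: J1_def J2_def label_index_def intro!: finite_vimageI)
 have J12: "J = Inl ` J1 \<union> Inr ` J2"
  by (auto simp: J1_def J2_def image_iff) (metis sumE)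
 have BJ: "!!v. v \<in> J1 ==> B (Inl v) \<in> sets borel" "!!v. v \<in> J2 ==> B (Inr v) \<in> sets borel"
  using B J12 by auto
 have 1: "(\<Inter>j\<in>J. A j) = {r \<in> space R. (\<forall>v\<in>J1. fst r v \<in> B (Inl v)) & (\<forall>e\<in>J2. snd r e \<in> B (Inr e))}"
  using J(1) B unfolding J12 by (auto simp: ball_Un)
 have 2: "labels.prob (A (Inl v)) = measure \<mu> (B (Inl v))" if "v \<in> J1" for v
 proof -
  have "A (Inl v) = {r \<in> space R. (\<forall>v\<in>{v}. fst r v \<in> B (Inl v)) & (\<forall>e\<in>{}. snd r e \<in> B (Inr e))}"
   using B[of "Inl v"] that by (auto simp: J1_def)
  thus ?thesis using BJ that by (simp only: ) (subst prob_labels, auto)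
 qed
 have 3: "labels.prob (A (Inr e)) = measure unit_uniform (B (Inr e))" if "e \<in> J2" for e
 proof -
  have "A (Inr e) = {r \<in> space R. (\<forall>v\<in>{}. fst r v \<in> B (Inl v)) & (\<forall>e\<in>{e}. snd r e \<in> B (Inr e))}"
   using B[of "Inr e"] that by (auto simp: J2_def)
  thus ?thesis using BJ fin that by (simp only: ) (subst prob_labels, auto)
 qed
 have "(\<Prod>j\<in>J. labels.prob (A j)) = (\<Prod>j\<in>Inl ` J1. labels.prob (A j)) * (\<Prod>j\<in>Inr ` J2. labels.prob (A j))"
  unfolding J12 using fin by (intro prod.union_disjoint) auto
 also have "... = (\<Prod>v\<in>J1. measure \<mu> (B (Inl v))) * (\<Prod>e\<in>J2. measure unit_uniform (B (Inr e)))"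
  by (simp add: prod.reindex 2 3)
 finally show "labels.prob (\<Inter>j\<in>J. A j) = (\<Prod>j\<in>J. labels.prob (A j))"
  unfolding 1 using fin BJ by (simp add: prob_labels)
qed (auto intro: measurable_sets[OF measurable_label])

lemma indep_labels_on:
 assumes "!!j. j \<in> L ==> K j \<subseteq> label_index" "disjoint_family_on K L"
 shows "labels.indep_vars (%j. PiM (K j) (%_. borel)) (%j. labels_on (K j)) L"
 using labels.indep_vars_restrict[OF indep_labels assms] by (simp add: labels_on_def[abs_def])

lemma measurable_labels_on: "K \<subseteq> label_index ==> labels_on K \<in> measurable R (PiM K (%_. borel))"
 unfolding labels_on_def by (intro measurable_restrict) (auto intro: measurable_label)

lemma prob_disjoint_labels:
 assumes K: "K1 \<inter> K2 = {}" "K1 \<subseteq> label_index" "K2 \<subseteq> label_index"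
  and [measurable]: "Measurable.pred (PiM K1 (%_. borel)) A" "Measurable.pred (PiM K2 (%_. borel)) B"
 shows "labels.prob {r \<in> space R. A (labels_on K1 r) & B (labels_on K2 r)} =
  labels.prob {r \<in> space R. A (labels_on K1 r)} * labels.prob {r \<in> space R. B (labels_on K2 r)}"
proof -
 let ?A = "{z \<in> space (PiM K1 (%_. borel)). A z}" and ?B = "{z \<in> space (PiM K2 (%_. borel)). B z}"
 have sp: "labels_on K1 r \<in> space (PiM K1 (%_. borel))" "labels_on K2 r \<in> space (PiM K2 (%_. borel))" for r
  by (auto simp: labels_on_def space_PiM)
 have "labels.prob ((%x. (labels_on K1 x, labels_on K2 x)) -` (?A \<times> ?B) \<inter> space R) =
   labels.prob (labels_on K1 -` ?A \<inter> space R) * labels.prob (labels_on K2 -` ?B \<inter> space R)"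
 proof (rule labels.indep_varD)
  show "labels.indep_var (PiM K1 (%_. borel)) (labels_on K1) (PiM K2 (%_. borel)) (labels_on K2)"
   using labels.indep_var_restrict[OF indep_labels K] by (simp add: labels_on_def[abs_def])
 qed measurable
 moreover have "(%x. (labels_on K1 x, labels_on K2 x)) -` (?A \<times> ?B) \<inter> space R =
  {r \<in> space R. A (labels_on K1 r) & B (labels_on K2 r)}" using sp by auto
 moreover have "labels_on K1 -` ?A \<inter> space R = {r \<in> space R. A (labels_on K1 r)}"
  "labels_on K2 -` ?B \<inter> space R = {r \<in> space R. B (labels_on K2 r)}" using sp by auto
 ultimately show ?thesis by simp
qed

end

section \<open>Component sizes under random labels\<close>

locale label_graph = mark_law \<mu> for \<mu> +
 fixes c :: "(real ^ 'd) => real => (real ^ 'd) => real => real" and p :: real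
 assumes conn_measurable:
   "(%(y, w, y', w'). c y w y' w') \<in> borel_measurable (borel \<Otimes>\<^sub>M borel \<Otimes>\<^sub>M borel \<Otimes>\<^sub>M borel)"
  and conn_sym: "!!y w y' w'. c y w y' w' = c y' w' y w"
  and conn_le: "!!y w y' w'. c y w y' w' <= p"
  and conn_translate: "!!y w y' w' a. c (y + a) w (y' + a) w' = c y w y' w'"
  and p_pos: "0 < p" and p_le: "p <= 1"
begin

lemma measurable_comp:
 "Measurable.pred R (%r. b \<in> comp_of c y (fst r) (snd r) V a)"
 by (rule measurable_comp_of[OF conn_measurable]) (auto intro: measurable_pair_label[simplified])

lemma measurable_comp_eq:
 assumes "finite S"
 shows "Measurable.pred R (%r. comp_of c y (fst r) (snd r) V a = S)"
proof -
 have "comp_of c y (fst r) (snd r) V a = S \<longleftrightarrow> (\<forall>b. b \<in> comp_of c y (fst r) (snd r) V a \<longleftrightarrow> b \<in> S)" for r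
  by auto
 thus ?thesis using measurable_comp by simp
qed

lemma measurable_card_comp:
 "(%r. card (comp_of c y (fst r) (snd r) V a)) \<in> measurable R (count_space UNIV)"
 by (rule measurable_card_countable(2)[OF measurable_comp])

lemma measurable_comp_local:
 "Measurable.pred (PiM K (%_. borel)) (%z. b \<in> comp_of c y (mark_of K z) (pair_of K z) V a)"
 by (rule measurable_comp_of[OF conn_measurable]) (auto intro: measurable_mark_of measurable_pair_of)

lemma measurable_card_comp_local:
 "(%z. card (comp_of c y (mark_of K z) (pair_of K z) V a)) \<in> measurable (PiM K (%_. borel)) (count_space UNIV)"
 by (rule measurable_card_countable(2)[OF measurable_comp_local])

text \<open>That the component equals a given \<open>S\<close> is decided by labels inside
  \<open>V\<close>, and avoidance by the labels between \<open>S\<close> and \<open>J\<close>. These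
  blocks are disjoint, so each \<open>S\<close> contributes its probability times
  \<open>((1 - q) ^ card J) ^ card S\<close>; summing over \<open>S\<close> gives the
  integral.\<close>

lemma prob_comp_avoids:
 assumes "finite V" "finite J" "V \<inter> J = {}" "v \<in> V" "0 <= q" "q <= 1"
 shows "labels.prob {r \<in> space R. P (card (comp_of c y (fst r) (snd r) V v)) &
   (\<forall>a\<in>comp_of c y (fst r) (snd r) V v. \<forall>i\<in>J. snd r {a, i} > q)} =
  (\<integral>r. (if P (card (comp_of c y (fst r) (snd r) V v))
     then ((1 - q) ^ card J) ^ card (comp_of c y (fst r) (snd r) V v) else 0) \<partial>R)"
proof -
 let ?C = "%r. comp_of c y (fst r) (snd r) V v"
 let ?av = "%S r. \<forall>a\<in>S. \<forall>i\<in>J. snd r {a, i} > q"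
 have CV: "?C r \<in> Pow V" for r using comp_of_subset[OF assms(4)] by (simp add: subset_iff)
 have meas: "Measurable.pred R (%r. ?C r = S)" if "S \<in> Pow V" for S
  using that assms(1) by (intro measurable_comp_eq) (auto intro: finite_subset)
 have av_meas: "Measurable.pred R (?av S)" if "S \<in> Pow V" for S
 proof -
  have "Measurable.pred R (%r. snd r {a, i} > q)" if "a \<in> S" "i \<in> J" for a i
  proof -
   have "a ~= i" using that \<open>S \<in> Pow V\<close> assms(3) by auto
   hence [measurable]: "(%r. snd r {a, i}) \<in> borel_measurable R"
    by (intro measurable_pair_label) auto
   show ?thesis by measurable
  qed
  thus ?thesis using that assms by (intro pred_intros_finite) (auto intro: finite_subset)
 qed
 have one: "labels.prob {r \<in> space R. ?C r = S & ?av S r} = labels.prob {r \<in> space R. ?C r = S} * ((1 - q) ^ card J) ^ card S"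
  if S: "S \<in> Pow V" for S
 proof -
  define K1 where "K1 = Inl ` V \<union> Inr ` pairs_in V"
  define F where "F = (%(a, i). {a, i}) ` (S \<times> J)"
  have F: "finite F" "F \<subseteq> vertex_pairs"
  proof -
   show "finite F" using S assms(1,2) by (auto simp: F_def intro: finite_subset)
   have "a ~= i" if "a \<in> S" "i \<in> J" for a i using that S assms(3) by auto
   thus "F \<subseteq> vertex_pairs" by (auto simp: F_def)
  qed
  \<comment> \<open>As \<open>S\<close> and \<open>J\<close> are disjoint, different
    \<open>(a, i)\<close> give different unordered pairs, so exactly \<open>card S * card J\<close>
    labels are tested.\<close>
  have inj: "inj_on (%(a, i). {a, i}) (S \<times> J)"
   using S assms(3) by (auto simp: inj_on_def doubleton_eq_iff)
  have cF: "card F = card S * card J"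
   unfolding F_def by (simp add: card_image[OF inj] card_cartesian_product)
  have K: "K1 \<inter> Inr ` F = {}" "K1 \<subseteq> label_index" "Inr ` F \<subseteq> label_index"
   using F assms(3) by (auto simp: K1_def pairs_in_def label_index_def F_def)
  have C1: "?C r = comp_of c y (mark_of K1 (labels_on K1 r)) (pair_of K1 (labels_on K1 r)) V v" for r
   by (rule comp_of_labels_on[symmetric]) (auto simp: K1_def)
  have avF: "?av S r \<longleftrightarrow> (\<forall>e\<in>F. labels_on (Inr ` F) r (Inr e) > q)" for r
   by (auto simp: F_def labels_on_def)
  have pred1: "Measurable.pred (PiM K1 (%_. borel)) (%z. comp_of c y (mark_of K1 z) (pair_of K1 z) V v = S)"
  proof -
   have "comp_of c y (mark_of K1 z) (pair_of K1 z) V v = S \<longleftrightarrow>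
    (\<forall>b. b \<in> comp_of c y (mark_of K1 z) (pair_of K1 z) V v \<longleftrightarrow> b \<in> S)" for z
    by auto
   thus ?thesis using measurable_comp_local by simp
  qed
  have pred2: "Measurable.pred (PiM (Inr ` F) (%_. borel)) (%z. \<forall>e\<in>F. z (Inr e) > q)"
   using F(1) by (intro pred_intros_finite) measurable
  have "labels.prob {r \<in> space R. ?C r = S & ?av S r} =
   labels.prob {r \<in> space R. ?C r = S} * labels.prob {r \<in> space R. ?av S r}"
   unfolding C1 avF by (rule prob_disjoint_labels[OF K pred1 pred2])
  also have "{r \<in> space R. ?av S r} = {r \<in> space R. (\<forall>v\<in>{}. fst r v \<in> UNIV) & (\<forall>e\<in>F. snd r e \<in> {q<..})}"
   by (auto simp: F_def)
  also have "labels.prob ... = (\<Prod>v\<in>({} :: vertex set). measure \<mu> UNIV) * (\<Prod>e\<in>F. measure unit_uniform {q<..})"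
   using F by (intro prob_labels) auto
  also have "... = (1 - q) ^ card F"
   by (simp only: prod_constant measure_unit_uniform_greater[OF assms(5,6)] card.empty power_0 mult_1)
  finally show ?thesis by (simp add: cF power_mult[symmetric] mult.commute)
 qed
 let ?T = "{S \<in> Pow V. P (card S)}"
 have finT: "finite ?T" using assms(1) by simp
 have "{r \<in> space R. P (card (?C r)) & ?av (?C r) r} = (\<Union>S\<in>?T. {r \<in> space R. ?C r = S & ?av S r})"
  using CV by blast
 hence "labels.prob {r \<in> space R. P (card (?C r)) & ?av (?C r) r} =
   labels.prob (\<Union>S\<in>?T. {r \<in> space R. ?C r = S & ?av S r})"
  by (rule arg_cong)
 also have "... = (\<Sum>S\<in>?T. labels.prob {r \<in> space R. ?C r = S & ?av S r})"
  
 proof (rule labels.finite_measure_finite_Union[OF finT])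
  show "(%S. {r \<in> space R. ?C r = S & ?av S r}) ` ?T \<subseteq> labels.events"
  proof (rule image_subsetI)
   fix S assume "S \<in> ?T"
   thus "{r \<in> space R. ?C r = S & ?av S r} \<in> labels.events"
    by (intro predE pred_intros_logic(3) meas av_meas) auto
  qed
  show "disjoint_family_on (%S. {r \<in> space R. ?C r = S & ?av S r}) ?T"
   unfolding disjoint_family_on_def by blast
 qed
 also have "... = (\<Sum>S\<in>?T. labels.prob {r \<in> space R. ?C r = S} * ((1 - q) ^ card J) ^ card S)"
  by (rule sum.cong[OF refl], rule one) simp
 also have "... = (\<Sum>S\<in>?T. \<integral>r. ((1 - q) ^ card J) ^ card S * indicator {r \<in> space R. ?C r = S} r \<partial>R)"
  by (rule sum.cong[OF refl]) (simp add: mult.commute Int_def conj_commute)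
 also have "... = (\<integral>r. (\<Sum>S\<in>?T. ((1 - q) ^ card J) ^ card S * indicator {r \<in> space R. ?C r = S} r) \<partial>R)"
 proof (rule Bochner_Integration.integral_sum[symmetric])
  fix S assume "S \<in> ?T"
  hence "{r \<in> space R. ?C r = S} \<in> sets R" by (intro predE[OF meas]) simp
  thus "integrable R (%r. ((1 - q) ^ card J) ^ card S * indicator {r \<in> space R. ?C r = S} r)"
   by (intro integrable_mult_right integrable_real_indicator) (simp_all add: labels.emeasure_eq_measure)
 qed
 also have "... = (\<integral>r. (if P (card (?C r)) then ((1 - q) ^ card J) ^ card (?C r) else 0) \<partial>R)"
 proof (rule Bochner_Integration.integral_cong[OF refl])
  fix r assume r: "r \<in> space R"
  have "(\<Sum>S\<in>?T. ((1 - q) ^ card J) ^ card S * indicator {r \<in> space R. ?C r = S} r) =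
   (\<Sum>S\<in>?T. if S = ?C r then ((1 - q) ^ card J) ^ card S else 0)"
   using r by (intro sum.cong) (auto simp: indicator_def)
  also have "... = (if P (card (?C r)) then ((1 - q) ^ card J) ^ card (?C r) else 0)"
   using CV[of r] by (simp only: sum.delta[OF finT]) simp
  finally show "(\<Sum>S\<in>?T. ((1 - q) ^ card J) ^ card S * indicator {r \<in> space R. ?C r = S} r) =
   (if P (card (?C r)) then ((1 - q) ^ card J) ^ card (?C r) else 0)" .
 qed
 finally show ?thesis .
qed

text \<open>Marks and labels are identically distributed and independent, so pulling them back along
  an injection gives the same product law on \<open>V\<close> and its pairs.\<close>

lemma nn_integral_card_comp_reindex:
 assumes inj: "inj_on f V" and y: "!!a. a \<in> V ==> y' (f a) = y a" and v: "v \<in> V"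
 shows "(\<integral>\<^sup>+r. G (card (comp_of c y' (fst r) (snd r) (f ` V) (f v))) \<partial>R) =
  (\<integral>\<^sup>+r. (G :: nat => ennreal) (card (comp_of c y (fst r) (snd r) V v)) \<partial>R)"
proof -
 let ?N = "PiM V (%_. \<mu>) \<Otimes>\<^sub>M PiM (pairs_in V) (%_. unit_uniform)"
 let ?C = "%r. card (comp_of c y (%a. if a \<in> V then fst r a else 0) (%e. if e \<in> pairs_in V then snd r e else 0) V v)"
 have mC: "?C \<in> measurable ?N (count_space UNIV)"
 proof (rule measurable_card_countable(2), rule measurable_comp_of[OF conn_measurable])
  fix a :: vertex
  show "(%om. if a \<in> V then fst om a else 0) \<in> borel_measurable ?N"
  proof (cases "a \<in> V")
   case True
   hence "(%om. fst om a) \<in> measurable ?N \<mu>" by measurable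
   thus ?thesis using True by (simp add: measurable_into_mark)
  qed auto
 next
  fix e :: "vertex set"
  show "(%om. if e \<in> pairs_in V then snd om e else 0) \<in> borel_measurable ?N"
  proof (cases "e \<in> pairs_in V")
   case True
   hence "(%om. snd om e) \<in> measurable ?N unit_uniform" by measurable
   thus ?thesis using True by (auto cong: measurable_cong_sets)
  qed auto
 qed auto
 \<comment> \<open>The right side does not mention \<open>g\<close>; comparing \<open>g = f\<close>
   with the identity gives the claim.\<close>
 have key: "(\<integral>\<^sup>+r. G (card (comp_of c y (fst r \<circ> g) (%e. snd r (g ` e)) V v)) \<partial>R) = (\<integral>\<^sup>+r. G (?C r) \<partial>?N)"
  if g: "inj_on g V" for g
 proof -
  have g2: "inj_on (image g) (pairs_in V)" "image g \<in> pairs_in V \<rightarrow> vertex_pairs"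
  proof -
   show "inj_on (image g) (pairs_in V)"
    using inj_on_image_Pow[OF g] by (rule inj_on_subset) (auto simp: pairs_in_def)
   show "image g \<in> pairs_in V \<rightarrow> vertex_pairs"
    using inj_on_subset[OF g] by (auto simp: pairs_in_def card_image)
  qed
  have mW: "(%w. \<lambda>n\<in>V. w (g n)) \<in> measurable PW (PiM V (%_. \<mu>))" by measurable
  have mU: "(%u. \<lambda>n\<in>pairs_in V. u (g ` n)) \<in> measurable PU (PiM (pairs_in V) (%_. unit_uniform))"
   using g2(2) by (intro measurable_restrict measurable_component_singleton) auto
  have dW: "distr PW (PiM V (%_. \<mu>)) (%w. \<lambda>n\<in>V. w (g n)) = PiM V (%_. \<mu>)"
   using g by (intro distr_PiM_reindex) (auto intro: prob_space_mark)
  have dU: "distr PU (PiM (pairs_in V) (%_. unit_uniform)) (%u. \<lambda>n\<in>pairs_in V. u (g ` n)) =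
   PiM (pairs_in V) (%_. unit_uniform)"
   using g2 by (intro distr_PiM_reindex) (auto intro: prob_space_unit_uniform)
  have ps: "prob_space (PiM (pairs_in V) (%_. unit_uniform))"
   by (intro prob_space_PiM prob_space_unit_uniform)
  let ?T = "%(w, u). (\<lambda>n\<in>V. w (g n), \<lambda>n\<in>pairs_in V. u (g ` n))"
  have "?N = distr R ?N ?T"
   using pair_measure_distr[OF mW mU] ps unfolding dW dU label_space_def
   by (simp add: prob_space_imp_sigma_finite)
  hence "(\<integral>\<^sup>+r. G (?C r) \<partial>?N) = (\<integral>\<^sup>+r. G (?C r) \<partial>distr R ?N ?T)" by simp
  also have "... = (\<integral>\<^sup>+r. G (?C (?T r)) \<partial>R)"
  proof (rule nn_integral_distr[where f="%r. G (?C r)" and T="?T" and M=R and M'="?N"])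
   have "(%r. (\<lambda>n\<in>V. fst r (g n), \<lambda>n\<in>pairs_in V. snd r (g ` n))) \<in> measurable (PW \<Otimes>\<^sub>M PU) ?N"
    by (intro measurable_Pair measurable_compose[OF measurable_fst mW] measurable_compose[OF measurable_snd mU])
   thus "?T \<in> measurable R ?N" by (simp only: label_space_def split_beta')
   show "(%r. G (?C r)) \<in> borel_measurable (distr R ?N ?T)"
    unfolding measurable_distr_eq1 by (rule measurable_compose[OF mC]) auto
  qed
  also have "... = (\<integral>\<^sup>+r. G (card (comp_of c y (fst r \<circ> g) (%e. snd r (g ` e)) V v)) \<partial>R)"
  proof (rule nn_integral_cong)
   fix r
   have "label_edges c y (%a. if a \<in> V then fst (?T r) a else 0) (%e. if e \<in> pairs_in V then snd (?T r) e else 0) V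
    = label_edges c y (fst r \<circ> g) (%e. snd r (g ` e)) V"
    by (rule label_edges_cong) (auto simp: split_beta pairs_in_def)
   thus "G (?C (?T r)) = G (card (comp_of c y (fst r \<circ> g) (%e. snd r (g ` e)) V v))"
    by simp
  qed
  finally show ?thesis by simp
 qed
 have "(\<integral>\<^sup>+r. G (card (comp_of c y' (fst r) (snd r) (f ` V) (f v))) \<partial>R) =
  (\<integral>\<^sup>+r. G (card (comp_of c y (fst r \<circ> f) (%e. snd r (f ` e)) V v)) \<partial>R)"
  using card_comp_of_reindex[where f=f and V=V and y'=y' and y=y] assms by (intro nn_integral_cong) simp
 also have "... = (\<integral>\<^sup>+r. G (card (comp_of c y (fst r \<circ> id) (%e. snd r (id ` e)) V v)) \<partial>R)"
  using key[OF inj] key[of id] by simp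
 finally show ?thesis by simp
qed

end

section \<open>The Janossy formula\<close>

text \<open>Extensional functions, so that there are finitely many of them and exactly
  \<open>fact (card A)\<close> when the sizes agree.\<close>

definition bijs :: "nat set => nat set => (nat => nat) set" where
 "bijs A I = {s \<in> A \<rightarrow>\<^sub>E I. bij_betw s A I}"

lemma finite_bijs: "finite A ==> finite I ==> finite (bijs A I)"
 unfolding bijs_def by (rule finite_subset[OF _ finite_PiE[of A "%_. I"]]) auto

text \<open>A bijection that respects two colourings is a choice of bijections between the colour classes.\<close>

lemma card_coloured_bijs:
 fixes g t :: "nat => 'c"
 assumes "finite A" "finite I"
 shows "card {s \<in> bijs A I. \<forall>a\<in>A. g (s a) = t a} =
  (if \<forall>S. card {i \<in> I. g i = S} = card {a \<in> A. t a = S} then (\<Prod>S\<in>t ` A. fact (card {a \<in> A. t a = S})) else 0)"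
 using assms
proof (induction A arbitrary: I rule: finite_induct)
 case empty
 show ?case
 proof (cases "I = {}")
  case True
  hence "{s \<in> bijs {} I. \<forall>a\<in>{}. g (s a) = t a} = {%_. undefined}"
   by (auto simp: bijs_def bij_betw_def)
  thus ?thesis using True by simp
 next
  case False
  then obtain i where "i \<in> I" by auto
  hence "card {j \<in> I. g j = g i} ~= 0" using empty by auto
  moreover have "{s \<in> bijs {} I. \<forall>a\<in>{}. g (s a) = t a} = {}"
   using False by (auto simp: bijs_def bij_betw_def)
  ultimately show ?thesis by (auto simp only: card.empty) auto
 qed
next
 case (insert a A)
 let ?col = "%A I. {s \<in> bijs A I. \<forall>a\<in>A. g (s a) = t a}"
 let ?match = "%A I. \<forall>S. card {i \<in> I. g i = S} = card {a \<in> A. t a = S}"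
 let ?I = "{i \<in> I. g i = t a}"
 \<comment> \<open>The image \<open>i\<close> of the new element is chosen among the points of its
   colour; what remains is a coloured bijection of \<open>A\<close> onto
   \<open>I - {i}\<close>.\<close>
 have "bij_betw (%(i, s). s(a := i)) (SIGMA i:?I. ?col A (I - {i})) (?col (insert a A) I)"
 proof (rule bij_betwI[where g="%s. (s a, s(a := undefined))"])
  show "(%(i, s). s(a := i)) \<in> (SIGMA i:?I. ?col A (I - {i})) \<rightarrow> ?col (insert a A) I"
  proof (intro Pi_I, clarify)
   fix i s assume *: "s \<in> bijs A (I - {i})" "i \<in> I" "g i = t a" "\<forall>a\<in>A. g (s a) = t a"
   have "bij_betw s A (I - {i})" using * by (simp add: bijs_def)
   hence "bij_betw (s(a := i)) A (I - {i})"
    using insert.hyps by (subst bij_betw_cong[where g=s]) auto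
   moreover have "bij_betw (s(a := i)) {a} {i}" by (simp add: bij_betw_def)
   ultimately have "bij_betw (s(a := i)) (A \<union> {a}) (I - {i} \<union> {i})"
    by (rule bij_betw_combine) auto
   hence "bij_betw (s(a := i)) (insert a A) I" using * by (simp add: insert_absorb)
   moreover have "s(a := i) \<in> insert a A \<rightarrow>\<^sub>E I"
    using * by (auto simp: bijs_def PiE_iff extensional_def)
   ultimately show "s(a := i) \<in> bijs (insert a A) I & (\<forall>b\<in>insert a A. g ((s(a := i)) b) = t b)"
    using * insert.hyps by (auto simp: bijs_def)
  qed
  show "(%s. (s a, s(a := undefined))) \<in> ?col (insert a A) I \<rightarrow> (SIGMA i:?I. ?col A (I - {i}))"
  proof (intro Pi_I)
   fix s assume *: "s \<in> ?col (insert a A) I"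
   hence b: "bij_betw s (insert a A) I" by (simp add: bijs_def)
   hence "bij_betw s A (I - {s a})"
    using insert.hyps by (simp add: bij_betw_def inj_on_insert) blast
   hence "bij_betw (s(a := undefined)) A (I - {s a})"
    using insert.hyps by (subst bij_betw_cong[where g=s]) auto
   moreover have "s(a := undefined) \<in> A \<rightarrow>\<^sub>E (I - {s a})"
    using * insert.hyps calculation by (auto simp: bijs_def PiE_iff extensional_def bij_betw_def)
   ultimately show "(s a, s(a := undefined)) \<in> (SIGMA i:?I. ?col A (I - {i}))"
    using * insert.hyps by (auto simp: bijs_def)
  qed
 qed (use insert.hyps in \<open>auto simp: bijs_def PiE_iff extensional_def fun_upd_idem_iff\<close>)
 hence "card (?col (insert a A) I) = card (SIGMA i:?I. ?col A (I - {i}))"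
  using bij_betw_same_card by force
 also have "... = (\<Sum>i\<in>?I. card (?col A (I - {i})))"
 proof (rule card_SigmaI)
  show "\<forall>i\<in>?I. finite (?col A (I - {i}))"
   using finite_bijs[OF insert.hyps(1)] insert.prems by simp
 qed (use insert.prems in simp)
 also have "... = (\<Sum>i\<in>?I. if ?match (insert a A) I then (\<Prod>S\<in>t ` A. fact (card {a \<in> A. t a = S})) else 0)"
 proof (rule sum.cong[OF refl])
  fix i assume i: "i \<in> ?I"
  have 1: "card {j \<in> I. g j = S} = card {j \<in> I - {i}. g j = S} + (if S = t a then 1 else 0)" for S
  proof (cases "S = t a")
   case True
   hence "{j \<in> I. g j = S} = insert i {j \<in> I - {i}. g j = S}" using i by auto
   thus ?thesis using True insert.prems by simp
  next
   case False
   hence "{j \<in> I. g j = S} = {j \<in> I - {i}. g j = S}" using i by auto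
   thus ?thesis using False by simp
  qed
  have 2: "card {b \<in> insert a A. t b = S} = card {b \<in> A. t b = S} + (if S = t a then 1 else 0)" for S
  proof (cases "S = t a")
   case True
   hence "{b \<in> insert a A. t b = S} = insert a {b \<in> A. t b = S}" by auto
   thus ?thesis using True insert.hyps by simp
  next
   case False
   hence "{b \<in> insert a A. t b = S} = {b \<in> A. t b = S}" by auto
   thus ?thesis using False by simp
  qed
  have "?match A (I - {i}) \<longleftrightarrow> ?match (insert a A) I" unfolding 1 2 by simp
  thus "card (?col A (I - {i})) = (if ?match (insert a A) I then (\<Prod>S\<in>t ` A. fact (card {a \<in> A. t a = S})) else 0)"
   using insert.IH[of "I - {i}"] insert.prems by simp
 qed
 also have "... = (if ?match (insert a A) I then card ?I * (\<Prod>S\<in>t ` A. fact (card {a \<in> A. t a = S})) else 0)"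
  by simp
 also have "... = (if ?match (insert a A) I then (\<Prod>S\<in>t ` insert a A. fact (card {b \<in> insert a A. t b = S})) else 0)"
 proof (rule if_cong[OF refl _ refl])
  assume "?match (insert a A) I"
  hence "card ?I = card {b \<in> insert a A. t b = t a}" by blast
  also have "{b \<in> insert a A. t b = t a} = insert a {b \<in> A. t b = t a}" by auto
  also have "card ... = Suc (card {b \<in> A. t b = t a})" using insert.hyps by simp
  finally have cI: "card ?I = Suc (card {b \<in> A. t b = t a})" .
  have ne: "(\<Prod>S\<in>t ` A - {t a}. fact (card {b \<in> insert a A. t b = S})) =
    (\<Prod>S\<in>t ` A - {t a}. fact (card {b \<in> A. t b = S}) :: nat)"
   by (intro prod.cong refl arg_cong[where f="%X. fact (card X)"]) auto
  \<comment> \<open>If the colour \<open>t a\<close> does not occur in \<open>A\<close>, its factor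
    is \<open>fact 0 = 1\<close>, so it can be split off in both cases.\<close>
  have A0: "(\<Prod>S\<in>t ` A. fact (card {b \<in> A. t b = S}) :: nat) =
   fact (card {b \<in> A. t b = t a}) * (\<Prod>S\<in>t ` A - {t a}. fact (card {b \<in> A. t b = S}))"
  proof (cases "t a \<in> t ` A")
   case True
   thus ?thesis using insert.hyps by (subst prod.remove[of _ "t a"]) auto
  next
   case False
   hence "{b \<in> A. t b = t a} = {}" by (metis (mono_tags, lifting) empty_Collect_eq imageI)
   moreover have "t ` A - {t a} = t ` A" using False by simp
   ultimately show ?thesis by (simp only: card.empty fact_0 mult_1)
  qed
  have "(\<Prod>S\<in>t ` insert a A. fact (card {b \<in> insert a A. t b = S}) :: nat) =
   fact (card {b \<in> insert a A. t b = t a}) * (\<Prod>S\<in>t ` A - {t a}. fact (card {b \<in> insert a A. t b = S}))"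
   using insert.hyps by (subst image_insert, subst prod.insert_remove) auto
  also have "card {b \<in> insert a A. t b = t a} = Suc (card {b \<in> A. t b = t a})"
   using \<open>{b \<in> insert a A. t b = t a} = insert a {b \<in> A. t b = t a}\<close> insert.hyps by simp
  finally show "card ?I * (\<Prod>S\<in>t ` A. fact (card {a \<in> A. t a = S})) =
   (\<Prod>S\<in>t ` insert a A. fact (card {b \<in> insert a A. t b = S}))"
   unfolding A0 ne cI by (simp add: algebra_simps)
 qed
 finally show ?case .
qed

lemma card_bijs:
 assumes "finite A" "finite I"
 shows "card (bijs A I) = (if card I = card A then fact (card A) else 0)"
proof -
 have "(\<Prod>S\<in>(%_. ()) ` A. fact (card {a \<in> A. () = S}) :: nat) = fact (card A)"
 proof (cases "A = {}")
  case False
  hence "(%_. ()) ` A = {()}" by auto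
  thus ?thesis by (simp only:) simp
 qed simp
 moreover have "(\<forall>S. card {i \<in> I. () = S} = card {a \<in> A. () = S}) \<longleftrightarrow> card I = card A"
  by simp
 moreover have "{s \<in> bijs A I. \<forall>a\<in>A. () = ()} = bijs A I" by simp
 ultimately show ?thesis
  using card_coloured_bijs[OF assms, where g="%_. ()" and t="%_. ()"] by (simp only:)
qed

section \<open>Refining finite partitions that generate the Borel sets\<close>

definition borel_generator :: "nat => (real ^ 'd) set" where
 "borel_generator = from_nat_into (SOME B. countable B & topological_basis B)"

lemma borel_eq_sigma_generator: "(borel :: (real ^ 'd) measure) = sigma UNIV (range borel_generator)"
proof -
 let ?B = "SOME B :: (real ^ 'd) set set. countable B & topological_basis B"
 have B: "countable ?B" "topological_basis ?B"
  using someI_ex[OF ex_countable_basis] by auto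
 have "?B ~= {}"
 proof
  assume "?B = {}"
  with B(2) have "topological_basis ({} :: (real ^ 'd) set set)" by simp
  thus False using topological_basisE[of "{}" "UNIV :: (real ^ 'd) set" 0] by auto
 qed
 hence "range borel_generator = ?B"
  unfolding borel_generator_def using B(1) by (rule range_from_nat_into)
 thus ?thesis using borel_eq_countable_basis[OF B] by simp
qed

lemma borel_generator_measurable[measurable]: "borel_generator i \<in> sets (borel :: (real ^ 'd) measure)"
proof -
 have "borel_generator i \<in> sigma_sets UNIV (range (borel_generator :: nat => (real ^ 'd) set))"
  by (rule sigma_sets.Basic, rule rangeI)
 hence "borel_generator i \<in> sets (sigma UNIV (range (borel_generator :: nat => (real ^ 'd) set)))"
  by (subst sets_measure_of) auto
 thus ?thesis using borel_eq_sigma_generator by metis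
qed

text \<open>The address of a point at level \<open>l\<close>: two points share it iff none of the
  first \<open>l\<close> generators separates them, so larger \<open>l\<close> refines the
  partition.\<close>

definition code :: "nat => real ^ 'd => nat set" where
 "code l y = {i. i < l & y \<in> borel_generator i}"

definition atom :: "(real ^ 'd) set => nat => nat set => (real ^ 'd) set" where
 "atom Q l S = {y \<in> Q. code l y = S}"

lemma code_subset: "code l y \<subseteq> {..<l}"
 by (auto simp: code_def)

lemma code_mono: "l <= l' ==> code l y = code l' y \<inter> {..<l}"
 by (auto simp: code_def)

lemma measurable_code[measurable]: "code l \<in> measurable borel (count_space UNIV)"
proof -
 have "{y. code l y = S} \<in> sets borel" for S
 proof -
  have "{y. code l y = S} = (if S \<subseteq> {..<l} then {y. \<forall>i\<in>{..<l}. y \<in> borel_generator i \<longleftrightarrow> i \<in> S} else {})"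
   using code_subset[of l] by (auto simp: code_def)
  also have "... \<in> sets borel" by (auto intro!: borel_measurable_pred_less) measurable
  finally show ?thesis .
 qed
 hence "(\<Union>S\<in>B \<inter> Pow {..<l}. {y. code l y = S}) \<in> sets borel" for B
  by (intro sets.finite_UN) auto
 moreover have "code l -` B = (\<Union>S\<in>B \<inter> Pow {..<l}. {y. code l y = S})" for B
  using code_subset[of l] by auto
 ultimately have "code l -` B \<in> sets borel" for B by metis
 thus ?thesis by (intro measurableI) (simp_all only: space_borel Int_UNIV_right space_count_space UNIV_I)
qed

lemma atom_measurable: "Q \<in> sets borel ==> atom Q l S \<in> sets borel"
proof -
 assume [measurable]: "Q \<in> sets borel"
 have "atom Q l S = Q \<inter> {y \<in> space borel. code l y = S}" by (auto simp: atom_def)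
 also have "... \<in> sets borel" by measurable
 finally show ?thesis .
qed

text \<open>Cells of the common refinements of the first \<open>l\<close> generators: their products form an
 intersection-stable generator of the product sigma-algebra, with pairwise equal or disjoint sides.\<close>

definition code_rects :: "nat set => (nat => real ^ 'd) set set" where
 "code_rects A = insert {} {{y \<in> A \<rightarrow>\<^sub>E UNIV. \<forall>a\<in>A. code l (y a) = t a} | l t. True}"

text \<open>A finer address determines the coarser one, so two such rectangles are nested or
  disjoint.\<close>

lemma Int_stable_code_rects: "Int_stable (code_rects A :: (nat => real ^ 'd) set set)"
proof -
 have *: "{y \<in> A \<rightarrow>\<^sub>E UNIV. \<forall>a\<in>A. code l (y a) = t a} \<inter> {y \<in> A \<rightarrow>\<^sub>E UNIV. \<forall>a\<in>A. code l' (y a) = t' a} \<in>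
   (code_rects A :: (nat => real ^ 'd) set set)"
  if "l <= l'" for l l' :: nat and t t' :: "nat => nat set"
 proof (cases "\<forall>a\<in>A. t a = t' a \<inter> {..<l}")
  case True
  hence "{y \<in> A \<rightarrow>\<^sub>E UNIV. \<forall>a\<in>A. code l (y a) = t a} \<inter> {y \<in> A \<rightarrow>\<^sub>E UNIV. \<forall>a\<in>A. code l' (y a) = t' a} =
   {y \<in> A \<rightarrow>\<^sub>E UNIV. \<forall>a\<in>A. code l' (y a) = t' a}"
   using code_mono[OF that] by auto
  thus ?thesis unfolding code_rects_def by (intro insertI2 CollectI exI[of _ l'] exI[of _ t']) (simp only: simp_thms)
 next
  case False
  hence "{y \<in> A \<rightarrow>\<^sub>E UNIV. \<forall>a\<in>A. code l (y a) = t a} \<inter> {y \<in> A \<rightarrow>\<^sub>E UNIV. \<forall>a\<in>A. code l' (y a) = t' a} = {}"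
   using code_mono[OF that] by fastforce
  thus ?thesis unfolding code_rects_def by (rule ssubst) (rule insertI1)
 qed
 show ?thesis
 proof (rule Int_stableI)
  fix a b :: "(nat => real ^ 'd) set" assume "a \<in> code_rects A" "b \<in> code_rects A"
  then consider "a = {} \<or> b = {}" | l t l' t' where
   "a = {y \<in> A \<rightarrow>\<^sub>E UNIV. \<forall>a\<in>A. code l (y a) = t a}"
   "b = {y \<in> A \<rightarrow>\<^sub>E UNIV. \<forall>a\<in>A. code l' (y a) = t' a}"
   unfolding code_rects_def by auto
  thus "a \<inter> b \<in> code_rects A"
  proof cases
   case 1
   thus ?thesis by (auto simp: code_rects_def)
  next
   case 2
   show ?thesis
   proof (cases "l <= l'")
    case True
    show ?thesis unfolding 2 by (rule *[OF True])
   next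
    case False
    hence "b \<inter> a \<in> code_rects A" unfolding 2 by (intro *) simp
    thus ?thesis by (simp add: Int_commute)
   qed
  qed
 qed
qed

lemma sets_PiM_code_rects:
 assumes "finite A"
 shows "sets (PiM A (%_. borel :: (real ^ 'd) measure)) = sigma_sets (A \<rightarrow>\<^sub>E UNIV) (code_rects A)"
proof (intro equalityI)
 let ?\<Omega> = "A \<rightarrow>\<^sub>E (UNIV :: (real ^ 'd) set)"
 let ?N = "sigma ?\<Omega> (code_rects A) :: (nat => real ^ 'd) measure"
 have pow: "code_rects A \<subseteq> Pow ?\<Omega>" by (auto simp: code_rects_def)
 have "{y \<in> ?\<Omega>. y a \<in> borel_generator j} \<in> sets ?N" if a: "a \<in> A" for a j
 proof -
  \<comment> \<open>Membership of one coordinate in the generator \<open>j\<close> is visible in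
    addresses of length \<open>Suc j\<close>, of which there are finitely many.\<close>
  have "{y \<in> ?\<Omega>. y a \<in> borel_generator j} =
   (\<Union>t\<in>{t \<in> A \<rightarrow>\<^sub>E Pow {..<Suc j}. j \<in> t a}. {y \<in> ?\<Omega>. \<forall>a\<in>A. code (Suc j) (y a) = t a})" (is "?L = ?R")
  proof (intro equalityI subsetI)
   fix y assume y: "y \<in> ?L"
   thus "y \<in> ?R" using a
    by (intro UN_I[of "\<lambda>a\<in>A. code (Suc j) (y a)"]) (auto simp: code_def)
  next
   fix y assume "y \<in> ?R"
   then obtain t where "j \<in> t a" "y \<in> ?\<Omega>" "\<forall>a\<in>A. code (Suc j) (y a) = t a" by auto
   hence "j \<in> code (Suc j) (y a)" using a by auto
   thus "y \<in> ?L" using \<open>y \<in> ?\<Omega>\<close> by (auto simp: code_def)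
  qed
  also have "... \<in> sets ?N"
  proof (rule sets.finite_UN)
   show "finite {t \<in> A \<rightarrow>\<^sub>E Pow {..<Suc j}. j \<in> t a}"
    using assms by (intro finite_subset[OF _ finite_PiE[of A "%_. Pow {..<Suc j}"]]) auto
   fix t
   have "{y \<in> ?\<Omega>. \<forall>a\<in>A. code (Suc j) (y a) = t a} \<in> code_rects A"
    unfolding code_rects_def by blast
   thus "{y \<in> ?\<Omega>. \<forall>a\<in>A. code (Suc j) (y a) = t a} \<in> sets ?N"
    using pow by (auto simp: sets_measure_of)
  qed
  finally show ?thesis .
 qed
 hence "(%y. y a) \<in> measurable ?N (sigma UNIV (range borel_generator))" if "a \<in> A" for a
  using that pow by (intro measurable_measure_of) (auto simp: vimage_def Int_def conj_commute space_measure_of)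
 hence m: "(%y. y) \<in> measurable ?N (PiM A (%_. borel))"
  using pow by (intro measurable_PiM_single') (auto simp: space_measure_of borel_eq_sigma_generator)
 show "sets (PiM A (%_. borel :: (real ^ 'd) measure)) \<subseteq> sigma_sets ?\<Omega> (code_rects A)"
 proof (intro subsetI)
  fix S assume S: "S \<in> sets (PiM A (%_. borel :: (real ^ 'd) measure))"
  have "S \<subseteq> ?\<Omega>" using sets.sets_into_space[OF S] by (simp add: space_PiM)
  hence "(%y. y) -` S \<inter> space ?N = S" using pow by (auto simp: space_measure_of)
  hence "S \<in> sets ?N" using measurable_sets[OF m S] by simp
  thus "S \<in> sigma_sets ?\<Omega> (code_rects A)" using pow by (simp add: sets_measure_of)
 qed
 show "sigma_sets ?\<Omega> (code_rects A) \<subseteq> sets (PiM A (%_. borel :: (real ^ 'd) measure))"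
 proof -
  have "code_rects A \<subseteq> sets (PiM A (%_. borel :: (real ^ 'd) measure))"
  proof
   fix r :: "(nat => real ^ 'd) set" assume "r \<in> code_rects A"
   then consider "r = {}" | l t where "r = {y \<in> ?\<Omega>. \<forall>a\<in>A. code l (y a) = t a}"
    by (auto simp: code_rects_def)
   thus "r \<in> sets (PiM A (%_. borel))"
   proof cases
    case 2
    have "r = {y \<in> space (PiM A (%_. borel)). \<forall>a\<in>A. code l (y a) = t a}"
     by (simp add: 2 space_PiM)
    also have "... \<in> sets (PiM A (%_. borel))"
     using assms by (intro predE pred_intros_finite) measurable
    finally show ?thesis .
   qed auto
  qed
  hence "sigma_sets (space (PiM A (%_. borel :: (real ^ 'd) measure))) (code_rects A) \<subseteq> sets (PiM A (%_. borel :: (real ^ 'd) measure))"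
   by (rule sets.sigma_sets_subset)
  thus ?thesis by (simp add: space_PiM)
 qed
qed

definition pts :: "(nat => 'w => real ^ 'd) => (real ^ 'd) set => 'w => nat set" where
 "pts X B om = {i. X i om \<in> B}"

text \<open>The environment states independence for a set of regions. An indexed disjoint family can
  repeat only the empty region, whose count is 0; empty members are removed before passing to the
  image, where the index map is injective.\<close>

lemma (in prob_space) prob_disjoint_counts:
 assumes indep: "!!\<B>. finite \<B> ==> disjoint \<B> ==> (\<forall>B\<in>\<B>. B \<in> sets borel & bounded B) ==>
   indep_vars (%_. count_space UNIV) (%B om. card {i. X i om \<in> B}) \<B>"
  and "finite T" "disjoint_family_on b T" and b: "!!t. t \<in> T ==> b t \<in> sets borel & bounded (b t)"
 shows "prob {om \<in> space M. \<forall>t\<in>T. card (pts X (b t) om) = \<kappa> t} =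
  (\<Prod>t\<in>T. prob {om \<in> space M. card (pts X (b t) om) = \<kappa> t})"
proof (cases "\<exists>t\<in>T. b t = {} & \<kappa> t ~= 0")
 case True
 then obtain t where t: "t \<in> T" "b t = {}" "\<kappa> t ~= 0" by blast
 hence e: "{om \<in> space M. card (pts X (b t) om) = \<kappa> t} = {}" by (auto simp: pts_def)
 hence "{om \<in> space M. \<forall>t\<in>T. card (pts X (b t) om) = \<kappa> t} = {}" using t(1) by blast
 moreover have "(\<Prod>t\<in>T. prob {om \<in> space M. card (pts X (b t) om) = \<kappa> t}) = 0"
  by (intro prod_zero[OF assms(2)] bexI[OF _ t(1)]) (simp only: e measure_empty)
 ultimately show ?thesis by (simp only: measure_empty)
next
 case False
 define T' where "T' = {t \<in> T. b t ~= {}}"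
 have T': "finite T'" "T' \<subseteq> T" using assms(2) by (auto simp: T'_def)
 have inj: "inj_on b T'"
  using assms(3) by (auto simp: T'_def inj_on_def disjoint_family_on_def)
 have null: "{om \<in> space M. card (pts X (b t) om) = \<kappa> t} = space M" if "t \<in> T - T'" for t
  using that False by (auto simp: T'_def pts_def)
 have prod: "(\<Prod>t\<in>T. prob {om \<in> space M. card (pts X (b t) om) = \<kappa> t}) =
   (\<Prod>t\<in>T'. prob {om \<in> space M. card (pts X (b t) om) = \<kappa> t})"
  using assms(2) T' null by (intro prod.mono_neutral_right) (auto simp: prob_space)
 have ev: "{om \<in> space M. \<forall>t\<in>T. card (pts X (b t) om) = \<kappa> t} = {om \<in> space M. \<forall>t\<in>T'. card (pts X (b t) om) = \<kappa> t}"
  using null T' by blast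
 show ?thesis
 proof (cases "T' = {}")
  case True
  thus ?thesis unfolding ev prod by (simp add: prob_space)
 next
  case ne: False
  define \<kappa>' where "\<kappa>' B = {\<kappa> (the_inv_into T' b B)}" for B
  have "indep_vars (%_. count_space UNIV) (%B om. card {i. X i om \<in> B}) (b ` T')"
  proof (rule indep)
   show "disjoint (b ` T')"
    using disjoint_family_on_mono[OF T'(2) assms(3)] by (rule disjoint_family_on_disjoint_image)
  qed (use T' b in auto)
  hence "prob (\<Inter>B\<in>b ` T'. (%om. card {i. X i om \<in> B}) -` \<kappa>' B \<inter> space M) =
   (\<Prod>B\<in>b ` T'. prob ((%om. card {i. X i om \<in> B}) -` \<kappa>' B \<inter> space M))"
   using T'(1) ne by (intro indep_varsD) auto
  also have "(\<Inter>B\<in>b ` T'. (%om. card {i. X i om \<in> B}) -` \<kappa>' B \<inter> space M) =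
   {om \<in> space M. \<forall>t\<in>T'. card (pts X (b t) om) = \<kappa> t}"
   using ne by (auto simp: \<kappa>'_def the_inv_into_f_f[OF inj] pts_def)
  also have "(\<Prod>B\<in>b ` T'. prob ((%om. card {i. X i om \<in> B}) -` \<kappa>' B \<inter> space M)) =
   (\<Prod>t\<in>T'. prob {om \<in> space M. card (pts X (b t) om) = \<kappa> t})"
  proof (subst prod.reindex[OF inj], rule prod.cong[OF refl])
   fix t assume t: "t \<in> T'"
   have "(%om. card {i. X i om \<in> b t}) -` \<kappa>' (b t) \<inter> space M = {om \<in> space M. card (pts X (b t) om) = \<kappa> t}"
    unfolding \<kappa>'_def the_inv_into_f_f[OF inj t] pts_def by auto
   thus "((%B. prob ((%om. card {i. X i om \<in> B}) -` \<kappa>' B \<inter> space M)) \<circ> b) t =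
     prob {om \<in> space M. card (pts X (b t) om) = \<kappa> t}" by simp
  qed
  finally show ?thesis unfolding ev prod .
 qed
qed

text \<open>Local finiteness holds for every outcome, so that sums over the points of a bounded set
  never meet the default \<open>card\<close> of an infinite set;
  \<open>locally_finite_version\<close> supplies such a version. Independence is indexed by
  \<open>{..<m}\<close> because the type of indices is fixed in an assumption;
  \<open>prob_counts\<close> restores arbitrary finite index sets.\<close>

locale poisson_points = prob_space M for M :: "'w measure" +
 fixes X :: "nat => 'w => real ^ 'd"
 assumes X_measurable[measurable]: "!!i. X i \<in> borel_measurable M"
  and locally_finite: "!!om B. bounded B ==> finite (pts X B om)"
  and count_law: "!!B k. B \<in> sets borel ==> bounded B ==>
    prob {om \<in> space M. card (pts X B om) = k} = exp (- measure lborel B) * measure lborel B ^ k / fact k"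
  and counts_indep: "!!(m :: nat) b \<kappa>. disjoint_family_on b {..<m} ==>
    (!!t. t < m ==> b t \<in> sets borel & bounded (b t)) ==>
    prob {om \<in> space M. \<forall>t\<in>{..<m}. card (pts X (b t) om) = \<kappa> t} =
     (\<Prod>t<m. prob {om \<in> space M. card (pts X (b t) om) = \<kappa> t})"

text \<open>A density and not a restriction: the space stays \<open>UNIV\<close> and the sets stay
  those of \<open>borel\<close>, so products of these measures share their measurable structure with
  products of \<open>borel\<close>.\<close>

definition lebesgue_on_set :: "(real ^ 'd) set => (real ^ 'd) measure" where
 "lebesgue_on_set Q = density lborel (indicator Q)"

lemma sets_lebesgue_on_set[simp, measurable_cong]: "sets (lebesgue_on_set Q) = sets borel"
 by (simp add: lebesgue_on_set_def)

lemma space_lebesgue_on_set[simp]: "space (lebesgue_on_set Q) = UNIV"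
 by (simp add: lebesgue_on_set_def)

lemma emeasure_lebesgue_on_set:
 assumes "Q \<in> sets borel" "bounded Q" "B \<in> sets borel"
 shows "emeasure (lebesgue_on_set Q) B = ennreal (measure lborel (Q \<inter> B))"
proof -
 have "emeasure (lebesgue_on_set Q) B = emeasure lborel (Q \<inter> B)"
  using assms unfolding lebesgue_on_set_def by (subst emeasure_density) (auto simp: indicator_inter_arith[symmetric] intro!: nn_integral_cong)
 also have "... = ennreal (measure lborel (Q \<inter> B))"
  using emeasure_bounded_finite[of "Q \<inter> B"] assms bounded_subset[of Q "Q \<inter> B"]
  by (intro emeasure_eq_ennreal_measure) auto
 finally show ?thesis .
qed

lemma finite_measure_lebesgue_on_set:
 assumes "Q \<in> sets borel" "bounded Q"
 shows "finite_measure (lebesgue_on_set Q)"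
 using emeasure_lebesgue_on_set[OF assms, of UNIV] by (intro finite_measureI) simp

lemma bounded_atom: "bounded Q ==> bounded (atom Q l S)"
 by (rule bounded_subset) (auto simp: atom_def)

lemma sum_measure_atom:
 assumes "Q \<in> sets borel" "bounded Q"
 shows "(\<Sum>S\<in>Pow {..<l}. measure lborel (atom Q l S)) = measure lborel Q"
proof -
 have "measure lborel (\<Union>S\<in>Pow {..<l}. atom Q l S) = (\<Sum>S\<in>Pow {..<l}. measure lborel (atom Q l S))"
 proof (rule measure_finite_Union)
  show "disjoint_family_on (atom Q l) (Pow {..<l})"
   by (auto simp: disjoint_family_on_def atom_def)
  fix S
  show "emeasure lborel (atom Q l S) ~= \<infinity>"
   using emeasure_bounded_finite[OF bounded_atom[OF assms(2)], of l S] by simp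
 qed (use atom_measurable[OF assms(1)] in auto)
 moreover have "(\<Union>S\<in>Pow {..<l}. atom Q l S) = Q"
  using code_subset[of l] by (auto simp: atom_def)
 ultimately show ?thesis by simp
qed

section \<open>The unlabelled configuration inside a bounded set\<close>

context poisson_points
begin

abbreviation "P \<equiv> pts X"

lemma finite_pts: "bounded B ==> finite (P B om)"
 by (rule locally_finite)

lemma measurable_pts: "B \<in> sets borel ==> Measurable.pred M (%om. i \<in> P B om)"
 unfolding pts_def by simp

lemma measurable_card_pts: "B \<in> sets borel ==> (%om. card (P B om)) \<in> measurable M (count_space UNIV)"
 by (rule measurable_card_countable(2)[OF measurable_pts])

lemma prob_count: "B \<in> sets borel ==> bounded B ==>
  prob {om \<in> space M. card (P B om) = k} = exp (- measure lborel B) * measure lborel B ^ k / fact k"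
 by (rule count_law)

lemma prob_counts:
 assumes "finite T" "disjoint_family_on b T" and b: "!!t. t \<in> T ==> b t \<in> sets borel & bounded (b t)"
 shows "prob {om \<in> space M. \<forall>t\<in>T. card (P (b t) om) = \<kappa> t} =
  (\<Prod>t\<in>T. prob {om \<in> space M. card (P (b t) om) = \<kappa> t})"
proof -
 obtain g where g: "bij_betw g {..<card T} T"
  using ex_bij_betw_nat_finite[OF assms(1)] by (auto simp: atLeast0LessThan)
 have gT: "g a \<in> T" if "a < card T" for a using bij_betwE[OF g] that by auto
 have "disjoint_family_on (b \<circ> g) {..<card T}"
  using assms(2) gT bij_betw_imp_inj_on[OF g]
  unfolding disjoint_family_on_def inj_on_def by (metis comp_apply lessThan_iff)
 hence "prob {om \<in> space M. \<forall>a\<in>{..<card T}. card (P ((b \<circ> g) a) om) = (\<kappa> \<circ> g) a} =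
   (\<Prod>a<card T. prob {om \<in> space M. card (P ((b \<circ> g) a) om) = (\<kappa> \<circ> g) a})"
  using b gT by (intro counts_indep) (auto simp: comp_def)
 also have "... = (\<Prod>t\<in>T. prob {om \<in> space M. card (P (b t) om) = \<kappa> t})"
  using prod.reindex_bij_betw[OF g] by simp
 also have "{om \<in> space M. \<forall>a\<in>{..<card T}. card (P ((b \<circ> g) a) om) = (\<kappa> \<circ> g) a} =
   {om \<in> space M. \<forall>t\<in>T. card (P (b t) om) = \<kappa> t}"
  using bij_betw_imp_surj_on[OF g] by force
 finally show ?thesis .
qed

definition count_event :: "(real ^ 'd) set => nat => (nat set => nat) => 'w set" where
 "count_event Q l \<kappa> = {om \<in> space M. \<forall>S\<in>Pow {..<l}. card (P (atom Q l S) om) = \<kappa> S}"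

definition count_events :: "(real ^ 'd) set => 'w set set" where
 "count_events Q = insert {} {count_event Q l \<kappa> | l \<kappa>. True}"

lemma disjoint_family_atom: "disjoint_family_on (atom Q l) T"
 by (auto simp: disjoint_family_on_def atom_def)

lemma card_pts_atom_refine:
 assumes "bounded Q" "l <= l'"
 shows "card (P (atom Q l S) om) = (\<Sum>S'\<in>{S' \<in> Pow {..<l'}. S' \<inter> {..<l} = S}. card (P (atom Q l' S') om))"
proof -
 have "P (atom Q l S) om = (\<Union>S'\<in>{S' \<in> Pow {..<l'}. S' \<inter> {..<l} = S}. P (atom Q l' S') om)"
  unfolding pts_def atom_def code_mono[OF assms(2)] using code_subset[of l'] by blast
 also have "card ... = (\<Sum>S'\<in>{S' \<in> Pow {..<l'}. S' \<inter> {..<l} = S}. card (P (atom Q l' S') om))"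
  using finite_pts[OF bounded_atom[OF assms(1)]] by (intro card_UN_disjoint) (auto simp: pts_def atom_def)
 finally show ?thesis .
qed

text \<open>Counts at a finer level sum up to the counts at a coarser one, so two count events are
  nested or disjoint.\<close>

lemma Int_stable_count_events:
 assumes "bounded Q" shows "Int_stable (count_events Q)"
proof (rule Int_stableI)
 have *: "count_event Q l \<kappa> \<inter> count_event Q l' \<kappa>' \<in> count_events Q" if l: "l <= l'" for l \<kappa> l' \<kappa>'
 proof (cases "\<forall>S\<in>Pow {..<l}. \<kappa> S = (\<Sum>S'\<in>{S' \<in> Pow {..<l'}. S' \<inter> {..<l} = S}. \<kappa>' S')")
  case True
  have "count_event Q l' \<kappa>' \<subseteq> count_event Q l \<kappa>"
   using True unfolding count_event_def card_pts_atom_refine[OF assms l] by auto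
  hence "count_event Q l \<kappa> \<inter> count_event Q l' \<kappa>' = count_event Q l' \<kappa>'" by auto
  thus ?thesis unfolding count_events_def by blast
 next
  case False
  then obtain S where S: "S \<in> Pow {..<l}" "\<kappa> S ~= (\<Sum>S'\<in>{S' \<in> Pow {..<l'}. S' \<inter> {..<l} = S}. \<kappa>' S')" by blast
  have "count_event Q l \<kappa> \<inter> count_event Q l' \<kappa>' = {}"
  proof (rule equals0I)
   fix om assume w: "om \<in> count_event Q l \<kappa> \<inter> count_event Q l' \<kappa>'"
   hence "\<kappa> S = card (P (atom Q l S) om)" using S(1) by (auto simp: count_event_def)
   also have "... = (\<Sum>S'\<in>{S' \<in> Pow {..<l'}. S' \<inter> {..<l} = S}. card (P (atom Q l' S') om))"
    by (rule card_pts_atom_refine[OF assms l])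
   also have "... = (\<Sum>S'\<in>{S' \<in> Pow {..<l'}. S' \<inter> {..<l} = S}. \<kappa>' S')"
    using w by (intro sum.cong) (auto simp: count_event_def)
   finally show False using S(2) by simp
  qed
  thus ?thesis unfolding count_events_def by (rule ssubst) (rule insertI1)
 qed
 fix a b assume "a \<in> count_events Q" "b \<in> count_events Q"
 then consider "a = {} \<or> b = {}" | l \<kappa> l' \<kappa>' where "a = count_event Q l \<kappa>" "b = count_event Q l' \<kappa>'"
  unfolding count_events_def by blast
 thus "a \<inter> b \<in> count_events Q"
 proof cases
  case 1
  thus ?thesis by (auto simp: count_events_def)
 next
  case 2
  show ?thesis
  proof (cases "l <= l'")
   case True
   show ?thesis unfolding 2 by (rule *[OF True])
  next
   case False
   hence "b \<inter> a \<in> count_events Q" unfolding 2 by (intro *) simp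
   thus ?thesis by (simp add: Int_commute)
  qed
 qed
qed

lemma count_event_measurable: "Q \<in> sets borel ==> count_event Q l \<kappa> \<in> events"
 unfolding count_event_def
proof (intro predE pred_intros_finite)
 fix S assume "Q \<in> sets borel"
 hence [measurable]: "(%om. card (P (atom Q l S) om)) \<in> measurable M (count_space UNIV)"
  by (intro measurable_card_pts atom_measurable)
 show "Measurable.pred M (%om. card (P (atom Q l S) om) = \<kappa> S)" by measurable
qed auto

lemma count_events_measurable: "Q \<in> sets borel ==> count_events Q \<subseteq> events"
 using count_event_measurable by (auto simp: count_events_def)

lemma prob_count_event:
 assumes "Q \<in> sets borel" "bounded Q"
 shows "prob (count_event Q l \<kappa>) = (\<Prod>S\<in>Pow {..<l}. prob {om \<in> space M. card (P (atom Q l S) om) = \<kappa> S})"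
 unfolding count_event_def using assms
 by (intro prob_counts disjoint_family_atom) (auto intro: atom_measurable bounded_atom)

text \<open>The atoms of disjoint regions, each at its own level, form one finite disjoint family,
  to which the independence of Poisson counts applies.\<close>

lemma indep_count_events:
 assumes "disjoint_family_on Q L" and Q: "!!j. j \<in> L ==> Q j \<in> sets borel & bounded (Q j)"
 shows "indep_sets (%j. count_events (Q j)) L"
proof (rule indep_setsI)
 fix A J assume J: "J ~= {}" "J \<subseteq> L" "finite J" and A: "\<forall>j\<in>J. A j \<in> count_events (Q j)"
 show "prob (\<Inter>j\<in>J. A j) = (\<Prod>j\<in>J. prob (A j))"
 proof (cases "\<exists>j\<in>J. A j = {}")
  case True
  then obtain j where "j \<in> J" "A j = {}" by blast
  hence "(\<Prod>j\<in>J. prob (A j)) = 0" by (intro prod_zero[OF J(3)] bexI[of _ j]) simp_all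
  moreover have "(\<Inter>j\<in>J. A j) = {}" using True by auto
  ultimately show ?thesis by simp
 next
  case False
  hence "\<forall>j\<in>J. \<exists>l \<kappa>. A j = count_event (Q j) l \<kappa>" using A by (auto simp: count_events_def)
  then obtain l \<kappa> where A': "!!j. j \<in> J ==> A j = count_event (Q j) (l j) (\<kappa> j)" by metis
  let ?T = "SIGMA j:J. Pow {..<l j}"
  let ?b = "%(j, S). atom (Q j) (l j) S"
  have "(\<Inter>j\<in>J. A j) = {om \<in> space M. \<forall>t\<in>?T. card (P (?b t) om) = (case t of (j, S) => \<kappa> j S)}"
   using J(1) A' by (auto simp: count_event_def)
  also have "prob ... = (\<Prod>t\<in>?T. prob {om \<in> space M. card (P (?b t) om) = (case t of (j, S) => \<kappa> j S)})"
  proof (rule prob_counts)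
   show "disjoint_family_on ?b ?T"
    unfolding disjoint_family_on_def
   proof (intro ballI impI)
    fix s t assume st: "s \<in> ?T" "t \<in> ?T" "s ~= t"
    show "?b s \<inter> ?b t = {}"
    proof (cases "fst s = fst t")
     case True
     thus ?thesis using st by (auto simp: atom_def)
    next
     case False
     hence "Q (fst s) \<inter> Q (fst t) = {}"
      proof -
      have "fst s \<in> L" "fst t \<in> L" using st J(2) by auto
      thus ?thesis using disjoint_family_onD[OF assms(1)] False by blast
     qed
     thus ?thesis by (auto simp: atom_def split_beta)
    qed
   qed
  qed (use J Q in \<open>auto intro!: atom_measurable bounded_atom\<close>)
  also have "... = (\<Prod>j\<in>J. \<Prod>S\<in>Pow {..<l j}. prob {om \<in> space M. card (P (atom (Q j) (l j) S) om) = \<kappa> j S})"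
   using J(3) by (subst prod.Sigma) (auto simp: split_beta')
  also have "... = (\<Prod>j\<in>J. prob (A j))"
   using A' J(2) Q by (intro prod.cong refl) (simp add: prob_count_event subset_iff)
  finally show ?thesis .
 qed
qed (use Q count_events_measurable in auto)

text \<open>Generated by atom counts only, so the numbering of the points is forgotten. Functions
  measurable here for disjoint regions are independent
  (\<open>indep_vars_count_sigma\<close>).\<close>

definition count_sigma :: "(real ^ 'd) set => 'w measure" where
 "count_sigma Q = sigma (space M) (count_events Q)"

lemma count_events_Pow: "count_events Q \<subseteq> Pow (space M)"
 by (auto simp: count_events_def count_event_def)

lemma space_count_sigma[simp]: "space (count_sigma Q) = space M"
 using count_events_Pow by (simp add: count_sigma_def)

lemma sets_count_sigma: "sets (count_sigma Q) = sigma_sets (space M) (count_events Q)"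
 using count_events_Pow by (simp add: count_sigma_def)

lemma count_sigma_subset: "Q \<in> sets borel ==> sets (count_sigma Q) \<subseteq> events"
 unfolding sets_count_sigma using count_events_measurable by (rule sets.sigma_sets_subset)

lemma measurable_count_sigma: "Q \<in> sets borel ==> f \<in> measurable (count_sigma Q) N ==> f \<in> measurable M N"
 using count_sigma_subset[of Q] by (auto simp: measurable_def)

lemma indep_vars_count_sigma:
 assumes "disjoint_family_on Q L" and Q: "!!j. j \<in> L ==> Q j \<in> sets borel & bounded (Q j)"
  and F: "!!j. j \<in> L ==> F j \<in> measurable (count_sigma (Q j)) (N j)"
 shows "indep_vars N F L"
 unfolding indep_vars_def2
proof (intro conjI ballI)
 show "F j \<in> measurable M (N j)" if "j \<in> L" for j
  using measurable_count_sigma[OF _ F[OF that]] Q[OF that] by blast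
 have "indep_sets (%j. sigma_sets (space M) (count_events (Q j))) L"
  using assms by (intro indep_sets_sigma indep_count_events Int_stable_count_events) auto
 thus "indep_sets (%j. {F j -` A \<inter> space M |A. A \<in> sets (N j)}) L"
 proof (rule indep_sets_mono_sets)
  fix j assume j: "j \<in> L"
  show "{F j -` A \<inter> space M |A. A \<in> sets (N j)} \<subseteq> sigma_sets (space M) (count_events (Q j))"
   using measurable_sets[OF F[OF j]] by (auto simp: sets_count_sigma)
 qed
qed

text \<open>Adds \<open>h\<close> over all listings of the points in \<open>Q\<close> by
  \<open>A\<close>; for finite \<open>A\<close> and bounded \<open>Q\<close> the sum is empty unless
  there are exactly \<open>card A\<close> points. Its expectation is the integral of
  \<open>h\<close> against the Janossy measure of that order.\<close>

definition bij_sum :: "nat set => (real ^ 'd) set => ((nat => real ^ 'd) => ennreal) => 'w => ennreal" where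
 "bij_sum A Q h om = (\<Sum>s\<in>bijs A (P Q om). h (\<lambda>a\<in>A. X (s a) om))"

text \<open>With addresses as colours, the listings that lie in the rectangle are the
  colour-preserving bijections of \<open>card_coloured_bijs\<close>. Sets outside
  \<open>{..<l}\<close> are no addresses, which accounts for the case distinction.\<close>

lemma bij_sum_rect:
 assumes "finite A" "bounded Q" "om \<in> space M"
 shows "bij_sum A Q (indicator {y \<in> A \<rightarrow>\<^sub>E UNIV. \<forall>a\<in>A. code l (y a) = t a}) om =
  (if \<forall>a\<in>A. t a \<subseteq> {..<l} then of_nat (\<Prod>S\<in>Pow {..<l}. fact (card {a \<in> A. t a = S})) else 0) *
  indicator (count_event Q l (%S. card {a \<in> A. t a = S})) om"
proof -
 let ?c = "%S. card {a \<in> A. t a = S}"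
 let ?I = "P Q om"
 have fin: "finite ?I" using assms by (intro finite_pts)
 have col: "{i \<in> ?I. code l (X i om) = S} = P (atom Q l S) om" for S
  by (auto simp: pts_def atom_def)
 have "bij_sum A Q (indicator {y \<in> A \<rightarrow>\<^sub>E UNIV. \<forall>a\<in>A. code l (y a) = t a}) om =
  (\<Sum>s\<in>bijs A ?I. if \<forall>a\<in>A. code l (X (s a) om) = t a then 1 else 0)"
  unfolding bij_sum_def by (intro sum.cong) (auto simp: indicator_def)
 also have "... = of_nat (card {s \<in> bijs A ?I. \<forall>a\<in>A. code l (X (s a) om) = t a})"
  using finite_bijs[OF assms(1) fin] by (simp add: sum.If_cases Int_def)
 also have "card {s \<in> bijs A ?I. \<forall>a\<in>A. code l (X (s a) om) = t a} =
  (if \<forall>S. card (P (atom Q l S) om) = ?c S then (\<Prod>S\<in>t ` A. fact (?c S)) else 0)"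
  using card_coloured_bijs[OF assms(1) fin, where g="%i. code l (X i om)" and t=t] unfolding col .
 finally have eq: "bij_sum A Q (indicator {y \<in> A \<rightarrow>\<^sub>E UNIV. \<forall>a\<in>A. code l (y a) = t a}) om =
  of_nat (if \<forall>S. card (P (atom Q l S) om) = ?c S then (\<Prod>S\<in>t ` A. fact (?c S)) else 0)" .
 have empty: "card (P (atom Q l S) om) = 0" if "\<not> S \<subseteq> {..<l}" for S
 proof -
  have "atom Q l S = {}" using code_subset[of l] that by (auto simp: atom_def)
  thus ?thesis by (simp add: pts_def)
 qed
 show ?thesis
 proof (cases "\<forall>a\<in>A. t a \<subseteq> {..<l}")
  case True
  hence c0: "?c S = 0" if "\<not> S \<subseteq> {..<l}" for S
  proof -
   have "{a \<in> A. t a = S} = {}" using that True by blast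
   thus ?thesis by (simp only: card.empty)
  qed
  have "card (P (atom Q l S) om) = ?c S" if "\<forall>S\<in>Pow {..<l}. card (P (atom Q l S) om) = ?c S" for S
   by (cases "S \<subseteq> {..<l}") (use that empty c0 in simp_all)
  hence "(\<forall>S. card (P (atom Q l S) om) = ?c S) \<longleftrightarrow> om \<in> count_event Q l ?c"
   using assms(3) unfolding count_event_def by blast
  moreover have "(\<Prod>S\<in>t ` A. fact (?c S) :: nat) = (\<Prod>S\<in>Pow {..<l}. fact (?c S))"
  proof (rule prod.mono_neutral_left)
   show "\<forall>S\<in>Pow {..<l} - t ` A. fact (?c S) = (1::nat)"
   proof
    fix S assume "S \<in> Pow {..<l} - t ` A"
    hence "{a \<in> A. t a = S} = {}" by auto
    thus "fact (?c S) = (1::nat)" by (simp only: card.empty fact_0)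
   qed
  qed (use True in auto)
  ultimately show ?thesis unfolding eq using True by (simp add: indicator_def)
 next
  case False
  then obtain a where a: "a \<in> A" "\<not> t a \<subseteq> {..<l}" by blast
  hence "?c (t a) ~= 0" using assms(1) by auto
  hence "\<not> (\<forall>S. card (P (atom Q l S) om) = ?c S)" using empty[OF a(2)] by metis
  thus ?thesis unfolding eq if_not_P[OF False] by (subst if_not_P) simp_all
 qed
qed

lemma prod_measure_atom:
 assumes "finite A" "!!a. a \<in> A ==> t a \<subseteq> {..<l}"
 shows "(\<Prod>a\<in>A. measure lborel (atom Q l (t a))) = (\<Prod>S\<in>Pow {..<l}. measure lborel (atom Q l S) ^ card {a \<in> A. t a = S})"
proof -
 have "(\<Prod>a\<in>A. measure lborel (atom Q l (t a))) =
  (\<Prod>S\<in>Pow {..<l}. \<Prod>a\<in>{a \<in> A. t a = S}. measure lborel (atom Q l (t a)))"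
  using assms by (intro prod.group[symmetric]) auto
 also have "... = (\<Prod>S\<in>Pow {..<l}. measure lborel (atom Q l S) ^ card {a \<in> A. t a = S})"
  by (intro prod.cong refl) simp
 finally show ?thesis .
qed

context
 fixes A :: "nat set" and Q :: "(real ^ 'd) set"
 assumes A: "finite A" and Q: "Q \<in> sets borel" "bounded Q"
begin

abbreviation "LQ \<equiv> PiM A (%_. lebesgue_on_set Q)"

interpretation product_sigma_finite "%_ :: nat. lebesgue_on_set Q"
 using finite_measure_lebesgue_on_set[OF Q]
 by (intro product_sigma_finite.intro) (simp add: finite_measure.sigma_finite_measure)

lemma sets_LQ: "sets LQ = sigma_sets (A \<rightarrow>\<^sub>E UNIV) (code_rects A)"
proof -
 have "sets LQ = sets (PiM A (%_. borel :: (real ^ 'd) measure))" by (intro sets_PiM_cong) auto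
 thus ?thesis using sets_PiM_code_rects[OF A] by simp
qed

lemma space_LQ: "space LQ = A \<rightarrow>\<^sub>E UNIV"
 by (simp add: space_PiM)

lemma emeasure_LQ_rect:
 "emeasure LQ {y \<in> A \<rightarrow>\<^sub>E UNIV. \<forall>a\<in>A. code l (y a) = t a} = ennreal (\<Prod>a\<in>A. measure lborel (atom Q l (t a)))"
proof -
 have m: "{y. code l y = S} \<in> sets (borel :: (real ^ 'd) measure)" for S
 proof -
  have "{y \<in> space borel. code l y = S} \<in> sets (borel :: (real ^ 'd) measure)" by measurable
  thus ?thesis by simp
 qed
 have set_eq: "{y \<in> A \<rightarrow>\<^sub>E UNIV. \<forall>a\<in>A. code l (y a) = t a} = Pi\<^sub>E A (%a. {y. code l y = t a})" by auto
 have "emeasure LQ (Pi\<^sub>E A (%a. {y. code l y = t a})) = (\<Prod>a\<in>A. emeasure (lebesgue_on_set Q) {y. code l y = t a})"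
  using A m by (intro emeasure_PiM) auto
 also have "... = (\<Prod>a\<in>A. ennreal (measure lborel (atom Q l (t a))))"
 proof (intro prod.cong refl)
  fix a
  have "Q \<inter> {y. code l y = t a} = atom Q l (t a)" by (auto simp: atom_def)
  thus "emeasure (lebesgue_on_set Q) {y. code l y = t a} = ennreal (measure lborel (atom Q l (t a)))"
   using emeasure_lebesgue_on_set[OF Q m] by simp
 qed
 finally show ?thesis unfolding set_eq by (simp add: prod_ennreal)
qed

text \<open>In each atom the Poisson weight \<open>m ^ c / fact c\<close> meets
  \<open>fact c\<close> matching listings. The factorials cancel, the exponentials multiply to
  \<open>exp (- measure lborel Q)\<close>, and the Lebesgue measure of the rectangle
  remains.\<close>

lemma janossy_rect:
 fixes l t
 defines "Y \<equiv> {y \<in> A \<rightarrow>\<^sub>E UNIV. \<forall>a\<in>A. code l (y a) = t a}"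
 shows "bij_sum A Q (indicator Y) \<in> borel_measurable (count_sigma Q)"
  and "(\<integral>\<^sup>+om. bij_sum A Q (indicator Y) om \<partial>M) = ennreal (exp (- measure lborel Q)) * emeasure LQ Y"
proof -
 let ?c = "%S. card {a \<in> A. t a = S}"
 let ?F = "if \<forall>a\<in>A. t a \<subseteq> {..<l} then of_nat (\<Prod>S\<in>Pow {..<l}. fact (?c S)) else 0 :: ennreal"
 note eq = bij_sum_rect[OF A Q(2), of _ l t, folded Y_def]
 have E: "count_event Q l ?c \<in> sets (count_sigma Q)"
  unfolding sets_count_sigma by (rule sigma_sets.Basic) (auto simp: count_events_def)
 have "(%om. ?F * indicator (count_event Q l ?c) om) \<in> borel_measurable (count_sigma Q)"
  using E by measurable
 thus "bij_sum A Q (indicator Y) \<in> borel_measurable (count_sigma Q)"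
  using eq by (subst measurable_cong) auto
 have "(\<integral>\<^sup>+om. bij_sum A Q (indicator Y) om \<partial>M) = (\<integral>\<^sup>+om. ?F * indicator (count_event Q l ?c) om \<partial>M)"
  by (rule nn_integral_cong) (rule eq)
 also have "... = ?F * ennreal (prob (count_event Q l ?c))"
  using count_event_measurable[OF Q(1)] by (simp add: nn_integral_cmult_indicator emeasure_eq_measure)
 also have "... = ennreal (exp (- measure lborel Q)) * emeasure LQ Y"
 proof (cases "\<forall>a\<in>A. t a \<subseteq> {..<l}")
  case True
  let ?m = "%S. measure lborel (atom Q l S)"
  have "prob (count_event Q l ?c) = (\<Prod>S\<in>Pow {..<l}. exp (- ?m S) * ?m S ^ ?c S / fact (?c S))"
   unfolding prob_count_event[OF Q] using Q by (intro prod.cong refl prob_count atom_measurable bounded_atom)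
  also have "... = (\<Prod>S\<in>Pow {..<l}. exp (- ?m S)) * (\<Prod>S\<in>Pow {..<l}. ?m S ^ ?c S) / (\<Prod>S\<in>Pow {..<l}. fact (?c S))"
   by (simp add: prod.distrib prod_dividef)
  also have "(\<Prod>S\<in>Pow {..<l}. exp (- ?m S)) = exp (- (\<Sum>S\<in>Pow {..<l}. ?m S))"
   by (simp add: exp_sum[symmetric] sum_negf)
  also have "(\<Sum>S\<in>Pow {..<l}. ?m S) = measure lborel Q" by (rule sum_measure_atom[OF Q])
  also have "(\<Prod>S\<in>Pow {..<l}. ?m S ^ ?c S) = (\<Prod>a\<in>A. ?m (t a))"
   using True by (intro prod_measure_atom[symmetric] A) auto
  finally have p: "prob (count_event Q l ?c) =
   exp (- measure lborel Q) * (\<Prod>a\<in>A. ?m (t a)) / (\<Prod>S\<in>Pow {..<l}. fact (?c S))" .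
  have F: "?F = ennreal (\<Prod>S\<in>Pow {..<l}. fact (?c S))"
   using True by (simp add: ennreal_of_nat_eq_real_of_nat)
  have "?F * ennreal (prob (count_event Q l ?c)) = ennreal ((\<Prod>S\<in>Pow {..<l}. fact (?c S)) * prob (count_event Q l ?c))"
   unfolding F by (rule ennreal_mult[symmetric]) (auto intro!: prod_nonneg)
  also have "(\<Prod>S\<in>Pow {..<l}. fact (?c S)) * prob (count_event Q l ?c) = exp (- measure lborel Q) * (\<Prod>a\<in>A. ?m (t a))"
   unfolding p by (simp add: field_simps)
  also have "ennreal ... = ennreal (exp (- measure lborel Q)) * emeasure LQ Y"
   unfolding Y_def emeasure_LQ_rect by (rule ennreal_mult) (auto intro!: prod_nonneg)
  finally show ?thesis .
 next
  case False
  then obtain a where a: "a \<in> A" "\<not> t a \<subseteq> {..<l}" by blast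
  hence "atom Q l (t a) = {}" using code_subset[of l] by (auto simp: atom_def)
  hence "(\<Prod>a\<in>A. measure lborel (atom Q l (t a))) = 0"
   using a(1) A by (intro prod_zero) (auto intro!: bexI[of _ a])
  hence 1: "emeasure LQ Y = 0" unfolding Y_def emeasure_LQ_rect by simp
  have 2: "?F = 0" using False by (rule if_not_P)
  show ?thesis unfolding 1 2 by simp
 qed
 finally show "(\<integral>\<^sup>+om. bij_sum A Q (indicator Y) om \<partial>M) = ennreal (exp (- measure lborel Q)) * emeasure LQ Y" .
qed

lemma arg_in_space: "(\<lambda>a\<in>A. X (s a) om) \<in> space LQ"
 by (auto simp: space_LQ)

text \<open>Induction over the intersection-stable generator. Measurability and the integral
  identity are proved together, because the complement and union steps integrate functions whose
  measurability comes from the induction itself.\<close>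

lemma janossy_set:
 assumes "Y \<in> sets LQ"
 shows "bij_sum A Q (indicator Y) \<in> borel_measurable (count_sigma Q) &
  (\<integral>\<^sup>+om. bij_sum A Q (indicator Y) om \<partial>M) = ennreal (exp (- measure lborel Q)) * emeasure LQ Y"
proof -
 let ?\<Omega> = "A \<rightarrow>\<^sub>E (UNIV :: (real ^ 'd) set)"
 have pow: "code_rects A \<subseteq> Pow ?\<Omega>" by (auto simp: code_rects_def)
 have fin: "emeasure LQ Y < \<infinity>" for Y
 proof -
  have "emeasure LQ Y <= emeasure LQ (space LQ)" by (rule emeasure_space)
  also have "space LQ = {y \<in> ?\<Omega>. \<forall>a\<in>A. code 0 (y a) = {}}" by (auto simp: space_LQ code_def)
  also have "emeasure LQ ... < \<infinity>" unfolding emeasure_LQ_rect by simp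
  finally show ?thesis .
 qed
 have "Y \<in> sigma_sets ?\<Omega> (code_rects A)" using assms sets_LQ by simp
 with Int_stable_code_rects pow show ?thesis
 proof (induction rule: sigma_sets_induct_disjoint)
  case (basic Y)
  show ?case
  proof (cases "Y = {}")
   case True
   thus ?thesis by (simp add: bij_sum_def[abs_def])
  next
   case False
   then obtain l t where "Y = {y \<in> A \<rightarrow>\<^sub>E UNIV. \<forall>a\<in>A. code l (y a) = t a}"
    using basic by (auto simp: code_rects_def)
   thus ?thesis using janossy_rect[of l t] by simp
  qed
 next
  case empty
  show ?case by (simp add: bij_sum_def[abs_def])
 next
  case (compl Y)
  have O: "bij_sum A Q (indicator ?\<Omega>) \<in> borel_measurable (count_sigma Q)"
   "(\<integral>\<^sup>+om. bij_sum A Q (indicator ?\<Omega>) om \<partial>M) = ennreal (exp (- measure lborel Q)) * emeasure LQ ?\<Omega>"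
   using janossy_rect[of 0 "%_. {}"] by (auto simp: code_def)
  have add: "bij_sum A Q (indicator (?\<Omega> - Y)) om + bij_sum A Q (indicator Y) om = bij_sum A Q (indicator ?\<Omega>) om" for om
   unfolding bij_sum_def sum.distrib[symmetric]
  proof (intro sum.cong refl)
   fix s
   have "(\<lambda>a\<in>A. X (s a) om) \<in> ?\<Omega>" by auto
   thus "indicator (?\<Omega> - Y) (\<lambda>a\<in>A. X (s a) om) + indicator Y (\<lambda>a\<in>A. X (s a) om) = (indicator ?\<Omega> (\<lambda>a\<in>A. X (s a) om) :: ennreal)"
    by (simp add: indicator_def)
  qed
  \<comment> \<open>Finiteness permits the subtraction in \<open>ennreal\<close> on which the
    complement step rests.\<close>
  have finY: "bij_sum A Q (indicator Y) om < \<infinity>" for om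
  proof -
   have "bij_sum A Q (indicator Y) om <= (\<Sum>s\<in>bijs A (P Q om). 1)"
    unfolding bij_sum_def by (intro sum_mono) (auto simp: indicator_def)
   also have "... < \<infinity>" by (simp add: of_nat_less_top)
   finally show ?thesis .
  qed
  have diff: "bij_sum A Q (indicator (?\<Omega> - Y)) = (%om. bij_sum A Q (indicator ?\<Omega>) om - bij_sum A Q (indicator Y) om)"
   using add finY by (intro ext) (metis ennreal_add_diff_cancel_right infinity_ennreal_def less_irrefl)
  have m: "bij_sum A Q (indicator (?\<Omega> - Y)) \<in> borel_measurable (count_sigma Q)"
  proof -
   have mY: "bij_sum A Q (indicator Y) \<in> borel_measurable (count_sigma Q)" using compl by blast
   show ?thesis unfolding diff using O(1) mY by measurable
  qed
  have YL: "Y \<in> sets LQ" "?\<Omega> \<in> sets LQ" using compl sets_LQ sets.top[of LQ] by (auto simp: space_LQ)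
  have "(\<integral>\<^sup>+om. bij_sum A Q (indicator (?\<Omega> - Y)) om \<partial>M) + (\<integral>\<^sup>+om. bij_sum A Q (indicator Y) om \<partial>M) =
   (\<integral>\<^sup>+om. bij_sum A Q (indicator ?\<Omega>) om \<partial>M)"
   unfolding add[symmetric] using m compl Q(1)
   by (intro nn_integral_add[symmetric]) (auto intro: measurable_count_sigma)
  also have "... = ennreal (exp (- measure lborel Q)) * (emeasure LQ (?\<Omega> - Y) + emeasure LQ Y)"
  proof -
   have "Y \<subseteq> ?\<Omega>" using sets.sets_into_space[OF YL(1)] by (simp add: space_LQ)
   thus ?thesis unfolding O(2) using YL by (subst plus_emeasure) (auto simp: Un_absorb2)
  qed
  finally have "(\<integral>\<^sup>+om. bij_sum A Q (indicator (?\<Omega> - Y)) om \<partial>M) + ennreal (exp (- measure lborel Q)) * emeasure LQ Y =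
   ennreal (exp (- measure lborel Q)) * emeasure LQ (?\<Omega> - Y) + ennreal (exp (- measure lborel Q)) * emeasure LQ Y"
   using compl by (simp add: distrib_left)
  moreover have "ennreal (exp (- measure lborel Q)) * emeasure LQ Y ~= \<infinity>"
   using fin[of Y] by (simp add: ennreal_mult_eq_top_iff)
  ultimately show ?case using m by (metis ennreal_add_diff_cancel_right infinity_ennreal_def)
 next
  case (union B)
  have eq: "bij_sum A Q (indicator (\<Union>i. B i)) om = (\<Sum>i. bij_sum A Q (indicator (B i)) om)" for om
   unfolding bij_sum_def suminf_indicator[OF union(1), symmetric] by (rule suminf_sum[symmetric]) auto
  have m: "bij_sum A Q (indicator (B i)) \<in> borel_measurable (count_sigma Q)" for i using union by blast
  have "(\<integral>\<^sup>+om. bij_sum A Q (indicator (\<Union>i. B i)) om \<partial>M) = (\<Sum>i. \<integral>\<^sup>+om. bij_sum A Q (indicator (B i)) om \<partial>M)"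
   unfolding eq using m Q(1) by (intro nn_integral_suminf) (auto intro: measurable_count_sigma)
  also have "... = ennreal (exp (- measure lborel Q)) * (\<Sum>i. emeasure LQ (B i))"
   using union by (simp add: ennreal_suminf_cmult)
  also have "(\<Sum>i. emeasure LQ (B i)) = emeasure LQ (\<Union>i. B i)"
   using union sets_LQ by (intro suminf_emeasure) auto
  finally show ?case using m unfolding eq[abs_def] by (auto intro!: borel_measurable_suminf_order)
 qed
qed

text \<open>The finite-dimensional form of the Poisson process: up to the weight, the points are
  independent and uniform given their number. The proof extends \<open>janossy_set\<close> along
  simple functions and monotone limits.\<close>

lemma janossy:
 assumes "h \<in> borel_measurable (PiM A (%_. borel))"
 shows "bij_sum A Q h \<in> borel_measurable (count_sigma Q) &
  (\<integral>\<^sup>+om. bij_sum A Q h om \<partial>M) = ennreal (exp (- measure lborel Q)) * (\<integral>\<^sup>+y. h y \<partial>LQ)"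
proof -
 have "sets LQ = sets (PiM A (%_. borel :: (real ^ 'd) measure))" by (intro sets_PiM_cong) auto
 hence "h \<in> borel_measurable LQ" using assms by (simp cong: measurable_cong_sets)
 thus ?thesis
 proof (induction rule: borel_measurable_induct)
  case (cong f g)
  have "bij_sum A Q f = bij_sum A Q g"
   unfolding bij_sum_def using cong(3)[OF arg_in_space] by (intro ext) simp
  moreover have "(\<integral>\<^sup>+y. f y \<partial>LQ) = (\<integral>\<^sup>+y. g y \<partial>LQ)" using cong(3) by (rule nn_integral_cong)
  ultimately show ?case using cong(4) by simp
 next
  case (set Y)
  thus ?case using janossy_set by simp
 next
  case (mult u c)
  have eq: "bij_sum A Q (%x. c * u x) = (%om. c * bij_sum A Q u om)"
   by (simp add: bij_sum_def sum_distrib_left fun_eq_iff)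
  show ?case unfolding eq using mult Q(1)
   by (auto simp: nn_integral_cmult measurable_count_sigma mult_ac)
 next
  case (add u v)
  have eq: "bij_sum A Q (%x. v x + u x) = (%om. bij_sum A Q v om + bij_sum A Q u om)"
   by (simp add: bij_sum_def sum.distrib fun_eq_iff)
  show ?case unfolding eq using add Q(1)
   by (auto simp: nn_integral_add measurable_count_sigma distrib_left)
 next
  case (seq U)
  have mono: "U m y <= U n y" if "m <= n" for m n y
   using \<open>incseq U\<close> that by (auto simp: incseq_def le_fun_def)
  have eq: "bij_sum A Q (SUP i. U i) = (%om. SUP i. bij_sum A Q (U i) om)"
   unfolding bij_sum_def using \<open>incseq U\<close>
   by (intro ext) (simp add: image_comp, intro ennreal_SUP_sum[symmetric], auto simp: incseq_def mono)
  have inc: "incseq (%i. bij_sum A Q (U i))"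
   by (auto simp: incseq_def bij_sum_def intro!: le_funI sum_mono mono)
  have m: "bij_sum A Q (U i) \<in> borel_measurable (count_sigma Q)" for i using seq by blast
  have "(\<integral>\<^sup>+om. (SUP i. bij_sum A Q (U i) om) \<partial>M) = (SUP i. \<integral>\<^sup>+om. bij_sum A Q (U i) om \<partial>M)"
   using inc m Q(1) by (intro nn_integral_monotone_convergence_SUP) (auto intro: measurable_count_sigma)
  also have "... = ennreal (exp (- measure lborel Q)) * (SUP i. \<integral>\<^sup>+y. U i y \<partial>LQ)"
   using seq by (simp add: SUP_mult_left_ennreal)
  also have "(SUP i. \<integral>\<^sup>+y. U i y \<partial>LQ) = (\<integral>\<^sup>+y. (SUP i. U i y) \<partial>LQ)"
   using seq by (intro nn_integral_monotone_convergence_SUP[symmetric]) auto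
  finally show ?case unfolding eq using m by (auto simp: image_comp)
 qed
qed

end

end

section \<open>Translates and locally finite versions of the process\<close>

lemma measure_lborel_translate:
 fixes B :: "'a :: euclidean_space set"
 assumes "B \<in> sets borel"
 shows "measure lborel {x. x + y \<in> B} = measure lborel B"
proof -
 have "measure lborel B = measure (distr lborel borel ((+) y)) B"
  by (simp add: lborel_distr_plus)
 also have "... = measure lborel ((+) y -` B \<inter> space lborel)"
  using assms by (intro measure_distr) auto
 also have "(+) y -` B \<inter> space lborel = {x. x + y \<in> B}" by (auto simp: add.commute)
 finally show ?thesis by simp
qed

lemma bounded_translate_iff:
 fixes B :: "'a :: euclidean_space set"
 shows "bounded B ==> bounded {x. x + y \<in> B}"
proof -
 assume "bounded B"
 hence "bounded ((+) (- y) ` B)" by (rule bounded_translation)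
 thus ?thesis by (rule bounded_subset) (force simp: image_iff)
qed

text \<open>In the Mecke formula the other points are seen from the position \<open>y\<close> of one
  point; translation invariance of Lebesgue measure keeps the process Poisson.\<close>

lemma (in poisson_points) poisson_points_translate: "poisson_points M (%i om. X i om + y)"
proof -
 have pts_eq: "pts (%i om. X i om + y) B om = P {x. x + y \<in> B} om" for B om
  by (simp add: pts_def)
 have meas: "{x. x + y \<in> B} \<in> sets borel" if "B \<in> sets borel" for B :: "(real ^ 'd) set"
  using measurable_sets[OF _ that, of "%x. x + y" borel] by (simp add: vimage_def)
 show ?thesis
 proof unfold_locales
  show "(%om. X i om + y) \<in> borel_measurable M" for i by measurable
  show "finite (pts (%i om. X i om + y) B om)" if "bounded B" for B om
   unfolding pts_eq by (intro finite_pts bounded_translate_iff that)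
  show "prob {om \<in> space M. card (pts (%i om. X i om + y) B om) = k} =
    exp (- measure lborel B) * measure lborel B ^ k / fact k"
   if "B \<in> sets borel" "bounded B" for B k
   unfolding pts_eq using prob_count[OF meas bounded_translate_iff] that
   by (simp add: measure_lborel_translate)
  show "prob {om \<in> space M. \<forall>t\<in>{..<m}. card (pts (%i om. X i om + y) (b t) om) = \<kappa> t} =
    (\<Prod>t<m. prob {om \<in> space M. card (pts (%i om. X i om + y) (b t) om) = \<kappa> t})"
   if "disjoint_family_on b {..<m}" "!!t. t < m ==> b t \<in> sets borel & bounded (b t)" for m :: nat and b \<kappa>
   unfolding pts_eq
  proof (rule prob_counts)
   show "disjoint_family_on (%t. {x. x + y \<in> b t}) {..<m}"
    using that(1) by (auto simp: disjoint_family_on_def)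
   fix t assume "t \<in> {..<m}"
   thus "{x. x + y \<in> b t} \<in> sets borel & bounded {x. x + y \<in> b t}"
    using that(2)[of t] by (intro conjI meas bounded_translate_iff) auto
  qed simp
 qed
qed

lemma (in prob_space) locally_finite_version:
 fixes X :: "nat => 'a => real ^ 'd"
 assumes "unit_poisson_process M X"
 obtains X' where "poisson_points M X'" "AE om in M. \<forall>i. X' i om = X i om"
proof -
 have X[measurable]: "X i \<in> borel_measurable M" for i
  using assms by (simp add: unit_poisson_process_def)
 have "AE om in M. \<forall>B. bounded B --> finite {i. X i om \<in> B}"
  using assms by (simp add: unit_poisson_process_def)
 then obtain N where N: "{om \<in> space M. \<not> (\<forall>B. bounded B --> finite {i. X i om \<in> B})} \<subseteq> N" "N \<in> null_sets M"
  by (elim AE_E) auto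
 \<comment> \<open>On the null set the points are moved to the multiples of the all-ones vector,
   some locally finite configuration.\<close>
 define X' where "X' i om = (if om \<in> space M - N then X i om else of_nat i *\<^sub>R 1)" for i om
 have AE_N: "AE om in M. om \<notin> N" using N(2) by (rule AE_not_in)
 hence ae: "AE om in M. \<forall>i. X' i om = X i om"
  using AE_space by eventually_elim (simp add: X'_def)
 have N_sets: "N \<in> sets M" using N(2) by auto
 have X'_meas: "X' i \<in> borel_measurable M" for i
  unfolding X'_def using N_sets by measurable
 have pts_ae: "AE om in M. pts X' B om = pts X B om" for B
  using ae by eventually_elim (simp add: pts_def)
 have c_meas: "(%om. card (pts Y B om)) \<in> measurable M (count_space UNIV)"
  if "!!i. Y i \<in> borel_measurable M" "B \<in> sets borel" for Y and B :: "(real ^ 'd) set"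
  unfolding pts_def using that by (intro measurable_card_countable(2)) simp
 have "poisson_points M X'"
 proof unfold_locales
  show "X' i \<in> borel_measurable M" for i by (rule X'_meas)
  show "finite (pts X' B om)" if B: "bounded B" for B om
  proof (cases "om \<in> space M - N")
   case True
   thus ?thesis using N(1) that by (auto simp: pts_def X'_def)
  next
   case False
   obtain b where b: "!!x. x \<in> B ==> norm x <= b" using B unfolding bounded_iff by blast
   have "pts X' B om \<subseteq> {i. real i <= b / norm (1 :: real ^ 'd)}"
   proof
    fix i assume "i \<in> pts X' B om"
    hence "of_nat i *\<^sub>R (1 :: real ^ 'd) \<in> B"
     using False by (auto simp: pts_def X'_def split: if_splits)
    from b[OF this] have "norm (of_nat i *\<^sub>R (1 :: real ^ 'd)) <= b" .
    thus "i \<in> {i. real i <= b / norm (1 :: real ^ 'd)}"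
     by (simp add: pos_le_divide_eq)
   qed
   moreover have "finite {i. real i <= b / norm (1 :: real ^ 'd)}"
    by (rule finite_subset[of _ "{..nat \<lfloor>b / norm (1 :: real ^ 'd)\<rfloor>}"]) (auto simp: le_nat_floor)
   ultimately show ?thesis by (rule finite_subset)
  qed
  show "prob {om \<in> space M. card (pts X' B om) = k} = exp (- measure lborel B) * measure lborel B ^ k / fact k"
   if B: "B \<in> sets borel" "bounded B" for B k
  proof -
   have [measurable]: "(%om. card (pts X' B om)) \<in> measurable M (count_space UNIV)"
    "(%om. card (pts X B om)) \<in> measurable M (count_space UNIV)"
    using X X'_meas B by (auto intro: c_meas)
   have "prob {om \<in> space M. card (pts X' B om) = k} = prob {om \<in> space M. card (pts X B om) = k}"
    by (rule finite_measure_eq_AE) (use pts_ae[of B] in auto)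
   thus ?thesis using assms B by (simp add: unit_poisson_process_def pts_def)
  qed
  show "prob {om \<in> space M. \<forall>t\<in>{..<m}. card (pts X' (b t) om) = \<kappa> t} =
    (\<Prod>t<m. prob {om \<in> space M. card (pts X' (b t) om) = \<kappa> t})"
   if b: "disjoint_family_on b {..<m}" "!!t. t < m ==> b t \<in> sets borel & bounded (b t)" for m :: nat and b \<kappa>
  proof -
   have m1: "(%om. card (pts X' (b t) om)) \<in> measurable M (count_space UNIV)"
    and m2: "(%om. card (pts X (b t) om)) \<in> measurable M (count_space UNIV)" if "t < m" for t
    using X X'_meas b(2)[OF that] by (auto intro: c_meas)
   have p1: "Measurable.pred M (%om. card (pts X' (b t) om) = \<kappa> t)"
    and p2: "Measurable.pred M (%om. card (pts X (b t) om) = \<kappa> t)" if "t < m" for t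
    using m1[OF that] m2[OF that] by measurable
   have "AE om in M. \<forall>t\<in>{..<m}. pts X' (b t) om = pts X (b t) om"
    using pts_ae by (intro AE_finite_allI) auto
   hence "prob {om \<in> space M. \<forall>t\<in>{..<m}. card (pts X' (b t) om) = \<kappa> t} =
    prob {om \<in> space M. \<forall>t\<in>{..<m}. card (pts X (b t) om) = \<kappa> t}"
    by (intro finite_measure_eq_AE predE pred_intros_finite p1 p2) auto
   also have "... = (\<Prod>t<m. prob {om \<in> space M. card (pts X (b t) om) = \<kappa> t})"
   proof (rule prob_disjoint_counts)
    show "indep_vars (%_. count_space UNIV) (%B om. card {i. X i om \<in> B}) \<B>"
     if "finite \<B>" "disjoint \<B>" "\<forall>B\<in>\<B>. B \<in> sets borel & bounded B" for \<B>
     using assms that by (simp add: unit_poisson_process_def)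
   qed (use b in auto)
   also have "... = (\<Prod>t<m. prob {om \<in> space M. card (pts X' (b t) om) = \<kappa> t})"
   proof (rule prod.cong[OF refl])
    fix t assume "t \<in> {..<m}"
    thus "prob {om \<in> space M. card (pts X (b t) om) = \<kappa> t} = prob {om \<in> space M. card (pts X' (b t) om) = \<kappa> t}"
     using pts_ae[of "b t"] by (intro finite_measure_eq_AE predE p1 p2) auto
   qed
   finally show ?thesis .
  qed
 qed
 thus ?thesis using that ae by blast
qed

lemma fact_ennreal_cancel: "fact k * (x :: ennreal) / fact k = x"
proof -
 have "(fact k :: ennreal) = of_nat (fact k)" by simp
 moreover have "(of_nat (fact k) :: ennreal) ~= 0" "(of_nat (fact k) :: ennreal) ~= top"
  using ennreal_of_nat_eq_real_of_nat[of "fact k"] by auto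
 ultimately have "(fact k :: ennreal) ~= 0" "(fact k :: ennreal) ~= top" by auto
 thus ?thesis by (subst mult.commute) (rule ennreal_mult_divide_eq)
qed

context poisson_points
begin

lemma bij_sum_const:
 assumes "finite A" "bounded Q" "!!s. s \<in> bijs A (P Q om) ==> h (\<lambda>a\<in>A. X (s a) om) = g"
 shows "bij_sum A Q h om = (if card (P Q om) = card A then fact (card A) * g else 0)"
proof -
 have "bij_sum A Q h om = (\<Sum>s\<in>bijs A (P Q om). g)"
  unfolding bij_sum_def by (rule sum.cong[OF refl], rule assms(3))
 thus ?thesis
  using card_bijs[OF assms(1) finite_pts[OF assms(2)], of om] by simp
qed

text \<open>A quantity that does not depend on the listing equals the sum over \<open>k\<close> of
  \<open>bij_sum\<close> divided by \<open>fact k\<close>, and each term is measurable by the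
  Janossy formula.\<close>

lemma symmetric_measurable:
 assumes Q: "Q \<in> sets borel" "bounded Q"
  and h: "!!k. h k \<in> borel_measurable (PiM {..<k} (%_. borel))"
  and G: "!!om k s. s \<in> bijs {..<k} (P Q om) ==> h k (\<lambda>a\<in>{..<k}. X (s a) om) = (G om :: ennreal)"
 shows "G \<in> borel_measurable (count_sigma Q)"
proof -
 have eq: "bij_sum {..<k} Q (h k) om / fact k = (if card (P Q om) = k then G om else 0)" for k om
  using bij_sum_const[of "{..<k}" Q om "h k" "G om"] G Q
  by (simp add: fact_ennreal_cancel)
 have "G om = (\<Sum>k. bij_sum {..<k} Q (h k) om / fact k)" for om
  unfolding eq using suminf_finite[of "{card (P Q om)}" "%k. if card (P Q om) = k then G om else 0"] by simp
 moreover have "(%om. \<Sum>k. bij_sum {..<k} Q (h k) om / fact k) \<in> borel_measurable (count_sigma Q)"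
  using janossy[OF _ Q h] by (intro borel_measurable_suminf_order borel_measurable_divide_ennreal) auto
 ultimately show ?thesis by presburger
qed

text \<open>Each configuration occurs once for each of its listings, whence the factorial on the
  left.\<close>

lemma nn_integral_symmetric:
 assumes A: "finite A" and Q: "Q \<in> sets borel" "bounded Q"
  and h: "h \<in> borel_measurable (PiM A (%_. borel))"
  and G: "!!om s. om \<in> space M ==> s \<in> bijs A (P Q om) ==> h (\<lambda>a\<in>A. X (s a) om) = (G om :: ennreal)"
 shows "fact (card A) * (\<integral>\<^sup>+om. (if card (P Q om) = card A then G om else 0) \<partial>M) =
  ennreal (exp (- measure lborel Q)) * (\<integral>\<^sup>+y. h y \<partial>PiM A (%_. lebesgue_on_set Q))"
proof -
 have eq: "bij_sum A Q h om = fact (card A) * (if card (P Q om) = card A then G om else 0)" if "om \<in> space M" for om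
  using bij_sum_const[of A Q om h "G om"] G[OF that] A Q by simp
 have m: "bij_sum A Q h \<in> borel_measurable M"
  using janossy[OF A Q h] measurable_count_sigma[OF Q(1)] by blast
 have "(%om. (bij_sum A Q h om) / fact (card A)) \<in> borel_measurable M"
  using m by measurable
 moreover have "bij_sum A Q h om / fact (card A) = (if card (P Q om) = card A then G om else 0)" if "om \<in> space M" for om
  unfolding eq[OF that] by (simp add: fact_ennreal_cancel)
 ultimately have "(%om. if card (P Q om) = card A then G om else 0) \<in> borel_measurable M"
  by (subst measurable_cong[where g="%om. (bij_sum A Q h om) / fact (card A)"]) auto
 hence "fact (card A) * (\<integral>\<^sup>+om. (if card (P Q om) = card A then G om else 0) \<partial>M) = (\<integral>\<^sup>+om. bij_sum A Q h om \<partial>M)"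
  by (subst nn_integral_cmult[symmetric]) (auto intro!: nn_integral_cong simp: eq)
 thus ?thesis using janossy[OF A Q h] by simp
qed

end

section \<open>The Mecke formula for components\<close>

fun vpos :: "(nat => real ^ 'd) => vertex => real ^ 'd" where
 "vpos x Root = 0"
| "vpos x (Point i) = x i"

lemma location_eq_vpos: "location X om = vpos (%i. X i om)"
proof
 show "location X om v = vpos (%i. X i om) v" for v by (cases v) auto
qed

lemma bijs_D: "s \<in> bijs A I ==> s ` A = I" "s \<in> bijs A I ==> inj_on s A"
 by (auto simp: bijs_def bij_betw_def)

context label_graph
begin

lemma comp_of_translate: "comp_of c (%v. y v + a) w u V = comp_of c y w u V"
 by (simp add: label_edges_def conn_translate fun_eq_iff)

text \<open>Marks and labels are averaged out while the locations stay frozen, so that only the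
  point process remains random afterwards.\<close>

definition comp_mean :: "(nat => ennreal) => (vertex => real ^ 'd) => vertex set => vertex => ennreal" where
 "comp_mean F y V v = (\<integral>\<^sup>+r. F (card (comp_of c y (fst r) (snd r) V v)) \<partial>R)"

lemma comp_mean_reindex:
 assumes "inj_on f V" "!!a. a \<in> V ==> y' (f a) = y a" "v \<in> V"
 shows "comp_mean F y' (f ` V) (f v) = comp_mean F y V v"
 unfolding comp_mean_def by (rule nn_integral_card_comp_reindex) (use assms in auto)

lemma comp_mean_cong:
 assumes "!!a. a \<in> V ==> y' a = y a" "v \<in> V"
 shows "comp_mean F y' V v = comp_mean F y V v"
 using comp_mean_reindex[of id V y' y v F] assms by simp

lemma measurable_comp_mean:
 assumes "!!v. v \<in> V ==> (%om. y om v) \<in> borel_measurable N" "v \<in> V"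
 shows "(%om. comp_mean F (y om) V v) \<in> borel_measurable N"
proof -
 \<comment> \<open>Locations are measurable on \<open>V\<close> only; elsewhere they do not matter
   and are set to 0.\<close>
 have eq: "comp_mean F (y om) V v = comp_mean F (%a. if a \<in> V then y om a else 0) V v" for om
  by (rule comp_mean_cong) (use assms in auto)
 have m[measurable]: "(%om. if a \<in> V then y om a else 0) \<in> borel_measurable N" for a
  using assms(1)[of a] by (cases "a \<in> V") auto
 have "(%q. card (comp_of c (%a. if a \<in> V then y (fst q) a else 0) (fst (snd q)) (snd (snd q)) V v))
   \<in> measurable (N \<Otimes>\<^sub>M R) (count_space UNIV)"
 proof (rule measurable_card_countable(2), rule measurable_comp_of[OF conn_measurable])
  show "(%q. fst (snd q) a) \<in> borel_measurable (N \<Otimes>\<^sub>M R)" for a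
   by (rule measurable_compose[OF measurable_snd measurable_mark])
  show "(%q. snd (snd q) e) \<in> borel_measurable (N \<Otimes>\<^sub>M R)" if "e \<in> vertex_pairs" for e
   by (rule measurable_compose[OF measurable_snd measurable_pair_label[OF that]])
  show "(%q. if a \<in> V then y (fst q) a else 0) \<in> borel_measurable (N \<Otimes>\<^sub>M R)" for a
   by (rule measurable_compose[OF measurable_fst m])
 qed auto
 hence "(%q. F (card (comp_of c (%a. if a \<in> V then y (fst q) a else 0) (fst (snd q)) (snd (snd q)) V v)))
   \<in> borel_measurable (N \<Otimes>\<^sub>M R)"
  by (rule measurable_compose) auto
 hence "(%(om, r). F (card (comp_of c (%a. if a \<in> V then y om a else 0) (fst r) (snd r) V v)))
   \<in> borel_measurable (N \<Otimes>\<^sub>M R)"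
  by (simp add: split_beta')
 thus ?thesis by (subst eq, unfold comp_mean_def) (rule labels.borel_measurable_nn_integral)
qed

end

locale ksrg_model = label_graph \<mu> c p + poisson_points M X
 for \<mu> and c :: "(real ^ 'd) => real => (real ^ 'd) => real => real" and p
  and M :: "'w measure" and X :: "nat => 'w => real ^ 'd"
begin

definition cell_sum :: "(nat => ennreal) => (real ^ 'd) set => 'w => ennreal" where
 "cell_sum F Q om = (\<Sum>i\<in>P Q om. comp_mean F (vpos (%i. X i om)) (Point ` P Q om) (Point i))"

definition palm_mean :: "(nat => ennreal) => (real ^ 'd) set => 'w => ennreal" where
 "palm_mean F Q om = comp_mean F (vpos (%i. X i om)) (insert Root (Point ` P Q om)) Root"

lemma cell_sum_bij:
 assumes s: "s \<in> bijs A (P Q om)"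
 shows "(\<Sum>i\<in>A. comp_mean F (vpos (\<lambda>a\<in>A. X (s a) om)) (Point ` A) (Point i)) = cell_sum F Q om"
proof -
 let ?f = "%v. case v of Root => Root | Point a => Point (s a)"
 have img: "?f ` Point ` A = Point ` P Q om"
  unfolding bijs_D(1)[OF s, symmetric] by (simp add: image_image)
 have inj: "inj_on ?f (Point ` A)"
  using bijs_D(2)[OF s] by (auto simp: inj_on_def)
 have "comp_mean F (vpos (%i. X i om)) (?f ` Point ` A) (?f (Point a)) =
   comp_mean F (vpos (\<lambda>a\<in>A. X (s a) om)) (Point ` A) (Point a)" if "a \<in> A" for a
  by (rule comp_mean_reindex[OF inj]) (use that in auto)
 hence "(\<Sum>i\<in>A. comp_mean F (vpos (\<lambda>a\<in>A. X (s a) om)) (Point ` A) (Point i)) =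
   (\<Sum>i\<in>A. comp_mean F (vpos (%i. X i om)) (Point ` P Q om) (Point (s i)))"
  unfolding img by (intro sum.cong refl) simp
 also have "... = cell_sum F Q om"
  unfolding cell_sum_def unfolding bijs_D(1)[OF s, symmetric] by (simp add: sum.reindex[OF bijs_D(2)[OF s]] image_image)
 finally show ?thesis .
qed

lemma measurable_point_mean:
 assumes "i \<in> A"
 shows "(%y. comp_mean F (vpos y) (Point ` A) (Point i)) \<in> borel_measurable (PiM A (%_. borel))"
proof (rule measurable_comp_mean)
 fix v assume "v \<in> Point ` A"
 then obtain a where "v = Point a" "a \<in> A" by auto
 thus "(%y. vpos y v) \<in> borel_measurable (PiM A (%_. borel))" by simp
qed (use assms in auto)

lemma measurable_cell_sum:
 assumes Q: "Q \<in> sets borel" "bounded Q"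
 shows "cell_sum F Q \<in> borel_measurable (count_sigma Q)"
 by (rule symmetric_measurable[OF Q, where h="%k y. \<Sum>i<k. comp_mean F (vpos y) (Point ` {..<k}) (Point i)"])
  (auto intro!: borel_measurable_sum measurable_point_mean cell_sum_bij)

text \<open>Translating by \<open>- y\<close> moves the vertex \<open>i\<close> to the origin, where
  it takes the role of \<open>Root\<close>; translation invariance of \<open>c\<close> and of the
  label law leaves the mean unchanged.\<close>

lemma palm_mean_translate:
 assumes s: "s \<in> bijs A (pts (%i om. X i om + y) Q om)" and i: "i \<notin> A"
 shows "comp_mean F (vpos ((\<lambda>a\<in>A. X (s a) om + y)(i := y))) (Point ` insert i A) (Point i) =
  palm_mean F {x. x + y \<in> Q} om"
proof -
 let ?f = "%v. case v of Root => Root | Point a => if a = i then Root else Point (s a)"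
 let ?z = "(\<lambda>a\<in>A. X (s a) om + y)(i := y)"
 have P: "pts (%i om. X i om + y) Q om = P {x. x + y \<in> Q} om" by (simp add: pts_def)
 have sA: "s ` A = P {x. x + y \<in> Q} om" "inj_on s A" using bijs_D[OF s] P by auto
 have "?f ` Point ` insert i A = insert Root ((%a. Point (s a)) ` A)"
  using i by (auto simp: image_image)
 hence img: "?f ` Point ` insert i A = insert Root (Point ` P {x. x + y \<in> Q} om)"
  unfolding sA(1)[symmetric] by (simp add: image_image)
 have inj: "inj_on ?f (Point ` insert i A)"
  using sA(2) i by (auto simp: inj_on_def)
 have "palm_mean F {x. x + y \<in> Q} om =
   comp_mean F (%v. vpos (%i. X i om) v + y) (?f ` Point ` insert i A) (?f (Point i))"
  unfolding palm_mean_def img comp_mean_def comp_of_translate by simp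
 also have "... = comp_mean F (vpos ?z) (Point ` insert i A) (Point i)"
  by (rule comp_mean_reindex[OF inj]) (use i in auto)
 finally show ?thesis by simp
qed

lemma palm_mean_bij:
 assumes s: "s \<in> bijs {..<k} (P Q om)"
 shows "comp_mean F (vpos ((\<lambda>a\<in>{..<k}. X (s a) om)(k := 0))) (Point ` {..k}) (Point k) = palm_mean F Q om"
 using palm_mean_translate[of s "{..<k}" 0 Q om k F] s by (simp add: lessThan_Suc[symmetric] lessThan_Suc_atMost)

lemma measurable_palm_mean:
 assumes Q: "Q \<in> sets borel" "bounded Q"
 shows "palm_mean F Q \<in> borel_measurable M"
proof (rule measurable_count_sigma[OF Q(1)], rule symmetric_measurable[OF Q])
 fix k
 show "(%y. comp_mean F (vpos (y(k := 0))) (Point ` {..k}) (Point k)) \<in> borel_measurable (PiM {..<k} (%_. borel))"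
 proof (rule measurable_comp_mean)
  fix v assume "v \<in> Point ` {..k}"
  then obtain a where a: "v = Point a" "a <= k" by auto
  thus "(%y. vpos (y(k := 0)) v) \<in> borel_measurable (PiM {..<k} (%_. borel))"
   by (cases "a = k") auto
 qed auto
qed (rule palm_mean_bij)

text \<open>The Janossy formula of order \<open>Suc k\<close> is integrated over the position
  \<open>y\<close> of one point. The other \<open>k\<close> coordinates then obey the formula of
  order \<open>k\<close>, so each point contributes a Palm mean, and the sum over \<open>k\<close>
  gives the Mecke formula for this functional.\<close>

lemma mecke:
 assumes Q: "Q \<in> sets borel" "bounded Q"
 shows "(\<integral>\<^sup>+om. cell_sum F Q om \<partial>M) = (\<integral>\<^sup>+y. (\<integral>\<^sup>+om. palm_mean F {x. x + y \<in> Q} om \<partial>M) \<partial>lebesgue_on_set Q)"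
proof -
 let ?L = "lebesgue_on_set Q"
 let ?E = "ennreal (exp (- measure lborel Q))"
 interpret L: product_sigma_finite "%_ :: nat. ?L"
  using finite_measure_lebesgue_on_set[OF Q]
  by (intro product_sigma_finite.intro) (simp add: finite_measure.sigma_finite_measure)
 have Qy: "{x. x + y \<in> Q} \<in> sets borel" "bounded {x. x + y \<in> Q}" for y
  using measurable_sets[OF _ Q(1), of "%x. x + y" borel] Q(2)
  by (simp_all add: vimage_def bounded_translate_iff)
 \<comment> \<open>The part of the Palm mean with exactly \<open>k\<close> points besides the one at
   \<open>y\<close>; the identity is proved separately for each \<open>k\<close>.\<close>
 define G where "G k y om = (if card (P {x. x + y \<in> Q} om) = k then palm_mean F {x. x + y \<in> Q} om else 0)" for k y om
 have mG[measurable]: "G k y \<in> borel_measurable M" for k y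
 proof -
  have [measurable]: "(%om. card (P {x. x + y \<in> Q} om)) \<in> measurable M (count_space UNIV)"
   by (rule measurable_card_pts[OF Qy(1)])
  show ?thesis unfolding G_def using measurable_palm_mean[OF Qy] by measurable
 qed
 have "(%y. \<integral>\<^sup>+om. G k y om \<partial>M) \<in> borel_measurable ?L &
  (\<integral>\<^sup>+om. (if card (P Q om) = Suc k then cell_sum F Q om else 0) \<partial>M) = (\<integral>\<^sup>+y. (\<integral>\<^sup>+om. G k y om \<partial>M) \<partial>?L)" for k
 proof -
  let ?\<Phi> = "%i y. comp_mean F (vpos y) (Point ` {..<Suc k}) (Point i)"
  have sets_PiM': "sets (PiM A (%_. ?L)) = sets (PiM A (%_. borel))" for A :: "nat set"
   by (intro sets_PiM_cong) auto
  have m\<Phi>: "?\<Phi> i \<in> borel_measurable (PiM {..<Suc k} (%_. ?L))" if "i < Suc k" for i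
   using measurable_point_mean[of i "{..<Suc k}" F] that by (simp cong: measurable_cong_sets add: sets_PiM')
  let ?h = "%i y. \<integral>\<^sup>+z. ?\<Phi> i (z(i := y)) \<partial>PiM ({..<Suc k} - {i}) (%_. ?L)"
  \<comment> \<open>With one coordinate fixed at \<open>y\<close>, the rest follows the Janossy
    formula of order \<open>k\<close> for the process shifted by \<open>y\<close>.\<close>
  have point: "?h i = (%y. fact k / ?E * (\<integral>\<^sup>+om. G k y om \<partial>M))" and
   point_meas: "?h i \<in> borel_measurable ?L" and
   point_int: "(\<integral>\<^sup>+y. ?\<Phi> i y \<partial>PiM {..<Suc k} (%_. ?L)) = (\<integral>\<^sup>+y. ?h i y \<partial>?L)"
   if i: "i < Suc k" for i
  proof -
   let ?g = "?h i"
   let ?A = "{..<Suc k} - {i}"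
   have ins: "insert i ?A = {..<Suc k}" using i by auto
   have cA: "card ?A = k" using i by simp
   have jm: "(%(y, z). ?\<Phi> i (z(i := y))) \<in> borel_measurable (?L \<Otimes>\<^sub>M PiM ?A (%_. ?L))"
   proof -
    have 1: "?\<Phi> i \<in> borel_measurable (PiM (insert i ?A) (%_. ?L))" using m\<Phi>[OF i] ins by simp
    have "(%(y, z). z(i := y)) \<in> measurable (?L \<Otimes>\<^sub>M PiM ?A (%_. ?L)) (PiM (insert i ?A) (%_. ?L))"
     by measurable
    from measurable_compose[OF this 1] show ?thesis by (simp add: split_beta')
   qed
   interpret A: finite_product_sigma_finite "%_. ?L" ?A by standard simp
   show "?g \<in> borel_measurable ?L"
    using A.borel_measurable_nn_integral[OF jm] by simp
   show "(\<integral>\<^sup>+y. ?\<Phi> i y \<partial>PiM {..<Suc k} (%_. ?L)) = (\<integral>\<^sup>+y. ?g y \<partial>?L)"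
    using L.product_nn_integral_insert_rev[of ?A i "?\<Phi> i"] m\<Phi>[OF i] unfolding ins by simp
   show "?g = (%y. fact k / ?E * (\<integral>\<^sup>+om. G k y om \<partial>M))"
   proof
    fix y
    interpret Y: poisson_points M "%i om. X i om + y" by (rule poisson_points_translate)
    have m: "(%z. ?\<Phi> i (z(i := y))) \<in> borel_measurable (PiM ?A (%_. borel))"
    proof -
     have "(%z. (y, z)) \<in> measurable (PiM ?A (%_. ?L)) (?L \<Otimes>\<^sub>M PiM ?A (%_. ?L))" by measurable
     from measurable_compose[OF this jm] show ?thesis by (simp cong: measurable_cong_sets add: sets_PiM')
    qed
    have "fact (card ?A) * (\<integral>\<^sup>+om. (if card (pts (%i om. X i om + y) Q om) = card ?A then palm_mean F {x. x + y \<in> Q} om else 0) \<partial>M) =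
     ?E * (\<integral>\<^sup>+z. ?\<Phi> i (z(i := y)) \<partial>PiM ?A (%_. ?L))"
     by (rule Y.nn_integral_symmetric[OF _ Q m]) (use palm_mean_translate[of _ ?A y Q _ i F, unfolded ins] in simp_all)
    moreover have "(\<integral>\<^sup>+om. (if card (pts (%i om. X i om + y) Q om) = card ?A then palm_mean F {x. x + y \<in> Q} om else 0) \<partial>M) =
     (\<integral>\<^sup>+om. G k y om \<partial>M)"
     unfolding G_def cA by (simp add: pts_def)
    ultimately have eq: "fact k * (\<integral>\<^sup>+om. G k y om \<partial>M) = ?E * ?g y" unfolding cA by simp
    have "?g y = ?g y * ?E / ?E" by (rule ennreal_mult_divide_eq[symmetric]) auto
    also have "... = fact k * (\<integral>\<^sup>+om. G k y om \<partial>M) / ?E" by (simp add: eq mult.commute)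
    finally show "?g y = fact k / ?E * (\<integral>\<^sup>+om. G k y om \<partial>M)"
     by (simp add: divide_ennreal_def mult_ac)
   qed
  qed
  \<comment> \<open>Measurability in \<open>y\<close> of the mean of \<open>G k y\<close> is read
    off from \<open>point\<close>, whose left side is a section integral; the factors cancel
    below.\<close>
  have "(%y. ?E * (fact k / ?E * (\<integral>\<^sup>+om. G k y om \<partial>M)) / fact k) \<in> borel_measurable ?L"
   using point_meas[of 0] unfolding point[of 0, simplified] by measurable
  moreover have "?E * (fact k / ?E * a) / fact k = a" for a
  proof -
   have "?E * (fact k / ?E * a) = fact k * a * ?E / ?E" by (simp add: divide_ennreal_def mult_ac)
   also have "... = fact k * a" by (rule ennreal_mult_divide_eq) auto
   finally show ?thesis by (simp add: fact_ennreal_cancel)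
  qed
  ultimately have mG': "(%y. \<integral>\<^sup>+om. G k y om \<partial>M) \<in> borel_measurable ?L" by simp
  have "fact (card {..<Suc k}) * (\<integral>\<^sup>+om. (if card (P Q om) = card {..<Suc k} then cell_sum F Q om else 0) \<partial>M) =
   ?E * (\<integral>\<^sup>+y. (\<Sum>i<Suc k. ?\<Phi> i y) \<partial>PiM {..<Suc k} (%_. ?L))"
   by (rule nn_integral_symmetric[OF _ Q])
    (auto intro!: borel_measurable_sum measurable_point_mean cell_sum_bij simp del: sum.lessThan_Suc)
  also have "(\<integral>\<^sup>+y. (\<Sum>i<Suc k. ?\<Phi> i y) \<partial>PiM {..<Suc k} (%_. ?L)) =
    (\<Sum>i<Suc k. \<integral>\<^sup>+y. ?\<Phi> i y \<partial>PiM {..<Suc k} (%_. ?L))"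
   by (rule nn_integral_sum) (use m\<Phi> in auto)
  also have "... = (\<Sum>i<Suc k. fact k / ?E * (\<integral>\<^sup>+y. (\<integral>\<^sup>+om. G k y om \<partial>M) \<partial>?L))"
   by (intro sum.cong refl) (simp add: point_int point nn_integral_cmult[OF mG'])
  \<comment> \<open>All \<open>Suc k\<close> summands agree, which turns \<open>fact k\<close> into
    \<open>fact (Suc k)\<close>.\<close>
  also have "... = fact (Suc k) / ?E * (\<integral>\<^sup>+y. (\<integral>\<^sup>+om. G k y om \<partial>M) \<partial>?L)"
   by (simp add: divide_ennreal_def mult_ac)
  finally have e: "fact (Suc k) * (\<integral>\<^sup>+om. (if card (P Q om) = Suc k then cell_sum F Q om else 0) \<partial>M) =
   ?E * (fact (Suc k) / ?E * (\<integral>\<^sup>+y. (\<integral>\<^sup>+om. G k y om \<partial>M) \<partial>?L))" by (simp only: card_lessThan)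
  have "?E * (fact (Suc k) / ?E * a) = fact (Suc k) * a" for a
  proof -
   have "?E * (fact (Suc k) / ?E * a) = fact (Suc k) * a * ?E / ?E" by (simp only: divide_ennreal_def mult_ac)
   also have "... = fact (Suc k) * a" by (rule ennreal_mult_divide_eq) auto
   finally show ?thesis .
  qed
  with e have "fact (Suc k) * (\<integral>\<^sup>+om. (if card (P Q om) = Suc k then cell_sum F Q om else 0) \<partial>M) =
   fact (Suc k) * (\<integral>\<^sup>+y. (\<integral>\<^sup>+om. G k y om \<partial>M) \<partial>?L)" by simp
  hence "(\<integral>\<^sup>+om. (if card (P Q om) = Suc k then cell_sum F Q om else 0) \<partial>M) = (\<integral>\<^sup>+y. (\<integral>\<^sup>+om. G k y om \<partial>M) \<partial>?L)"
   by (metis fact_ennreal_cancel)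
  with mG' show ?thesis by simp
 qed
 hence mG': "(%y. \<integral>\<^sup>+om. G k y om \<partial>M) \<in> borel_measurable ?L" and
  step: "(\<integral>\<^sup>+om. (if card (P Q om) = Suc k then cell_sum F Q om else 0) \<partial>M) = (\<integral>\<^sup>+y. (\<integral>\<^sup>+om. G k y om \<partial>M) \<partial>?L)" for k
  by blast+
 have m1: "(%om. if card (P Q om) = Suc k then cell_sum F Q om else 0) \<in> borel_measurable M" for k
 proof -
  have [measurable]: "(%om. card (P Q om)) \<in> measurable M (count_space UNIV)"
   by (rule measurable_card_pts[OF Q(1)])
  show ?thesis using measurable_count_sigma[OF Q(1) measurable_cell_sum[OF Q]] by measurable
 qed
 have "cell_sum F Q om = (\<Sum>k. if card (P Q om) = Suc k then cell_sum F Q om else 0)" for om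
 proof (cases "card (P Q om)")
  case 0
  hence "P Q om = {}" using finite_pts[OF Q(2)] by simp
  thus ?thesis by (simp add: cell_sum_def)
 next
  case (Suc k)
  thus ?thesis
   using suminf_finite[of "{k}" "%k. if card (P Q om) = Suc k then cell_sum F Q om else 0"] by simp
 qed
 hence "(\<integral>\<^sup>+om. cell_sum F Q om \<partial>M) = (\<integral>\<^sup>+om. (\<Sum>k. if card (P Q om) = Suc k then cell_sum F Q om else 0) \<partial>M)"
  by presburger
 also have "... = (\<Sum>k. \<integral>\<^sup>+y. (\<integral>\<^sup>+om. G k y om \<partial>M) \<partial>?L)"
  unfolding step[symmetric] using m1 by (rule nn_integral_suminf)
 also have "... = (\<integral>\<^sup>+y. (\<Sum>k. \<integral>\<^sup>+om. G k y om \<partial>M) \<partial>?L)"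
  using mG' by (rule nn_integral_suminf[symmetric])
 also have "... = (\<integral>\<^sup>+y. (\<integral>\<^sup>+om. palm_mean F {x. x + y \<in> Q} om \<partial>M) \<partial>?L)"
 proof (rule nn_integral_cong)
  fix y
  have "(\<Sum>k. G k y om) = palm_mean F {x. x + y \<in> Q} om" for om
   using suminf_finite[of "{card (P {x. x + y \<in> Q} om)}" "%k. G k y om"] by (simp add: G_def)
  thus "(\<Sum>k. \<integral>\<^sup>+om. G k y om \<partial>M) = (\<integral>\<^sup>+om. palm_mean F {x. x + y \<in> Q} om \<partial>M)"
   by (subst nn_integral_suminf[symmetric]) auto
 qed
 finally show ?thesis .
qed

end

section \<open>Cubes\<close>

lemma emeasure_lborel_bounded: "bounded B ==> emeasure lborel B = ennreal (measure lborel B)"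
 using emeasure_bounded_finite[of B] by (intro emeasure_eq_ennreal_measure) (simp add: less_top)

definition hbox :: "('d => real) => ('d => real) => (real ^ 'd) set" where
 "hbox a b = {x. \<forall>i. a i <= x $ i & x $ i < b i}"

lemma hbox_subset_cbox: "hbox a b \<subseteq> cbox (\<chi> i. a i) (\<chi> i. b i)"
 by (auto simp: hbox_def mem_box_cart less_imp_le)

lemma hbox_borel[measurable]: "hbox a b \<in> sets borel"
proof -
 have "hbox a b = (\<Inter>i. {x \<in> space borel. a i <= x $ i & x $ i < b i})"
  by (auto simp: hbox_def)
 also have "... \<in> sets borel" by measurable
 finally show ?thesis .
qed

lemma bounded_hbox: "bounded (hbox a b)"
 by (rule bounded_subset[OF bounded_cbox hbox_subset_cbox])

lemma measure_hbox:
 assumes "!!i. a i <= b i"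
 shows "measure lborel (hbox a b) = (\<Prod>i\<in>UNIV. b i - a i)"
proof -
 let ?a = "\<chi> i. a i" and ?b = "(\<chi> i. b i) :: real ^ 'a"
 have ab: "\<forall>u\<in>Basis. ?a \<bullet> u <= ?b \<bullet> u"
  using assms by (auto simp: Basis_vec_def inner_axis)
 have e: "emeasure lborel (box ?a ?b) = emeasure lborel (cbox ?a ?b)"
  using ab by (simp add: emeasure_lborel_box_eq emeasure_lborel_cbox_eq)
 have "emeasure lborel (hbox a b) = emeasure lborel (cbox ?a ?b)"
 proof (rule antisym)
  show "emeasure lborel (hbox a b) <= emeasure lborel (cbox ?a ?b)"
   by (rule emeasure_mono[OF hbox_subset_cbox]) simp
  show "emeasure lborel (cbox ?a ?b) <= emeasure lborel (hbox a b)"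
   unfolding e[symmetric] by (rule emeasure_mono) (auto simp: hbox_def mem_box_cart less_imp_le)
 qed
 hence "measure lborel (hbox a b) = measure lborel (cbox ?a ?b)" by (simp add: measure_def)
 also have "... = (\<Prod>i\<in>UNIV. b i - a i)"
 proof -
  have "?a \<in> cbox ?a ?b" using assms by (simp add: mem_box_cart)
  hence "cbox ?a ?b ~= {}" by blast
  thus ?thesis by (subst content_cbox_cart) auto
 qed
 finally show ?thesis .
qed

text \<open>Floor and integer division serve as address: cubes with different addresses are disjoint
  by construction, and the cube of side \<open>L\<close> around a point is a function of its unit
  cube.\<close>

definition cube :: "nat => ('d => int) => (real ^ 'd) set" where
 "cube L q = {x. \<forall>i. \<lfloor>x $ i\<rfloor> div int L = q i}"

lemma cube_eq_hbox:
 assumes "L > 0"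
 shows "cube L q = hbox (%i. real L * q i) (%i. real L * (q i + 1))"
proof -
 have "\<lfloor>y\<rfloor> div int L = k \<longleftrightarrow> real L * k <= y & y < real L * (k + 1)" for y :: real and k
 proof -
  have "\<lfloor>y\<rfloor> div int L = \<lfloor>y / real_of_int (int L)\<rfloor>"
   by (rule floor_divide_real_eq_div[symmetric]) simp
  thus ?thesis using assms by (simp add: floor_eq_iff field_simps)
 qed
 thus ?thesis by (simp add: cube_def hbox_def)
qed

lemma cube_borel[measurable]: "L > 0 ==> cube L q \<in> sets borel"
 by (simp add: cube_eq_hbox)

lemma bounded_cube: "L > 0 ==> bounded (cube L q)"
 by (simp add: cube_eq_hbox bounded_hbox)

lemma measure_cube: "L > 0 ==> measure lborel (cube L q :: (real ^ 'd) set) = real L ^ CARD('d)"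
 by (simp add: cube_eq_hbox measure_hbox algebra_simps)

lemma disjoint_cube: "q ~= q' ==> cube L q \<inter> cube L q' = {}"
 by (auto simp: cube_def fun_eq_iff)

section \<open>Components in large cubes\<close>

lemma nn_integral_lebesgue_on_set:
 assumes "Q \<in> sets borel" "f \<in> borel_measurable borel"
 shows "(\<integral>\<^sup>+y. f y \<partial>lebesgue_on_set Q) = (\<integral>\<^sup>+y. f y * indicator Q y \<partial>lborel)"
 using assms unfolding lebesgue_on_set_def by (subst nn_integral_density) (auto simp: mult.commute)

lemma graph_component_Union:
 assumes "mono E" and v: "w \<in> graph_component (\<Union>n. E n) v"
 shows "\<exists>n :: nat. w \<in> graph_component (E n) v"
proof -
 have "(v, w) \<in> (\<Union>n. E n)\<^sup>*" using v by (simp add: graph_component_def)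
 hence "\<exists>n. (v, w) \<in> (E n)\<^sup>*"
 proof induction
  case (step a b)
  then obtain n m where "(v, a) \<in> (E n)\<^sup>*" "(a, b) \<in> E m" by auto
  hence "(v, a) \<in> (E (max n m))\<^sup>*" "(a, b) \<in> E (max n m)"
   using rtrancl_mono[of "E n" "E (max n m)"] monoD[OF assms(1), of n "max n m"] monoD[OF assms(1), of m "max n m"] by auto
  thus ?case by (meson rtrancl.rtrancl_into_rtrancl)
 qed auto
 thus ?thesis by (auto simp: graph_component_def)
qed

text \<open>A finite union is attained at a finite stage; otherwise the cardinalities diverge and
  \<open>F\<close> tends to 0.\<close>

lemma tendsto_card_increasing_union:
 fixes F :: "nat => ennreal"
 assumes S: "mono S" "!!n. finite (S n)" and F: "F \<longlonglongrightarrow> 0"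
 shows "(%n. F (card (S n))) \<longlonglongrightarrow> (if finite (\<Union>n. S n) then F (card (\<Union>n. S n)) else 0)"
proof (cases "finite (\<Union>n. S n)")
 case True
 have "\<exists>n. (\<Union>n. S n) \<subseteq> S n"
 proof -
  have "\<forall>a\<in>(\<Union>n. S n). \<exists>n. a \<in> S n" by auto
  then obtain f where f: "!!a. a \<in> (\<Union>n. S n) ==> a \<in> S (f a)" by metis
  define n where "n = Max (insert 0 (f ` (\<Union>n. S n)))"
  have "a \<in> S n" if "a \<in> (\<Union>n. S n)" for a
  proof -
   have "f a <= n" unfolding n_def using True that by (intro Max_ge) auto
   thus ?thesis using f[OF that] monoD[OF S(1)] by blast
  qed
  thus ?thesis by blast
 qed
 then obtain n where n: "(\<Union>n. S n) \<subseteq> S n" by blast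
 have "\<forall>\<^sub>F k in sequentially. F (card (S k)) = F (card (\<Union>n. S n))"
  using eventually_ge_at_top[of n]
 proof eventually_elim
  case (elim k)
  hence "S k = (\<Union>n. S n)" using n monoD[OF S(1), of n k] by auto
  thus ?case by simp
 qed
 thus ?thesis using True by (simp add: tendsto_eventually)
next
 case False
 have "filterlim (%n. card (S n)) sequentially sequentially"
  unfolding filterlim_at_top
 proof
  fix k
  obtain T where T: "T \<subseteq> (\<Union>n. S n)" "finite T" "card T = k"
   using infinite_arbitrarily_large[OF False] by blast
  have "\<forall>a\<in>T. \<exists>n. a \<in> S n" using T by auto
  then obtain f where f: "!!a. a \<in> T ==> a \<in> S (f a)" by metis
  define n where "n = Max (insert 0 (f ` T))"
  have "T \<subseteq> S n"
  proof
   fix a assume a: "a \<in> T"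
   have "f a <= n" unfolding n_def using T a by (intro Max_ge) auto
   thus "a \<in> S n" using f[OF a] monoD[OF S(1)] by blast
  qed
  show "\<forall>\<^sub>F n in sequentially. k <= card (S n)"
   using eventually_ge_at_top[of n]
  proof eventually_elim
   case (elim m)
   hence "T \<subseteq> S m" using \<open>T \<subseteq> S n\<close> monoD[OF S(1), of n m] by auto
   thus ?case using T S(2) card_mono by metis
  qed
 qed
 thus ?thesis using filterlim_compose[OF F] False by simp
qed

context ksrg_model
begin

text \<open>For \<open>F k = z ^ k\<close> this is the generating function of the size of the root
  component (\<open>Hc_palm\<close>). The value 0 for infinite components is the limit of
  \<open>F\<close>.\<close>

definition palm_total :: "(nat => ennreal) => ennreal" where
 "palm_total F = (\<integral>\<^sup>+om. (\<integral>\<^sup>+r. (let C = comp_of c (vpos (%i. X i om)) (fst r) (snd r) UNIV Root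
  in if finite C then F (card C) else 0) \<partial>R) \<partial>M)"

lemma measurable_palm_joint:
 "(%q. let C = comp_of c (vpos (%i. X i (fst q))) (fst (snd q)) (snd (snd q)) UNIV Root
  in if finite C then F (card C) else (0 :: ennreal)) \<in> borel_measurable (M \<Otimes>\<^sub>M R)"
proof -
 let ?C = "%q. comp_of c (vpos (%i. X i (fst q))) (fst (snd q)) (snd (snd q)) UNIV Root"
 have pred: "Measurable.pred (M \<Otimes>\<^sub>M R) (%q. b \<in> ?C q)" for b
 proof (rule measurable_comp_of[OF conn_measurable])
  show "(%q. fst (snd q) a) \<in> borel_measurable (M \<Otimes>\<^sub>M R)" for a
   by (rule measurable_compose[OF measurable_snd measurable_mark])
  show "(%q. snd (snd q) e) \<in> borel_measurable (M \<Otimes>\<^sub>M R)" if "e \<in> vertex_pairs" for e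
   by (rule measurable_compose[OF measurable_snd measurable_pair_label[OF that]])
  show "(%q. vpos (%i. X i (fst q)) a) \<in> borel_measurable (M \<Otimes>\<^sub>M R)" for a
   by (cases a) auto
 qed auto
 have [measurable]: "Measurable.pred (M \<Otimes>\<^sub>M R) (%q. finite (?C q))"
  "(%q. card (?C q)) \<in> measurable (M \<Otimes>\<^sub>M R) (count_space UNIV)"
  using measurable_card_countable(1,2)[OF pred] by auto
 show ?thesis unfolding Let_def by measurable
qed

lemma palm_total_le_palm_mean:
 assumes Q: "Q \<in> sets borel" "bounded Q" and F: "!!m n. m <= n ==> F n <= F m"
 shows "palm_total F <= (\<integral>\<^sup>+om. palm_mean F Q om \<partial>M)"
 unfolding palm_total_def palm_mean_def comp_mean_def
proof (intro nn_integral_mono)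
 fix om r
 let ?C = "comp_of c (vpos (%i. X i om)) (fst r) (snd r) UNIV Root"
 let ?CQ = "comp_of c (vpos (%i. X i om)) (fst r) (snd r) (insert Root (Point ` P Q om)) Root"
 have "?CQ \<subseteq> ?C" by (rule comp_of_mono) simp
 thus "(let C = ?C in if finite C then F (card C) else 0) <= F (card ?CQ)"
  by (auto simp: Let_def intro!: F card_mono)
qed

lemma finite_vertices: "bounded Q ==> finite (insert Root (Point ` P Q om))"
 using finite_pts by simp

lemma palm_mean_antimono:
 assumes "Q \<subseteq> Q'" "bounded Q'" and F: "!!m n. m <= n ==> F n <= F m"
 shows "palm_mean F Q' om <= palm_mean F Q om"
 unfolding palm_mean_def comp_mean_def
proof (intro nn_integral_mono F card_mono comp_of_mono)
 fix r :: "(vertex => real) \<times> (vertex set => real)"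
 show "finite (comp_of c (vpos (%i. X i om)) (fst r) (snd r) (insert Root (Point ` P Q' om)) Root)"
  by (rule finite_subset[OF comp_of_subset finite_vertices[OF assms(2)]]) simp
qed (use assms(1) in \<open>auto simp: pts_def\<close>)

text \<open>Every vertex and every walk lies in some box, so the components inside growing boxes
  increase to the full one. Dominated convergence is used twice, for the labels and for the
  locations.\<close>

lemma palm_mean_tendsto:
 assumes F: "!!n. F n <= 1" "F \<longlonglongrightarrow> 0"
 shows "(%n. \<integral>\<^sup>+om. palm_mean F (cbox (\<chi> i. - real n) (\<chi> i. real n)) om \<partial>M) \<longlonglongrightarrow> palm_total F"
proof -
 let ?B = "%n. cbox (\<chi> i. - real n) (\<chi> i. real n) :: (real ^ 'd) set"
 let ?V = "%n om. insert Root (Point ` P (?B n) om)"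
 let ?C = "%n om r. comp_of c (vpos (%i. X i om)) (fst r) (snd r) (?V n om) Root"
 let ?T = "%om r. comp_of c (vpos (%i. X i om)) (fst r) (snd r) UNIV Root"
 have B: "?B n \<in> sets borel" "bounded (?B n)" for n by auto
 have Bmono: "?B m \<subseteq> ?B n" if "m <= n" for m n using that by (auto simp: mem_box_cart) (smt (verit) of_nat_mono)+
 have UV: "(\<Union>n. ?V n om) = UNIV" for om
 proof (intro equalityI subsetI)
  fix v :: vertex
  show "v \<in> (\<Union>n. ?V n om)"
  proof (cases v)
   case (Point j)
   obtain n where n: "norm (X j om) <= real n" using real_arch_simple by blast
   have "X j om \<in> ?B n"
    using n component_le_norm_cart[of "X j om"] by (auto simp: mem_box_cart) (smt (verit))+
   thus ?thesis using Point by (auto simp: pts_def)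
  qed auto
 qed auto
 have Vmono: "?V m om \<subseteq> ?V n om" if "m <= n" for m n om
  using Bmono[OF that] by (auto simp: pts_def)
 have UC: "(\<Union>n. ?C n om r) = ?T om r" for om r
 proof (intro equalityI subsetI)
  let ?E = "%n. label_edges c (vpos (%i. X i om)) (fst r) (snd r) (?V n om)"
  have "mono ?E" by (intro monoI label_edges_mono Vmono)
  moreover have "(\<Union>n. ?E n) = label_edges c (vpos (%i. X i om)) (fst r) (snd r) UNIV"
  proof (intro equalityI subsetI)
   fix e assume e: "e \<in> label_edges c (vpos (%i. X i om)) (fst r) (snd r) UNIV"
   obtain n m where "fst e \<in> ?V n om" "snd e \<in> ?V m om" using UV[of om] by blast
   hence "fst e \<in> ?V (max n m) om" "snd e \<in> ?V (max n m) om"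
    using Vmono[of n "max n m" om] Vmono[of m "max n m" om] by (meson max.cobounded1 max.cobounded2 subsetD)+
   hence "e \<in> ?E (max n m)" using e by (auto simp: label_edges_def)
   thus "e \<in> (\<Union>n. ?E n)" by blast
  qed (auto simp: label_edges_def)
  ultimately show "w \<in> (\<Union>n. ?C n om r)" if "w \<in> ?T om r" for w
   using graph_component_Union[of ?E w Root] that by auto
 next
  show "w \<in> ?T om r" if "w \<in> (\<Union>n. ?C n om r)" for w
   using that comp_of_mono[of "?V _ om" UNIV] by blast
 qed
 have lim: "(%n. F (card (?C n om r))) \<longlonglongrightarrow> (let C = ?T om r in if finite C then F (card C) else 0)" for om r
  unfolding Let_def UC[symmetric]
 proof (rule tendsto_card_increasing_union[OF _ _ F(2)])
  show "mono (%n. ?C n om r)" by (intro monoI comp_of_mono Vmono)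
  show "finite (?C n om r)" for n by (rule finite_subset[OF comp_of_subset finite_vertices[OF B(2)]]) simp
 qed
 have mC: "(%r. F (card (?C n om r))) \<in> borel_measurable R" for n om
  by (rule measurable_compose[OF measurable_card_comp]) simp
 have mT: "(%r. let C = ?T om r in if finite C then F (card C) else 0) \<in> borel_measurable R" if "om \<in> space M" for om
 proof -
  have "(%r. (om, r)) \<in> measurable R (M \<Otimes>\<^sub>M R)" using that by simp
  from measurable_compose[OF this measurable_palm_joint[of F]] show ?thesis by simp
 qed
 have le1: "palm_mean F (?B n) om <= 1" for n om
 proof -
  have "palm_mean F (?B n) om <= (\<integral>\<^sup>+r. 1 \<partial>R)"
   unfolding palm_mean_def comp_mean_def by (intro nn_integral_mono F(1))
  thus ?thesis by (simp add: labels.emeasure_space_1)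
 qed
 have inner: "(%n. palm_mean F (?B n) om) \<longlonglongrightarrow> (\<integral>\<^sup>+r. (let C = ?T om r in if finite C then F (card C) else 0) \<partial>R)"
  if "om \<in> space M" for om
  unfolding palm_mean_def comp_mean_def
  by (rule nn_integral_dominated_convergence[where w="%_. 1"])
   (use mC mT[OF that] lim F(1) in \<open>auto simp: labels.emeasure_space_1\<close>)
 have mT': "(%om. \<integral>\<^sup>+r. (let C = ?T om r in if finite C then F (card C) else 0) \<partial>R) \<in> borel_measurable M"
  by (rule labels.borel_measurable_nn_integral) (use measurable_palm_joint[of F] in \<open>simp add: split_beta'\<close>)
 show ?thesis
  unfolding palm_total_def
  by (rule nn_integral_dominated_convergence[where w="%_. 1"])
   (use measurable_palm_mean[OF B] mT' inner le1 in \<open>auto simp: emeasure_space_1\<close>)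
qed

text \<open>Restricting the graph to a region only shrinks components and \<open>F\<close>
  decreases, so the Palm mean seen from any point of \<open>Q\<close> is at least
  \<open>palm_total F\<close>; no boundary correction arises.\<close>

lemma cell_sum_lower:
 assumes Q: "Q \<in> sets borel" "bounded Q" and F: "!!m n. m <= n ==> F n <= F m"
 shows "ennreal (measure lborel Q) * palm_total F <= (\<integral>\<^sup>+om. cell_sum F Q om \<partial>M)"
proof -
 have Qy: "{x. x + y \<in> Q} \<in> sets borel" "bounded {x. x + y \<in> Q}" for y
  using measurable_sets[OF _ Q(1), of "%x. x + y" borel] Q(2)
  by (simp_all add: vimage_def bounded_translate_iff)
 have "palm_total F * emeasure (lebesgue_on_set Q) UNIV = (\<integral>\<^sup>+y. palm_total F \<partial>lebesgue_on_set Q)"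
  by simp
 also have "... <= (\<integral>\<^sup>+y. (\<integral>\<^sup>+om. palm_mean F {x. x + y \<in> Q} om \<partial>M) \<partial>lebesgue_on_set Q)"
  by (intro nn_integral_mono palm_total_le_palm_mean Qy F)
 also have "... = (\<integral>\<^sup>+om. cell_sum F Q om \<partial>M)" by (rule mecke[OF Q, symmetric])
 finally show ?thesis using emeasure_lebesgue_on_set[OF Q, of UNIV] by (simp add: mult.commute)
qed

text \<open>From a position at distance \<open>n\<close> from the faces the cube contains the box of
  radius \<open>n\<close>, inside which the Palm mean is close to its limit. The remaining layer has
  relative volume at most \<open>e / 2\<close> for large \<open>L\<close>, and there
  \<open>F <= 1\<close> suffices.\<close>

lemma cell_sum_upper:
 assumes F: "!!n. F n <= 1" "F \<longlonglongrightarrow> 0" "!!m n. m <= n ==> F n <= F m" and "e > 0"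
 shows "\<forall>\<^sub>F L in sequentially. \<forall>q. (\<integral>\<^sup>+om. cell_sum F (cube L q) om \<partial>M) <=
   ennreal (real L ^ CARD('d)) * (palm_total F + ennreal e)"
proof -
 let ?B = "%n. cbox (\<chi> i. - real n) (\<chi> i. real n) :: (real ^ 'd) set"
 let ?h = "%n. \<integral>\<^sup>+om. palm_mean F (?B n) om \<partial>M"
 have fin: "palm_total F < top"
 proof -
  have "palm_total F <= ?h 0" by (rule palm_total_le_palm_mean) (use F(3) in auto)
  also have "... <= (\<integral>\<^sup>+om. (\<integral>\<^sup>+r. 1 \<partial>R) \<partial>M)"
   unfolding palm_mean_def comp_mean_def by (intro nn_integral_mono F(1))
  also have "... < top" by (simp add: labels.emeasure_space_1 emeasure_space_1)
  finally show ?thesis .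
 qed
 have "palm_total F < palm_total F + ennreal (e / 2)"
  using fin \<open>e > 0\<close>
  by (cases "palm_total F") (auto simp: ennreal_plus[symmetric] ennreal_less_iff simp del: ennreal_plus)
 hence "\<forall>\<^sub>F n in sequentially. ?h n < palm_total F + ennreal (e / 2)"
  by (rule order_tendstoD(2)[OF palm_mean_tendsto[OF F(1,2)]])
 then obtain n where n: "?h n < palm_total F + ennreal (e / 2)"
  by (auto simp: eventually_sequentially)
 have "(%L. (1 - 2 * real n / real L) ^ CARD('d)) \<longlonglongrightarrow> (1 - 0) ^ CARD('d)"
  by (intro tendsto_intros tendsto_divide_0 filterlim_at_top_imp_at_infinity filterlim_real_sequentially)
 hence "\<forall>\<^sub>F L in sequentially. (1 - 2 * real n / real L) ^ CARD('d) > 1 - e / 2"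
  using \<open>e > 0\<close> by (intro order_tendstoD(1)) auto
 moreover have "\<forall>\<^sub>F L in sequentially. L > 2 * n" by (rule eventually_gt_at_top)
 ultimately show ?thesis
 proof eventually_elim
  case (elim L)
  have L: "L > 0" using elim by simp
  show ?case
  proof
   fix q :: "'d => int"
   let ?Q = "cube L q :: (real ^ 'd) set"
   \<comment> \<open>The positions whose box of radius \<open>n\<close> stays inside the
     cube.\<close>
   let ?D = "hbox (%i. real L * q i + real n) (%i. real L * (q i + 1) - real n) :: (real ^ 'd) set"
   have Qy: "bounded {x. x + y \<in> ?Q}" for y by (intro bounded_translate_iff bounded_cube L)
   have DQ: "?D \<subseteq> ?Q"
   proof
    fix x assume "x \<in> ?D"
    hence x: "real L * q i + real n <= x $ i" "x $ i < real L * (q i + 1) - real n" for i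
     by (simp_all add: hbox_def)
    have "real L * q i <= x $ i & x $ i < real L * (q i + 1)" for i
     using x[of i] by linarith
    thus "x \<in> ?Q" unfolding cube_eq_hbox[OF L] by (simp add: hbox_def)
   qed
   have one: "(\<integral>\<^sup>+om. palm_mean F {x. x + y \<in> ?Q} om \<partial>M) <= ?h n * indicator ?D y + indicator (?Q - ?D) y"
    if "y \<in> ?Q" for y
   proof (cases "y \<in> ?D")
    case True
    have "?B n \<subseteq> {x. x + y \<in> ?Q}"
    proof
     fix x assume "x \<in> ?B n"
     hence "- real n <= x $ i & x $ i <= real n" for i by (simp add: mem_box_cart)
     moreover have "real L * q i + real n <= y $ i & y $ i < real L * (q i + 1) - real n" for i
      using True by (simp add: hbox_def)
     ultimately have "real L * q i <= (x + y) $ i & (x + y) $ i < real L * (q i + 1)" for i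
      by (smt (verit) vector_add_component)
     thus "x \<in> {x. x + y \<in> ?Q}" unfolding cube_eq_hbox[OF L] by (auto simp: hbox_def)
    qed
    hence "(\<integral>\<^sup>+om. palm_mean F {x. x + y \<in> ?Q} om \<partial>M) <= ?h n"
     by (intro nn_integral_mono palm_mean_antimono Qy F(3))
    thus ?thesis using True by simp
   next
    case False
    have "(\<integral>\<^sup>+om. palm_mean F {x. x + y \<in> ?Q} om \<partial>M) <= (\<integral>\<^sup>+om. (\<integral>\<^sup>+r. 1 \<partial>R) \<partial>M)"
     unfolding palm_mean_def comp_mean_def by (intro nn_integral_mono F(1))
    thus ?thesis using False that by (simp add: labels.emeasure_space_1 emeasure_space_1)
   qed
   have D: "emeasure lborel ?D = ennreal ((real L - 2 * real n) ^ CARD('d))"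
   proof -
    have "measure lborel ?D = (\<Prod>i\<in>(UNIV :: 'd set). real L - 2 * real n)"
     using elim by (subst measure_hbox) (auto simp: algebra_simps)
    thus ?thesis
     by (simp add: emeasure_lborel_bounded bounded_hbox)
   qed
   have eQ: "emeasure lborel ?Q = ennreal (real L ^ CARD('d))"
    by (simp add: emeasure_lborel_bounded bounded_cube[OF L] measure_cube[OF L])
   have QD: "emeasure lborel (?Q - ?D) = ennreal (real L ^ CARD('d) - (real L - 2 * real n) ^ CARD('d))"
   proof -
    have "emeasure lborel (?Q - ?D) = emeasure lborel ?Q - emeasure lborel ?D"
    proof (rule emeasure_Diff)
     show "emeasure lborel ?D ~= \<infinity>" unfolding D by simp
    qed (use DQ L in \<open>simp_all\<close>)
    also have "... = ennreal (real L ^ CARD('d) - (real L - 2 * real n) ^ CARD('d))"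
     unfolding D eQ using elim by (intro ennreal_minus) simp
    finally show ?thesis .
   qed
   have "(\<integral>\<^sup>+om. cell_sum F ?Q om \<partial>M) = (\<integral>\<^sup>+y. (\<integral>\<^sup>+om. palm_mean F {x. x + y \<in> ?Q} om \<partial>M) \<partial>lebesgue_on_set ?Q)"
    using L by (intro mecke bounded_cube) auto
   also have "... <= (\<integral>\<^sup>+y. ?h n * indicator ?D y + indicator (?Q - ?D) y \<partial>lebesgue_on_set ?Q)"
   proof (rule nn_integral_mono_AE)
    have "AE y in lebesgue_on_set ?Q. y \<in> ?Q"
     using L unfolding lebesgue_on_set_def by (subst AE_density) (auto simp: indicator_def)
    thus "AE y in lebesgue_on_set ?Q. (\<integral>\<^sup>+om. palm_mean F {x. x + y \<in> ?Q} om \<partial>M) <= ?h n * indicator ?D y + indicator (?Q - ?D) y"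
     by eventually_elim (rule one)
   qed
   also have "... = (\<integral>\<^sup>+y. (?h n * indicator ?D y + indicator (?Q - ?D) y) * indicator ?Q y \<partial>lborel)"
    using L by (intro nn_integral_lebesgue_on_set) auto
   also have "... = (\<integral>\<^sup>+y. ?h n * indicator ?D y + indicator (?Q - ?D) y \<partial>lborel)"
    using DQ by (intro nn_integral_cong) (auto simp: indicator_def)
   also have "... = ?h n * emeasure lborel ?D + emeasure lborel (?Q - ?D)"
    using L by (subst nn_integral_add) (auto simp: nn_integral_cmult)
   also have "... <= (palm_total F + ennreal (e / 2)) * ennreal (real L ^ CARD('d)) + ennreal (real L ^ CARD('d) * (e / 2))"
   proof (intro add_mono mult_mono)
    show "emeasure lborel ?D <= ennreal (real L ^ CARD('d))"
     unfolding eQ[symmetric] using DQ L by (intro emeasure_mono) auto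
    have "real L ^ CARD('d) * (1 - e / 2) <= real L ^ CARD('d) * (1 - 2 * real n / real L) ^ CARD('d)"
     using elim by (intro mult_left_mono) auto
    also have "... = (real L - 2 * real n) ^ CARD('d)"
     using L by (simp add: power_mult_distrib[symmetric] algebra_simps)
    finally show "emeasure lborel (?Q - ?D) <= ennreal (real L ^ CARD('d) * (e / 2))"
     unfolding QD by (intro ennreal_leI) (simp add: algebra_simps)
   qed (use n in auto)
   also have "... = ennreal (real L ^ CARD('d)) * (palm_total F + ennreal (e / 2) + ennreal (e / 2))"
   proof -
    have m: "ennreal (real L ^ CARD('d) * (e / 2)) = ennreal (real L ^ CARD('d)) * ennreal (e / 2)"
     using \<open>e > 0\<close> by (intro ennreal_mult) auto
    have "(a + b) * k + k * b = k * (a + b + b)" for a b k :: ennreal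
     by (simp add: distrib_left mult.commute)
    thus ?thesis unfolding m .
   qed
   also have "palm_total F + ennreal (e / 2) + ennreal (e / 2) = palm_total F + ennreal e"
    using \<open>e > 0\<close> by (simp add: add.assoc ennreal_plus[symmetric] del: ennreal_plus)
   finally show "(\<integral>\<^sup>+om. cell_sum F ?Q om \<partial>M) <= ennreal (real L ^ CARD('d)) * (palm_total F + ennreal e)" .
  qed
 qed
qed

end

section \<open>Two counting arguments\<close>

text \<open>The vertices whose cell component is small and reaches neither \<open>J\<close> nor another cell are lost
 for every large component.\<close>

lemma card_large_component:
 fixes V :: "vertex set" and E :: "(vertex \<times> vertex) set"
 assumes V: "finite V" "E \<subseteq> V \<times> V" "sym E" and Qs: "finite Qs" "disjoint_family_on Vq Qs"
  and Vq: "!!q. q \<in> Qs ==> Vq q \<subseteq> V"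
  and cc: "!!q v. cc q v = graph_component (E \<inter> (Vq q \<times> Vq q)) v"
  and Good: "!!q. Good q = {v \<in> Vq q. card (cc q v) <= m & (\<forall>a\<in>cc q v. \<forall>b\<in>J. (a, b) \<notin> E)}"
  and T: "T = {a. \<exists>q\<in>Qs. a \<in> Vq q & (\<exists>b\<in>V - J. b \<notin> Vq q & (a, b) \<in> E)}"
  and v0: "v0 \<in> V" "m < card (graph_component E v0)"
 shows "card (graph_component E v0) + (\<Sum>q\<in>Qs. card (Good q)) <= card V + m * card T"
proof -
 let ?K = "graph_component E v0"
 define G where "G = (\<Union>q\<in>Qs. Good q)"
 \<comment> \<open>Good vertices whose cell component contains an endpoint in \<open>T\<close>. An
   endpoint lies in one cell only, and all these vertices belong to its cell component, which has at
   most \<open>m\<close> elements.\<close>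
 define G' where "G' = (\<Union>q\<in>Qs. {v \<in> Good q. cc q v \<inter> T ~= {}})"
 have GV: "Good q \<subseteq> Vq q" for q unfolding Good by auto
 have KV: "?K \<subseteq> V" using graph_component_subset[OF V(2) v0(1)] .
 have ccVq: "cc q v \<subseteq> Vq q" if "v \<in> Vq q" for q v
  unfolding cc by (rule graph_component_subset) (use that in auto)
 have symq: "sym (E \<inter> (Vq q \<times> Vq q))" for q
  using V(3) by (auto simp: sym_def)
 have fG: "finite (Good q)" if "q \<in> Qs" for q
  using GV Vq[OF that] V(1) by (meson finite_subset)
 have cG: "card G = (\<Sum>q\<in>Qs. card (Good q))"
  unfolding G_def using Qs fG GV
  by (intro card_UN_disjoint) (auto simp: disjoint_family_on_def, blast)
 have TV: "T \<subseteq> V" using T Vq by blast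
 have fT: "finite T" using TV V(1) by (rule finite_subset)
 have G'sub: "G' \<subseteq> (\<Union>a\<in>T. \<Union>q\<in>{q \<in> Qs. a \<in> Vq q}. {v \<in> Good q. a \<in> cc q v})"
 proof
  fix v assume "v \<in> G'"
  then obtain q a where "q \<in> Qs" "v \<in> Good q" "a \<in> cc q v" "a \<in> T" unfolding G'_def by auto
  moreover have "a \<in> Vq q" using ccVq[of v q] GV calculation by blast
  ultimately show "v \<in> (\<Union>a\<in>T. \<Union>q\<in>{q \<in> Qs. a \<in> Vq q}. {v \<in> Good q. a \<in> cc q v})" by blast
 qed
 have one: "card (\<Union>q\<in>{q \<in> Qs. a \<in> Vq q}. {v \<in> Good q. a \<in> cc q v}) <= m &
   finite (\<Union>q\<in>{q \<in> Qs. a \<in> Vq q}. {v \<in> Good q. a \<in> cc q v})" if aT: "a \<in> T" for a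
 proof -
  obtain q where q: "q \<in> Qs" "a \<in> Vq q" using aT unfolding T by blast
  have "{q \<in> Qs. a \<in> Vq q} = {q}"
   using q Qs(2) by (auto simp: disjoint_family_on_def)
  hence U: "(\<Union>q\<in>{q \<in> Qs. a \<in> Vq q}. {v \<in> Good q. a \<in> cc q v}) = {v \<in> Good q. a \<in> cc q v}" by auto
  have "card {v \<in> Good q. a \<in> cc q v} <= m"
  proof (cases "{v \<in> Good q. a \<in> cc q v} = {}")
   case False
   then obtain v where v: "v \<in> Good q" "a \<in> cc q v" by blast
   have "cc q v' = cc q v" if "v' \<in> Good q" "a \<in> cc q v'" for v'
    using graph_component_sym_eq[OF symq] v(2) that(2) unfolding cc by metis
   hence "{v' \<in> Good q. a \<in> cc q v'} \<subseteq> cc q v"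
    using graph_component_self unfolding cc by blast
   moreover have "finite (cc q v)"
    using ccVq[of v q] GV v(1) Vq[OF q(1)] V(1) by (meson finite_subset subsetD)
   ultimately have "card {v' \<in> Good q. a \<in> cc q v'} <= card (cc q v)" by (rule card_mono[rotated])
   also have "... <= m" using v(1) unfolding Good by simp
   finally show ?thesis .
  qed (simp only: card.empty)
  thus ?thesis unfolding U using fG[OF q(1)] by simp
 qed
 have "card G' <= card (\<Union>a\<in>T. \<Union>q\<in>{q \<in> Qs. a \<in> Vq q}. {v \<in> Good q. a \<in> cc q v})"
 proof (rule card_mono[OF _ G'sub], rule finite_UN_I[OF fT])
  show "finite (\<Union>q\<in>{q \<in> Qs. a \<in> Vq q}. {v \<in> Good q. a \<in> cc q v})" if "a \<in> T" for a
   using one[OF that] by blast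
 qed
 also have "... <= (\<Sum>a\<in>T. card (\<Union>q\<in>{q \<in> Qs. a \<in> Vq q}. {v \<in> Good q. a \<in> cc q v}))"
  by (rule card_UN_le[OF fT])
 also have "... <= (\<Sum>a\<in>T. m)" using one by (intro sum_mono) auto
 finally have G': "card G' <= m * card T" by (simp add: mult.commute)
 \<comment> \<open>A good vertex untouched by \<open>T\<close> has its cell component as its full
   component, too small to be the large one.\<close>
 have disj: "?K \<inter> (G - G') = {}"
 proof (rule equals0I)
  fix v assume "v \<in> ?K \<inter> (G - G')"
  then obtain q where q: "q \<in> Qs" "v \<in> Good q" "v \<in> ?K" "cc q v \<inter> T = {}"
   unfolding G_def G'_def by blast
  have vq: "v \<in> Vq q" using q(2) GV by blast
  have "graph_component E v = cc q v"
  proof (rule graph_component_closed)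
   show "cc q v \<subseteq> graph_component E v" unfolding cc by (rule graph_component_mono) auto
   show "v \<in> cc q v" unfolding cc by (rule graph_component_self)
   fix a b assume a: "a \<in> cc q v" and ab: "(a, b) \<in> E"
   have aq: "a \<in> Vq q" using ccVq[OF vq] a by blast
   have "b \<notin> J" using q(2) a ab unfolding Good by blast
   hence "b \<in> V - J" using ab V(2) by auto
   moreover have "a \<notin> T" using a q(4) by blast
   ultimately have "b \<in> Vq q" using T q(1) aq ab by blast
   hence "(a, b) \<in> E \<inter> (Vq q \<times> Vq q)" using ab aq by auto
   thus "b \<in> cc q v" using a unfolding cc graph_component_def by (auto intro: rtrancl_into_rtrancl)
  qed
  moreover have "graph_component E v = ?K" by (rule graph_component_sym_eq[OF V(3) q(3)])
  moreover have "card (cc q v) <= m" using q(2) unfolding Good by blast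
  ultimately show False using v0(2) by simp
 qed
 have GVV: "G \<subseteq> V" unfolding G_def using GV Vq by blast
 have "card ?K + card (G - G') = card (?K \<union> (G - G'))"
  using disj KV GVV V(1) by (intro card_Un_disjoint[symmetric]) (auto intro: finite_subset)
 also have "... <= card V" using KV GVV V(1) by (intro card_mono) auto
 finally have "card ?K + card (G - G') <= card V" .
 moreover have "G' \<subseteq> G" unfolding G_def G'_def by blast
 hence "card G = card (G - G') + card G'"
  using GVV V(1) by (metis card_Diff_subset card_mono finite_subset le_add_diff_inverse2)
 ultimately show ?thesis using cG G' by linarith
qed

text \<open>The hubs form a clique, so an edge from a cell component to any hub leads on to the
  distinguished hub \<open>j0\<close>.\<close>

lemma hub_component:
 assumes "sym E" and j0: "j0 \<in> J" and J: "!!a b. a \<in> J ==> b \<in> J ==> a ~= b ==> (a, b) \<in> E"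
  and v: "a \<in> graph_component (E \<inter> (W \<times> W)) v" "b \<in> J" "(a, b) \<in> E"
 shows "v \<in> graph_component E j0"
proof -
 have "(v, a) \<in> E\<^sup>*" using v(1) rtrancl_mono[of "E \<inter> (W \<times> W)" E] by (auto simp: graph_component_def)
 moreover have "(b, j0) \<in> E\<^sup>*" using J[OF v(2) j0] by (cases "b = j0") auto
 ultimately have "(v, j0) \<in> E\<^sup>*" using v(3) by (meson rtrancl.rtrancl_into_rtrancl rtrancl_trans)
 thus ?thesis using sym_rtrancl[OF assms(1)] by (auto simp: graph_component_def dest: symD)
qed

lemma label_edges_Int: "W \<subseteq> V ==> label_edges c y w u W = label_edges c y w u V \<inter> (W \<times> W)"
 by (auto simp: label_edges_def)

section \<open>Poisson counts\<close>

context poisson_points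
begin

lemma nn_integral_card_pts:
 assumes "B \<in> sets borel" "bounded B"
 shows "(\<integral>\<^sup>+om. f (card (P B om)) \<partial>M) =
  (\<Sum>k. f k * ennreal (exp (- measure lborel B) * measure lborel B ^ k / fact k))"
proof -
 have [measurable]: "(%om. card (P B om)) \<in> measurable M (count_space UNIV)"
  by (rule measurable_card_pts[OF assms(1)])
 have "f (card (P B om)) = (\<Sum>k. f k * indicator {om \<in> space M. card (P B om) = k} om)" if "om \<in> space M" for om
  using suminf_finite[of "{card (P B om)}" "%k. f k * indicator {om \<in> space M. card (P B om) = k} om"] that
  by (simp add: indicator_def)
 hence "(\<integral>\<^sup>+om. f (card (P B om)) \<partial>M) = (\<integral>\<^sup>+om. (\<Sum>k. f k * indicator {om \<in> space M. card (P B om) = k} om) \<partial>M)"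
  by (intro nn_integral_cong) simp
 also have "... = (\<Sum>k. \<integral>\<^sup>+om. f k * indicator {om \<in> space M. card (P B om) = k} om \<partial>M)"
  by (rule nn_integral_suminf) measurable
 also have "... = (\<Sum>k. f k * ennreal (prob {om \<in> space M. card (P B om) = k}))"
  by (intro suminf_cong) (simp add: nn_integral_cmult_indicator emeasure_eq_measure)
 finally show ?thesis unfolding prob_count[OF assms] .
qed

lemma nn_integral_exp_card_pts:
 assumes "B \<in> sets borel" "bounded B"
 shows "(\<integral>\<^sup>+om. ennreal (exp (t * real (card (P B om)))) \<partial>M) = ennreal (exp (measure lborel B * (exp t - 1)))"
proof -
 let ?m = "measure lborel B"
 have "(%k. (?m * exp t) ^ k /\<^sub>R fact k) sums exp (?m * exp t)"
  by (rule exp_converges)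
 hence "(%k. exp (- ?m) * ((?m * exp t) ^ k /\<^sub>R fact k)) sums (exp (- ?m) * exp (?m * exp t))"
  by (rule sums_mult)
 moreover have "exp (- ?m) * ((?m * exp t) ^ k /\<^sub>R fact k) = exp (t * real k) * (exp (- ?m) * ?m ^ k / fact k)" for k
  by (simp add: power_mult_distrib exp_of_nat_mult[symmetric] field_simps)
 moreover have "exp (- ?m) * exp (?m * exp t) = exp (?m * (exp t - 1))"
  by (simp add: exp_add[symmetric] algebra_simps)
 ultimately have s: "(%k. exp (t * real k) * (exp (- ?m) * ?m ^ k / fact k)) sums exp (?m * (exp t - 1))"
  by simp
 have "(\<integral>\<^sup>+om. ennreal (exp (t * real (card (P B om)))) \<partial>M) =
  (\<Sum>k. ennreal (exp (t * real k)) * ennreal (exp (- ?m) * ?m ^ k / fact k))"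
  by (rule nn_integral_card_pts[OF assms])
 also have "... = (\<Sum>k. ennreal (exp (t * real k) * (exp (- ?m) * ?m ^ k / fact k)))"
  by (intro suminf_cong ennreal_mult[symmetric]) auto
 also have "... = ennreal (exp (?m * (exp t - 1)))"
  using s by (intro suminf_ennreal_eq) auto
 finally show ?thesis .
qed

lemma measurable_card_real[measurable]:
 assumes [measurable]: "B \<in> sets borel"
 shows "(%om. real (card (P B om))) \<in> borel_measurable M"
 by (rule measurable_compose[OF measurable_card_pts[OF assms]]) simp

lemma exp_card_pts:
 assumes "B \<in> sets borel" "bounded B"
 shows "integrable M (%om. exp (t * real (card (P B om))))"
  and "expectation (%om. exp (t * real (card (P B om)))) = exp (measure lborel B * (exp t - 1))"
proof -
 have "(%om. exp (t * real (card (P B om)))) \<in> borel_measurable M" using assms(1) by measurable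
 from nn_integral_eq_integrable[OF this, of "exp (measure lborel B * (exp t - 1))"]
 show "integrable M (%om. exp (t * real (card (P B om))))"
  and "expectation (%om. exp (t * real (card (P B om)))) = exp (measure lborel B * (exp t - 1))"
  using nn_integral_exp_card_pts[OF assms, of t] by auto
qed

text \<open>The sign of \<open>t\<close> is free: positive values give the upper tail, negative ones
  the lower tail.\<close>

lemma prob_card_exp_le:
 assumes "B \<in> sets borel" "bounded B"
 shows "prob {om \<in> space M. t * a <= t * real (card (P B om))} <= exp (measure lborel B * (exp t - 1) - t * a)"
proof -
 have "prob {om \<in> space M. t * a <= t * real (card (P B om))} =
   prob {om \<in> space M. exp (t * real (card (P B om))) \<ge> exp (t * a)}" by simp
 also have "... <= expectation (%om. exp (t * real (card (P B om)))) / exp (t * a)"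
  by (rule integral_Markov_inequality_measure[OF exp_card_pts(1)[OF assms], where A="{}"]) auto
 finally show ?thesis unfolding exp_card_pts(2)[OF assms] by (simp add: exp_diff)
qed

lemma prob_card_ge:
 assumes "B \<in> sets borel" "bounded B" "0 < e" "e <= 1"
 shows "prob {om \<in> space M. (1 + e) * measure lborel B <= real (card (P B om))} <= exp (- (e\<^sup>2 / 4) * measure lborel B)"
proof -
 have "exp (e / 2) <= 1 + e / 2 + (e / 2)\<^sup>2" using assms by (intro exp_bound) auto
 hence "measure lborel B * (exp (e / 2) - 1) <= measure lborel B * (e / 2 + (e / 2)\<^sup>2)"
  by (intro mult_left_mono) auto
 hence "measure lborel B * (exp (e / 2) - 1) - e / 2 * ((1 + e) * measure lborel B) <= - (e\<^sup>2 / 4) * measure lborel B"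
  by (simp add: field_simps power2_eq_square)
 thus ?thesis
  using prob_card_exp_le[OF assms(1,2), of "e / 2" "(1 + e) * measure lborel B"] assms(3)
  by (smt (verit) exp_le_cancel_iff Collect_cong mult_le_cancel_left_pos half_gt_zero)
qed

lemma prob_card_le:
 assumes "B \<in> sets borel" "bounded B" "0 < e" "e <= 1"
 shows "prob {om \<in> space M. real (card (P B om)) <= (1 - e) * measure lborel B} <= exp (- (e\<^sup>2 / 4) * measure lborel B)"
proof -
 let ?q = "e / 2"
 have "(1 - ?q + ?q\<^sup>2) * (1 + ?q) = 1 + ?q ^ 3"
  by (simp add: algebra_simps power2_eq_square power3_eq_cube)
 hence "1 / (1 + ?q) <= 1 - ?q + ?q\<^sup>2"
  using assms by (simp add: pos_divide_le_eq)
 moreover have "exp (- ?q) <= 1 / (1 + ?q)"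
  using assms exp_ge_add_one_self[of ?q] by (simp add: exp_minus inverse_eq_divide frac_le)
 ultimately have "measure lborel B * (exp (- ?q) - 1) <= measure lborel B * (- ?q + ?q\<^sup>2)"
  by (intro mult_left_mono) auto
 hence le: "measure lborel B * (exp (- ?q) - 1) - (- ?q) * ((1 - e) * measure lborel B) <= - (e\<^sup>2 / 4) * measure lborel B"
  by (simp add: field_simps power2_eq_square)
 have "{om \<in> space M. real (card (P B om)) <= (1 - e) * measure lborel B} =
   {om \<in> space M. (- ?q) * ((1 - e) * measure lborel B) <= (- ?q) * real (card (P B om))}"
  using assms(3) by auto
 hence "prob {om \<in> space M. real (card (P B om)) <= (1 - e) * measure lborel B} <=
   exp (measure lborel B * (exp (- ?q) - 1) - (- ?q) * ((1 - e) * measure lborel B))"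
  using prob_card_exp_le[OF assms(1,2), of "- ?q" "(1 - e) * measure lborel B"] by simp
 also have "... <= exp (- (e\<^sup>2 / 4) * measure lborel B)" using le by simp
 finally show ?thesis .
qed

lemma prob_card_large:
 assumes "B \<in> sets borel" "bounded B"
 shows "prob {om \<in> space M. a <= real (card (P B om))} <= exp (2 * measure lborel B) * exp (- a)"
proof -
 have "prob {om \<in> space M. a <= real (card (P B om))} <= exp (measure lborel B * (exp 1 - 1) - a)"
  using prob_card_exp_le[OF assms, of 1 a] by simp
 also have "... <= exp (2 * measure lborel B - a)"
  using mult_right_mono[OF exp_le, of "measure lborel B"] by (simp add: algebra_simps)
 finally show ?thesis by (simp add: exp_diff exp_minus field_simps)
qed

lemma card_square:
 assumes "B \<in> sets borel" "bounded B"
 shows "integrable M (%om. (real (card (P B om)))\<^sup>2)"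
  and "expectation (%om. (real (card (P B om)))\<^sup>2) <= 2 * exp (2 * measure lborel B)"
proof -
 have le: "(real k)\<^sup>2 <= 2 * exp (1 * real k)" for k
  using exp_lower_Taylor_quadratic[of "real k"] by (simp add: power2_eq_square)
 have int: "integrable M (%om. 2 * exp (1 * real (card (P B om))))"
  using exp_card_pts(1)[OF assms, of 1] by simp
 show i: "integrable M (%om. (real (card (P B om)))\<^sup>2)"
  by (rule Bochner_Integration.integrable_bound[OF int]) (use assms(1) le in auto)
 have "expectation (%om. (real (card (P B om)))\<^sup>2) <= expectation (%om. 2 * exp (1 * real (card (P B om))))"
  by (rule integral_mono[OF i int le])
 also have "... = 2 * exp (measure lborel B * (exp 1 - 1))"
  using exp_card_pts(2)[OF assms, of 1] by simp
 also have "... <= 2 * exp (2 * measure lborel B)"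
  using mult_right_mono[OF exp_le, of "measure lborel B"] by (simp add: algebra_simps)
 finally show "expectation (%om. (real (card (P B om)))\<^sup>2) <= 2 * exp (2 * measure lborel B)" .
qed

lemma nn_integral_card:
 assumes "B \<in> sets borel" "bounded B"
 shows "(\<integral>\<^sup>+om. ennreal (real (card (P B om))) \<partial>M) = ennreal (measure lborel B)"
proof -
 let ?m = "measure lborel B"
 have "(%k. exp (- ?m) * ?m * (?m ^ k /\<^sub>R fact k)) sums (exp (- ?m) * ?m * exp ?m)"
  by (intro sums_mult exp_converges)
 moreover have "exp (- ?m) * ?m * exp ?m = ?m" by (simp add: exp_minus)
 moreover have "exp (- ?m) * ?m * (?m ^ k /\<^sub>R fact k) = real (Suc k) * (exp (- ?m) * ?m ^ Suc k / fact (Suc k))" for k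
 proof -
  have "(fact (Suc k) :: real) = real (Suc k) * fact k" by (rule fact_Suc)
  thus ?thesis by (simp add: field_simps del: of_nat_Suc fact_Suc)
 qed
 ultimately have "(%k. real (Suc k) * (exp (- ?m) * ?m ^ Suc k / fact (Suc k))) sums ?m" by simp
 hence s: "(%k. real k * (exp (- ?m) * ?m ^ k / fact k)) sums ?m"
  using sums_Suc_iff[of "%k. real k * (exp (- ?m) * ?m ^ k / fact k)" ?m] by simp
 have "(\<integral>\<^sup>+om. ennreal (real (card (P B om))) \<partial>M) = (\<Sum>k. ennreal (real k) * ennreal (exp (- ?m) * ?m ^ k / fact k))"
  by (rule nn_integral_card_pts[OF assms])
 also have "... = (\<Sum>k. ennreal (real k * (exp (- ?m) * ?m ^ k / fact k)))"
  by (intro suminf_cong ennreal_mult[symmetric]) auto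
 also have "... = ennreal ?m" using s by (intro suminf_ennreal_eq) auto
 finally show ?thesis .
qed

text \<open>Two coordinates coincide only on a Lebesgue null set, so by the Janossy formula the points of
 the process are almost surely distinct.\<close>

lemma AE_distinct_points:
 assumes Q: "Q \<in> sets borel" "bounded Q"
 shows "AE om in M. inj_on (%i. X i om) (P Q om)"
proof -
 let ?L = "lebesgue_on_set Q"
 interpret L: product_sigma_finite "%_ :: nat. ?L"
  using finite_measure_lebesgue_on_set[OF Q]
  by (intro product_sigma_finite.intro) (simp add: finite_measure.sigma_finite_measure)
 define G :: "'w => ennreal" where "G om = (if inj_on (%i. X i om) (P Q om) then 0 else 1)" for om
 have eqm: "Measurable.pred (PiM A (%_. borel)) (%y :: nat => real ^ 'd. y a = y b)" if "a \<in> A" "b \<in> A" for a b A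
 proof -
  have [measurable]: "(%y :: nat => real ^ 'd. y a) \<in> borel_measurable (PiM A (%_. borel))"
   "(%y :: nat => real ^ 'd. y b) \<in> borel_measurable (PiM A (%_. borel))" using that by auto
  have "Measurable.pred (PiM A (%_. borel)) (%y :: nat => real ^ 'd. y a - y b \<in> {0})" by measurable
  thus ?thesis by simp
 qed
 have "AE om in M. card (P Q om) = k --> inj_on (%i. X i om) (P Q om)" for k
 proof -
  let ?A = "{..<k}"
  let ?bad = "%a b. %y :: nat => real ^ 'd. (if y a = y b then 1 else 0) :: ennreal"
  let ?h = "%y. \<Sum>(a, b)\<in>{(a, b) \<in> ?A \<times> ?A. a ~= b}. ?bad a b y"
  have sets_PiM': "sets (PiM ?A (%_. ?L)) = sets (PiM ?A (%_. borel))"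
   by (intro sets_PiM_cong) auto
  have mb: "?bad a b \<in> borel_measurable (PiM ?A (%_. borel))" if "a < k" "b < k" for a b
  proof -
   have [measurable]: "Measurable.pred (PiM ?A (%_. borel)) (%y :: nat => real ^ 'd. y a = y b)"
    by (rule eqm) (use that in auto)
   show ?thesis by measurable
  qed
  have null: "(\<integral>\<^sup>+y. ?bad a b y \<partial>PiM ?A (%_. ?L)) = 0" if ab: "a < k" "b < k" "a ~= b" for a b
  proof -
   have ins: "insert a (?A - {a}) = ?A" using ab by auto
   have m: "?bad a b \<in> borel_measurable (PiM (insert a (?A - {a})) (%_. ?L))"
    unfolding ins using mb[OF ab(1,2)] by (simp cong: measurable_cong_sets add: sets_PiM')
   have "(\<integral>\<^sup>+y. ?bad a b y \<partial>PiM ?A (%_. ?L)) =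
    (\<integral>\<^sup>+z. (\<integral>\<^sup>+y. ?bad a b (z(a := y)) \<partial>?L) \<partial>PiM (?A - {a}) (%_. ?L))"
    using L.product_nn_integral_insert[of "?A - {a}" a "?bad a b"] m unfolding ins by simp
   also have "... = (\<integral>\<^sup>+z. 0 \<partial>PiM (?A - {a}) (%_. ?L))"
   proof (rule nn_integral_cong)
    fix z :: "nat => real ^ 'd"
    have "(\<integral>\<^sup>+y. ?bad a b (z(a := y)) \<partial>?L) = (\<integral>\<^sup>+y. indicator {z b} y \<partial>?L)"
     using ab(3) by (intro nn_integral_cong) (auto simp: indicator_def)
    also have "... = emeasure ?L {z b}" by simp
    also have "... = ennreal (measure lborel (Q \<inter> {z b}))" by (rule emeasure_lebesgue_on_set[OF Q]) simp
    also have "measure lborel (Q \<inter> {z b}) = 0"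
     by (cases "z b \<in> Q") (simp_all add: measure_def Int_insert_right)
    finally show "(\<integral>\<^sup>+y. ?bad a b (z(a := y)) \<partial>?L) = 0" by simp
   qed
   finally show ?thesis by simp
  qed
  \<comment> \<open>The minimum with 1 turns the number of coinciding ordered pairs into the
    indicator \<open>G\<close>, which does not depend on the listing.\<close>
  have mh: "(%y. min 1 (?h y)) \<in> borel_measurable (PiM ?A (%_. borel))"
   by (intro borel_measurable_min borel_measurable_sum borel_measurable_const) (auto intro: mb)
  have "fact (card ?A) * (\<integral>\<^sup>+om. (if card (P Q om) = card ?A then G om else 0) \<partial>M) =
   ennreal (exp (- measure lborel Q)) * (\<integral>\<^sup>+y. min 1 (?h y) \<partial>PiM ?A (%_. ?L))"
  proof (rule nn_integral_symmetric[OF _ Q mh])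
   fix om s assume s: "s \<in> bijs ?A (P Q om)"
   let ?y = "\<lambda>a\<in>?A. X (s a) om"
   have sA: "s ` ?A = P Q om" "inj_on s ?A" using bijs_D[OF s] by auto
   have inj_iff: "inj_on (%i. X i om) (P Q om) \<longleftrightarrow> (\<forall>a<k. \<forall>b<k. a ~= b --> ?y a ~= ?y b)"
    unfolding sA(1)[symmetric] using sA(2) by (auto simp: inj_on_def)
   show "min 1 (?h ?y) = G om"
   proof (cases "inj_on (%i. X i om) (P Q om)")
    case True
    hence "?h ?y = 0" unfolding inj_iff by (intro sum.neutral) auto
    thus ?thesis using True by (simp add: G_def)
   next
    case False
    then obtain a b where ab: "a < k" "b < k" "a ~= b" "?y a = ?y b" unfolding inj_iff by blast
    have "finite {(a, b) \<in> ?A \<times> ?A. a ~= b}" by (rule finite_subset[of _ "?A \<times> ?A"]) auto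
    hence "(case (a, b) of (a, b) => ?bad a b ?y) <= ?h ?y"
     using ab by (intro member_le_sum) auto
    hence "1 <= ?h ?y" using ab(4) by simp
    hence "min 1 (?h ?y) = 1" by (rule min_absorb1)
    thus ?thesis using False by (simp only: G_def if_False)
   qed
  qed simp
  also have "(\<integral>\<^sup>+y. min 1 (?h y) \<partial>PiM ?A (%_. ?L)) = 0"
  proof -
   have "(\<integral>\<^sup>+y. min 1 (?h y) \<partial>PiM ?A (%_. ?L)) <= (\<integral>\<^sup>+y. ?h y \<partial>PiM ?A (%_. ?L))"
    by (intro nn_integral_mono) simp
   also have "... = (\<Sum>(a, b)\<in>{(a, b) \<in> ?A \<times> ?A. a ~= b}. \<integral>\<^sup>+y. ?bad a b y \<partial>PiM ?A (%_. ?L))"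
    using mb by (subst nn_integral_sum) (auto simp: split_beta' sets_PiM' cong: measurable_cong_sets)
   also have "... = 0" using null by (intro sum.neutral) auto
   finally show ?thesis by simp
  qed
  finally have z: "(\<integral>\<^sup>+om. (if card (P Q om) = k then G om else 0) \<partial>M) = 0" by simp
  have [measurable]: "G \<in> borel_measurable M"
  proof -
   have "inj_on (%i. X i om) (P Q om) \<longleftrightarrow> (\<forall>i l. i \<in> P Q om & l \<in> P Q om & X i om = X l om --> i = l)" for om
    by (auto simp: inj_on_def)
   thus ?thesis unfolding G_def using measurable_pts[OF Q(1)] by simp
  qed
  have [measurable]: "(%om. card (P Q om)) \<in> measurable M (count_space UNIV)"
   by (rule measurable_card_pts[OF Q(1)])
  have "AE om in M. (if card (P Q om) = k then G om else 0) = 0"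
   using z by (subst (asm) nn_integral_0_iff_AE) auto
  thus ?thesis by eventually_elim (auto simp: G_def split: if_splits)
 qed
 hence "AE om in M. \<forall>k. card (P Q om) = k --> inj_on (%i. X i om) (P Q om)"
  by (subst AE_all_countable) simp
 thus ?thesis by eventually_elim simp
qed

end

context label_graph
begin

lemma measurable_avoids:
 assumes "v \<in> V" "V \<inter> J = {}"
 shows "Measurable.pred R (%r. P (card (comp_of c y (fst r) (snd r) V v)) &
  (\<forall>a\<in>comp_of c y (fst r) (snd r) V v. \<forall>b\<in>J. snd r {a, b} > p))"
proof -
 have "Measurable.pred R (%r. snd r {a, b} > p)" if "a \<in> V" "b \<in> J" for a b
 proof -
  have "a ~= b" using that assms by auto
  hence [measurable]: "(%r. snd r {a, b}) \<in> borel_measurable R" by (intro measurable_pair_label) auto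
  show ?thesis by measurable
 qed
 hence "Measurable.pred R (%r. a \<in> V --> b \<in> J --> snd r {a, b} > p)" for a b
  by (cases "a \<in> V & b \<in> J") auto
 hence "Measurable.pred R (%r. \<forall>a b. a \<in> comp_of c y (fst r) (snd r) V v --> (a \<in> V --> b \<in> J --> snd r {a, b} > p))"
 proof (intro pred_intros_countable(1))
  fix a b assume *: "!!a b. Measurable.pred R (%r. a \<in> V --> b \<in> J --> snd r {a, b} > p)"
  show "Measurable.pred R (%r. a \<in> comp_of c y (fst r) (snd r) V v --> (a \<in> V --> b \<in> J --> snd r {a, b} > p))"
   by (rule pred_intros_logic(4)[OF measurable_comp *])
 qed
 moreover have "(\<forall>a b. a \<in> comp_of c y (fst r) (snd r) V v --> (a \<in> V --> b \<in> J --> snd r {a, b} > p)) \<longleftrightarrow>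
  (\<forall>a\<in>comp_of c y (fst r) (snd r) V v. \<forall>b\<in>J. snd r {a, b} > p)" for r
  using comp_of_subset[OF assms(1)] by blast
 ultimately have "Measurable.pred R (%r. \<forall>a\<in>comp_of c y (fst r) (snd r) V v. \<forall>b\<in>J. snd r {a, b} > p)"
  by simp
 moreover have "Measurable.pred R (%r. P (card (comp_of c y (fst r) (snd r) V v)))"
  using measurable_card_comp by measurable
 ultimately show ?thesis by simp
qed

text \<open>The probability of avoiding the hubs becomes a mean of a function of the component size,
  to which the Mecke formula applies. The predicate \<open>P\<close> is the cap on the size in the
  upper bound and always true in the lower bound.\<close>

lemma comp_mean_avoids:
 assumes "finite V" "finite J" "V \<inter> J = {}" "v \<in> V"
 shows "comp_mean (%k. if P k then ennreal (((1 - p) ^ card J) ^ k) else 0) y V v =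
  ennreal (labels.prob {r \<in> space R. P (card (comp_of c y (fst r) (snd r) V v)) &
   (\<forall>a\<in>comp_of c y (fst r) (snd r) V v. \<forall>b\<in>J. snd r {a, b} > p)})"
proof -
 let ?f = "%r. if P (card (comp_of c y (fst r) (snd r) V v))
     then ((1 - p) ^ card J) ^ card (comp_of c y (fst r) (snd r) V v) else 0"
 have "(%r. ?f r) \<in> borel_measurable R"
  by (rule measurable_compose[OF measurable_card_comp, where g="%k. if P k then ((1 - p) ^ card J) ^ k else 0"]) simp
 hence "integrable R ?f"
  by (intro labels.integrable_const_bound[of _ 1]) (use p_pos p_le in \<open>auto intro!: power_le_one\<close>)
 hence "(\<integral>\<^sup>+r. ennreal (?f r) \<partial>R) = ennreal (\<integral>r. ?f r \<partial>R)"
  using p_le by (intro nn_integral_eq_integral) auto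
 also have "(\<integral>r. ?f r \<partial>R) = labels.prob {r \<in> space R. P (card (comp_of c y (fst r) (snd r) V v)) &
   (\<forall>a\<in>comp_of c y (fst r) (snd r) V v. \<forall>b\<in>J. snd r {a, b} > p)}"
  using p_pos p_le by (intro prob_comp_avoids[symmetric] assms) auto
 finally show ?thesis unfolding comp_mean_def by (simp add: if_distrib cong: if_cong)
qed

end

text \<open>\<open>hub_conn\<close> drives the lower bound and \<open>conn_decay\<close> the upper
  one. The decay bounds only one of the two marks; the other enters through
  \<open>w' powr (1 + \<eta>)\<close>, which has a finite mean when
  \<open>1 + \<eta> < \<tau> - 1\<close>.\<close>

locale ksrg_bounds = ksrg_model \<mu> c p M X
 for \<mu> and c :: "(real ^ 'd) => real => (real ^ 'd) => real => real" and p
  and M :: "'w measure" and X :: "nat => 'w => real ^ 'd" +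
 fixes \<tau> \<eta>\<^sub>0 hc :: real
 assumes tau: "\<tau> > 2"
  and mark_tail: "!!t. 1 <= t ==> measure \<mu> {t..} = t powr (- (\<tau> - 1))"
  and hc: "0 < hc"
  and hub_conn: "!!y w y' w'. y ~= y' ==> 1 <= w ==> 1 <= w' ==> hc * dist y y' ^ CARD('d) <= w ==> c y w y' w' = p"
  and \<eta>\<^sub>0: "0 < \<eta>\<^sub>0"
  and conn_decay: "!!\<eta> m. 0 < \<eta> ==> \<eta> <= \<eta>\<^sub>0 ==> 1 <= m ==>
   \<exists>C\<ge>0. \<forall>y w y' w'. y ~= y' --> 1 <= w --> w <= m --> 1 <= w' -->
    c y w y' w' <= C * w' powr (1 + \<eta>) * max 1 (dist y y') powr (- (real CARD('d) * (1 + \<eta>)))"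
begin

lemma AE_mark_ge_1: "AE r in R. \<forall>v. 1 <= fst r v"
proof -
 have "AE r in R. 1 <= fst r v" for v
 proof -
  have "labels.prob {r \<in> space R. (\<forall>a\<in>{v}. fst r a \<in> {1..}) & (\<forall>e\<in>{}. snd r e \<in> UNIV)} = 1"
   by (subst prob_labels) (auto simp: mark_tail)
  hence "labels.prob {r \<in> space R. 1 <= fst r v} = 1" by simp
  thus ?thesis by (rule labels.AE_prob_1[THEN AE_mp]) (auto intro!: AE_I2)
 qed
 thus ?thesis by (subst AE_all_countable) simp
qed

lemma prob_marks_ge:
 assumes "finite J" "1 <= h"
 shows "labels.prob {r \<in> space R. \<forall>v\<in>J. h <= fst r v} = (h powr (- (\<tau> - 1))) ^ card J"
proof -
 have "{r \<in> space R. \<forall>v\<in>J. h <= fst r v} = {r \<in> space R. (\<forall>v\<in>J. fst r v \<in> {h..}) & (\<forall>e\<in>{}. snd r e \<in> UNIV)}"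
  by auto
 also have "labels.prob ... = (\<Prod>v\<in>J. measure \<mu> {h..}) * (\<Prod>e\<in>({} :: vertex set set). measure unit_uniform UNIV)"
  using assms by (intro prob_labels) auto
 finally show ?thesis by (simp add: mark_tail assms)
qed

text \<open>\<open>J\<close> is prescribed as the exact set of vertices with mark at least
  \<open>h\<close>, so that events for different \<open>J\<close> are disjoint. Cells that meet
  \<open>J\<close> are dropped; then what happens inside \<open>J\<close> uses labels disjoint from
  all others and factors out. Markov's inequality bounds the number of missed vertices.\<close>

lemma prob_hub_lower_one:
 fixes I :: "nat set" and x :: "nat => real ^ 'd" and Cq :: "'q => nat set" and h s t S B :: real
 assumes I: "finite I" and Qs: "finite Qs" "disjoint_family_on Cq Qs" "!!q. q \<in> Qs ==> Cq q \<subseteq> I"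
  and h: "1 <= h" and J: "J \<subseteq> I"
  and S: "(\<Sum>q\<in>Qs. \<Sum>i\<in>Cq q. comp_mean (%k. ennreal (((1 - p) ^ card J) ^ k)) (vpos x) (Point ` Cq q) (Point i)) <= ennreal S"
   "0 <= S" and s: "0 < s"
 defines "Qs' \<equiv> {q \<in> Qs. Cq q \<inter> J = {}}"
 defines "avoid r q i \<equiv> (\<forall>a\<in>comp_of c (vpos x) (fst r) (snd r) (Point ` Cq q) (Point i). \<forall>b\<in>Point ` J. snd r {a, b} > p)"
 defines "E \<equiv> {r \<in> space R. (\<forall>i\<in>J. h <= fst r (Point i)) & (\<forall>e\<in>pairs_in (Point ` J). snd r e <= p) &
   (\<forall>i\<in>I - J. fst r (Point i) < h) & (\<Sum>q\<in>Qs'. \<Sum>i\<in>Cq q. if avoid r q i then 1 else (0::real)) < s}"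
 shows "E \<in> sets R"
  and "(h powr (- (\<tau> - 1))) ^ card J * p ^ (card J choose 2) * (1 - card I * h powr (- (\<tau> - 1)) - S / s) <= labels.prob E"
proof -
 have fin: "finite J" "finite (Cq q)" if "q \<in> Qs" for q using I J Qs(3)[OF that] by (auto intro: finite_subset)
 have finJ: "finite J" using I J by (rule rev_finite_subset)
 have finQ': "finite Qs'" unfolding Qs'_def using Qs(1) by simp
 let ?pJ = "pairs_in (Point ` J)"
 have finpJ: "finite ?pJ" unfolding pairs_in_def by (rule finite_subset[of _ "Pow (Point ` J)"]) (use finJ in auto)
 \<comment> \<open>\<open>K1\<close> holds the marks of \<open>J\<close> and the labels inside
   \<open>J\<close>; \<open>K2\<close> holds everything else on \<open>I\<close>, including the
   labels between \<open>J\<close> and the cells.\<close>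
 define K1 where "K1 = Inl ` Point ` J \<union> Inr ` ?pJ"
 define K2 where "K2 = Inl ` Point ` (I - J) \<union> Inr ` (pairs_in (Point ` I) - ?pJ)"
 have K: "K1 \<inter> K2 = {}" "K1 \<subseteq> label_index" "K2 \<subseteq> label_index"
  unfolding K1_def K2_def label_index_def pairs_in_def by auto
 define A where "A z \<longleftrightarrow> (\<forall>i\<in>J. h <= z (Inl (Point i))) & (\<forall>e\<in>?pJ. z (Inr e) <= p)" for z :: "vertex + vertex set => real"
 define av where "av z q i \<longleftrightarrow> (\<forall>a\<in>comp_of c (vpos x) (mark_of K2 z) (pair_of K2 z) (Point ` Cq q) (Point i).
   \<forall>b\<in>Point ` J. pair_of K2 z {a, b} > p)" for z q i
 define B where "B z \<longleftrightarrow> (\<forall>i\<in>I - J. z (Inl (Point i)) < h) & (\<Sum>q\<in>Qs'. \<Sum>i\<in>Cq q. if av z q i then 1 else 0) < s" for z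
 have in_K2: "Inl ` Point ` Cq q \<union> Inr ` pairs_in (Point ` Cq q) \<subseteq> K2" "!!a b. a \<in> Point ` Cq q ==> b \<in> Point ` J ==> Inr {a, b} \<in> K2"
  if "q \<in> Qs'" for q
 proof -
  have q: "Cq q \<subseteq> I - J" using that Qs(3) by (auto simp: Qs'_def)
  have "e \<in> pairs_in (Point ` I) - ?pJ" if "e \<in> pairs_in (Point ` Cq q)" for e
  proof -
   have e: "card e = 2" "e \<subseteq> Point ` Cq q" using that by (auto simp: pairs_in_def)
   hence "e ~= {}" by auto
   thus ?thesis using e q by (auto simp: pairs_in_def)
  qed
  thus "Inl ` Point ` Cq q \<union> Inr ` pairs_in (Point ` Cq q) \<subseteq> K2" using q by (auto simp: K2_def)
  fix a b assume ab: "a \<in> Point ` Cq q" "b \<in> Point ` J"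
  hence "a ~= b" "a \<notin> Point ` J" using q by auto
  moreover have "{a, b} \<subseteq> Point ` I" using ab q J by auto
  ultimately have "{a, b} \<in> pairs_in (Point ` I) - ?pJ" by (auto simp: pairs_in_def)
  thus "Inr {a, b} \<in> K2" unfolding K2_def by blast
 qed
 have av_eq: "av (labels_on K2 r) q i \<longleftrightarrow> avoid r q i" if "q \<in> Qs'" "i \<in> Cq q" for r q i
 proof -
  have "pair_of K2 (labels_on K2 r) {a, b} = snd r {a, b}"
   if "a \<in> comp_of c (vpos x) (fst r) (snd r) (Point ` Cq q) (Point i)" "b \<in> Point ` J" for a b
  proof -
   have "a \<in> Point ` Cq q" using that(1) comp_of_subset[of "Point i" "Point ` Cq q"] \<open>i \<in> Cq q\<close> by blast
   hence "Inr {a, b} \<in> K2" using in_K2(2)[OF \<open>q \<in> Qs'\<close>] that(2) by blast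
   thus ?thesis by (simp add: pair_of_def labels_on_def)
  qed
  thus ?thesis unfolding av_def avoid_def comp_of_labels_on[OF in_K2(1)[OF that(1)]] by auto
 qed
 have A_eq: "A (labels_on K1 r) \<longleftrightarrow> (\<forall>i\<in>J. h <= fst r (Point i)) & (\<forall>e\<in>?pJ. snd r e <= p)" for r
  by (auto simp: A_def labels_on_def K1_def)
 have B_eq: "B (labels_on K2 r) \<longleftrightarrow> (\<forall>i\<in>I - J. fst r (Point i) < h) & (\<Sum>q\<in>Qs'. \<Sum>i\<in>Cq q. if avoid r q i then 1 else (0::real)) < s" for r
 proof -
  have "(\<Sum>q\<in>Qs'. \<Sum>i\<in>Cq q. if av (labels_on K2 r) q i then 1 else (0::real)) = (\<Sum>q\<in>Qs'. \<Sum>i\<in>Cq q. if avoid r q i then 1 else (0::real))"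
   by (intro sum.cong refl) (simp add: av_eq)
  thus ?thesis by (auto simp: B_def labels_on_def K2_def)
 qed
 have mA[measurable]: "Measurable.pred (PiM K1 (%_. borel)) A"
  unfolding A_def using finJ finpJ
 proof (intro pred_intros_logic pred_intros_finite)
  fix i assume "i \<in> J"
  hence [measurable]: "(%z. z (Inl (Point i))) \<in> borel_measurable (PiM K1 (%_. borel))" by (auto simp: K1_def)
  show "Measurable.pred (PiM K1 (%_. borel)) (%z. h <= z (Inl (Point i)))" by measurable
 next
  fix e assume "e \<in> ?pJ"
  hence [measurable]: "(%z. z (Inr e)) \<in> borel_measurable (PiM K1 (%_. borel))" by (auto simp: K1_def)
  show "Measurable.pred (PiM K1 (%_. borel)) (%z. z (Inr e) <= p)" by measurable
 qed auto
 have mav: "Measurable.pred (PiM K2 (%_. borel)) (%z. av z q i)" for q i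
 proof -
  have [measurable]: "Measurable.pred (PiM K2 (%_. borel)) (%z. a \<in> comp_of c (vpos x) (mark_of K2 z) (pair_of K2 z) (Point ` Cq q) (Point i))" for a
   by (rule measurable_comp_local)
  have [measurable]: "(%z. pair_of K2 z e) \<in> borel_measurable (PiM K2 (%_. borel))" for e
   by (rule measurable_pair_of)
  have "av z q i \<longleftrightarrow> (\<forall>a. a \<in> comp_of c (vpos x) (mark_of K2 z) (pair_of K2 z) (Point ` Cq q) (Point i) -->
    (\<forall>b. b \<in> Point ` J --> pair_of K2 z {a, b} > p))" for z
   by (auto simp: av_def)
  thus ?thesis by simp
 qed
 have mB[measurable]: "Measurable.pred (PiM K2 (%_. borel)) B"
 proof -
  have 1: "Measurable.pred (PiM K2 (%_. borel)) (%z. \<forall>i\<in>I - J. z (Inl (Point i)) < h)"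
  proof (intro pred_intros_finite)
   fix i assume "i \<in> I - J"
   hence [measurable]: "(%z. z (Inl (Point i))) \<in> borel_measurable (PiM K2 (%_. borel))" by (auto simp: K2_def)
   show "Measurable.pred (PiM K2 (%_. borel)) (%z. z (Inl (Point i)) < h)" by measurable
  qed (use I in auto)
  have [measurable]: "(%z. (\<Sum>q\<in>Qs'. \<Sum>i\<in>Cq q. if av z q i then 1 else (0::real))) \<in> borel_measurable (PiM K2 (%_. borel))"
   using mav by (intro borel_measurable_sum measurable_If) auto
  show ?thesis unfolding B_def using 1 by measurable
 qed
 have E_eq: "E = {r \<in> space R. A (labels_on K1 r) & B (labels_on K2 r)}"
  unfolding E_def A_eq B_eq by auto
 have mAR: "Measurable.pred R (%r. A (labels_on K1 r))" and mBR: "Measurable.pred R (%r. B (labels_on K2 r))"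
  using measurable_compose[OF measurable_labels_on[OF K(2)] mA] measurable_compose[OF measurable_labels_on[OF K(3)] mB] by auto
 show "E \<in> sets R" unfolding E_eq using mAR mBR by simp
 have "labels.prob E = labels.prob {r \<in> space R. A (labels_on K1 r)} * labels.prob {r \<in> space R. B (labels_on K2 r)}"
  unfolding E_eq by (rule prob_disjoint_labels[OF K mA mB])
 moreover have "labels.prob {r \<in> space R. A (labels_on K1 r)} = (h powr (- (\<tau> - 1))) ^ card J * p ^ (card J choose 2)"
 proof -
  have "{r \<in> space R. A (labels_on K1 r)} = {r \<in> space R. (\<forall>v\<in>Point ` J. fst r v \<in> {h..}) & (\<forall>e\<in>?pJ. snd r e \<in> {..p})}"
   unfolding A_eq by auto
  also have "labels.prob ... = (\<Prod>v\<in>Point ` J. measure \<mu> {h..}) * (\<Prod>e\<in>?pJ. measure unit_uniform {..p})"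
   using finJ finpJ by (intro prob_labels) (auto simp: pairs_in_def)
  also have "(\<Prod>v\<in>Point ` J. measure \<mu> {h..}) = (h powr (- (\<tau> - 1))) ^ card J"
   by (simp add: mark_tail[OF h] card_image inj_on_def)
  also have "(\<Prod>e\<in>?pJ. measure unit_uniform {..p}) = p ^ card ?pJ"
   using measure_unit_uniform_atMost[of p] p_pos p_le by (simp only: prod_constant less_imp_le)
  also have "card ?pJ = card J choose 2"
  proof -
   have "?pJ = {e. e \<subseteq> Point ` J & card e = 2}" by (auto simp: pairs_in_def)
   thus ?thesis using n_subsets[of "Point ` J" 2] finJ by (simp add: card_image inj_on_def)
  qed
  finally show ?thesis .
 qed
 moreover have "1 - card I * h powr (- (\<tau> - 1)) - S / s <= labels.prob {r \<in> space R. B (labels_on K2 r)}"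
 proof -
  let ?U = "%r. \<Sum>q\<in>Qs'. \<Sum>i\<in>Cq q. if avoid r q i then 1 else (0::real)"
  have mavoid: "Measurable.pred R (%r. avoid r q i)" if "q \<in> Qs'" "i \<in> Cq q" for q i
   using measurable_avoids[of "Point i" "Point ` Cq q" "Point ` J" "%_. True" "vpos x"] that
   unfolding avoid_def by (auto simp: Qs'_def)
  have mU: "?U \<in> borel_measurable R"
   using mavoid by (intro borel_measurable_sum measurable_If) auto
  have "(\<integral>\<^sup>+r. ennreal (?U r) \<partial>R) = (\<Sum>q\<in>Qs'. \<Sum>i\<in>Cq q. \<integral>\<^sup>+r. ennreal (if avoid r q i then 1 else (0::real)) \<partial>R)"
  proof -
   have "(\<integral>\<^sup>+r. ennreal (?U r) \<partial>R) = (\<integral>\<^sup>+r. (\<Sum>q\<in>Qs'. \<Sum>i\<in>Cq q. ennreal (if avoid r q i then 1 else (0::real))) \<partial>R)"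
    by (intro nn_integral_cong) (simp add: sum_nonneg)
   also have "... = (\<Sum>q\<in>Qs'. \<integral>\<^sup>+r. (\<Sum>i\<in>Cq q. ennreal (if avoid r q i then 1 else (0::real))) \<partial>R)"
    using mavoid by (intro nn_integral_sum borel_measurable_sum measurable_compose[OF _ measurable_ennreal] measurable_If) auto
   also have "... = (\<Sum>q\<in>Qs'. \<Sum>i\<in>Cq q. \<integral>\<^sup>+r. ennreal (if avoid r q i then 1 else (0::real)) \<partial>R)"
    using mavoid by (intro sum.cong refl nn_integral_sum measurable_compose[OF _ measurable_ennreal] measurable_If) auto
   finally show ?thesis .
  qed
  also have "... = (\<Sum>q\<in>Qs'. \<Sum>i\<in>Cq q. comp_mean (%k. ennreal (((1 - p) ^ card J) ^ k)) (vpos x) (Point ` Cq q) (Point i))"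
  proof (intro sum.cong refl)
   fix q i assume q: "q \<in> Qs'" and i: "i \<in> Cq q"
   have "(\<integral>\<^sup>+r. ennreal (if avoid r q i then 1 else (0::real)) \<partial>R) = (\<integral>\<^sup>+r. indicator {r \<in> space R. avoid r q i} r \<partial>R)"
    by (intro nn_integral_cong) (auto simp: indicator_def)
   also have "... = ennreal (labels.prob {r \<in> space R. True & avoid r q i})"
    using mavoid[OF q i] by (simp add: labels.emeasure_eq_measure)
   also have "... = comp_mean (%k. if True then ennreal (((1 - p) ^ card (Point ` J)) ^ k) else 0) (vpos x) (Point ` Cq q) (Point i)"
    unfolding avoid_def using q i fin(2) finJ
    by (intro comp_mean_avoids[symmetric]) (auto simp: Qs'_def)
   also have "card (Point ` J) = card J" by (simp add: card_image inj_on_def)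
   finally show "(\<integral>\<^sup>+r. ennreal (if avoid r q i then 1 else (0::real)) \<partial>R) =
    comp_mean (%k. ennreal (((1 - p) ^ card J) ^ k)) (vpos x) (Point ` Cq q) (Point i)" by simp
  qed
  also have "... <= (\<Sum>q\<in>Qs. \<Sum>i\<in>Cq q. comp_mean (%k. ennreal (((1 - p) ^ card J) ^ k)) (vpos x) (Point ` Cq q) (Point i))"
   using Qs(1) by (intro sum_mono2) (auto simp: Qs'_def)
  also note S(1)
  finally have EU: "(\<integral>\<^sup>+r. ennreal (?U r) \<partial>R) <= ennreal S" .
  have U0: "0 <= ?U r" for r by (intro sum_nonneg) simp
  have iU: "integrable R ?U"
   using EU mU U0 by (intro integrableI_nonneg) (auto intro: le_less_trans)
  have "labels.expectation ?U <= S"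
   using EU nn_integral_eq_integral[OF iU] U0 S(2) by simp
  have "labels.prob {r \<in> space R. s <= ?U r} <= labels.expectation ?U / s"
   by (rule integral_Markov_inequality_measure[OF iU, where A="{}"]) (use U0 s in auto)
  also have "... <= S / s" using \<open>labels.expectation ?U <= S\<close> s by (intro divide_right_mono) auto
  finally have mk: "labels.prob {r \<in> space R. s <= ?U r} <= S / s" .
  have u1: "labels.prob {r \<in> space R. \<exists>i\<in>I - J. h <= fst r (Point i)} <= card I * h powr (- (\<tau> - 1))"
  proof -
   have "{r \<in> space R. \<exists>i\<in>I - J. h <= fst r (Point i)} = (\<Union>i\<in>I - J. {r \<in> space R. h <= fst r (Point i)})" by auto
   also have "labels.prob ... <= (\<Sum>i\<in>I - J. labels.prob {r \<in> space R. h <= fst r (Point i)})"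
    using I by (intro labels.finite_measure_subadditive_finite) auto
   also have "... = (\<Sum>i\<in>I - J. h powr (- (\<tau> - 1)))"
    using prob_marks_ge[of "{Point _}" h] h by (intro sum.cong refl) simp
   also have "... <= card I * h powr (- (\<tau> - 1))"
    using I by (simp add: card_mono mult_right_mono)
   finally show ?thesis .
  qed
  have mU': "{r \<in> space R. s <= ?U r} \<in> sets R" using mU by measurable
  have mW': "{r \<in> space R. \<exists>i\<in>I - J. h <= fst r (Point i)} \<in> sets R"
   using I by (intro predE pred_intros_finite) auto
  have "space R - ({r \<in> space R. \<exists>i\<in>I - J. h <= fst r (Point i)} \<union> {r \<in> space R. s <= ?U r}) \<subseteq> {r \<in> space R. B (labels_on K2 r)}"
   unfolding B_eq by (auto simp: not_le)
  hence "labels.prob (space R - ({r \<in> space R. \<exists>i\<in>I - J. h <= fst r (Point i)} \<union> {r \<in> space R. s <= ?U r})) <= labels.prob {r \<in> space R. B (labels_on K2 r)}"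
   using mBR by (intro labels.finite_measure_mono) auto
  moreover have "labels.prob (space R - ({r \<in> space R. \<exists>i\<in>I - J. h <= fst r (Point i)} \<union> {r \<in> space R. s <= ?U r})) =
   1 - labels.prob ({r \<in> space R. \<exists>i\<in>I - J. h <= fst r (Point i)} \<union> {r \<in> space R. s <= ?U r})"
   using mU' mW' by (intro labels.prob_compl) auto
  moreover have "labels.prob ({r \<in> space R. \<exists>i\<in>I - J. h <= fst r (Point i)} \<union> {r \<in> space R. s <= ?U r}) <=
   labels.prob {r \<in> space R. \<exists>i\<in>I - J. h <= fst r (Point i)} + labels.prob {r \<in> space R. s <= ?U r}"
   using mW' mU' by (rule measure_Un_le)
  ultimately show ?thesis using mk u1 by linarith
 qed
 ultimately show "(h powr (- (\<tau> - 1))) ^ card J * p ^ (card J choose 2) * (1 - card I * h powr (- (\<tau> - 1)) - S / s) <= labels.prob E"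
  using p_pos by (simp add: mult_left_mono)
qed

text \<open>Summing over all \<open>J\<close> of size \<open>j\<close> gains the binomial
  coefficient, so that with \<open>h\<close> of order \<open>n\<close> the total has order
  \<open>n powr (- (\<tau> - 2) * j)\<close>. Hypothesis \<open>t\<close> is the budget: size
  wanted, missed vertices, the at most \<open>j\<close> cells with a hub, and points in no
  cell.\<close>

lemma prob_hub_lower:
 fixes I :: "nat set" and x :: "nat => real ^ 'd" and Cq :: "'q => nat set" and h s t S B :: real
 assumes I: "finite I" "inj_on x I" and Qs: "finite Qs" "disjoint_family_on Cq Qs" "!!q. q \<in> Qs ==> Cq q \<subseteq> I"
  and h: "1 <= h" "!!i l. i \<in> I ==> l \<in> I ==> hc * dist (x i) (x l) ^ CARD('d) <= h" and j: "1 <= j"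
  and S: "(\<Sum>q\<in>Qs. \<Sum>i\<in>Cq q. comp_mean (%k. ennreal (((1 - p) ^ j) ^ k)) (vpos x) (Point ` Cq q) (Point i)) <= ennreal S"
   "0 <= S" and s: "0 < s"
  and B: "!!q. q \<in> Qs ==> real (card (Cq q)) <= B" "0 <= B"
  and t: "t + s + j * B + card (I - (\<Union>q\<in>Qs. Cq q)) <= card I"
 shows "(card I choose j) * ((h powr (- (\<tau> - 1))) ^ j * p ^ (j choose 2) * (1 - card I * h powr (- (\<tau> - 1)) - S / s)) <=
  labels.prob {r \<in> space R. \<exists>i\<in>I. t < card (comp_of c (vpos x) (fst r) (snd r) (Point ` I) (Point i))}"
proof -
 define Qs' where "Qs' J = {q \<in> Qs. Cq q \<inter> J = {}}" for J
 define avoid where "avoid J r q i \<longleftrightarrow>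
  (\<forall>a\<in>comp_of c (vpos x) (fst r) (snd r) (Point ` Cq q) (Point i). \<forall>b\<in>Point ` J. snd r {a, b} > p)" for J r q i
 define E where "E J = {r \<in> space R. (\<forall>i\<in>J. h <= fst r (Point i)) & (\<forall>e\<in>pairs_in (Point ` J). snd r e <= p) &
   (\<forall>i\<in>I - J. fst r (Point i) < h) & (\<Sum>q\<in>Qs' J. \<Sum>i\<in>Cq q. if avoid J r q i then 1 else (0::real)) < s}" for J
 let ?Js = "{J. J \<subseteq> I & card J = j}"
 let ?b = "(h powr (- (\<tau> - 1))) ^ j * p ^ (j choose 2) * (1 - card I * h powr (- (\<tau> - 1)) - S / s)"
 have finJs: "finite ?Js" using I(1) by simp
 have EJ: "E J \<in> sets R" "?b <= labels.prob (E J)" if "J \<in> ?Js" for J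
 proof -
  have J: "J \<subseteq> I" "card J = j" using that by auto
  have S': "(\<Sum>q\<in>Qs. \<Sum>i\<in>Cq q. comp_mean (%k. ennreal (((1 - p) ^ card J) ^ k)) (vpos x) (Point ` Cq q) (Point i)) <= ennreal S"
   unfolding J(2) by (rule S(1))
  show "E J \<in> sets R"
   unfolding E_def Qs'_def avoid_def
   by (rule prob_hub_lower_one(1)[where I=I and Qs=Qs and Cq=Cq and h=h and J=J and x=x and S=S and s=s])
    (fact I(1) Qs h(1) J(1) S' S(2) s)+
  show "?b <= labels.prob (E J)"
   using prob_hub_lower_one(2)[OF I(1) Qs h(1) J(1) S' S(2) s]
   unfolding E_def Qs'_def avoid_def J(2) .
 qed
 have disj: "disjoint_family_on E ?Js"
  unfolding disjoint_family_on_def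
 proof (intro ballI impI equals0I)
  fix J J' r assume *: "J \<in> ?Js" "J' \<in> ?Js" "J ~= J'" "r \<in> E J \<inter> E J'"
  hence "J = {i \<in> I. h <= fst r (Point i)}" "J' = {i \<in> I. h <= fst r (Point i)}"
   by (auto simp: E_def not_le[symmetric])
  thus False using *(3) by simp
 qed
 have large: "\<exists>i\<in>I. t < card (comp_of c (vpos x) (fst r) (snd r) (Point ` I) (Point i))"
  if J: "J \<in> ?Js" and r: "r \<in> E J" and w: "\<forall>v. 1 <= fst r v" for J r
 proof -
  let ?G = "label_edges c (vpos x) (fst r) (snd r) (Point ` I)"
  let ?A = "{(q, i). q \<in> Qs' J & i \<in> Cq q & \<not> avoid J r q i}"
  have JI: "J \<subseteq> I" "card J = j" using J by auto
  have finJ: "finite J" using I(1) JI(1) by (rule rev_finite_subset)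
  have CI: "Cq q \<subseteq> I - J" if "q \<in> Qs' J" for q using that Qs(3) by (auto simp: Qs'_def)
  obtain j0 where j0: "j0 \<in> J" using JI(2) j by (cases "J = {}") auto
  have conn: "(Point i, Point l) \<in> ?G" if il: "i \<in> I" "l \<in> J" "i ~= l" "snd r {Point i, Point l} <= p" for i l
  proof -
   have l: "l \<in> I" using il(2) JI by auto
   have "x i ~= x l" using I(2) il l by (auto dest: inj_onD)
   hence "c (x l) (fst r (Point l)) (x i) (fst r (Point i)) = p"
    using w h(2)[OF l il(1)] r il(2) by (intro hub_conn) (auto simp: E_def)
   hence "c (x i) (fst r (Point i)) (x l) (fst r (Point l)) = p" by (subst conn_sym)
   thus ?thesis using il l by (auto simp: label_edges_def)
  qed
  have hubs: "(a, b) \<in> ?G" if ab: "a \<in> Point ` J" "b \<in> Point ` J" "a ~= b" for a b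
  proof -
   have "{a, b} \<in> pairs_in (Point ` J)" using ab by (auto simp: pairs_in_def)
   hence "snd r {a, b} <= p" using r by (auto simp: E_def)
   thus ?thesis using ab JI(1) conn by auto
  qed
  let ?K = "graph_component ?G (Point j0)"
  have KI: "?K \<subseteq> Point ` I" using comp_of_subset[of "Point j0" "Point ` I"] j0 JI(1) by blast
  have symG: "sym ?G" by (rule sym_label_edges) (rule conn_sym)
  have att: "Point i \<in> ?K" if qi: "q \<in> Qs' J" "i \<in> Cq q" "\<not> avoid J r q i" for q i
  proof -
   obtain a b where ab: "a \<in> comp_of c (vpos x) (fst r) (snd r) (Point ` Cq q) (Point i)" "b \<in> Point ` J" "snd r {a, b} <= p"
    using qi(3) by (auto simp: avoid_def not_less)
   have "a \<in> Point ` Cq q" using ab(1) comp_of_subset[of "Point i" "Point ` Cq q"] qi(2) by blast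
   hence "(a, b) \<in> ?G" using conn ab CI[OF qi(1)] by auto
   moreover have "label_edges c (vpos x) (fst r) (snd r) (Point ` Cq q) = ?G \<inter> (Point ` Cq q \<times> Point ` Cq q)"
    using CI[OF qi(1)] by (intro label_edges_Int) auto
   ultimately show ?thesis
    using hub_component[OF symG _ hubs, of "Point j0" "Point ` J" a "Point ` Cq q" "Point i" b] ab j0 by simp
  qed
  have hubK: "Point i \<in> ?K" if "i \<in> J" for i
   using hub_component[OF symG _ hubs, of "Point j0" "Point ` J" "Point i" "{}" "Point i" ]
   using hubs[of "Point j0" "Point i"] that j0 by (cases "i = j0") (auto simp: graph_component_def)
  let ?un = "%q. {i \<in> Cq q. avoid J r q i}"
  let ?bad = "\<Union>q\<in>Qs - Qs' J. Cq q"
  \<comment> \<open>A vertex outside the component of the hubs lies in no cell, is missed inside a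
    cell without hubs, or shares its cell with a hub.\<close>
  have cover: "I \<subseteq> {i \<in> I. Point i \<in> ?K} \<union> (I - (\<Union>q\<in>Qs. Cq q)) \<union> (\<Union>q\<in>Qs' J. ?un q) \<union> ?bad"
   using att by blast
  have finC: "finite (Cq q)" if "q \<in> Qs" for q using Qs(3)[OF that] I(1) by (rule finite_subset)
  have cbad: "real (card ?bad) <= j * B"
  proof -
   have QJ: "card (Qs - Qs' J) <= j"
   proof -
    have "\<forall>q\<in>Qs - Qs' J. \<exists>i. i \<in> Cq q \<inter> J" by (auto simp: Qs'_def)
    then obtain f where f: "!!q. q \<in> Qs - Qs' J ==> f q \<in> Cq q \<inter> J" by metis
    have "inj_on f (Qs - Qs' J)"
    proof (rule inj_onI)
     fix q q' assume "q \<in> Qs - Qs' J" "q' \<in> Qs - Qs' J" "f q = f q'"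
     hence "Cq q \<inter> Cq q' ~= {}" "q \<in> Qs" "q' \<in> Qs" using f by (metis IntD1 IntI emptyE, auto)
     thus "q = q'" using Qs(2) by (auto simp: disjoint_family_on_def)
    qed
    hence "card (Qs - Qs' J) <= card J" using f finJ by (intro card_inj_on_le[of f]) auto
    thus ?thesis using JI by simp
   qed
   have "real (card ?bad) <= (\<Sum>q\<in>Qs - Qs' J. real (card (Cq q)))"
    using of_nat_mono[OF card_UN_le[of "Qs - Qs' J" Cq], where 'a = real] Qs(1) by simp
   also have "... <= (\<Sum>q\<in>Qs - Qs' J. B)" using B(1) by (intro sum_mono) auto
   also have "... <= j * B" using QJ B(2) by (simp add: mult_right_mono)
   finally show ?thesis .
  qed
  have cun: "real (card (\<Union>q\<in>Qs' J. ?un q)) < s"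
  proof -
   have fQ: "finite (Qs' J)" using Qs(1) by (simp add: Qs'_def)
   have "real (card (\<Union>q\<in>Qs' J. ?un q)) <= (\<Sum>q\<in>Qs' J. real (card (?un q)))"
    using of_nat_mono[OF card_UN_le[OF fQ, of ?un], where 'a = real] by simp
   also have "... = (\<Sum>q\<in>Qs' J. \<Sum>i\<in>Cq q. if avoid J r q i then 1 else (0::real))"
    using finC by (intro sum.cong refl) (auto simp: sum.If_cases Qs'_def Int_def)
   also have "... < s" using r by (simp add: E_def)
   finally show ?thesis .
  qed
  have "card I <= card ({i \<in> I. Point i \<in> ?K} \<union> (I - (\<Union>q\<in>Qs. Cq q)) \<union> (\<Union>q\<in>Qs' J. ?un q) \<union> ?bad)"
  proof (rule card_mono[OF _ cover])
   show "finite ({i \<in> I. Point i \<in> ?K} \<union> (I - (\<Union>q\<in>Qs. Cq q)) \<union> (\<Union>q\<in>Qs' J. ?un q) \<union> ?bad)"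
    by (rule finite_subset[OF _ I(1)]) (use Qs(3) in \<open>auto simp: Qs'_def\<close>)
  qed
  also have "... <= card {i \<in> I. Point i \<in> ?K} + card (I - (\<Union>q\<in>Qs. Cq q)) + card (\<Union>q\<in>Qs' J. ?un q) + card ?bad"
   by (meson add_le_mono card_Un_le le_refl order_trans)
  finally have c1: "card I <= card {i \<in> I. Point i \<in> ?K} + card (I - (\<Union>q\<in>Qs. Cq q)) + card (\<Union>q\<in>Qs' J. ?un q) + card ?bad" .
  have "card {i \<in> I. Point i \<in> ?K} = card (Point ` {i \<in> I. Point i \<in> ?K})"
   by (rule card_image[symmetric]) (simp add: inj_on_def)
  also have "Point ` {i \<in> I. Point i \<in> ?K} = ?K" using KI by auto
  finally have "t < card ?K" using c1 cun cbad t by linarith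
  thus ?thesis using j0 JI(1) by blast
 qed
 have mL: "{r \<in> space R. \<exists>i\<in>I. t < card (comp_of c (vpos x) (fst r) (snd r) (Point ` I) (Point i))} \<in> sets R"
 proof (intro predE pred_intros_finite)
  fix i
  have [measurable]: "(%r. card (comp_of c (vpos x) (fst r) (snd r) (Point ` I) (Point i))) \<in> measurable R (count_space UNIV)"
   by (rule measurable_card_comp)
  show "Measurable.pred R (%r. t < card (comp_of c (vpos x) (fst r) (snd r) (Point ` I) (Point i)))" by measurable
 qed (use I in auto)
 have "(card I choose j) * ?b = (\<Sum>J\<in>?Js. ?b)" using n_subsets[OF I(1), of j] by simp
 also have "... <= (\<Sum>J\<in>?Js. labels.prob (E J))" using EJ(2) by (rule sum_mono)
 also have "... = labels.prob (\<Union>J\<in>?Js. E J)"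
  using finJs EJ(1) disj by (intro labels.finite_measure_finite_Union[symmetric]) auto
 also have "... <= labels.prob {r \<in> space R. \<exists>i\<in>I. t < card (comp_of c (vpos x) (fst r) (snd r) (Point ` I) (Point i))}"
 proof (rule labels.finite_measure_mono_AE[OF _ mL])
  show "AE r in R. r \<in> (\<Union>J\<in>?Js. E J) --> r \<in> {r \<in> space R. \<exists>i\<in>I. t < card (comp_of c (vpos x) (fst r) (snd r) (Point ` I) (Point i))}"
   using AE_mark_ge_1 AE_space by eventually_elim (use large in blast)
 qed
 finally show ?thesis .
qed

end

section \<open>The volume box\<close>

lemma root_power: "0 <= n ==> 0 < D ==> (n powr (1 / real D)) ^ D = n"
 by (cases "n = 0") (simp_all add: powr_realpow[symmetric] powr_powr zero_power)

lemma volume_box_eq: "volume_box n = cbox (\<chi> i. - (n powr (1 / real CARD('d)) / 2)) (\<chi> i. n powr (1 / real CARD('d)) / 2 :: real ^ 'd)"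
proof (rule set_eqI)
 fix x :: "real ^ 'd"
 let ?s = "n powr (1 / real CARD('d)) / 2"
 have "\<bar>x $ i\<bar> <= ?s \<longleftrightarrow> - ?s <= x $ i & x $ i <= ?s" for i by linarith
 thus "x \<in> volume_box n \<longleftrightarrow> x \<in> cbox (\<chi> i. - ?s) (\<chi> i. ?s)"
  unfolding volume_box_def mem_box_cart mem_Collect_eq vec_lambda_beta by blast
qed

lemma volume_box_borel[measurable]: "volume_box n \<in> sets (borel :: (real ^ 'd) measure)"
 by (simp add: volume_box_eq)

lemma bounded_volume_box: "bounded (volume_box n :: (real ^ 'd) set)"
 by (simp add: volume_box_eq)

lemma measure_volume_box:
 assumes "0 <= n"
 shows "measure lborel (volume_box n :: (real ^ 'd) set) = n"
proof -
 let ?s = "n powr (1 / real CARD('d))"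
 have "(0 :: real ^ 'd) \<in> volume_box n" by (simp add: volume_box_def)
 hence "cbox (\<chi> i. - (?s / 2)) (\<chi> i. ?s / 2 :: real ^ 'd) ~= {}" unfolding volume_box_eq by blast
 hence "measure lborel (volume_box n :: (real ^ 'd) set) = (\<Prod>i\<in>(UNIV :: 'd set). ?s / 2 - (- (?s / 2)))"
  unfolding volume_box_eq by (subst content_cbox_cart) auto
 also have "... = ?s ^ CARD('d)" by simp
 finally show ?thesis using assms by (simp add: root_power)
qed

lemma dist_volume_box:
 fixes x y :: "real ^ 'd"
 assumes "x \<in> volume_box n" "y \<in> volume_box n" "0 <= n"
 shows "dist x y ^ CARD('d) <= real CARD('d) ^ CARD('d) * n"
proof -
 let ?s = "n powr (1 / real CARD('d))"
 have "dist x y <= (\<Sum>i\<in>(UNIV :: 'd set). \<bar>(x - y) $ i\<bar>)"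
  unfolding dist_norm by (rule norm_le_l1_cart)
 also have "... <= (\<Sum>i\<in>(UNIV :: 'd set). ?s)"
 proof (rule sum_mono)
  fix i
  have "\<bar>x $ i\<bar> <= ?s / 2" "\<bar>y $ i\<bar> <= ?s / 2" using assms by (simp_all add: volume_box_def)
  thus "\<bar>(x - y) $ i\<bar> <= ?s" by simp
 qed
 finally have "dist x y ^ CARD('d) <= (real CARD('d) * ?s) ^ CARD('d)"
  by (intro power_mono) auto
 thus ?thesis using assms(3) by (simp add: power_mult_distrib root_power)
qed

text \<open>The number of cubes of side \<open>L\<close> that fit between the origin and a face of
  the box; the inner grid has twice as many along each axis.\<close>

definition inner_range :: "nat => nat => real => int" where
 "inner_range D L n = \<lfloor>n powr (1 / real D) / (2 * real L)\<rfloor>"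

definition inner_cells :: "nat => real => ('d::finite => int) set" where
 "inner_cells L n = (UNIV \<rightarrow>\<^sub>E {- inner_range CARD('d) L n..<inner_range CARD('d) L n})"

lemma finite_inner_cells: "finite (inner_cells L n)"
 unfolding inner_cells_def by (intro finite_PiE) auto

lemma cube_subset_volume_box:
 assumes "q \<in> inner_cells L n" "L > 0"
 shows "cube L q \<subseteq> (volume_box n :: (real ^ 'd) set)"
proof
 fix x :: "real ^ 'd" assume x: "x \<in> cube L q"
 let ?h = "inner_range CARD('d) L n" and ?s = "n powr (1 / real CARD('d))"
 have h: "real L * ?h <= ?s / 2"
 proof -
  have "real_of_int ?h <= ?s / (2 * real L)" by (simp add: inner_range_def)
  hence "real L * ?h <= real L * (?s / (2 * real L))" using assms(2) by (intro mult_left_mono) auto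
  thus ?thesis using assms(2) by simp
 qed
 have "\<bar>x $ i\<bar> <= ?s / 2" for i
 proof -
  have "- ?h <= q i & q i < ?h" using assms(1) by (auto simp: inner_cells_def PiE_iff)
  hence q: "- ?h <= q i" "q i + 1 <= ?h" by auto
  have "real L * q i <= x $ i" "x $ i < real L * (q i + 1)"
   using x assms(2) by (auto simp: cube_eq_hbox hbox_def)
  moreover have "real L * (- ?h) <= real L * q i"
   using q(1) by (intro mult_left_mono) (auto simp flip: of_int_minus)
  moreover have "real L * (q i + 1) <= real L * ?h"
  proof -
   have "real_of_int (q i) + 1 <= real_of_int ?h" using q(2) by linarith
   thus ?thesis by (intro mult_left_mono) auto
  qed
  ultimately show ?thesis using h by simp
 qed
 thus "x \<in> volume_box n" by (simp add: volume_box_def)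
qed

lemma inner_cells_volume:
 assumes "L > 0" "0 < n" "2 * real L <= n powr (1 / real CARD('d))"
 shows "real (card (inner_cells L n :: ('d::finite => int) set)) * real L ^ CARD('d) <= n"
  and "n * (1 - 2 * real L / n powr (1 / real CARD('d))) ^ CARD('d) <=
   real (card (inner_cells L n :: ('d => int) set)) * real L ^ CARD('d)"
proof -
 let ?h = "inner_range CARD('d) L n" and ?s = "n powr (1 / real CARD('d))"
 have h0: "0 <= ?h" using assms by (simp add: inner_range_def)
 have "card (inner_cells L n :: ('d => int) set) = nat (2 * ?h) ^ CARD('d)"
  unfolding inner_cells_def by (subst card_PiE) auto
 hence eq: "real (card (inner_cells L n :: ('d => int) set)) * real L ^ CARD('d) = (2 * real L * ?h) ^ CARD('d)"
 proof -
  have "real (nat (2 * ?h)) = 2 * real_of_int ?h" using h0 by simp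
  moreover have "2 * real_of_int ?h * real L = 2 * real L * ?h" by simp
  ultimately show ?thesis
   unfolding \<open>card (inner_cells L n :: ('d => int) set) = nat (2 * ?h) ^ CARD('d)\<close> of_nat_power
   by (simp only: power_mult_distrib[symmetric])
 qed
 have "real_of_int ?h <= ?s / (2 * real L)" by (simp add: inner_range_def)
 hence up: "2 * real L * ?h <= ?s" using assms(1) by (simp add: field_simps)
 have "?s / (2 * real L) < real_of_int ?h + 1" unfolding inner_range_def by linarith
 hence lo: "?s - 2 * real L <= 2 * real L * ?h" using assms(1) by (simp add: field_simps)
 have sD: "?s ^ CARD('d) = n" using assms(2) by (intro root_power) auto
 have s0: "?s > 0" using assms(2) by simp
 show "real (card (inner_cells L n :: ('d => int) set)) * real L ^ CARD('d) <= n"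
  unfolding eq using power_mono[OF up, of "CARD('d)"] h0 sD by simp
 have "n * (1 - 2 * real L / ?s) ^ CARD('d) = (?s * (1 - 2 * real L / ?s)) ^ CARD('d)"
  by (simp add: power_mult_distrib sD)
 also have "?s * (1 - 2 * real L / ?s) = ?s - 2 * real L" using s0 by (simp add: field_simps)
 also have "(?s - 2 * real L) ^ CARD('d) <= (2 * real L * ?h) ^ CARD('d)"
  using lo assms(3) by (intro power_mono) auto
 finally show "n * (1 - 2 * real L / ?s) ^ CARD('d) <= real (card (inner_cells L n :: ('d => int) set)) * real L ^ CARD('d)"
  unfolding eq .
qed

lemma eventually_le_if_tendsto_0: "(f \<longlongrightarrow> 0) F ==> 0 < c ==> \<forall>\<^sub>F n in F. f n <= (c :: real)"
 by (drule order_tendstoD(2), assumption, erule eventually_mono) simp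

lemma filterlim_root: "0 < D ==> filterlim (%n :: real. n powr (1 / real D)) at_top at_top"
proof -
 assume "0 < D"
 hence "0 < 1 / real D" by simp
 thus ?thesis by real_asymp
qed

lemma eventually_inner_cells:
 assumes "L > 0" "e > 0"
 shows "\<forall>\<^sub>F n in at_top. real (card (inner_cells L n :: ('d::finite => int) set)) * real L ^ CARD('d) <= n &
  (1 - e) * n <= real (card (inner_cells L n :: ('d => int) set)) * real L ^ CARD('d)"
proof -
 let ?s = "%n :: real. n powr (1 / real CARD('d))"
 have s: "filterlim ?s at_top at_top" by (rule filterlim_root) simp
 hence "((%n. (1 - 2 * real L / ?s n) ^ CARD('d)) \<longlongrightarrow> (1 - 0) ^ CARD('d)) at_top"
  by (intro tendsto_intros tendsto_divide_0[OF tendsto_const filterlim_at_top_imp_at_infinity[OF s]])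
 hence "\<forall>\<^sub>F n in at_top. (1 - 2 * real L / ?s n) ^ CARD('d) > 1 - e"
  using assms(2) by (intro order_tendstoD(1)) auto
 moreover have "\<forall>\<^sub>F n in at_top. ?s n \<ge> 2 * real L"
  using s unfolding filterlim_at_top by blast
 moreover have "\<forall>\<^sub>F n :: real in at_top. n > 0" by (rule eventually_gt_at_top)
 ultimately show ?thesis
 proof eventually_elim
  case (elim n)
  have "(1 - e) * n <= n * (1 - 2 * real L / ?s n) ^ CARD('d)"
   using elim by (subst mult.commute) (intro mult_left_mono, auto)
  thus ?case using inner_cells_volume[OF assms(1) elim(3,2)] by linarith
 qed
qed

section \<open>The lower bound\<close>

lemma (in prob_space) prob_Markov_nn_integral:
 assumes "f \<in> borel_measurable M" "(\<integral>\<^sup>+om. f om \<partial>M) <= ennreal b" "0 <= b" "0 < t"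
 shows "prob {om \<in> space M. ennreal t <= f om} <= b / t"
proof -
 let ?S = "{om \<in> space M. ennreal t <= f om}"
 have S: "?S \<in> sets M" using assms(1) by measurable
 have "ennreal (t * prob ?S) = ennreal t * emeasure M ?S"
  using assms(4) by (simp add: emeasure_eq_measure ennreal_mult)
 also have "... = (\<integral>\<^sup>+om. ennreal t * indicator ?S om \<partial>M)"
  using S by (simp add: nn_integral_cmult_indicator)
 also have "... <= (\<integral>\<^sup>+om. f om \<partial>M)"
  by (intro nn_integral_mono) (auto simp: indicator_def)
 also note assms(2)
 finally show ?thesis using assms(3,4) by (simp add: ennreal_le_iff field_simps)
qed

context ksrg_model
begin

definition large :: "real => real => 'w => ((vertex => real) \<times> (vertex set => real)) => bool" where
 "large \<rho> n om r \<longleftrightarrow> (\<exists>i\<in>P (volume_box n) om. \<rho> * n <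
  card (comp_of c (vpos (%i. X i om)) (fst r) (snd r) (Point ` P (volume_box n) om) (Point i)))"

text \<open>The probability taken in two stages, labels for frozen locations and then locations;
  \<open>prob_large_eq\<close> identifies it with the probability of the statement.\<close>

definition prob_large :: "real => real => ennreal" where
 "prob_large \<rho> n = (\<integral>\<^sup>+om. ennreal (labels.prob {r \<in> space R. large \<rho> n om r}) \<partial>M)"

lemma disjoint_family_pts_cube: "disjoint_family_on (%q. P (cube L q) om) Q"
 using disjoint_cube[of _ _ L] by (auto simp: disjoint_family_on_def pts_def)

lemma cell_sum_measurable: "Q \<in> sets borel ==> bounded Q ==> cell_sum F Q \<in> borel_measurable M"
 using measurable_count_sigma measurable_cell_sum by blast

end

context ksrg_bounds
begin

text \<open>If \<open>j\<close> hubs miss a density \<open>H < 1 - \<rho>\<close>, the event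
  \<open>large\<close> follows from having such hubs. The locations need to be good only with a
  probability bounded below, as a constant factor is lost in the logarithm.\<close>

lemma prob_large_lower:
 assumes j: "1 <= j" and \<rho>: "0 < \<rho>" "\<rho> < 1"
  and H: "palm_total (%k. ennreal (((1 - p) ^ j) ^ k)) < ennreal (1 - \<rho>)"
 shows "\<exists>C>0. \<forall>\<^sub>F n in at_top. ennreal (C * n powr (- ((\<tau> - 2) * real j))) <= prob_large \<rho> n"
proof -
 let ?z = "(1 - p) ^ j"
 let ?F = "%k. ennreal (?z ^ k)"
 let ?D = "CARD('d)"
 have z: "0 <= ?z" "?z < 1" using p_pos p_le j by (auto intro: power_strict_decreasing power_Suc_less_one simp: power_less_one_iff)
 have F1: "?F k <= 1" for k using z by (simp add: power_le_one)
 have F0: "?F \<longlonglongrightarrow> 0"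
  using tendsto_ennrealI[OF LIMSEQ_power_zero[of ?z]] z by simp
 have Fmono: "?F k <= ?F l" if "l <= k" for k l
  using z that by (intro ennreal_leI power_decreasing) auto
 obtain H where H': "palm_total ?F = ennreal H" "0 <= H" "H < 1 - \<rho>"
  using H by (cases "palm_total ?F") (auto simp: ennreal_less_iff)
 define e where "e = (1 - \<rho> - H) / 8"
 \<comment> \<open>Markov's inequality with mean at most \<open>(H + e) * n\<close> and level
   \<open>(H + 2 * e) * n\<close> leaves probability \<open>\<kappa>0\<close>. Likewise
   \<open>\<kappa>1 = 1 - (H + 2 * e) / (H + 5 * e)\<close> is left for the labels, where the level
   is \<open>(1 - \<rho> - 3 * e) * n = (H + 5 * e) * n\<close>.\<close>
 define \<kappa>0 where "\<kappa>0 = e / (H + 2 * e)"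
 define \<kappa>1 where "\<kappa>1 = 3 * e / (H + 5 * e)"
 have e: "0 < e" "e <= 1 / 8" "1 - \<rho> = H + 8 * e" using H' \<rho> by (simp_all add: e_def field_simps)
 have \<kappa>: "0 < \<kappa>0" "0 < \<kappa>1" using e H'(2) by (auto simp: \<kappa>0_def \<kappa>1_def)
 have "\<forall>\<^sub>F L in sequentially. L > 0 & (\<forall>q. (\<integral>\<^sup>+om. cell_sum ?F (cube L q) om \<partial>M) <= ennreal (real L ^ ?D) * (palm_total ?F + ennreal e))"
 proof -
  have "\<forall>\<^sub>F L in sequentially. \<forall>q. (\<integral>\<^sup>+om. cell_sum ?F (cube L q) om \<partial>M) <= ennreal (real L ^ ?D) * (palm_total ?F + ennreal e)"
   by (rule cell_sum_upper[OF F1 F0 _ e(1)]) (rule Fmono)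
  thus ?thesis using eventually_gt_at_top[of "0 :: nat"] by eventually_elim auto
 qed
 then obtain L where L: "L > 0" "!!q. (\<integral>\<^sup>+om. cell_sum ?F (cube L q) om \<partial>M) <= ennreal (real L ^ ?D) * (palm_total ?F + ennreal e)"
  by (auto simp: eventually_sequentially)
 \<comment> \<open>Points of the box satisfy \<open>dist ^ d <= d ^ d * n\<close>, so a mark of at
   least \<open>a * n\<close> connects to every point of the box with probability
   \<open>p\<close>.\<close>
 define a where "a = hc * real ?D ^ ?D"
 have a: "0 < a" using hc by (simp add: a_def)
 define C where "C = ((1 - e) / real j) ^ j * (a powr (- (\<tau> - 1))) ^ j * p ^ (j choose 2) * (\<kappa>1 / 2) * (\<kappa>0 / 2)"
 have C: "0 < C" using e j a p_pos \<kappa> by (simp add: C_def)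
 let ?V = "real L ^ ?D"
 have ev1: "\<forall>\<^sub>F n :: real in at_top. exp (- (e\<^sup>2 / 4) * n) <= \<kappa>0 / 8"
 proof -
  have "((%n. exp (- (e\<^sup>2 / 4) * n)) \<longlongrightarrow> 0) at_top" using e by real_asymp
  thus ?thesis using \<kappa> by (intro eventually_le_if_tendsto_0) auto
 qed
 have ev2: "\<forall>\<^sub>F n :: real in at_top. exp (- (1\<^sup>2 / 4) * n) <= \<kappa>0 / 8"
 proof -
  have "((%n :: real. exp (- (1\<^sup>2 / 4) * n)) \<longlongrightarrow> 0) at_top" by real_asymp
  thus ?thesis using \<kappa> by (intro eventually_le_if_tendsto_0) auto
 qed
 have ev3: "\<forall>\<^sub>F n :: real in at_top. n * (exp (2 * ?V) * exp (- sqrt n)) <= \<kappa>0 / 8"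
 proof -
  have "((%n :: real. n * exp (- sqrt n)) \<longlongrightarrow> 0) at_top" by real_asymp
  hence "((%n :: real. exp (2 * ?V) * (n * exp (- sqrt n))) \<longlongrightarrow> exp (2 * ?V) * 0) at_top" by (intro tendsto_intros)
  hence "\<forall>\<^sub>F n in at_top. exp (2 * ?V) * (n * exp (- sqrt n)) < \<kappa>0 / 8"
   using \<kappa> by (intro order_tendstoD(2)) auto
  thus ?thesis by eventually_elim (simp add: mult_ac)
 qed
 have ev4: "\<forall>\<^sub>F n :: real in at_top. real j * sqrt n <= e * n" using e by real_asymp
 have ev5: "\<forall>\<^sub>F n :: real in at_top. 1 <= a * n" using a by real_asymp
 have ev6: "\<forall>\<^sub>F n :: real in at_top. 2 * n * (a * n) powr (- (\<tau> - 1)) <= \<kappa>1 / 2"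
 proof -
  have "((%n :: real. n powr (2 - \<tau>)) \<longlongrightarrow> 0) at_top" using tau tendsto_neg_powr[of "2 - \<tau>" "%n. n" at_top] filterlim_ident by auto
  hence "((%n :: real. 2 * a powr (- (\<tau> - 1)) * n powr (2 - \<tau>)) \<longlongrightarrow> 2 * a powr (- (\<tau> - 1)) * 0) at_top" by (intro tendsto_intros)
  hence "\<forall>\<^sub>F n in at_top. 2 * a powr (- (\<tau> - 1)) * n powr (2 - \<tau>) < \<kappa>1 / 2"
   using \<kappa> by (intro order_tendstoD(2)) auto
  thus ?thesis using eventually_gt_at_top[of 0]
  proof eventually_elim
   case (elim n)
   have "2 * n * (a * n) powr (- (\<tau> - 1)) = 2 * a powr (- (\<tau> - 1)) * (n powr 1 * n powr (- (\<tau> - 1)))"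
    using elim a by (simp add: powr_mult)
   also have "n powr 1 * n powr (- (\<tau> - 1)) = n powr (2 - \<tau>)"
    by (subst powr_add[symmetric]) simp
   finally show ?case using elim by simp
  qed
 qed
 have ev7: "\<forall>\<^sub>F n :: real in at_top. real j <= (1 - e) * n" using e by real_asymp
 have ev8: "\<forall>\<^sub>F n :: real in at_top. 1 <= n" by (rule eventually_ge_at_top)
 have ev9: "\<forall>\<^sub>F n in at_top. real (card (inner_cells L n :: ('d => int) set)) * ?V <= n &
  (1 - e * \<kappa>0 / 8) * n <= real (card (inner_cells L n :: ('d => int) set)) * ?V"
  using e \<kappa> L(1) by (intro eventually_inner_cells) auto
 have "\<forall>\<^sub>F n in at_top. ennreal (C * n powr (- ((\<tau> - 2) * real j))) <= prob_large \<rho> n"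
  using ev1 ev2 ev3 ev4 ev5 ev6 ev7 ev8 ev9
 proof eventually_elim
  case (elim n)
  let ?Q = "inner_cells L n :: ('d => int) set"
  let ?bx = "volume_box n :: (real ^ 'd) set"
  let ?out = "?bx - (\<Union>q\<in>?Q. cube L q)"
  let ?N = "%om. real (card (P ?bx om))"
  have n: "0 < n" "1 <= n" using elim by auto
  have finQ: "finite ?Q" by (rule finite_inner_cells)
  have cb: "cube L q \<in> sets borel" "bounded (cube L q)" for q :: "'d => int"
   using L(1) by (auto intro: bounded_cube)
  have Ub: "(\<Union>q\<in>?Q. cube L q) \<in> sets borel" using finQ cb by (intro sets.finite_UN) auto
  have Usub: "(\<Union>q\<in>?Q. cube L q) \<subseteq> ?bx" using cube_subset_volume_box L(1) by blast
  have ob: "?out \<in> sets borel" "bounded ?out" using Ub bounded_subset[OF bounded_volume_box, of ?out] by auto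
  have measU: "measure lborel (\<Union>q\<in>?Q. cube L q :: (real ^ 'd) set) = real (card ?Q) * ?V"
  proof -
   have "measure lborel (\<Union>q\<in>?Q. cube L q :: (real ^ 'd) set) = (\<Sum>q\<in>?Q. measure lborel (cube L q :: (real ^ 'd) set))"
   proof (rule measure_finite_Union[OF finQ])
    show "disjoint_family_on (cube L) ?Q" using disjoint_cube[of _ _ L] by (auto simp: disjoint_family_on_def)
    show "emeasure lborel (cube L q) ~= \<infinity>" for q :: "'d => int"
     by (simp add: emeasure_lborel_bounded cb)
   qed (use cb in auto)
   thus ?thesis using L(1) by (simp add: measure_cube)
  qed
  have measout: "measure lborel ?out <= e * \<kappa>0 / 8 * n"
  proof -
   have "measure lborel ?out = measure lborel ?bx - measure lborel (\<Union>q\<in>?Q. cube L q)"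
    using Ub Usub by (intro measure_Diff) (auto simp: emeasure_lborel_bounded bounded_volume_box)
   thus ?thesis using elim(9) n by (simp add: measU measure_volume_box algebra_simps)
  qed
  \<comment> \<open>Bad locations: too few points, too many, an overfull cube, too many points
    outside the cubes, too large cell means. The first four cost \<open>\<kappa>0 / 8\<close> each
    and the last at most \<open>1 - \<kappa>0\<close>, which leaves \<open>\<kappa>0 / 2\<close> for
    \<open>G\<close>.\<close>
  define B1 where "B1 = {om \<in> space M. ?N om <= (1 - e) * measure lborel ?bx}"
  define B2 where "B2 = {om \<in> space M. (1 + 1) * measure lborel ?bx <= ?N om}"
  define B3 where "B3 q = {om \<in> space M. sqrt n <= real (card (P (cube L q) om))}" for q :: "'d => int"
  define B4 where "B4 = {om \<in> space M. ennreal (e * n) <= ennreal (real (card (P ?out om)))}"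
  define B5 where "B5 = {om \<in> space M. ennreal ((H + 2 * e) * n) <= (\<Sum>q\<in>?Q. cell_sum ?F (cube L q) om)}"
  have [measurable]: "(%om. ?N om) \<in> borel_measurable M" "(%om. real (card (P (cube L q) om))) \<in> borel_measurable M"
   "(%om. real (card (P ?out om))) \<in> borel_measurable M" for q :: "'d => int"
   using cb ob(1) by (auto intro: measurable_card_real)
  have mS[measurable]: "(%om. \<Sum>q\<in>?Q. cell_sum ?F (cube L q) om) \<in> borel_measurable M"
   using cb by (intro borel_measurable_sum cell_sum_measurable)
  have sB: "B1 \<in> sets M" "B2 \<in> sets M" "B3 q \<in> sets M" "B4 \<in> sets M" "B5 \<in> sets M" for q
   unfolding B1_def B2_def B3_def B4_def B5_def by measurable
  have bxn: "measure lborel ?bx = n" using n by (simp add: measure_volume_box)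
  have p1: "prob B1 <= \<kappa>0 / 8"
  proof -
   have "prob B1 <= exp (- (e\<^sup>2 / 4) * measure lborel ?bx)"
    unfolding B1_def by (rule prob_card_le) (use e bounded_volume_box in auto)
   thus ?thesis using elim(1) unfolding bxn by linarith
  qed
  have p2: "prob B2 <= \<kappa>0 / 8"
  proof -
   have "prob B2 <= exp (- (1\<^sup>2 / 4) * measure lborel ?bx)"
    unfolding B2_def by (rule prob_card_ge) (use bounded_volume_box in auto)
   thus ?thesis using elim(2) unfolding bxn by linarith
  qed
  have p3: "prob (\<Union>q\<in>?Q. B3 q) <= \<kappa>0 / 8"
  proof -
   have "prob (\<Union>q\<in>?Q. B3 q) <= (\<Sum>q\<in>?Q. prob (B3 q))"
    using finQ sB by (intro finite_measure_subadditive_finite) auto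
   also have "... <= (\<Sum>q\<in>?Q. exp (2 * ?V) * exp (- sqrt n))"
   proof (rule sum_mono)
    fix q :: "'d => int"
    show "prob (B3 q) <= exp (2 * ?V) * exp (- sqrt n)"
     using prob_card_large[OF cb, of "sqrt n" q] L(1) unfolding B3_def by (simp add: measure_cube)
   qed
   also have "... = real (card ?Q) * (exp (2 * ?V) * exp (- sqrt n))" by simp
   also have "... <= n * (exp (2 * ?V) * exp (- sqrt n))"
   proof (rule mult_right_mono)
    have "real (card ?Q) * 1 <= real (card ?Q) * ?V" using L(1) by (intro mult_left_mono) auto
    thus "real (card ?Q) <= n" using elim(9) by simp
   qed simp
   finally show ?thesis using elim(3) by simp
  qed
  have p4: "prob B4 <= \<kappa>0 / 8"
  proof -
   have "prob B4 <= (e * \<kappa>0 / 8 * n) / (e * n)"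
    unfolding B4_def
   proof (rule prob_Markov_nn_integral)
    show "(\<integral>\<^sup>+om. ennreal (real (card (P ?out om))) \<partial>M) <= ennreal (e * \<kappa>0 / 8 * n)"
     unfolding nn_integral_card[OF ob] by (rule ennreal_leI[OF measout])
   qed (use e \<kappa> n in auto)
   thus ?thesis using e n by simp
  qed
  have p5: "prob B5 <= 1 - \<kappa>0"
  proof -
   have "prob B5 <= (n * (H + e)) / ((H + 2 * e) * n)"
    unfolding B5_def
   proof (rule prob_Markov_nn_integral[OF mS])
    have "(\<integral>\<^sup>+om. (\<Sum>q\<in>?Q. cell_sum ?F (cube L q) om) \<partial>M) = (\<Sum>q\<in>?Q. \<integral>\<^sup>+om. cell_sum ?F (cube L q) om \<partial>M)"
     using cb by (intro nn_integral_sum cell_sum_measurable)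
    also have "... <= (\<Sum>q\<in>?Q. ennreal ?V * (palm_total ?F + ennreal e))"
     using L(2) by (rule sum_mono)
    also have "... = ennreal (real (card ?Q) * ?V * (H + e))"
     using H' e(1) by (simp add: ennreal_mult ennreal_plus[symmetric] ennreal_of_nat_eq_real_of_nat mult.assoc del: ennreal_plus)
    also have "... <= ennreal (n * (H + e))"
     using elim(9) H'(2) e(1) by (intro ennreal_leI mult_right_mono) auto
    finally show "(\<integral>\<^sup>+om. (\<Sum>q\<in>?Q. cell_sum ?F (cube L q) om) \<partial>M) <= ennreal (n * (H + e))" .
   qed (use e H'(2) n in \<open>auto intro!: mult_pos_pos\<close>)
   also have "... = 1 - \<kappa>0"
   proof -
    have "H + 2 * e ~= 0" using e(1) H'(2) by linarith
    hence "1 - \<kappa>0 = ((H + 2 * e) - e) / (H + 2 * e)" unfolding \<kappa>0_def diff_divide_distrib by simp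
    thus ?thesis using n by simp
   qed
   finally show ?thesis .
  qed
  define G where "G = space M - (B1 \<union> B2 \<union> (\<Union>q\<in>?Q. B3 q) \<union> B4 \<union> B5)"
  have sG: "G \<in> sets M" unfolding G_def using sB finQ by auto
  have pG: "\<kappa>0 / 2 <= prob G"
  proof -
   have "prob (B1 \<union> B2 \<union> (\<Union>q\<in>?Q. B3 q) \<union> B4 \<union> B5) <= prob B1 + prob B2 + prob (\<Union>q\<in>?Q. B3 q) + prob B4 + prob B5"
    using sB finQ by (intro order_trans[OF measure_Un_le] add_mono order_refl) auto
   moreover have "prob G = 1 - prob (B1 \<union> B2 \<union> (\<Union>q\<in>?Q. B3 q) \<union> B4 \<union> B5)"
    unfolding G_def using sB finQ by (intro prob_compl) auto
   ultimately show ?thesis using p1 p2 p3 p4 p5 by linarith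
  qed
  define v where "v = ((1 - e) * n / real j) ^ j * (((a * n) powr (- (\<tau> - 1))) ^ j * p ^ (j choose 2) * (\<kappa>1 / 2))"
  have v0: "0 <= v" using e n \<kappa> p_pos by (simp add: v_def)
  have main: "v <= labels.prob {r \<in> space R. large \<rho> n om r}"
   if w: "om \<in> G" and inj: "inj_on (%i. X i om) (P ?bx om)" for om
  proof -
   let ?I = "P ?bx om"
   have wM: "om \<in> space M" using w by (simp add: G_def)
   have N1: "(1 - e) * n < ?N om" and N2: "?N om < 2 * n" and N3: "!!q. q \<in> ?Q ==> real (card (P (cube L q) om)) < sqrt n"
    and N4: "real (card (P ?out om)) < e * n"
    and N5: "(\<Sum>q\<in>?Q. cell_sum ?F (cube L q) om) < ennreal ((H + 2 * e) * n)"
    using w wM n e by (auto simp: G_def B1_def B2_def B3_def B4_def B5_def measure_volume_box not_le ennreal_le_iff)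
   have outeq: "?I - (\<Union>q\<in>?Q. P (cube L q) om) = P ?out om" by (auto simp: pts_def)
   have b: "(card ?I choose j) * (((a * n) powr (- (\<tau> - 1))) ^ j * p ^ (j choose 2) *
     (1 - card ?I * (a * n) powr (- (\<tau> - 1)) - (H + 2 * e) * n / ((1 - \<rho> - 3 * e) * n))) <=
    labels.prob {r \<in> space R. \<exists>i\<in>?I. \<rho> * n < card (comp_of c (vpos (%i. X i om)) (fst r) (snd r) (Point ` ?I) (Point i))}"
   proof (rule prob_hub_lower[where Qs="?Q" and Cq="%q. P (cube L q) om" and B="sqrt n"])
    show "finite ?I" by (intro finite_pts bounded_volume_box)
    show "disjoint_family_on (%q. P (cube L q) om) ?Q" by (rule disjoint_family_pts_cube)
    show "P (cube L q) om \<subseteq> ?I" if "q \<in> ?Q" for q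
     using cube_subset_volume_box[OF that L(1)] by (auto simp: pts_def)
    show "hc * dist (X i om) (X l om) ^ ?D <= a * n" if "i \<in> ?I" "l \<in> ?I" for i l
    proof -
     have "dist (X i om) (X l om) ^ ?D <= real ?D ^ ?D * n"
      using that n by (intro dist_volume_box) (auto simp: pts_def)
     thus ?thesis using hc by (simp add: a_def mult_left_mono mult.assoc)
    qed
    show "(\<Sum>q\<in>?Q. \<Sum>i\<in>P (cube L q) om. comp_mean ?F (vpos (%i. X i om)) (Point ` P (cube L q) om) (Point i)) <= ennreal ((H + 2 * e) * n)"
     using N5 by (simp add: cell_sum_def)
    show "real (card (P (cube L q) om)) <= sqrt n" if "q \<in> ?Q" for q using N3[OF that] by simp
    \<comment> \<open>In units of \<open>n\<close> the budget is
      \<open>\<rho> + (1 - \<rho> - 3 * e) + e + e = 1 - e\<close>, below the number of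
      points.\<close>
    show "\<rho> * n + (1 - \<rho> - 3 * e) * n + real j * sqrt n + real (card (?I - (\<Union>q\<in>?Q. P (cube L q) om))) <= ?N om"
     unfolding outeq using N1 N4 elim(4) by (simp add: algebra_simps)
   qed (use inj finQ elim(5) j H'(2) e n in auto)
   have x1: "\<kappa>1 / 2 <= 1 - card ?I * (a * n) powr (- (\<tau> - 1)) - (H + 2 * e) * n / ((1 - \<rho> - 3 * e) * n)"
   proof -
    have "card ?I * (a * n) powr (- (\<tau> - 1)) <= 2 * n * (a * n) powr (- (\<tau> - 1))"
     using N2 by (intro mult_right_mono) auto
    moreover have "(H + 2 * e) * n / ((1 - \<rho> - 3 * e) * n) = (H + 2 * e) / (H + 5 * e)"
     using n e(3) by simp
    moreover have "1 - (H + 2 * e) / (H + 5 * e) = \<kappa>1"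
     using e(1) H'(2) by (simp add: \<kappa>1_def field_simps)
    ultimately show ?thesis using elim(6) by linarith
   qed
   have jN: "real j <= ?N om" using elim(7) N1 by linarith
   have "((1 - e) * n / real j) ^ j <= (?N om / real j) ^ j"
    using N1 e n by (intro power_mono divide_right_mono) auto
   also have "... <= real (card ?I choose j)"
    using jN by (intro binomial_ge_n_over_k_pow_k) simp
   finally have x2: "((1 - e) * n / real j) ^ j <= real (card ?I choose j)" .
   have "v <= (card ?I choose j) * (((a * n) powr (- (\<tau> - 1))) ^ j * p ^ (j choose 2) *
     (1 - card ?I * (a * n) powr (- (\<tau> - 1)) - (H + 2 * e) * n / ((1 - \<rho> - 3 * e) * n)))"
    unfolding v_def using x1 x2 p_pos \<kappa> by (intro mult_mono mult_left_mono) auto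
   also note b
   finally show ?thesis by (simp add: large_def)
  qed
  have "ennreal (v * (\<kappa>0 / 2)) <= ennreal v * emeasure M G"
   using v0 ennreal_leI[OF mult_left_mono[OF pG v0]] by (simp only: emeasure_eq_measure ennreal_mult measure_nonneg)
  also have "... = (\<integral>\<^sup>+om. ennreal v * indicator G om \<partial>M)"
   using sG by (simp add: nn_integral_cmult_indicator)
  also have "... <= prob_large \<rho> n"
   unfolding prob_large_def
  proof (rule nn_integral_mono_AE)
   have "AE om in M. inj_on (%i. X i om) (P ?bx om)" by (rule AE_distinct_points) (auto simp: bounded_volume_box)
   thus "AE om in M. ennreal v * indicator G om <= ennreal (labels.prob {r \<in> space R. large \<rho> n om r})"
    by eventually_elim (auto simp: indicator_def intro!: ennreal_leI main)
  qed
  finally have "ennreal (v * (\<kappa>0 / 2)) <= prob_large \<rho> n" .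
  \<comment> \<open>About \<open>n ^ j\<close> choices of hubs against
    \<open>n powr (- (\<tau> - 1))\<close> for each mark leave
    \<open>n powr (- (\<tau> - 2))\<close> per hub.\<close>
  moreover have "v * (\<kappa>0 / 2) = C * n powr (- ((\<tau> - 2) * real j))"
  proof -
   have "n ^ j * (n powr (- (\<tau> - 1))) ^ j = (n powr 1 * n powr (- (\<tau> - 1))) ^ j"
    using n by (simp add: power_mult_distrib)
   also have "n powr 1 * n powr (- (\<tau> - 1)) = n powr (- (\<tau> - 2))" by (subst powr_add[symmetric]) simp
   also have "(n powr (- (\<tau> - 2))) ^ j = n powr (- (\<tau> - 2) * real j)"
    using n by (simp add: powr_powr powr_realpow[symmetric])
   also have "- (\<tau> - 2) * real j = - ((\<tau> - 2) * real j)" by (rule mult_minus_left)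
   finally have "n ^ j * (n powr (- (\<tau> - 1))) ^ j = n powr (- ((\<tau> - 2) * real j))" .
   moreover have "v * (\<kappa>0 / 2) = C * (n ^ j * (n powr (- (\<tau> - 1))) ^ j)"
    using a n by (simp add: v_def C_def powr_mult power_mult_distrib power_divide)
   ultimately show ?thesis by simp
  qed
  ultimately show ?case by simp
 qed
 thus ?thesis using C by blast
qed

end

section \<open>Isolated small components\<close>

text \<open>Choosing an element of \<open>J\<close> in each cell that it meets is injective, as the
  cells are disjoint.\<close>

lemma card_cells_hit:
 assumes "disjoint_family_on Cq Qs" "finite J"
 shows "card {q \<in> Qs. Cq q \<inter> J ~= {}} <= card J"
proof -
 have "\<forall>q\<in>{q \<in> Qs. Cq q \<inter> J ~= {}}. \<exists>i. i \<in> Cq q \<inter> J" by auto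
 then obtain f where f: "!!q. q \<in> {q \<in> Qs. Cq q \<inter> J ~= {}} ==> f q \<in> Cq q \<inter> J"
  using bchoice[of "{q \<in> Qs. Cq q \<inter> J ~= {}}" "%q i. i \<in> Cq q \<inter> J"] by blast
 have "inj_on f {q \<in> Qs. Cq q \<inter> J ~= {}}"
 proof (rule inj_onI)
  fix q q' assume q: "q \<in> {q \<in> Qs. Cq q \<inter> J ~= {}}" "q' \<in> {q \<in> Qs. Cq q \<inter> J ~= {}}" "f q = f q'"
  have "f q \<in> Cq q \<inter> Cq q'" using f[OF q(1)] f[OF q(2)] q(3) by simp
  thus "q = q'" using q assms(1) by (auto simp: disjoint_family_on_def)
 qed
 thus ?thesis using f assms(2) by (intro card_inj_on_le[of f]) auto
qed

context ksrg_bounds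
begin

lemma comp_mean_le_1: "(!!k. F k <= 1) ==> comp_mean F y V v <= 1"
proof -
 assume F: "!!k. F k <= 1"
 have "comp_mean F y V v <= (\<integral>\<^sup>+r. 1 \<partial>R)" unfolding comp_mean_def by (intro nn_integral_mono F)
 thus ?thesis by (simp add: labels.emeasure_space_1)
qed

text \<open>For fixed locations and a fixed \<open>J\<close>, the counts in cells without hubs are
  functions of disjoint blocks of labels and are at most \<open>A\<close>, so the lower Chernoff
  bound applies. At most \<open>j\<close> cells are dropped, each with mean at most
  \<open>A\<close>.\<close>

lemma prob_few_isolated:
 fixes I :: "nat set" and x :: "nat => real ^ 'd" and Cq :: "'q => nat set" and S A s d :: real
 assumes I: "finite I" and Qs: "finite Qs" "disjoint_family_on Cq Qs" "!!q. q \<in> Qs ==> Cq q \<subseteq> I"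
  and J: "J \<subseteq> I" "card J <= j" and A: "!!q. q \<in> Qs ==> real (card (Cq q)) <= A" "0 < A"
  and S: "ennreal S <= (\<Sum>q\<in>Qs. \<Sum>i\<in>Cq q.
    comp_mean (%k. if k <= m then ennreal (((1 - p) ^ j) ^ k) else 0) (vpos x) (Point ` Cq q) (Point i))"
  and d: "0 < d" "d <= 1"
 defines "good r q \<equiv> {v \<in> Point ` Cq q. card (comp_of c (vpos x) (fst r) (snd r) (Point ` Cq q) v) <= m &
   (\<forall>a\<in>comp_of c (vpos x) (fst r) (snd r) (Point ` Cq q) v. \<forall>b\<in>Point ` J. snd r {a, b} > p)}"
 shows "{r \<in> space R. (\<Sum>q\<in>{q \<in> Qs. Cq q \<inter> J = {}}. real (card (good r q))) <= (1 - d) * (S - j * A) - s} \<in> sets R"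
  and "labels.prob {r \<in> space R. (\<Sum>q\<in>{q \<in> Qs. Cq q \<inter> J = {}}. real (card (good r q))) <= (1 - d) * (S - j * A) - s} <=
   exp (- (d * s / A))"
proof -
 let ?Q = "{q \<in> Qs. Cq q \<inter> J = {}}"
 have finJ: "finite J" using I J(1) by (rule rev_finite_subset)
 have finC: "finite (Cq q)" if "q \<in> Qs" for q using Qs(3)[OF that] I by (rule finite_subset)
 \<comment> \<open>The block of a cell includes its labels towards \<open>J\<close>. All endpoints
   of these pairs lie in the cell or in \<open>J\<close>, so they meet no other cell that avoids
   \<open>J\<close>, and the blocks are disjoint.\<close>
 define K where "K q = Inl ` Point ` Cq q \<union>
  Inr ` {e \<in> vertex_pairs. e \<inter> Point ` Cq q ~= {} & e \<subseteq> Point ` (Cq q \<union> J)}" for q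
 have K1: "K q \<subseteq> label_index" for q unfolding K_def label_index_def by auto
 have K2: "disjoint_family_on K ?Q"
  unfolding disjoint_family_on_def
 proof (intro ballI impI equals0I)
  fix q q' i assume q: "q \<in> ?Q" "q' \<in> ?Q" "q ~= q'" and i: "i \<in> K q \<inter> K q'"
  have dis: "Cq q \<inter> Cq q' = {}" using q Qs(2) by (auto simp: disjoint_family_on_def)
  show False
  proof (cases i)
   case (Inl v)
   thus False using i dis by (auto simp: K_def)
  next
   case (Inr e)
   then obtain a where "a \<in> e" "a \<in> Point ` Cq q'" "e \<subseteq> Point ` (Cq q \<union> J)" using i by (auto simp: K_def)
   thus False using dis q by auto
  qed
 qed
 define av where "av q z i \<longleftrightarrow> card (comp_of c (vpos x) (mark_of (K q) z) (pair_of (K q) z) (Point ` Cq q) (Point i)) <= m &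
   (\<forall>a\<in>comp_of c (vpos x) (mark_of (K q) z) (pair_of (K q) z) (Point ` Cq q) (Point i).
   \<forall>b\<in>Point ` J. pair_of (K q) z {a, b} > p)" for q z i
 define gd where "gd r q i \<longleftrightarrow> card (comp_of c (vpos x) (fst r) (snd r) (Point ` Cq q) (Point i)) <= m &
   (\<forall>a\<in>comp_of c (vpos x) (fst r) (snd r) (Point ` Cq q) (Point i). \<forall>b\<in>Point ` J. snd r {a, b} > p)" for r q i
 have in_K: "Inl ` Point ` Cq q \<union> Inr ` pairs_in (Point ` Cq q) \<subseteq> K q" for q
 proof -
  have "e \<inter> Point ` Cq q ~= {}" if "e \<in> pairs_in (Point ` Cq q)" for e
   using that by (cases "e = {}") (auto simp: pairs_in_def)
  moreover have "e \<in> vertex_pairs & e \<subseteq> Point ` (Cq q \<union> J)" if "e \<in> pairs_in (Point ` Cq q)" for e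
   using that by (auto simp: pairs_in_def)
  ultimately have "Inr ` pairs_in (Point ` Cq q) \<subseteq> Inr ` {e \<in> vertex_pairs. e \<inter> Point ` Cq q ~= {} & e \<subseteq> Point ` (Cq q \<union> J)}"
   by (intro image_mono subsetI CollectI conjI) blast+
  thus ?thesis unfolding K_def by (intro Un_mono order_refl)
 qed
 have av_eq: "av q (labels_on (K q) r) i \<longleftrightarrow> gd r q i" if "q \<in> ?Q" "i \<in> Cq q" for r q i
 proof -
  have "pair_of (K q) (labels_on (K q) r) {a, b} = snd r {a, b}"
   if ab: "a \<in> comp_of c (vpos x) (fst r) (snd r) (Point ` Cq q) (Point i)" "b \<in> Point ` J" for a b
  proof -
   have a: "a \<in> Point ` Cq q" using ab(1) comp_of_subset[of "Point i" "Point ` Cq q"] \<open>i \<in> Cq q\<close> by blast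
   have ne: "a ~= b" using a ab(2) \<open>q \<in> ?Q\<close> by auto
   have "{a, b} \<subseteq> Point ` (Cq q \<union> J)" using a ab(2) by auto
   hence "Inr {a, b} \<in> K q" using a ne unfolding K_def by auto
   thus ?thesis by (simp add: pair_of_def labels_on_def)
  qed
  thus ?thesis unfolding av_def gd_def comp_of_labels_on[OF in_K] by auto
 qed
 have mav: "Measurable.pred (PiM (K q) (%_. borel)) (%z. av q z i)" for q i
 proof -
  have [measurable]: "Measurable.pred (PiM (K q) (%_. borel)) (%z. a \<in> comp_of c (vpos x) (mark_of (K q) z) (pair_of (K q) z) (Point ` Cq q) (Point i))" for a
   by (rule measurable_comp_local)
  have [measurable]: "(%z. card (comp_of c (vpos x) (mark_of (K q) z) (pair_of (K q) z) (Point ` Cq q) (Point i))) \<in>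
    measurable (PiM (K q) (%_. borel)) (count_space UNIV)"
   by (rule measurable_card_comp_local)
  have [measurable]: "(%z. pair_of (K q) z e) \<in> borel_measurable (PiM (K q) (%_. borel))" for e
   by (rule measurable_pair_of)
  have "av q z i \<longleftrightarrow> card (comp_of c (vpos x) (mark_of (K q) z) (pair_of (K q) z) (Point ` Cq q) (Point i)) <= m &
    (\<forall>a. a \<in> comp_of c (vpos x) (mark_of (K q) z) (pair_of (K q) z) (Point ` Cq q) (Point i) -->
    (\<forall>b. b \<in> Point ` J --> pair_of (K q) z {a, b} > p))" for z
   by (auto simp: av_def)
  thus ?thesis by simp
 qed
 let ?Y = "%q r. \<Sum>i\<in>Cq q. if av q (labels_on (K q) r) i then 1 else (0::real)"
 have indY: "labels.indep_vars (%_. borel) ?Y ?Q"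
 proof (rule labels.indep_vars_compose2[OF indep_labels_on[OF K1 K2]])
  fix q assume "q \<in> ?Q"
  show "(%z. \<Sum>i\<in>Cq q. if av q z i then 1 else (0::real)) \<in> measurable (PiM (K q) (%_. borel)) borel"
   using mav by (intro borel_measurable_sum measurable_If) auto
 qed
 have card_good: "real (card (good r q)) = ?Y q r" if "q \<in> ?Q" for r q
 proof -
  have "good r q = Point ` {i \<in> Cq q. gd r q i}" unfolding good_def gd_def by auto
  hence "card (good r q) = card {i \<in> Cq q. gd r q i}" by (simp add: card_image inj_on_def)
  also have "real ... = (\<Sum>i\<in>Cq q. if gd r q i then 1 else 0)"
   using finC[of q] that by (simp add: sum.If_cases Int_def)
  also have "... = ?Y q r" using av_eq[OF that] by (intro sum.cong refl) simp
  finally show ?thesis .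
 qed
 have Yb: "0 <= ?Y q r & ?Y q r <= A" if "q \<in> ?Q" for q r
 proof -
  have "?Y q r <= (\<Sum>i\<in>Cq q. 1)" by (intro sum_mono) simp
  also have "... <= A" using A(1)[of q] that by simp
  finally show ?thesis by (auto intro: sum_nonneg)
 qed
 have mY: "?Y q \<in> borel_measurable R" if "q \<in> ?Q" for q
  using indY that unfolding labels.indep_vars_def by auto
 let ?F = "%k. if k <= m then ennreal (((1 - p) ^ j) ^ k) else 0"
 let ?c = "%q. \<Sum>i\<in>Cq q. comp_mean ?F (vpos x) (Point ` Cq q) (Point i)"
 have EY: "?c q <= ennreal (labels.expectation (?Y q))" if q: "q \<in> ?Q" for q
 proof -
  have "ennreal (labels.expectation (?Y q)) = (\<integral>\<^sup>+r. ennreal (?Y q r) \<partial>R)"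
   using Yb[OF q] mY[OF q] by (intro nn_integral_eq_integral[symmetric] labels.integrable_const_bound[of _ A]) auto
  also have "... = (\<integral>\<^sup>+r. (\<Sum>i\<in>Cq q. ennreal (if av q (labels_on (K q) r) i then 1 else 0)) \<partial>R)"
   by (intro nn_integral_cong) (simp add: sum_nonneg)
  also have "... = (\<integral>\<^sup>+r. (\<Sum>i\<in>Cq q. indicator {r \<in> space R. gd r q i} r) \<partial>R)"
   using av_eq[OF q] by (intro nn_integral_cong sum.cong refl) (auto simp: indicator_def)
  also have "... = (\<Sum>i\<in>Cq q. emeasure R {r \<in> space R. gd r q i})"
  proof -
   have "{r \<in> space R. gd r q i} \<in> sets R" if "i \<in> Cq q" for i
    unfolding gd_def using that q by (intro predE measurable_avoids) auto
   thus ?thesis by (subst nn_integral_sum) auto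
  qed
  also have "... \<ge> ?c q"
  proof (rule sum_mono)
   fix i assume i: "i \<in> Cq q"
   have "comp_mean ?F (vpos x) (Point ` Cq q) (Point i) <=
    comp_mean (%k. if k <= m then ennreal (((1 - p) ^ card (Point ` J)) ^ k) else 0) (vpos x) (Point ` Cq q) (Point i)"
    unfolding comp_mean_def
   proof (rule nn_integral_mono)
    fix r
    \<comment> \<open>Having fewer than \<open>j\<close> hubs only raises the chance of avoiding
      them.\<close>
    have "(1 - p) ^ j <= (1 - p) ^ card (Point ` J)"
     using J(2) p_pos p_le by (intro power_decreasing) (auto simp: card_image inj_on_def)
    hence "((1 - p) ^ j) ^ k <= ((1 - p) ^ card (Point ` J)) ^ k" for k
     using p_le by (intro power_mono) auto
    thus "?F (card (comp_of c (vpos x) (fst r) (snd r) (Point ` Cq q) (Point i))) <=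
     (if card (comp_of c (vpos x) (fst r) (snd r) (Point ` Cq q) (Point i)) <= m
     then ennreal (((1 - p) ^ card (Point ` J)) ^ card (comp_of c (vpos x) (fst r) (snd r) (Point ` Cq q) (Point i))) else 0)"
     by (auto intro: ennreal_leI)
   qed
   also have "... = emeasure R {r \<in> space R. gd r q i}"
    unfolding gd_def labels.emeasure_eq_measure
    using q i finC[of q] finJ by (intro comp_mean_avoids) auto
   finally show "comp_mean ?F (vpos x) (Point ` Cq q) (Point i) <= emeasure R {r \<in> space R. gd r q i}" .
  qed
  finally show ?thesis .
 qed
 have mean: "S - j * A <= (\<Sum>q\<in>?Q. labels.expectation (?Y q))"
 proof -
  let ?B = "{q \<in> Qs. Cq q \<inter> J ~= {}}"
  have cB: "real (card ?B) <= real j" using card_cells_hit[OF Qs(2) finJ] J(2) by linarith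
  have F1: "?F k <= 1" for k using p_pos p_le by (auto intro!: power_le_one)
  have "(\<Sum>q\<in>?B. ?c q) <= (\<Sum>q\<in>?B. ennreal A)"
  proof (rule sum_mono)
   fix q assume q: "q \<in> ?B"
   have "?c q <= (\<Sum>i\<in>Cq q. 1)" by (intro sum_mono comp_mean_le_1 F1)
   also have "... = ennreal (real (card (Cq q)))" by (simp add: ennreal_of_nat_eq_real_of_nat)
   also have "... <= ennreal A" using A(1)[of q] q by (intro ennreal_leI) auto
   finally show "?c q <= ennreal A" .
  qed
  also have "... = ennreal (real (card ?B) * A)" using A(2) by (simp add: ennreal_mult ennreal_of_nat_eq_real_of_nat)
  also have "... <= ennreal (real j * A)" using cB A(2) by (intro ennreal_leI mult_right_mono) auto
  finally have b: "(\<Sum>q\<in>?B. ?c q) <= ennreal (real j * A)" .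
  have e0: "0 <= labels.expectation (?Y q)" if "q \<in> ?Q" for q using Yb[OF that] by (intro Bochner_Integration.integral_nonneg) auto
  have "(\<Sum>q\<in>?Q. ?c q) <= (\<Sum>q\<in>?Q. ennreal (labels.expectation (?Y q)))" using EY by (intro sum_mono) auto
  also have "... = ennreal (\<Sum>q\<in>?Q. labels.expectation (?Y q))" using e0 by (intro sum_ennreal) auto
  finally have a: "(\<Sum>q\<in>?Q. ?c q) <= ennreal (\<Sum>q\<in>?Q. labels.expectation (?Y q))" .
  have "Qs = ?Q \<union> ?B" by auto
  hence "(\<Sum>q\<in>Qs. ?c q) = (\<Sum>q\<in>?Q. ?c q) + (\<Sum>q\<in>?B. ?c q)"
   using Qs(1) by (subst (1) \<open>Qs = ?Q \<union> ?B\<close>, intro sum.union_disjoint) auto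
  with S have "ennreal S <= (\<Sum>q\<in>?Q. ?c q) + (\<Sum>q\<in>?B. ?c q)" by (simp only:)
  also have "... <= ennreal (\<Sum>q\<in>?Q. labels.expectation (?Y q)) + ennreal (real j * A)" using a b by (rule add_mono)
  also have "... = ennreal ((\<Sum>q\<in>?Q. labels.expectation (?Y q)) + real j * A)"
   using e0 A(2) by (intro ennreal_plus[symmetric] sum_nonneg) auto
  finally have "S <= (\<Sum>q\<in>?Q. labels.expectation (?Y q)) + real j * A"
   using e0 A(2) by (subst (asm) ennreal_le_iff) (auto intro!: add_nonneg_nonneg sum_nonneg)
  thus ?thesis by simp
 qed
 have eq: "(\<Sum>q\<in>?Q. real (card (good r q))) = (\<Sum>q\<in>?Q. ?Y q r)" for r
  using card_good by (intro sum.cong refl) auto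
 show "{r \<in> space R. (\<Sum>q\<in>?Q. real (card (good r q))) <= (1 - d) * (S - j * A) - s} \<in> sets R"
  unfolding eq using mY by measurable
 show "labels.prob {r \<in> space R. (\<Sum>q\<in>?Q. real (card (good r q))) <= (1 - d) * (S - j * A) - s} <= exp (- (d * s / A))"
  unfolding eq
  by (rule labels.chernoff_lower[OF _ indY Yb A(2) d mean]) (use Qs(1) in auto)
qed

section \<open>Edges between cells\<close>

text \<open>The mark law is given by its tail, so the moment is bounded by dyadic layers; they form
  a geometric series of ratio \<open>2 powr (2 + \<eta> - \<tau>) < 1\<close>.\<close>

lemma nn_integral_mark_moment:
 assumes "0 < \<eta>" "1 + \<eta> < \<tau> - 1"
 shows "(\<integral>\<^sup>+w. ennreal (if 1 <= w then w powr (1 + \<eta>) else 0) \<partial>\<mu>) < \<infinity>"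
proof -
 let ?a = "%k. ennreal ((2 ^ Suc k) powr (1 + \<eta>))"
 have ind: "indicator {2 ^ k..} \<in> borel_measurable \<mu>" for k :: nat
  using sets_mark by (intro borel_measurable_indicator) auto
 have "(\<integral>\<^sup>+w. ennreal (if 1 <= w then w powr (1 + \<eta>) else 0) \<partial>\<mu>) <=
  (\<integral>\<^sup>+w. (\<Sum>k. ?a k * indicator {2 ^ k..} w) \<partial>\<mu>)"
 proof (rule nn_integral_mono)
  fix w :: real
  show "ennreal (if 1 <= w then w powr (1 + \<eta>) else 0) <= (\<Sum>k. ?a k * indicator {2 ^ k..} w)"
  proof (cases "1 <= w")
   case True
   define k where "k = nat \<lfloor>log 2 w\<rfloor>"
   have l0: "0 <= log 2 w" using True by simp
   hence k: "real k <= log 2 w" "log 2 w < real (Suc k)" unfolding k_def by linarith+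
   have "2 powr real k <= w" using k(1) True by (simp add: le_log_iff)
   hence 1: "2 ^ k <= w" by (simp add: powr_realpow)
   have "w <= 2 powr real (Suc k)" using k(2) True by (simp add: log_less_iff less_imp_le)
   hence 2: "w <= 2 ^ Suc k" by (simp only: powr_realpow[of 2] zero_less_numeral)
   have "ennreal (w powr (1 + \<eta>)) <= ?a k * indicator {2 ^ k..} w"
    using 1 2 True assms(1) by (auto intro!: ennreal_leI powr_mono2)
   also have "... <= (\<Sum>k. ?a k * indicator {2 ^ k..} w)"
   proof -
    define f where "f k = ?a k * indicator {2 ^ k..} w" for k
    have "f k <= (\<Sum>k. f k)" using sum_le_suminf[OF summableI, of "{k}" f] by simp
    thus ?thesis by (simp only: f_def)
   qed
   finally show ?thesis using True by simp
  qed simp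
 qed
 also have "... = (\<Sum>k. \<integral>\<^sup>+w. ?a k * indicator {2 ^ k..} w \<partial>\<mu>)"
  using ind by (intro nn_integral_suminf borel_measurable_times_ennreal) auto
 also have "... = (\<Sum>k. ennreal (2 powr (1 + \<eta>) * (2 powr (2 + \<eta> - \<tau>)) ^ k))"
 proof (rule suminf_cong)
  fix k :: nat
  have "(\<integral>\<^sup>+w. ?a k * indicator {2 ^ k..} w \<partial>\<mu>) = ?a k * emeasure \<mu> {2 ^ k..}"
   using sets_mark by (intro nn_integral_cmult_indicator) auto
  also have "emeasure \<mu> {2 ^ k..} = ennreal ((2 ^ k) powr (- (\<tau> - 1)))"
   by (simp add: mark.emeasure_eq_measure mark_tail)
  also have "?a k * ennreal ((2 ^ k) powr (- (\<tau> - 1))) = ennreal ((2 ^ Suc k) powr (1 + \<eta>) * (2 ^ k) powr (- (\<tau> - 1)))"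
   by (rule ennreal_mult[symmetric]) auto
  also have "(2 ^ Suc k) powr (1 + \<eta>) * (2 ^ k) powr (- (\<tau> - 1)) = 2 powr (1 + \<eta>) * (2 powr (2 + \<eta> - \<tau>)) ^ k"
  proof -
   have "(2 ^ k :: real) = 2 powr real k" "(2 ^ Suc k :: real) = 2 powr real (Suc k)"
    by (simp_all only: powr_realpow[of 2] zero_less_numeral)
   thus ?thesis
    by (simp only: powr_powr powr_add[symmetric] powr_realpow[symmetric] powr_gt_zero zero_less_numeral)
     (simp add: algebra_simps powr_powr powr_add[symmetric] powr_realpow[symmetric])
  qed
  finally show "(\<integral>\<^sup>+w. ?a k * indicator {2 ^ k..} w \<partial>\<mu>) = ennreal (2 powr (1 + \<eta>) * (2 powr (2 + \<eta> - \<tau>)) ^ k)" .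
 qed
 also have "... = ennreal (\<Sum>k. 2 powr (1 + \<eta>) * (2 powr (2 + \<eta> - \<tau>)) ^ k)"
 proof (rule suminf_ennreal2)
  have "2 powr (2 + \<eta> - \<tau>) < (1 :: real)" using assms(2) by (subst powr_less_one) auto
  thus "summable (%k. 2 powr (1 + \<eta>) * (2 powr (2 + \<eta> - \<tau>)) ^ k)"
   by (intro summable_mult summable_geometric) simp
 qed simp
 also have "... < \<infinity>" by simp
 finally show ?thesis .
qed

lemma indep_pair_labels: "PU.P.indep_vars (%_. unit_uniform) (%e u. u e) vertex_pairs"
proof (subst PU.P.indep_vars_iff_distr_eq_PiM')
 have "card {Root, Point 0} = 2" by simp
 thus "vertex_pairs ~= {}" by blast
 show "distr PU (PiM vertex_pairs (%_. unit_uniform)) (%u. \<lambda>e\<in>vertex_pairs. u e) =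
  PiM vertex_pairs (%e. distr PU unit_uniform (%u. u e))"
 proof -
  have "distr PU PU (%u. \<lambda>e\<in>vertex_pairs. u e) = distr PU PU (%u. u)"
   by (intro distr_cong refl) (auto simp: space_PiM PiE_def extensional_def)
  moreover have "PiM vertex_pairs (%e. distr PU unit_uniform (%u. u e)) = PU"
   by (intro PiM_cong refl PU.PiM_component)
  ultimately show ?thesis by simp
 qed
qed (rule measurable_component_singleton)

text \<open>\<open>T\<close> holds the endpoints of crossing edges between vertices of mark at most
  \<open>t\<close>. If one mark is below \<open>m'\<close>, the decay bounds the chance of the edge
  by a power of the other mark. Three Chernoff bounds control the vertices of mark at least
  \<open>m'\<close>, the weighted sum of the truncated powers, and the edges given the marks;
  \<open>b\<close> combines them.\<close>

lemma prob_many_cross: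
 fixes I :: "nat set" and x :: "nat => real ^ 'd" and crs :: "nat => nat => bool"
  and C K1 Gm SG s t m' \<eta> b :: real
 assumes I: "finite I" "inj_on x I" and crs: "!!i l. crs i l \<longleftrightarrow> crs l i" "!!i. \<not> crs i i"
  and m': "1 <= m'" and t: "1 <= t" and C: "0 <= C" and s: "0 <= s"
  and decay: "!!y w y' w'. y ~= y' ==> 1 <= w ==> w <= m' ==> 1 <= w' ==>
    c y w y' w' <= C * w' powr (1 + \<eta>) * max 1 (dist y y') powr (- (real CARD('d) * (1 + \<eta>)))"
  and \<eta>: "0 < \<eta>"
  and K1: "(\<integral>\<^sup>+w. ennreal (if 1 <= w then w powr (1 + \<eta>) else 0) \<partial>\<mu>) <= ennreal K1" "0 <= K1"
  and Gm: "!!i. i \<in> I ==> (\<Sum>l\<in>{l \<in> I. crs i l}. max 1 (dist (x i) (x l)) powr (- (real CARD('d) * (1 + \<eta>)))) <= Gm" "0 < Gm"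
  and SG: "(\<Sum>i\<in>I. \<Sum>l\<in>{l \<in> I. crs i l}. max 1 (dist (x i) (x l)) powr (- (real CARD('d) * (1 + \<eta>)))) <= SG"
 defines "T r \<equiv> {i \<in> I. fst r (Point i) <= t & (\<exists>l\<in>I. crs i l & fst r (Point l) <= t &
   (Point i, Point l) \<in> label_edges c (vpos x) (fst r) (snd r) (Point ` I))}"
 defines "b \<equiv> 2 * (card I * m' powr (- (\<tau> - 1))) + s + 2 * (2 * (C * (2 * (K1 * SG) + s)) + s)"
 shows "{r \<in> space R. b <= card (T r)} \<in> sets R"
  and "labels.prob {r \<in> space R. b <= card (T r)} <= 2 * exp (- s) + exp (- (s / (t powr (1 + \<eta>) * Gm)))"
proof -
 let ?\<psi> = "%i l. max 1 (dist (x i) (x l)) powr (- (real CARD('d) * (1 + \<eta>)))"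
 let ?G = "%i. \<Sum>l\<in>{l \<in> I. crs i l}. ?\<psi> i l"
 define V where "V w i = (if 1 <= w (Point i) & w (Point i) <= t then w (Point i) powr (1 + \<eta>) else 0)" for w :: "vertex => real" and i
 have \<psi>0: "0 <= ?\<psi> i l" for i l by simp
 have \<psi>sym: "?\<psi> i l = ?\<psi> l i" for i l by (simp add: dist_commute)
 have G0: "0 <= ?G i" for i by (intro sum_nonneg \<psi>0)
 have V0: "0 <= V w i" for w i by (simp add: V_def)
 have Vt: "V w i <= t powr (1 + \<eta>)" for w i using \<eta> by (auto simp: V_def intro!: powr_mono2)
 have mV: "(%r. V (fst r) i) \<in> borel_measurable R" for i unfolding V_def by measurable
 \<comment> \<open>Ordered by \<open>i < l\<close>, so that each label occurs once, as independence
   requires.\<close>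
 define Pr where "Pr = {(i, l). i \<in> I & l \<in> I & i < l & crs i l}"
 have finPr: "finite Pr" unfolding Pr_def by (rule finite_subset[of _ "I \<times> I"]) (use I(1) in auto)
 \<comment> \<open>Symmetrised, because either endpoint may be the one with the small mark.\<close>
 define g where "g w e = C * (V w (fst e) + V w (snd e)) * ?\<psi> (fst e) (snd e)" for w and e :: "nat \<times> nat"
 have g0: "0 <= g w e" for w e unfolding g_def using C V0 \<psi>0 by (intro mult_nonneg_nonneg add_nonneg_nonneg) auto
 define D where "D e w u = (if u {Point (fst e), Point (snd e)} <= g w e then 1 else (0::real))" for e w and u :: "vertex set => real"
 have pairD: "{Point (fst e), Point (snd e)} \<in> vertex_pairs" if "e \<in> Pr" for e
  using that by (auto simp: Pr_def)
 have mD: "(%r. D e (fst r) (snd r)) \<in> borel_measurable R" if "e \<in> Pr" for e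
 proof -
  have [measurable]: "(%r. snd r {Point (fst e), Point (snd e)}) \<in> borel_measurable R"
   by (rule measurable_pair_label[OF pairD[OF that]])
  have [measurable]: "(%r. g (fst r) e) \<in> borel_measurable R" unfolding g_def using mV by measurable
  show ?thesis unfolding D_def by measurable
 qed
 let ?Z = "%w. \<Sum>i\<in>I. V w i * ?G i"
 have sumg: "(\<Sum>e\<in>Pr. g w e) = C * ?Z w" for w
 proof -
  have "?Z w = (\<Sum>(i, l)\<in>{(i, l). i \<in> I & l \<in> I & crs i l}. V w i * ?\<psi> i l)"
  proof -
   have "?Z w = (\<Sum>i\<in>I. \<Sum>l\<in>{l \<in> I. crs i l}. V w i * ?\<psi> i l)" by (simp add: sum_distrib_left)
   also have "... = (\<Sum>(i, l)\<in>(SIGMA i:I. {l \<in> I. crs i l}). V w i * ?\<psi> i l)"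
    using I(1) by (intro sum.Sigma) auto
   also have "(SIGMA i:I. {l \<in> I. crs i l}) = {(i, l). i \<in> I & l \<in> I & crs i l}" by auto
   finally show ?thesis .
  qed
  also have "{(i, l). i \<in> I & l \<in> I & crs i l} = Pr \<union> prod.swap ` Pr"
  proof -
   have "i = l \<or> i < l \<or> l < i" for i l :: nat by auto
   thus ?thesis unfolding Pr_def using crs by (auto simp: image_iff) (metis crs(2) nat_neq_iff)+
  qed
  also have "(\<Sum>(i, l)\<in>Pr \<union> prod.swap ` Pr. V w i * ?\<psi> i l) =
   (\<Sum>(i, l)\<in>Pr. V w i * ?\<psi> i l) + (\<Sum>(i, l)\<in>prod.swap ` Pr. V w i * ?\<psi> i l)"
   using finPr by (intro sum.union_disjoint) (auto simp: Pr_def)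
  also have "(\<Sum>(i, l)\<in>prod.swap ` Pr. V w i * ?\<psi> i l) = (\<Sum>(i, l)\<in>Pr. V w l * ?\<psi> l i)"
   by (subst sum.reindex) (auto simp: inj_on_def split_beta' intro!: sum.cong)
  finally have "?Z w = (\<Sum>(i, l)\<in>Pr. V w i * ?\<psi> i l) + (\<Sum>(i, l)\<in>Pr. V w l * ?\<psi> l i)" .
  also have "... = (\<Sum>(i, l)\<in>Pr. (V w i + V w l) * ?\<psi> i l)"
   unfolding sum.distrib[symmetric] by (intro sum.cong refl) (simp add: split_beta' distrib_right \<psi>sym)
  finally show ?thesis unfolding g_def by (simp add: sum_distrib_left split_beta' mult.assoc)
 qed
 \<comment> \<open>An element of \<open>T\<close> has a mark of at least \<open>m'\<close> or is one
   of the two endpoints of a pair whose label is below \<open>g\<close>.\<close>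
 have T_le: "real (card (T r)) <= real (card {i \<in> I. m' <= fst r (Point i)}) + 2 * (\<Sum>e\<in>Pr. D e (fst r) (snd r))"
  if w: "\<forall>v. 1 <= fst r v" for r
 proof -
  let ?E = "{e \<in> Pr. D e (fst r) (snd r) = 1}"
  have "T r \<subseteq> {i \<in> I. m' <= fst r (Point i)} \<union> fst ` ?E \<union> snd ` ?E"
  proof
   fix i assume i: "i \<in> T r"
   then obtain l where l: "i \<in> I" "l \<in> I" "crs i l" "fst r (Point i) <= t" "fst r (Point l) <= t"
    "(Point i, Point l) \<in> label_edges c (vpos x) (fst r) (snd r) (Point ` I)" by (auto simp: T_def)
   show "i \<in> {i \<in> I. m' <= fst r (Point i)} \<union> fst ` ?E \<union> snd ` ?E"
   proof (cases "m' <= fst r (Point i)")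
    case False
    have il: "i ~= l" using l(3) crs(2) by auto
    hence "x i ~= x l" using I(2) l(1,2) by (auto dest: inj_onD)
    hence "c (x i) (fst r (Point i)) (x l) (fst r (Point l)) <= C * fst r (Point l) powr (1 + \<eta>) * ?\<psi> i l"
     using w False by (intro decay) auto
    moreover have "snd r {Point i, Point l} <= c (x i) (fst r (Point i)) (x l) (fst r (Point l))"
     using l(6) by (auto simp: label_edges_def)
    moreover have "fst r (Point l) powr (1 + \<eta>) = V (fst r) l" using w l(5) by (simp add: V_def)
    moreover have "C * V (fst r) l * ?\<psi> i l <= C * (V (fst r) i + V (fst r) l) * ?\<psi> i l"
     using C V0[of "fst r" i] \<psi>0[of i l] by (intro mult_right_mono mult_left_mono) auto
    ultimately have u: "snd r {Point i, Point l} <= C * (V (fst r) i + V (fst r) l) * ?\<psi> i l" by simp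
    show ?thesis
    proof (cases "i < l")
     case True
     hence "(i, l) \<in> ?E" using l u by (auto simp: Pr_def D_def g_def)
     thus ?thesis by force
    next
     case False
     hence "l < i" using il by simp
     moreover have "snd r {Point l, Point i} <= C * (V (fst r) l + V (fst r) i) * ?\<psi> l i"
      using u by (simp only: insert_commute[of "Point l"] add.commute[of "V (fst r) l"] \<psi>sym[of l])
     ultimately have "(l, i) \<in> ?E" using l crs(1) by (auto simp: Pr_def D_def g_def)
     thus ?thesis by force
    qed
   qed (use l in auto)
  qed
  hence "card (T r) <= card ({i \<in> I. m' <= fst r (Point i)} \<union> fst ` ?E \<union> snd ` ?E)"
   using I(1) finPr by (intro card_mono) auto
  also have "... <= card {i \<in> I. m' <= fst r (Point i)} + card (fst ` ?E) + card (snd ` ?E)"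
   by (meson add_le_mono card_Un_le le_refl order_trans)
  also have "... <= card {i \<in> I. m' <= fst r (Point i)} + card ?E + card ?E"
   using finPr by (intro add_mono card_image_le) auto
  finally have 1: "card (T r) <= card {i \<in> I. m' <= fst r (Point i)} + card ?E + card ?E" .
  have "(\<Sum>e\<in>Pr. D e (fst r) (snd r)) = (\<Sum>e\<in>Pr. if D e (fst r) (snd r) = 1 then 1 else 0)"
   by (intro sum.cong refl) (auto simp: D_def)
  also have "... = real (card ?E)" using finPr by (simp add: sum.If_cases Int_def)
  finally show ?thesis using 1 by linarith
 qed
 have indW: "labels.indep_vars (%_. borel) (%i r. f (fst r (Point i))) I" if "f \<in> borel_measurable borel" for f :: "real => real"
 proof -
  have "labels.indep_vars (%j. PiM {Inl (Point j)} (%_. borel)) (%j. labels_on {Inl (Point j)}) I"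
   by (rule indep_labels_on) (auto simp: disjoint_family_on_def)
  hence "labels.indep_vars (%_. borel) (%i r. f (labels_on {Inl (Point i)} r (Inl (Point i)))) I"
   by (rule labels.indep_vars_compose2) (use that in measurable)
  thus ?thesis by (simp add: labels_on_def)
 qed
 have A1: "labels.prob {r \<in> space R. (1 + 1) * (card I * m' powr (- (\<tau> - 1))) + s <= (\<Sum>i\<in>I. if m' <= fst r (Point i) then 1 else 0)} <= exp (- (1 * s / 1))"
 proof (rule labels.chernoff_upper[OF I(1)])
  show "labels.indep_vars (%_. borel) (%i r. if m' <= fst r (Point i) then 1 else (0::real)) I"
   using indW[of "%w. if m' <= w then 1 else 0"] by simp
  have "labels.expectation (%r. if m' <= fst r (Point i) then 1 else (0::real)) = m' powr (- (\<tau> - 1))" for i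
  proof -
   have "labels.expectation (%r. if m' <= fst r (Point i) then 1 else (0::real)) = labels.expectation (indicator {r \<in> space R. m' <= fst r (Point i)})"
    by (intro Bochner_Integration.integral_cong) (auto simp: indicator_def)
   also have "... = labels.prob {r \<in> space R. m' <= fst r (Point i)}" by simp
   also have "... = m' powr (- (\<tau> - 1))" using prob_marks_ge[of "{Point i}" m'] m' by simp
   finally show ?thesis .
  qed
  thus "(\<Sum>i\<in>I. labels.expectation (%r. if m' <= fst r (Point i) then 1 else (0::real))) <= card I * m' powr (- (\<tau> - 1))" by simp
 qed auto
 have A2: "labels.prob {r \<in> space R. (1 + 1) * (K1 * SG) + s <= ?Z (fst r)} <= exp (- (1 * s / (t powr (1 + \<eta>) * Gm)))"
 proof (rule labels.chernoff_upper[OF I(1)])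
  show "labels.indep_vars (%_. borel) (%i r. V (fst r) i * ?G i) I"
  proof -
   have "labels.indep_vars (%_. borel) (%i r. (%w. if 1 <= w & w <= t then w powr (1 + \<eta>) else 0) (fst r (Point i))) I"
    by (rule indW) measurable
   hence "labels.indep_vars (%_. borel) (%i r. V (fst r) i) I" by (simp add: V_def)
   thus ?thesis by (rule labels.indep_vars_compose2) measurable
  qed
  show "0 <= V (fst r) i * ?G i & V (fst r) i * ?G i <= t powr (1 + \<eta>) * Gm" if "i \<in> I" for i r
   using V0 G0 Vt Gm(1)[OF that] by (intro conjI mult_nonneg_nonneg mult_mono) auto
  have EV: "labels.expectation (%r. V (fst r) i) <= K1" for i
  proof -
   have iV: "integrable R (%r. V (fst r) i)"
    using mV V0 Vt by (intro labels.integrable_const_bound[of _ "t powr (1 + \<eta>)"]) auto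
   have "ennreal (labels.expectation (%r. V (fst r) i)) = (\<integral>\<^sup>+r. ennreal (V (fst r) i) \<partial>R)"
    using nn_integral_eq_integral[OF iV] V0 by simp
   also have "... <= (\<integral>\<^sup>+r. ennreal (if 1 <= fst r (Point i) then fst r (Point i) powr (1 + \<eta>) else 0) \<partial>R)"
    by (intro nn_integral_mono ennreal_leI) (auto simp: V_def)
   also have "... = (\<integral>\<^sup>+w. ennreal (if 1 <= w then w powr (1 + \<eta>) else 0) \<partial>distr R borel (%r. fst r (Point i)))"
    by (subst nn_integral_distr) auto
   also have "distr R borel (%r. fst r (Point i)) = \<mu>"
   proof (rule measure_eqI)
    fix B assume "B \<in> sets (distr R borel (%r. fst r (Point i)))"
    hence B: "B \<in> sets borel" by simp
    have "emeasure (distr R borel (%r. fst r (Point i))) B = emeasure R {r \<in> space R. fst r (Point i) \<in> B}"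
     using B by (subst emeasure_distr) (auto simp: vimage_def Int_def conj_commute)
    also have "... = emeasure \<mu> B"
     using prob_labels[of "{Point i}" "{}" "%_. B" "%_. UNIV"] B
     by (simp add: labels.emeasure_eq_measure mark.emeasure_eq_measure)
    finally show "emeasure (distr R borel (%r. fst r (Point i))) B = emeasure \<mu> B" .
   qed (simp add: sets_mark)
   also note K1(1)
   finally show ?thesis using K1(2) by (simp add: ennreal_le_iff)
  qed
  have "(\<Sum>i\<in>I. labels.expectation (%r. V (fst r) i * ?G i)) = (\<Sum>i\<in>I. labels.expectation (%r. V (fst r) i) * ?G i)"
   by simp
  also have "... <= (\<Sum>i\<in>I. K1 * ?G i)" using EV G0 by (intro sum_mono mult_right_mono) auto
  also have "... = K1 * (\<Sum>i\<in>I. ?G i)" by (simp add: sum_distrib_left)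
  also have "... <= K1 * SG" using SG K1(2) by (rule mult_left_mono)
  finally show "(\<Sum>i\<in>I. labels.expectation (%r. V (fst r) i * ?G i)) <= K1 * SG" .
 qed (use t Gm in auto)
 let ?S3 = "{r \<in> space R. (1 + 1) * (C * ?Z (fst r)) + s <= (\<Sum>e\<in>Pr. D e (fst r) (snd r))}"
 have mZ: "(%r. ?Z (fst r)) \<in> borel_measurable R" using mV by measurable
 have mS: "(%r. \<Sum>e\<in>Pr. D e (fst r) (snd r)) \<in> borel_measurable R" using mD by measurable
 have S3: "?S3 \<in> sets R" using mZ mS by measurable
 have A3: "labels.prob ?S3 <= exp (- s)"
 proof -
  \<comment> \<open>Sum and threshold both depend on the marks. For fixed marks the labels are
    independent and the bound does not depend on the marks, so integrating over the marks keeps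
    it.\<close>
  have sec: "emeasure PU (Pair w -` ?S3) <= ennreal (exp (- s))" for w
  proof -
   have comp: "(%u. u {Point (fst e), Point (snd e)}) \<in> borel_measurable PU" if "e \<in> Pr" for e
    using measurable_component_singleton[OF pairD[OF that], of "%_. unit_uniform"] by (simp cong: measurable_cong_sets)
   have indU: "PU.P.indep_vars (%_. borel) (%e u. D e w u) Pr"
   proof -
    let ?e = "%e. {Point (fst e), Point (snd e)}"
    have "PU.P.indep_vars (%_. unit_uniform) (%e u. u e) vertex_pairs"
     by (rule indep_pair_labels)
    hence "PU.P.indep_vars (%e. PiM {?e e} (%_. unit_uniform)) (%e u. restrict (%i. u i) {?e e}) Pr"
    proof (rule PU.P.indep_vars_restrict)
     show "{?e e} \<subseteq> vertex_pairs" if "e \<in> Pr" for e using pairD[OF that] by simp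
     show "disjoint_family_on (%e. {?e e}) Pr"
      by (auto simp: disjoint_family_on_def Pr_def doubleton_eq_iff)
    qed
    hence "PU.P.indep_vars (%_. borel) (%e u. if restrict (%i. u i) {?e e} (?e e) <= g w e then 1 else (0::real)) Pr"
    proof (rule PU.P.indep_vars_compose2[where Y="%e z. if z (?e e) <= g w e then 1 else (0::real)"])
     fix e
     have "(%z. z (?e e)) \<in> measurable (PiM {?e e} (%_. unit_uniform)) unit_uniform" by measurable
     hence [measurable]: "(%z. z (?e e)) \<in> borel_measurable (PiM {?e e} (%_. unit_uniform))"
      by (simp cong: measurable_cong_sets)
     show "(%z. if z (?e e) <= g w e then 1 else (0::real)) \<in> borel_measurable (PiM {?e e} (%_. unit_uniform))"
      by measurable
    qed
    thus ?thesis by (simp add: D_def[abs_def])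
   qed
   have "PU.P.prob {u \<in> space PU. (1 + 1) * (C * ?Z w) + s <= (\<Sum>e\<in>Pr. D e w u)} <= exp (- (1 * s / 1))"
   proof (rule PU.P.chernoff_upper[OF finPr indU])
    have "PU.P.expectation (%u. D e w u) <= g w e" if e: "e \<in> Pr" for e
    proof -
     let ?S = "{u \<in> space PU. u {Point (fst e), Point (snd e)} \<in> {..g w e}}"
     have "PU.P.expectation (%u. D e w u) = PU.P.expectation (indicator ?S)"
      by (intro Bochner_Integration.integral_cong) (auto simp: D_def indicator_def)
     also have "... = PU.P.prob ?S" by (simp add: Int_absorb2 Collect_restrict)
     also have "... = measure unit_uniform {..g w e}"
      using PU.emeasure_PiM_Collect_single[OF pairD[OF e], of "{..g w e}"] by (simp add: measure_def)
     also have "... <= g w e"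
     proof (cases "g w e <= 1")
      case True
      show ?thesis using measure_unit_uniform_atMost[OF g0 True] by simp
     next
      case False
      thus ?thesis using prob_space.prob_le_1[OF prob_space_unit_uniform, of "{..g w e}"] by linarith
     qed
     finally show ?thesis .
    qed
    hence "(\<Sum>e\<in>Pr. PU.P.expectation (%u. D e w u)) <= (\<Sum>e\<in>Pr. g w e)" by (rule sum_mono)
    thus "(\<Sum>e\<in>Pr. PU.P.expectation (%u. D e w u)) <= C * ?Z w" unfolding sumg .
   qed (auto simp: D_def)
   moreover have "Pair w -` ?S3 = {u \<in> space PU. (1 + 1) * (C * ?Z w) + s <= (\<Sum>e\<in>Pr. D e w u)}"
    by (auto simp: space_R space_PiM)
   ultimately show ?thesis by (simp add: PU.P.emeasure_eq_measure ennreal_leI)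
  qed
  have "emeasure R ?S3 = (\<integral>\<^sup>+w. emeasure PU (Pair w -` ?S3) \<partial>PW)"
   using PU.P.emeasure_pair_measure_alt[OF S3[unfolded label_space_def[of \<mu>]]] by (simp only: label_space_def)
  also have "... <= (\<integral>\<^sup>+w. ennreal (exp (- s)) \<partial>PW)" by (intro nn_integral_mono sec)
  also have "... = ennreal (exp (- s))" by (simp add: PW.emeasure_space_1)
  finally show ?thesis by (simp add: labels.emeasure_eq_measure)
 qed
 let ?S1 = "{r \<in> space R. (1 + 1) * (card I * m' powr (- (\<tau> - 1))) + s <= (\<Sum>i\<in>I. if m' <= fst r (Point i) then 1 else 0)}"
 let ?S2 = "{r \<in> space R. (1 + 1) * (K1 * SG) + s <= ?Z (fst r)}"
 have S12: "?S1 \<in> sets R" "?S2 \<in> sets R"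
 proof -
  show "?S2 \<in> sets R" by (rule borel_measurable_le[OF borel_measurable_const mZ])
  have "(%r. \<Sum>i\<in>I. if m' <= fst r (Point i) then 1 else (0::real)) \<in> borel_measurable R"
   by (intro borel_measurable_sum measurable_If borel_measurable_const borel_measurable_le measurable_mark)
  thus "?S1 \<in> sets R" by (rule borel_measurable_le[OF borel_measurable_const])
 qed
 show mT: "{r \<in> space R. b <= card (T r)} \<in> sets R"
 proof -
  have "Measurable.pred R (%r. i \<in> T r)" for i
  proof -
   have [measurable]: "Measurable.pred R (%r. e \<in> label_edges c (vpos x) (fst r) (snd r) (Point ` I))" for e
    using measurable_label_edges[OF conn_measurable, of "%_. vpos x" R fst snd "%_. Point ` I" "fst e" "snd e"]
     measurable_pair_label by simp
   show ?thesis unfolding T_def mem_Collect_eq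
    using I(1) by (intro pred_intros_logic pred_intros_finite) measurable
  qed
  hence [measurable]: "(%r. card (T r)) \<in> measurable R (count_space UNIV)" by (rule measurable_card_countable(2))
  show ?thesis by measurable
 qed
 have "labels.prob {r \<in> space R. b <= card (T r)} <= labels.prob (?S1 \<union> ?S2 \<union> ?S3)"
 proof (rule labels.finite_measure_mono_AE)
  show "AE r in R. r \<in> {r \<in> space R. b <= card (T r)} --> r \<in> ?S1 \<union> ?S2 \<union> ?S3"
   using AE_mark_ge_1
  proof eventually_elim
   case (elim r)
   show ?case
   proof (rule impI, rule ccontr)
    assume r: "r \<in> {r \<in> space R. b <= card (T r)}" and n: "r \<notin> ?S1 \<union> ?S2 \<union> ?S3"
    have "(\<Sum>i\<in>I. if m' <= fst r (Point i) then 1 else (0::real)) = real (card {i \<in> I. m' <= fst r (Point i)})"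
     using I(1) by (simp add: sum.If_cases Int_def)
    hence 1: "real (card {i \<in> I. m' <= fst r (Point i)}) < 2 * (card I * m' powr (- (\<tau> - 1))) + s"
     using n r by (auto simp: not_le)
    have 2: "?Z (fst r) < 2 * (K1 * SG) + s" and 3: "(\<Sum>e\<in>Pr. D e (fst r) (snd r)) < 2 * (C * ?Z (fst r)) + s"
     using n r by (auto simp: not_le)
    have "C * ?Z (fst r) <= C * (2 * (K1 * SG) + s)" using 2 C by (intro mult_left_mono) auto
    thus False using T_le[OF elim] r 1 3 unfolding b_def by simp
   qed
  qed
  show "?S1 \<union> ?S2 \<union> ?S3 \<in> sets R" using S12 S3 by (intro sets.Un)
 qed
 also have "... <= labels.prob ?S1 + labels.prob ?S2 + labels.prob ?S3"
  by (intro order_trans[OF measure_Un_le] add_mono measure_Un_le order_refl sets.Un S12 S3)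
 finally show "labels.prob {r \<in> space R. b <= card (T r)} <= 2 * exp (- s) + exp (- (s / (t powr (1 + \<eta>) * Gm)))"
  using add_mono[OF add_mono[OF A1 A2] A3] by simp
qed

end

section \<open>Sums over pairs of cells\<close>

text \<open>The decay along one axis, for rounded coordinates: the 1 subtracted absorbs the
  rounding, since coordinates differ by at least the difference of their floors less 1.\<close>

definition spread :: "real => int => real" where
 "spread \<eta> k = max 1 (\<bar>real_of_int k\<bar> - 1) powr (- (1 + \<eta>))"

lemma spread_nonneg[simp]: "0 <= spread \<eta> k"
 by (simp add: spread_def)

text \<open>Nonnegative and negative integers are summed apart; on each part the absolute value is
  injective.\<close>

lemma sum_abs_int_le:
 fixes f :: "nat => real"
 assumes f: "summable f" "!!m. 0 <= f m" and F: "finite F" "!!k. k \<in> F ==> int R <= \<bar>k\<bar>"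
 shows "(\<Sum>k\<in>F. f (nat \<bar>k\<bar>)) <= 2 * (\<Sum>m. f (m + R))"
proof -
 have sm: "summable (%m. f (m + R))" using f(1) by (subst summable_iff_shift)
 have part: "(\<Sum>k\<in>F'. f (nat \<bar>k\<bar>)) <= (\<Sum>m. f (m + R))" if F': "F' \<subseteq> F" "inj_on abs F'" for F'
 proof -
  have fin: "finite F'" using F' F(1) by (meson finite_subset)
  have "inj_on (%k. nat \<bar>k\<bar> - R) F'"
  proof (rule inj_onI)
   fix k l assume kl: "k \<in> F'" "l \<in> F'" "nat \<bar>k\<bar> - R = nat \<bar>l\<bar> - R"
   have "int R <= \<bar>k\<bar>" "int R <= \<bar>l\<bar>" using F(2) F'(1) kl by auto
   hence "\<bar>k\<bar> = \<bar>l\<bar>" using kl(3) by linarith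
   thus "k = l" by (rule inj_onD[OF F'(2) _ kl(1,2)])
  qed
  moreover have "nat \<bar>k\<bar> - R + R = nat \<bar>k\<bar>" if "k \<in> F'" for k
   using F(2)[of k] F'(1) that by auto
  ultimately have "(\<Sum>k\<in>F'. f (nat \<bar>k\<bar>)) = (\<Sum>m\<in>(%k. nat \<bar>k\<bar> - R) ` F'. f (m + R))"
   by (simp only: sum.reindex comp_def cong: sum.cong)
  also have "... <= (\<Sum>m. f (m + R))" using fin f(2) by (intro sum_le_suminf[OF sm]) auto
  finally show ?thesis .
 qed
 have "(\<Sum>k\<in>F. f (nat \<bar>k\<bar>)) = (\<Sum>k\<in>F \<inter> {0..}. f (nat \<bar>k\<bar>)) + (\<Sum>k\<in>F \<inter> - {0..}. f (nat \<bar>k\<bar>))"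
  by (rule sum.Int_Diff[OF F(1), unfolded Diff_eq])
 also have "... <= (\<Sum>m. f (m + R)) + (\<Sum>m. f (m + R))"
  by (intro add_mono part) (auto simp: inj_on_def)
 finally show ?thesis by simp
qed

lemma spread_summable:
 assumes "0 < \<eta>"
 shows "summable (%m. max 1 (real m - 1) powr (- (1 + \<eta>)))"
proof -
 have "summable (%m. real m powr (- (1 + \<eta>)))" using assms by (subst summable_real_powr_iff) auto
 hence "summable (%m. real (m + 1) powr (- (1 + \<eta>)))" by (subst summable_iff_shift)
 hence "summable (%m. max 1 (real (m + 2) - 1) powr (- (1 + \<eta>)))" by (simp add: max_def add.commute)
 thus ?thesis by (subst (asm) summable_iff_shift)
qed

lemma spread_eq: "spread \<eta> k = max 1 (real (nat \<bar>k\<bar>) - 1) powr (- (1 + \<eta>))"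
 by (simp add: spread_def)

lemma spread_sum:
 assumes "0 < \<eta>"
 obtains \<Psi> where "1 <= \<Psi>" "!!F. finite F ==> (\<Sum>k\<in>F. spread \<eta> k) <= \<Psi>"
proof
 let ?f = "%m. max 1 (real m - 1) powr (- (1 + \<eta>))"
 show "(\<Sum>k\<in>F. spread \<eta> k) <= max 1 (2 * (\<Sum>m. ?f (m + 0)))" if "finite F" for F
  using sum_abs_int_le[of ?f F 0, OF spread_summable[OF assms] _ that] by (simp add: spread_eq)
qed simp

lemma spread_tail:
 assumes "0 < \<eta>" "0 < e"
 obtains R where "!!F. finite F ==> (!!k. k \<in> F ==> int R <= \<bar>k\<bar>) ==> (\<Sum>k\<in>F. spread \<eta> k) <= e"
proof -
 let ?f = "%m. max 1 (real m - 1) powr (- (1 + \<eta>))"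
 obtain R where "norm (\<Sum>m. ?f (m + R)) < e / 2"
  using suminf_exist_split[of "e / 2" ?f] assms spread_summable[OF assms(1)] by auto
 hence R: "2 * (\<Sum>m. ?f (m + R)) <= e" by (simp add: abs_le_iff abs_less_iff)
 show ?thesis
 proof
  fix F :: "int set" assume F: "finite F" "!!k. k \<in> F ==> int R <= \<bar>k\<bar>"
  show "(\<Sum>k\<in>F. spread \<eta> k) <= e"
   using sum_abs_int_le[of ?f F R, OF spread_summable[OF assms(1)] _ F] R by (simp add: spread_eq)
 qed
qed

text \<open>The exponent is shared out equally among the axes, and the distance is at least each
  coordinate difference. The bound is a product over the axes, so that sums over cells
  factorise.\<close>

lemma decay_le_spread:
 fixes x y :: "real ^ 'd"
 assumes "0 < \<eta>"
 shows "max 1 (dist x y) powr (- (real CARD('d) * (1 + \<eta>))) <= (\<Prod>i\<in>UNIV. spread \<eta> (\<lfloor>x $ i\<rfloor> - \<lfloor>y $ i\<rfloor>))"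
proof -
 let ?m = "max 1 (dist x y)"
 have "?m powr (- (real CARD('d) * (1 + \<eta>))) = (\<Prod>i\<in>(UNIV :: 'd set). ?m powr (- (1 + \<eta>)))"
 proof -
  have "(?m powr (- (1 + \<eta>))) ^ CARD('d) = ?m powr (- (1 + \<eta>) * real CARD('d))"
   by (subst powr_powr[symmetric]) (simp add: powr_realpow')
  moreover have "- (1 + \<eta>) * real CARD('d) = - (real CARD('d) * (1 + \<eta>))" by (simp add: algebra_simps)
  ultimately show ?thesis by simp
 qed
 also have "... <= (\<Prod>i\<in>UNIV. spread \<eta> (\<lfloor>x $ i\<rfloor> - \<lfloor>y $ i\<rfloor>))"
 proof (intro prod_mono conjI)
  fix i :: 'd
  have "\<bar>x $ i - y $ i\<bar> <= dist x y" using component_le_norm_cart[of "x - y" i] by (simp add: dist_norm)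
  hence "max 1 (\<bar>real_of_int (\<lfloor>x $ i\<rfloor> - \<lfloor>y $ i\<rfloor>)\<bar> - 1) <= ?m" by linarith
  thus "?m powr (- (1 + \<eta>)) <= spread \<eta> (\<lfloor>x $ i\<rfloor> - \<lfloor>y $ i\<rfloor>)"
   unfolding spread_def using assms by (intro powr_mono2') auto
 qed simp
 finally show ?thesis .
qed

text \<open>Integer vectors address unit cubes; division by \<open>L\<close> gives the large cube
  that contains them.\<close>

definition separated :: "nat => ('d => int) => ('d => int) => bool" where
 "separated L a b \<longleftrightarrow> (\<exists>i. a i div int L ~= b i div int L)"

definition cross_weight :: "real => nat => int set => ('d::finite => int) => real" where
 "cross_weight \<eta> L H a = (\<Sum>b\<in>{b \<in> UNIV \<rightarrow>\<^sub>E H. separated L a b}. \<Prod>i\<in>UNIV. spread \<eta> (a i - b i))"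

lemma cross_weight_nonneg: "0 <= cross_weight \<eta> L H a"
 unfolding cross_weight_def by (intro sum_nonneg prod_nonneg) auto

lemma sum_spread_diff:
 assumes "!!F. finite F ==> (\<Sum>k\<in>F. spread \<eta> k) <= \<Psi>" "finite H"
 shows "(\<Sum>v\<in>H. spread \<eta> (u - v)) <= \<Psi>"
proof -
 have "(\<Sum>v\<in>H. spread \<eta> (u - v)) = (\<Sum>k\<in>(%v. u - v) ` H. spread \<eta> k)"
  by (subst sum.reindex) (auto simp: inj_on_def)
 thus ?thesis using assms by simp
qed

lemma sum_prod_spread:
 fixes a :: "'d::finite => int"
 assumes "!!F. finite F ==> (\<Sum>k\<in>F. spread \<eta> k) <= \<Psi>" "finite H"
 shows "(\<Sum>b\<in>UNIV \<rightarrow>\<^sub>E H. \<Prod>i\<in>UNIV. spread \<eta> (a i - b i)) <= \<Psi> ^ CARD('d)"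
proof -
 have "(\<Sum>b\<in>UNIV \<rightarrow>\<^sub>E H. \<Prod>i\<in>UNIV. spread \<eta> (a i - b i)) = (\<Prod>i\<in>UNIV. \<Sum>v\<in>H. spread \<eta> (a i - v))"
  using assms(2) by (subst prod_sum_PiE) auto
 also have "... <= (\<Prod>i\<in>(UNIV :: 'd set). \<Psi>)"
  using sum_spread_diff[OF assms] by (intro prod_mono conjI sum_nonneg) auto
 finally show ?thesis by simp
qed

text \<open>Separated cells lie in different blocks along some axis. A union bound over this axis
  leaves products of one-dimensional sums: the separated sum along that axis, at most
  \<open>e * card H\<close>, and at most \<open>card H * \<Psi>\<close> along every other.\<close>

lemma sum_cross_weight:
 fixes e \<Psi> :: real
 assumes \<Psi>: "!!F. finite F ==> (\<Sum>k\<in>F. spread \<eta> k) <= \<Psi>" "0 <= \<Psi>" and H: "finite H"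
  and g: "(\<Sum>u\<in>H. \<Sum>v\<in>{v \<in> H. u div int L ~= v div int L}. spread \<eta> (u - v)) <= e * card H"
 shows "(\<Sum>a\<in>UNIV \<rightarrow>\<^sub>E H. cross_weight \<eta> L H (a :: 'd::finite => int)) <=
  real CARD('d) * e * \<Psi> ^ (CARD('d) - 1) * real (card H) ^ CARD('d)"
proof -
 let ?G = "UNIV \<rightarrow>\<^sub>E H :: ('d => int) set"
 \<comment> \<open>Along the chosen axis \<open>i\<close> only pairs in different blocks keep their
   weight.\<close>
 let ?t = "%i k u v. if k = i & u div int L = v div int L then 0 else spread \<eta> (u - v)"
 have fG: "finite ?G" using H by (intro finite_PiE) auto
 have split: "cross_weight \<eta> L H a <= (\<Sum>i\<in>UNIV. \<Sum>b\<in>?G. \<Prod>k\<in>UNIV. ?t i k (a k) (b k))" for a :: "'d => int"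
 proof -
  have "cross_weight \<eta> L H a <= (\<Sum>b\<in>{b \<in> ?G. separated L a b}. \<Sum>i\<in>UNIV. \<Prod>k\<in>UNIV. ?t i k (a k) (b k))"
   unfolding cross_weight_def
  proof (rule sum_mono)
   fix b assume "b \<in> {b \<in> ?G. separated L a b}"
   then obtain i where i: "a i div int L ~= b i div int L" by (auto simp: separated_def)
   have "(\<Prod>k\<in>UNIV. spread \<eta> (a k - b k)) = (\<Prod>k\<in>UNIV. ?t i k (a k) (b k))"
    using i by (intro prod.cong) auto
   also have "... <= (\<Sum>i\<in>UNIV. \<Prod>k\<in>UNIV. ?t i k (a k) (b k))"
    by (rule member_le_sum) (auto intro!: prod_nonneg)
   finally show "(\<Prod>k\<in>UNIV. spread \<eta> (a k - b k)) <= (\<Sum>i\<in>UNIV. \<Prod>k\<in>UNIV. ?t i k (a k) (b k))" .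
  qed
  also have "... <= (\<Sum>b\<in>?G. \<Sum>i\<in>UNIV. \<Prod>k\<in>UNIV. ?t i k (a k) (b k))"
   using fG by (intro sum_mono2) (auto intro!: sum_nonneg prod_nonneg)
  also have "... = (\<Sum>i\<in>UNIV. \<Sum>b\<in>?G. \<Prod>k\<in>UNIV. ?t i k (a k) (b k))" by (rule sum.swap)
  finally show ?thesis .
 qed
 have each: "(\<Sum>a\<in>?G. \<Sum>b\<in>?G. \<Prod>k\<in>UNIV. ?t i k (a k) (b k)) <= e * \<Psi> ^ (CARD('d) - 1) * real (card H) ^ CARD('d)" for i :: 'd
 proof -
  have "(\<Sum>a\<in>?G. \<Sum>b\<in>?G. \<Prod>k\<in>UNIV. ?t i k (a k) (b k)) = (\<Sum>a\<in>?G. \<Prod>k\<in>UNIV. \<Sum>v\<in>H. ?t i k (a k) v)"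
   using H by (subst prod_sum_PiE) auto
  also have "... = (\<Prod>k\<in>UNIV. \<Sum>u\<in>H. \<Sum>v\<in>H. ?t i k u v)"
   using H by (subst prod_sum_PiE) auto
  also have "... = (\<Sum>u\<in>H. \<Sum>v\<in>H. ?t i i u v) * (\<Prod>k\<in>UNIV - {i}. \<Sum>u\<in>H. \<Sum>v\<in>H. ?t i k u v)"
   by (subst prod.remove[of UNIV i]) auto
  also have "... <= (e * card H) * (\<Prod>k\<in>UNIV - {i}. card H * \<Psi>)"
  proof (intro mult_mono prod_mono conjI)
   have "(\<Sum>v\<in>H. ?t i i u v) = (\<Sum>v\<in>{v \<in> H. u div int L ~= v div int L}. spread \<eta> (u - v))" for u
    using H by (subst sum.inter_filter) (auto intro!: sum.cong)
   thus "(\<Sum>u\<in>H. \<Sum>v\<in>H. ?t i i u v) <= e * card H" using g by simp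
   have "0 <= (\<Sum>u\<in>H. \<Sum>v\<in>{v \<in> H. u div int L ~= v div int L}. spread \<eta> (u - v))"
    by (intro sum_nonneg) auto
   with g show "0 <= e * card H" by linarith
   fix k assume k: "k \<in> UNIV - {i}"
   have "(\<Sum>u\<in>H. \<Sum>v\<in>H. ?t i k u v) <= (\<Sum>u\<in>H. \<Psi>)"
    using sum_spread_diff[OF \<Psi>(1) H] k by (intro sum_mono) auto
   thus "(\<Sum>u\<in>H. \<Sum>v\<in>H. ?t i k u v) <= card H * \<Psi>" by simp
  qed (auto intro!: sum_nonneg prod_nonneg zero_le_power)
  also have "... = e * \<Psi> ^ (CARD('d) - 1) * (real (card H) * real (card H) ^ (CARD('d) - 1))"
   by (simp add: power_mult_distrib)
  also have "real (card H) * real (card H) ^ (CARD('d) - 1) = real (card H) ^ CARD('d)"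
   by (simp add: power_eq_if)
  finally show ?thesis .
 qed
 have "(\<Sum>a\<in>?G. cross_weight \<eta> L H a) <= (\<Sum>a\<in>?G. \<Sum>i\<in>UNIV. \<Sum>b\<in>?G. \<Prod>k\<in>UNIV. ?t i k (a k) (b k))"
  by (intro sum_mono split)
 also have "... = (\<Sum>i\<in>UNIV. \<Sum>a\<in>?G. \<Sum>b\<in>?G. \<Prod>k\<in>UNIV. ?t i k (a k) (b k))" by (rule sum.swap)
 also have "... <= (\<Sum>i\<in>(UNIV :: 'd set). e * \<Psi> ^ (CARD('d) - 1) * real (card H) ^ CARD('d))"
  by (intro sum_mono each)
 finally show ?thesis by (simp add: mult.assoc)
qed

text \<open>A position at distance at least \<open>R\<close> from the ends of its block sees other
  blocks only through the tail of \<open>spread\<close>. The remaining positions are a fraction of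
  order \<open>R / L\<close>, and each costs at most \<open>\<Psi>\<close>.\<close>

lemma sum_spread_blocks:
 fixes h :: nat and e \<Psi> :: real
 assumes \<Psi>: "!!F. finite F ==> (\<Sum>k\<in>F. spread \<eta> k) <= \<Psi>" "0 <= \<Psi>"
  and R: "!!F. finite F ==> (!!k. k \<in> F ==> int R <= \<bar>k\<bar>) ==> (\<Sum>k\<in>F. spread \<eta> k) <= e"
  and L: "0 < L" "2 * R * \<Psi> <= e * L"
 defines "H \<equiv> {- int (h * L)..<int (h * L)}"
 shows "(\<Sum>u\<in>H. \<Sum>v\<in>{v \<in> H. u div int L ~= v div int L}. spread \<eta> (u - v)) <= 2 * e * card H"
proof -
 let ?bad = "{u \<in> H. u mod int L < int R \<or> int L - int R < u mod int L}"
 let ?g = "%u. \<Sum>v\<in>{v \<in> H. u div int L ~= v div int L}. spread \<eta> (u - v)"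
 have e0: "0 <= e" using R[of "{}"] by simp
 have finH: "finite H" by (simp add: H_def)
 have cH: "real (card H) = 2 * real h * real L" by (simp add: H_def)
 have g: "?g u <= e + (if u \<in> ?bad then \<Psi> else 0)" if u: "u \<in> H" for u
 proof (cases "u \<in> ?bad")
  case True
  thus ?thesis using sum_spread_diff[OF \<Psi>(1), of "{v \<in> H. u div int L ~= v div int L}" u] finH e0 by auto
 next
  case False
  hence m: "int R <= u mod int L" "u mod int L <= int L - int R" using u by auto
  have far: "int R <= \<bar>u - v\<bar>" if ne: "u div int L ~= v div int L" for v
  proof -
   have uv: "u = int L * (u div int L) + u mod int L" "v = int L * (v div int L) + v mod int L" by simp_all
   have vm: "0 <= v mod int L" "v mod int L < int L" using L(1) by auto
   consider "u div int L + 1 <= v div int L" | "v div int L + 1 <= u div int L" using ne by linarith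
   thus ?thesis
   proof cases
    case 1
    hence "int L * (u div int L + 1) <= int L * (v div int L)" by (intro mult_left_mono) auto
    thus ?thesis using uv vm m unfolding distrib_left by linarith
   next
    case 2
    hence "int L * (v div int L + 1) <= int L * (u div int L)" by (intro mult_left_mono) auto
    thus ?thesis using uv vm m unfolding distrib_left by linarith
   qed
  qed
  have "?g u = (\<Sum>k\<in>(%v. u - v) ` {v \<in> H. u div int L ~= v div int L}. spread \<eta> k)"
   by (subst sum.reindex) (auto simp: inj_on_def)
  also have "... <= e" using finH far by (intro R) auto
  finally show ?thesis using False by (simp only: if_False add_0_right)
 qed
 \<comment> \<open>There are \<open>2 * h\<close> blocks, each with at most \<open>2 * R\<close>
   residues near an end.\<close>
 have cbad: "card ?bad <= 4 * h * R"
 proof -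
  let ?B = "{- int h..<int h}" and ?C = "{0..<int R} \<union> {int L - int R<..<int L}"
  have "?bad \<subseteq> (%(b, r). int L * b + r) ` (?B \<times> ?C)"
  proof
   fix u assume u: "u \<in> ?bad"
   have 1: "u = (%(b, r). int L * b + r) (u div int L, u mod int L)" by simp
   have "u mod int L \<in> ?C" using u L(1) by auto
   moreover have "u div int L \<in> ?B"
   proof -
    have "- (int h * int L) <= u" "u < int h * int L" using u by (auto simp: H_def)
    moreover define d m where "d = u div int L" and "m = u mod int L"
    have dm: "u = int L * d + m" "0 <= m" "m < int L" using L(1) by (simp_all add: d_def m_def)
    have "\<not> int h <= d"
    proof
     assume "int h <= d"
     hence "int h * int L <= int L * d" using mult_left_mono[of "int h" d "int L"] by (simp add: mult.commute)
     thus False using dm \<open>u < int h * int L\<close> by linarith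
    qed
    moreover have "\<not> d <= - int h - 1"
    proof
     assume "d <= - int h - 1"
     hence "int L * d <= int L * (- int h - 1)" by (intro mult_left_mono) auto
     hence "int L * d <= - (int h * int L) - int L" by (simp add: right_diff_distrib mult.commute)
     thus False using dm \<open>- (int h * int L) <= u\<close> by linarith
    qed
    ultimately have "- int h <= u div int L" "u div int L < int h" unfolding d_def by linarith+
    thus ?thesis by auto
   qed
   ultimately show "u \<in> (%(b, r). int L * b + r) ` (?B \<times> ?C)" using 1 by blast
  qed
  hence "card ?bad <= card ((%(b, r). int L * b + r) ` (?B \<times> ?C))" by (intro card_mono) auto
  also have "... <= card (?B \<times> ?C)" by (intro card_image_le) auto
  also have "... = 2 * h * card ?C" by (simp add: card_cartesian_product nat_mult_distrib)
  also have "... <= 2 * h * (2 * R)"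
  proof -
   have "card ?C <= card {0..<int R} + card {int L - int R<..<int L}" by (rule card_Un_le)
   hence "card ?C <= 2 * R" by simp
   thus ?thesis by (rule mult_le_mono2)
  qed
  finally show ?thesis by simp
 qed
 have "(\<Sum>u\<in>H. ?g u) <= (\<Sum>u\<in>H. e + (if u \<in> ?bad then \<Psi> else 0))" by (rule sum_mono[OF g])
 also have "... = e * card H + card ?bad * \<Psi>"
 proof -
  have "(\<Sum>u\<in>H. if u \<in> ?bad then \<Psi> else 0) = (\<Sum>u\<in>H \<inter> ?bad. \<Psi>)"
   using finH by (rule sum.inter_restrict[symmetric])
  also have "H \<inter> ?bad = ?bad" by blast
  finally have "(\<Sum>u\<in>H. if u \<in> ?bad then \<Psi> else 0) = card ?bad * \<Psi>" by (simp only: sum_constant)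
  thus ?thesis by (simp only: sum.distrib sum_constant mult.commute)
 qed
 also have "... <= e * card H + (4 * h * R) * \<Psi>"
  using of_nat_mono[OF cbad, where 'a=real] \<Psi>(2) by (intro add_left_mono mult_right_mono) simp_all
 also have "(4 * h * R) * \<Psi> = 2 * real h * (2 * R * \<Psi>)" by simp
 also have "... <= 2 * real h * (e * L)" using L(2) by (intro mult_left_mono) auto
 also have "... = e * card H" using cH by simp
 finally show ?thesis by simp
qed

text \<open>The side \<open>L\<close> depends on \<open>e\<close> and \<open>\<eta>\<close> only and
  serves all grids of whole blocks, whatever their number.\<close>

lemma cross_weight_small:
 assumes "0 < \<eta>" "0 < e"
 obtains L where "0 < L"
  "!!h. (\<Sum>a\<in>UNIV \<rightarrow>\<^sub>E {- int (h * L)..<int (h * L)}. cross_weight \<eta> L {- int (h * L)..<int (h * L)} (a :: 'd::finite => int)) <=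
   e * (2 * real (h * L)) ^ CARD('d)"
proof -
 obtain \<Psi> where \<Psi>: "1 <= \<Psi>" "!!F. finite F ==> (\<Sum>k\<in>F. spread \<eta> k) <= \<Psi>" using spread_sum[OF assms(1)] by metis
 \<comment> \<open>Compensates for the \<open>d\<close> axes, the factor \<open>\<Psi>\<close> of
   each other axis and the 2 of \<open>sum_spread_blocks\<close>.\<close>
 define e' where "e' = e / (2 * real CARD('d) * \<Psi> ^ (CARD('d) - 1))"
 have e': "0 < e'" using assms \<Psi> by (simp add: e'_def)
 obtain R where R: "!!F. finite F ==> (!!k. k \<in> F ==> int R <= \<bar>k\<bar>) ==> (\<Sum>k\<in>F. spread \<eta> k) <= e'"
  using spread_tail[OF assms(1) e'] by metis
 define L where "L = Suc (nat \<lceil>2 * R * \<Psi> / e'\<rceil>)"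
 have L: "0 < L" "2 * R * \<Psi> <= e' * L"
 proof -
  have "2 * R * \<Psi> / e' <= L" unfolding L_def by linarith
  thus "2 * R * \<Psi> <= e' * L" using e' by (simp add: field_simps)
 qed (simp add: L_def)
 show ?thesis
 proof (rule that[OF L(1)])
  fix h
  let ?H = "{- int (h * L)..<int (h * L)}"
  have cH: "real (card ?H) = 2 * real (h * L)" by simp
  have "(\<Sum>a\<in>UNIV \<rightarrow>\<^sub>E ?H. cross_weight \<eta> L ?H (a :: 'd => int)) <=
   real CARD('d) * (2 * e') * \<Psi> ^ (CARD('d) - 1) * real (card ?H) ^ CARD('d)"
  proof (rule sum_cross_weight)
   show "(\<Sum>u\<in>?H. \<Sum>v\<in>{v \<in> ?H. u div int L ~= v div int L}. spread \<eta> (u - v)) <= 2 * e' * card ?H"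
    by (rule sum_spread_blocks[where \<Psi>=\<Psi> and R=R]) (use \<Psi> R L in auto)
  qed (use \<Psi> in auto)
  also have "real CARD('d) * (2 * e') * \<Psi> ^ (CARD('d) - 1) = e" using \<Psi>(1) by (simp add: e'_def field_simps)
  finally show "(\<Sum>a\<in>UNIV \<rightarrow>\<^sub>E ?H. cross_weight \<eta> L ?H (a :: 'd => int)) <= e * (2 * real (h * L)) ^ CARD('d)"
   unfolding cH .
 qed
qed

section \<open>The upper bound\<close>

text \<open>The hub set is random, so the bound for fixed \<open>J\<close> is summed over all
  candidates; their number is polynomial and loses against an exponentially small bound.\<close>

lemma card_small_subsets:
 assumes "finite I"
 shows "finite {J. J \<subseteq> I & card J <= j}" and "card {J. J \<subseteq> I & card J <= j} <= Suc j * Suc (card I) ^ j"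
proof -
 show "finite {J. J \<subseteq> I & card J <= j}" using assms by (rule rev_finite_subset[OF finite_Pow_iff[THEN iffD2]]) auto
 have "{J. J \<subseteq> I & card J <= j} = (\<Union>k\<in>{..j}. {J. J \<subseteq> I & card J = k})" by auto
 hence "card {J. J \<subseteq> I & card J <= j} <= (\<Sum>k\<in>{..j}. card {J. J \<subseteq> I & card J = k})"
  using card_UN_le[of "{..j}" "%k. {J. J \<subseteq> I & card J = k}"] by simp
 also have "... <= (\<Sum>k\<in>{..j}. Suc (card I) ^ j)"
 proof (rule sum_mono)
  fix k assume k: "k \<in> {..j}"
  have "card {J. J \<subseteq> I & card J = k} = card I choose k" by (rule n_subsets[OF assms])
  also have "... <= Suc (card I) ^ j"
  proof (cases "k <= card I")
   case True
   hence "card I choose k <= card I ^ k" by (rule binomial_le_pow)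
   also have "... <= Suc (card I) ^ k" by (intro power_mono) auto
   also have "... <= Suc (card I) ^ j" using k by (intro power_increasing) auto
   finally show ?thesis .
  qed (simp add: binomial_eq_0)
  finally show "card {J. J \<subseteq> I & card J = k} <= Suc (card I) ^ j" .
 qed
 finally show "card {J. J \<subseteq> I & card J <= j} <= Suc j * Suc (card I) ^ j" by simp
qed

context ksrg_model
begin

lemma measurable_card_count_sigma:
 assumes "Q \<in> sets borel" "bounded Q"
 shows "(%om. real (card (P Q om))) \<in> borel_measurable (count_sigma Q)"
proof -
 have "(%om. ennreal (real (card (P Q om)))) \<in> borel_measurable (count_sigma Q)"
 proof (rule symmetric_measurable[OF assms, where h="%k _. ennreal (real k)"])
  fix om k s assume "s \<in> bijs {..<k} (P Q om)"
  hence "card (P Q om) = k" using bij_betw_same_card[of s "{..<k}"] by (auto simp: bijs_def)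
  thus "ennreal (real k) = ennreal (real (card (P Q om)))" by simp
 qed simp
 hence "(%om. enn2real (ennreal (real (card (P Q om))))) \<in> borel_measurable (count_sigma Q)"
  by (rule borel_measurable_enn2real)
 thus ?thesis by simp
qed

text \<open>Squares stand for pairs: the product of two counts is at most half the sum of their
  squares, which reduces sums over pairs of cells to sums over independent cells. The cut at
  \<open>A\<close> makes the terms bounded; \<open>2 * exp 2\<close> bounds the second moment of the
  count in a unit cube.\<close>

lemma prob_cell_squares:
 fixes G :: "('d => int) set" and A \<Psi> S s :: real
 assumes G: "finite G" and \<kappa>: "!!a. a \<in> G ==> 0 <= \<kappa> a" "!!a. a \<in> G ==> \<kappa> a <= \<Psi>" "(\<Sum>a\<in>G. \<kappa> a) <= S" and A: "0 < A" "0 < \<Psi>"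
 shows "prob {om \<in> space M. (1 + 1) * (2 * exp 2 * S) + s <=
  (\<Sum>a\<in>G. if real (card (P (cube 1 a) om)) <= A then (real (card (P (cube 1 a) om)))\<^sup>2 * \<kappa> a else 0)} <= exp (- (s / (A\<^sup>2 * \<Psi>)))"
proof -
 let ?N = "%a om. real (card (P (cube 1 a) om))"
 let ?Z = "%a om. if ?N a om <= A then (?N a om)\<^sup>2 * \<kappa> a else 0"
 have cb: "cube 1 a \<in> sets borel" "bounded (cube 1 a)" for a :: "'d => int" by (auto intro: bounded_cube)
 have ms: "?Z a \<in> borel_measurable (count_sigma (cube 1 a))" for a
 proof -
  note [measurable] = measurable_card_count_sigma[OF cb, of a]
  show ?thesis by measurable
 qed
 have ind: "indep_vars (%_. borel) ?Z G"
 proof (rule indep_vars_count_sigma[OF _ _ ms])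
  show "disjoint_family_on (cube 1) G" using disjoint_cube[of _ _ 1] by (auto simp: disjoint_family_on_def)
 qed (use cb in auto)
 have "prob {om \<in> space M. (1 + 1) * (2 * exp 2 * S) + s <= (\<Sum>a\<in>G. ?Z a om)} <= exp (- (1 * s / (A\<^sup>2 * \<Psi>)))"
 proof (rule chernoff_upper[OF G ind])
  show "0 <= ?Z a om & ?Z a om <= A\<^sup>2 * \<Psi>" if "a \<in> G" for a om
   using \<kappa>(1,2)[OF that] A by (auto intro!: mult_mono power_mono)
  have "expectation (?Z a) <= 2 * exp 2 * \<kappa> a" if a: "a \<in> G" for a
  proof -
   have "expectation (?Z a) <= expectation (%om. (?N a om)\<^sup>2 * \<kappa> a)"
    using card_square(1)[OF cb, of a] \<kappa>(1)[OF a] by (intro integral_mono_AE' AE_I2) auto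
   also have "... = expectation (%om. (?N a om)\<^sup>2) * \<kappa> a" by simp
   also have "... <= 2 * exp 2 * \<kappa> a"
    using card_square(2)[OF cb, of a] \<kappa>(1)[OF a] by (intro mult_right_mono) (simp_all add: measure_cube)
   finally show ?thesis .
  qed
  hence "(\<Sum>a\<in>G. expectation (?Z a)) <= (\<Sum>a\<in>G. 2 * exp 2 * \<kappa> a)" by (rule sum_mono)
  also have "... <= 2 * exp 2 * S" using \<kappa>(3) by (simp add: sum_distrib_left[symmetric])
  finally show "(\<Sum>a\<in>G. expectation (?Z a)) <= 2 * exp 2 * S" .
 qed (use A in auto)
 thus ?thesis by simp
qed

lemma cell_sum_le_card: "(!!k. F k <= 1) ==> cell_sum F Q om <= ennreal (real (card (P Q om)))"
proof -
 assume F: "!!k. F k <= 1"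
 have "comp_mean F y V v <= 1" for y V v
 proof -
  have "comp_mean F y V v <= (\<integral>\<^sup>+r. 1 \<partial>R)" unfolding comp_mean_def by (intro nn_integral_mono F)
  thus ?thesis by (simp add: labels.emeasure_space_1)
 qed
 hence "cell_sum F Q om <= (\<Sum>i\<in>P Q om. 1)" unfolding cell_sum_def by (rule sum_mono)
 thus ?thesis by (simp add: ennreal_of_nat_eq_real_of_nat)
qed

text \<open>The cell mean is at most the count \<open>N\<close>, and
  \<open>N <= N\<^sup>2 / A\<close> where the count exceeds \<open>A\<close>; truncation therefore
  lowers the expectation by at most the second moment divided by \<open>A\<close>.\<close>

lemma prob_truncated_cell_sums:
 fixes Qs :: "('d => int) set" and A H d s :: real
 assumes Qs: "finite Qs" and L: "0 < L" and F: "!!m n. m <= n ==> F n <= F m" "!!k. F k <= 1"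
  and H: "ennreal H <= palm_total F" "0 <= H" and A: "0 < A" and d: "0 < d" "d <= 1"
 shows "prob {om \<in> space M. (\<Sum>q\<in>Qs. if real (card (P (cube L q) om)) <= A then enn2real (cell_sum F (cube L q) om) else 0) <=
   (1 - d) * (card Qs * (real L ^ CARD('d) * H - 2 * exp (2 * real L ^ CARD('d)) / A)) - s} <= exp (- (d * s / A))"
proof -
 let ?N = "%q om. real (card (P (cube L q) om))"
 let ?c = "%q om. enn2real (cell_sum F (cube L q) om)"
 let ?Z = "%q om. if ?N q om <= A then ?c q om else 0"
 let ?V = "real L ^ CARD('d)"
 have cb: "cube L q \<in> sets borel" "bounded (cube L q)" for q :: "'d => int" using L by (auto intro: bounded_cube)
 have ms: "?Z q \<in> borel_measurable (count_sigma (cube L q))" for q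
 proof -
  note [measurable] = measurable_card_count_sigma[OF cb(1)[of q] cb(2)] measurable_cell_sum[OF cb(1)[of q] cb(2), of F]
  show ?thesis by measurable
 qed
 have ind: "indep_vars (%_. borel) ?Z Qs"
 proof (rule indep_vars_count_sigma[OF _ _ ms])
  show "disjoint_family_on (cube L) Qs" using disjoint_cube[of _ _ L] by (auto simp: disjoint_family_on_def)
 qed (use cb in auto)
 have cN: "cell_sum F (cube L q) om <= ennreal (?N q om)" for q om by (rule cell_sum_le_card[OF F(2)])
 have cfin: "cell_sum F (cube L q) om = ennreal (?c q om)" for q om
  using le_less_trans[OF cN ennreal_less_top, of q om] by simp
 have cle: "?c q om <= ?N q om" for q om using enn2real_mono[OF cN[of q om] ennreal_less_top] by simp
 show ?thesis
 proof (rule chernoff_lower[OF Qs ind _ A d])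
  show "0 <= ?Z q om & ?Z q om <= A" for q om using cle[of q om] A by auto
  have each: "?V * H - 2 * exp (2 * ?V) / A <= expectation (?Z q)" for q
  proof -
   have mN: "(%om. ?N q om) \<in> borel_measurable M" by (rule measurable_card_real[OF cb(1)])
   have mc: "?c q \<in> borel_measurable M" using cell_sum_measurable[OF cb] by (intro borel_measurable_enn2real)
   have iN2: "integrable M (%om. (?N q om)\<^sup>2)" by (rule card_square(1)[OF cb])
   have N_le: "?N q om <= (?N q om)\<^sup>2" for om
   proof (cases "card (P (cube L q) om)")
    case (Suc k)
    hence "1 <= ?N q om" by simp
    thus ?thesis by (simp add: power2_eq_square)
   qed simp
   have ic: "integrable M (?c q)"
    by (rule Bochner_Integration.integrable_bound[OF iN2 mc])
     (use order_trans[OF cle N_le] in auto)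
   have mZ: "?Z q \<in> borel_measurable M" by (rule measurable_count_sigma[OF cb(1) ms])
   have iZ: "integrable M (?Z q)"
    by (rule Bochner_Integration.integrable_bound[OF ic mZ]) auto
   have "?c q om <= ?Z q om + (?N q om)\<^sup>2 / A" for om
   proof (cases "?N q om <= A")
    case False
    hence "?N q om * A <= (?N q om)\<^sup>2" using A by (simp add: power2_eq_square mult_left_mono)
    hence "?N q om <= (?N q om)\<^sup>2 / A" using A by (simp add: field_simps)
    thus ?thesis using cle[of q om] False by simp
   qed (use A in auto)
   hence "expectation (?c q) <= expectation (%om. ?Z q om + (?N q om)\<^sup>2 / A)"
    using iZ iN2 ic by (intro integral_mono) auto
   also have "... = expectation (?Z q) + expectation (%om. (?N q om)\<^sup>2) / A" using iZ iN2 by simp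
   also have "... <= expectation (?Z q) + 2 * exp (2 * ?V) / A"
    using card_square(2)[OF cb, of q] A L by (intro add_left_mono divide_right_mono) (simp_all add: measure_cube)
   finally have 1: "expectation (?c q) <= expectation (?Z q) + 2 * exp (2 * ?V) / A" .
   have "ennreal (?V * H) <= ennreal ?V * palm_total F"
    using H by (subst ennreal_mult) (auto intro: mult_left_mono)
   also have "... <= (\<integral>\<^sup>+om. cell_sum F (cube L q) om \<partial>M)"
    using cell_sum_lower[OF cb(1)[of q] cb(2) F(1)] L by (simp add: measure_cube)
   also have "... = (\<integral>\<^sup>+om. ennreal (?c q om) \<partial>M)" by (intro nn_integral_cong cfin)
   also have "... = ennreal (expectation (?c q))" using ic by (intro nn_integral_eq_integral) auto
   finally have "?V * H <= expectation (?c q)" by (simp add: ennreal_le_iff)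
   with 1 show ?thesis by simp
  qed
  have "(\<Sum>q\<in>Qs. ?V * H - 2 * exp (2 * ?V) / A) <= (\<Sum>q\<in>Qs. expectation (?Z q))" by (intro sum_mono each)
  thus "card Qs * (?V * H - 2 * exp (2 * ?V) / A) <= (\<Sum>q\<in>Qs. expectation (?Z q))" by simp
 qed
qed

end

context ksrg_bounds
begin

text \<open>If there are few hubs and few edges between cells, then the small components of the cells
 that avoid the hubs are not absorbed by the large component.\<close>

lemma prob_large_le:
 fixes I :: "nat set" and x :: "nat => real ^ 'd" and Cq :: "'q => nat set" and crs :: "nat => nat => bool"
  and S A s s' d C K1 Gm SG t m' \<eta> l :: real
 assumes I: "finite I" "inj_on x I" and Qs: "finite Qs" "disjoint_family_on Cq Qs" "!!q. q \<in> Qs ==> Cq q \<subseteq> I"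
  and A: "!!q. q \<in> Qs ==> real (card (Cq q)) <= A" "0 < A"
  and S: "ennreal S <= (\<Sum>q\<in>Qs. \<Sum>i\<in>Cq q.
    comp_mean (%k. if k <= m then ennreal (((1 - p) ^ j) ^ k) else 0) (vpos x) (Point ` Cq q) (Point i))"
  and d: "0 < d" "d <= 1"
  and crs: "!!i l. crs i l \<longleftrightarrow> crs l i" "!!i. \<not> crs i i" "!!q i l. q \<in> Qs ==> i \<in> Cq q ==> l \<in> I ==> l \<notin> Cq q ==> crs i l"
  and m': "1 <= m'" and t: "1 <= t" and C: "0 <= C" and s: "0 <= s"
  and decay: "!!y w y' w'. y ~= y' ==> 1 <= w ==> w <= m' ==> 1 <= w' ==>
    c y w y' w' <= C * w' powr (1 + \<eta>) * max 1 (dist y y') powr (- (real CARD('d) * (1 + \<eta>)))"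
  and \<eta>: "0 < \<eta>"
  and K1: "(\<integral>\<^sup>+w. ennreal (if 1 <= w then w powr (1 + \<eta>) else 0) \<partial>\<mu>) <= ennreal K1" "0 <= K1"
  and Gm: "!!i. i \<in> I ==> (\<Sum>l\<in>{l \<in> I. crs i l}. max 1 (dist (x i) (x l)) powr (- (real CARD('d) * (1 + \<eta>)))) <= Gm" "0 < Gm"
  and SG: "(\<Sum>i\<in>I. \<Sum>l\<in>{l \<in> I. crs i l}. max 1 (dist (x i) (x l)) powr (- (real CARD('d) * (1 + \<eta>)))) <= SG"
  and l: "real m <= l" "card I + m * (2 * (card I * m' powr (- (\<tau> - 1))) + s + 2 * (2 * (C * (2 * (K1 * SG) + s)) + s)) <=
   l + ((1 - d) * (S - j * A) - s')"
 shows "labels.prob {r \<in> space R. \<exists>i\<in>I. l < card (comp_of c (vpos x) (fst r) (snd r) (Point ` I) (Point i))} <=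
  (card I * t powr (- (\<tau> - 1))) ^ Suc j + real (Suc j * Suc (card I) ^ j) * exp (- (d * s' / A)) +
  (2 * exp (- s) + exp (- (s / (t powr (1 + \<eta>) * Gm))))"
proof -
 define E where "E r = label_edges c (vpos x) (fst r) (snd r) (Point ` I)" for r
 define good where "good J r q = {v \<in> Point ` Cq q. card (comp_of c (vpos x) (fst r) (snd r) (Point ` Cq q) v) <= m &
   (\<forall>a\<in>comp_of c (vpos x) (fst r) (snd r) (Point ` Cq q) v. \<forall>b\<in>Point ` J. snd r {a, b} > p)}" for J r q
 define b where "b = 2 * (card I * m' powr (- (\<tau> - 1))) + s + 2 * (2 * (C * (2 * (K1 * SG) + s)) + s)"
 define T where "T r = {i \<in> I. fst r (Point i) <= t & (\<exists>l\<in>I. crs i l & fst r (Point l) <= t &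
   (Point i, Point l) \<in> E r)}" for r
 define Jh where "Jh r = {i \<in> I. t < fst r (Point i)}" for r :: "(vertex => real) \<times> (vertex set => real)"
 define B1 where "B1 J = {r \<in> space R. \<forall>v\<in>Point ` J. t <= fst r v}" for J
 define B2 where "B2 J = {r \<in> space R. (\<Sum>q\<in>{q \<in> Qs. Cq q \<inter> J = {}}. real (card (good J r q))) <= (1 - d) * (S - j * A) - s'}" for J
 define B3 where "B3 = {r \<in> space R. b <= card (T r)}"
 \<comment> \<open>More than \<open>j\<close> hubs show up as some set of exactly
   \<open>Suc j\<close> vertices with marks at least \<open>t\<close>; otherwise the hub set belongs
   to \<open>?J2\<close>.\<close>
 let ?J1 = "{J. J \<subseteq> I & card J = Suc j}" and ?J2 = "{J. J \<subseteq> I & card J <= j}"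
 have fJ: "finite ?J1" "finite ?J2" using I(1) by (auto intro: rev_finite_subset[OF finite_Pow_iff[THEN iffD2]])
 have finC: "finite (Cq q)" if "q \<in> Qs" for q using Qs(3)[OF that] I(1) by (rule finite_subset)
 have sB1: "B1 J \<in> sets R" if "J \<subseteq> I" for J
 proof -
  have "finite (Point ` J)" using that I(1) by (auto intro: finite_subset)
  thus ?thesis unfolding B1_def by (intro sets.sets_Collect_finite_All borel_measurable_le borel_measurable_const measurable_mark) auto
 qed
 have B2: "B2 J \<in> sets R" "labels.prob (B2 J) <= exp (- (d * s' / A))" if "J \<subseteq> I" "card J <= j" for J
  using prob_few_isolated[OF I(1) Qs that A S d, of s'] unfolding B2_def good_def by blast+
 have B3: "B3 \<in> sets R" "labels.prob B3 <= 2 * exp (- s) + exp (- (s / (t powr (1 + \<eta>) * Gm)))"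
  using prob_many_cross[OF I crs(1,2) m' t C s decay \<eta> K1 Gm SG] unfolding B3_def b_def T_def E_def by blast+
 have PB1: "labels.prob (B1 J) = (t powr (- (\<tau> - 1))) ^ Suc j" if "J \<in> ?J1" for J
 proof -
  have "finite (Point ` J)" "card (Point ` J) = Suc j"
   using that I(1) by (auto intro: finite_subset simp: card_image inj_on_def)
  thus ?thesis unfolding B1_def using prob_marks_ge[of "Point ` J" t] t by simp
 qed
 \<comment> \<open>Outside the exceptional sets, \<open>card_large_component\<close> with the actual
   hub set \<open>Jh r\<close> contradicts a component of more than \<open>l\<close> vertices. The
   union over \<open>?J2\<close> is taken because \<open>Jh r\<close> is random while
   \<open>B2\<close> needs a fixed set.\<close>
 have cover: "{r \<in> space R. \<exists>i\<in>I. l < card (comp_of c (vpos x) (fst r) (snd r) (Point ` I) (Point i))} \<subseteq>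
  (\<Union>J\<in>?J1. B1 J) \<union> (\<Union>J\<in>?J2. B2 J) \<union> B3"
 proof (rule subsetI, rule ccontr)
  fix r assume r: "r \<in> {r \<in> space R. \<exists>i\<in>I. l < card (comp_of c (vpos x) (fst r) (snd r) (Point ` I) (Point i))}"
   and n: "r \<notin> (\<Union>J\<in>?J1. B1 J) \<union> (\<Union>J\<in>?J2. B2 J) \<union> B3"
  obtain i where i: "i \<in> I" "l < card (graph_component (E r) (Point i))" using r by (auto simp: E_def)
  have rs: "r \<in> space R" using r by simp
  let ?J = "Jh r"
  have JI: "?J \<subseteq> I" by (auto simp: Jh_def)
  have cJ: "card ?J <= j"
  proof (rule ccontr)
   assume "\<not> card ?J <= j"
   hence "Suc j <= card ?J" by simp
   then obtain J where J: "J \<subseteq> ?J" "card J = Suc j" by (rule obtain_subset_with_card_n)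
   have "t <= fst r v" if v: "v \<in> Point ` J" for v
   proof -
    obtain i where "v = Point i" "i \<in> ?J" using v J(1) by blast
    thus ?thesis by (simp add: Jh_def)
   qed
   hence "r \<in> B1 J" using rs unfolding B1_def by blast
   moreover have "J \<in> ?J1" using J(2) order_trans[OF J(1) JI] by simp
   ultimately show False using n by blast
  qed
  let ?Q = "{q \<in> Qs. Cq q \<inter> ?J = {}}"
  have n2: "(1 - d) * (S - j * A) - s' < (\<Sum>q\<in>?Q. real (card (good ?J r q)))"
  proof -
   have "r \<notin> B2 ?J" using n JI cJ by blast
   thus ?thesis using rs unfolding B2_def mem_Collect_eq not_le[symmetric] by blast
  qed
  have n3: "real (card (T r)) < b"
  proof -
   have "r \<notin> B3" using n by blast
   thus ?thesis using rs unfolding B3_def mem_Collect_eq not_le[symmetric] by blast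
  qed
  define cc where "cc q v = graph_component (E r \<inter> (Point ` Cq q \<times> Point ` Cq q)) v" for q v
  define Gd where "Gd q = {v \<in> Point ` Cq q. card (cc q v) <= m & (\<forall>a\<in>cc q v. \<forall>b\<in>Point ` ?J. (a, b) \<notin> E r)}" for q
  define T' where "T' = {a. \<exists>q\<in>?Q. a \<in> Point ` Cq q & (\<exists>b\<in>Point ` I - Point ` ?J. b \<notin> Point ` Cq q & (a, b) \<in> E r)}"
  have big: "card (graph_component (E r) (Point i)) + (\<Sum>q\<in>?Q. card (Gd q)) <= card (Point ` I) + m * card T'"
  proof (rule card_large_component[OF _ _ _ _ _ _ cc_def Gd_def T'_def])
   show "E r \<subseteq> Point ` I \<times> Point ` I" by (auto simp: E_def label_edges_def)
   show "sym (E r)" unfolding E_def by (rule sym_label_edges[OF conn_sym])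
   show "disjoint_family_on (%q. Point ` Cq q) ?Q" using Qs(2) by (auto simp: disjoint_family_on_def)
   show "m < card (graph_component (E r) (Point i))" using i(2) l(1) by simp
  qed (use I(1) Qs i in auto)
  \<comment> \<open>The endpoint lies in a cell without hubs and its partner outside
    \<open>Jh r\<close>, so both marks are at most \<open>t\<close>, as \<open>T\<close>
    demands.\<close>
  have T'T: "T' \<subseteq> Point ` T r"
  proof
   fix a assume "a \<in> T'"
   then obtain q u w where q: "q \<in> Qs" "Cq q \<inter> ?J = {}" "u \<in> Cq q" "a = Point u" "w \<in> I" "w \<notin> ?J" "w \<notin> Cq q" "(a, Point w) \<in> E r"
    unfolding T'_def by blast
   have "u \<in> I" "u \<notin> ?J" using q Qs(3) by auto
   moreover have "crs u w" using crs(3) q by blast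
   ultimately have "u \<in> T r" using q by (auto simp: T_def Jh_def not_less)
   thus "a \<in> Point ` T r" using q by simp
  qed
  have "finite (T r)" using I(1) by (simp add: T_def)
  hence cT: "card T' <= card (T r)" using card_mono[OF _ T'T] by (simp add: card_image inj_on_def)
  have goodGd: "card (good ?J r q) <= card (Gd q)" if q: "q \<in> ?Q" for q
  proof (rule card_mono)
   show "finite (Gd q)" using finC[of q] q by (simp add: Gd_def)
   have sub: "Point ` Cq q \<subseteq> Point ` I" using Qs(3)[of q] q by auto
   have ccq: "cc q v = comp_of c (vpos x) (fst r) (snd r) (Point ` Cq q) v" for v
    unfolding cc_def E_def label_edges_Int[OF sub] by (rule refl)
   \<comment> \<open>No connection probability exceeds \<open>p\<close>, so a label above
     \<open>p\<close> excludes the edge whatever the marks are.\<close>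
   have "(a, b) \<notin> E r" if "snd r {a, b} > p" for a b
    using that conn_le[of "vpos x a" "fst r a" "vpos x b" "fst r b"] by (auto simp: E_def label_edges_def)
   thus "good ?J r q \<subseteq> Gd q" unfolding good_def Gd_def ccq by blast
  qed
  have "(\<Sum>q\<in>?Q. real (card (good ?J r q))) <= (\<Sum>q\<in>?Q. real (card (Gd q)))" using goodGd by (intro sum_mono) simp
  moreover have "real (card (graph_component (E r) (Point i))) + (\<Sum>q\<in>?Q. real (card (Gd q))) <= card I + m * real (card (T r))"
  proof -
   have "card (graph_component (E r) (Point i)) + (\<Sum>q\<in>?Q. card (Gd q)) <= card I + m * card (T r)"
   proof -
    have "card (Point ` I) = card I" by (simp add: card_image inj_on_def)
    thus ?thesis using big mult_le_mono2[OF cT, of m] by linarith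
   qed
   hence "real (card (graph_component (E r) (Point i)) + (\<Sum>q\<in>?Q. card (Gd q))) <= real (card I + m * card (T r))"
    by (rule of_nat_mono)
   thus ?thesis by simp
  qed
  moreover have "real m * real (card (T r)) <= real m * b" using n3 by (intro mult_left_mono) auto
  ultimately show False using n2 i(2) l(2) unfolding b_def by linarith
 qed
 have "labels.prob {r \<in> space R. \<exists>i\<in>I. l < card (comp_of c (vpos x) (fst r) (snd r) (Point ` I) (Point i))} <=
  labels.prob ((\<Union>J\<in>?J1. B1 J) \<union> (\<Union>J\<in>?J2. B2 J) \<union> B3)"
  using cover by (rule labels.finite_measure_mono) (intro sets.Un sets.finite_UN fJ B3(1); use sB1 B2(1) in auto)
 also have "... <= labels.prob (\<Union>J\<in>?J1. B1 J) + labels.prob (\<Union>J\<in>?J2. B2 J) + labels.prob B3"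
  by (intro order_trans[OF measure_Un_le] add_mono measure_Un_le order_refl sets.Un sets.finite_UN fJ B3(1); use sB1 B2(1) in auto)
 also have "... <= (\<Sum>J\<in>?J1. labels.prob (B1 J)) + (\<Sum>J\<in>?J2. labels.prob (B2 J)) + labels.prob B3"
  by (intro add_mono order_refl labels.finite_measure_subadditive_finite fJ; use sB1 B2(1) in auto)
 also have "... <= (card I * t powr (- (\<tau> - 1))) ^ Suc j + real (Suc j * Suc (card I) ^ j) * exp (- (d * s' / A)) +
  (2 * exp (- s) + exp (- (s / (t powr (1 + \<eta>) * Gm))))"
 proof (intro add_mono B3(2))
  have "(\<Sum>J\<in>?J1. labels.prob (B1 J)) = real (card ?J1) * (t powr (- (\<tau> - 1))) ^ Suc j" by (simp add: PB1)
  also have "... <= real (card I ^ Suc j) * (t powr (- (\<tau> - 1))) ^ Suc j"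
  proof (intro mult_right_mono of_nat_mono)
   show "card ?J1 <= card I ^ Suc j"
    unfolding n_subsets[OF I(1)] by (cases "Suc j <= card I") (auto simp: binomial_eq_0 intro: binomial_le_pow simp del: power_Suc)
  qed simp
  also have "... = (card I * t powr (- (\<tau> - 1))) ^ Suc j" unfolding power_mult_distrib by simp
  finally show "(\<Sum>J\<in>?J1. labels.prob (B1 J)) <= (card I * t powr (- (\<tau> - 1))) ^ Suc j" .
  have "(\<Sum>J\<in>?J2. labels.prob (B2 J)) <= (\<Sum>J\<in>?J2. exp (- (d * s' / A)))" using B2(2) by (intro sum_mono) auto
  also have "... = real (card ?J2) * exp (- (d * s' / A))" by simp
  also have "... <= real (Suc j * Suc (card I) ^ j) * exp (- (d * s' / A))"
   using card_small_subsets(2)[OF I(1), of j] by (intro mult_right_mono of_nat_mono) auto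
  finally show "(\<Sum>J\<in>?J2. labels.prob (B2 J)) <= real (Suc j * Suc (card I) ^ j) * exp (- (d * s' / A))" .
 qed
 finally show ?thesis .
qed

end

text \<open>In the variable \<open>n powr q\<close> the last factor is an ordinary exponential; the
  exponent \<open>\<bar>b + B\<bar> / q + 1\<close> is large enough to cover
  \<open>n powr (b + B)\<close> after the substitution.\<close>

lemma eventually_exp_powr_small:
 fixes a b c q B :: real
 assumes "0 < a" "0 < q"
 shows "\<forall>\<^sub>F n in at_top. c * n powr b * exp (- (a * n powr q)) <= n powr (- B)"
proof -
 have "((%x. \<bar>c\<bar> * x powr (\<bar>b + B\<bar> / q + 1) * exp (- (a * x))) \<longlongrightarrow> 0) at_top"
  using assms by real_asymp
 hence "\<forall>\<^sub>F x in at_top. \<bar>c\<bar> * x powr (\<bar>b + B\<bar> / q + 1) * exp (- (a * x)) <= 1"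
  by (rule eventually_le_if_tendsto_0) simp
 moreover have "filterlim (%n :: real. n powr q) at_top at_top" using assms(2) by real_asymp
 ultimately have "\<forall>\<^sub>F n in at_top. \<bar>c\<bar> * (n powr q) powr (\<bar>b + B\<bar> / q + 1) * exp (- (a * n powr q)) <= 1"
  by (rule eventually_compose_filterlim)
 thus ?thesis using eventually_ge_at_top[of "1 :: real"]
 proof eventually_elim
  case (elim n)
  have "c * n powr b * exp (- (a * n powr q)) * n powr B = c * n powr (b + B) * exp (- (a * n powr q))"
   by (simp add: powr_add)
  also have "... <= \<bar>c\<bar> * (n powr q) powr (\<bar>b + B\<bar> / q + 1) * exp (- (a * n powr q))"
  proof (intro mult_right_mono mult_mono)
   have "b + B <= \<bar>b + B\<bar> + q" using assms(2) by simp
   hence "n powr (b + B) <= n powr (q * (\<bar>b + B\<bar> / q + 1))"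
    using elim assms(2) by (intro powr_mono) (auto simp: distrib_left)
   thus "n powr (b + B) <= (n powr q) powr (\<bar>b + B\<bar> / q + 1)" by (simp add: powr_powr)
  qed auto
  also have "... <= 1" by (rule elim(1))
  finally show ?case using elim by (simp add: powr_minus field_simps)
 qed
qed

definition cell_of :: "real ^ 'd => 'd => int" where
 "cell_of y i = \<lfloor>y $ i\<rfloor>"

lemma cube_1: "y \<in> cube 1 a \<longleftrightarrow> cell_of y = a"
 by (auto simp: cube_def cell_of_def fun_eq_iff)

text \<open>Passes from pairs of points to pairs of unit cells. In the double sum the product of the
  counts is replaced by half the sum of their squares, and by symmetry of the weights both halves
  agree.\<close>

lemma cross_decay:
 fixes x :: "nat => real ^ 'd" and \<Psi> A :: real and L :: nat
 assumes \<eta>: "0 < \<eta>" and \<Psi>: "!!F. finite F ==> (\<Sum>k\<in>F. spread \<eta> k) <= \<Psi>"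
  and I: "finite I" "!!i. i \<in> I ==> cell_of (x i) \<in> UNIV \<rightarrow>\<^sub>E H" and H: "finite H"
  and N: "!!a. a \<in> UNIV \<rightarrow>\<^sub>E H ==> real (card {i \<in> I. cell_of (x i) = a}) <= N a"
 defines "\<psi> \<equiv> %i l. max 1 (dist (x i) (x l)) powr (- (real CARD('d) * (1 + \<eta>)))"
  and "crs \<equiv> %i l. separated L (cell_of (x i)) (cell_of (x l))"
 shows "(!!a. a \<in> UNIV \<rightarrow>\<^sub>E H ==> N a <= A) ==> i \<in> I ==> (\<Sum>l\<in>{l \<in> I. crs i l}. \<psi> i l) <= A * \<Psi> ^ CARD('d)"
  and "(\<Sum>i\<in>I. \<Sum>l\<in>{l \<in> I. crs i l}. \<psi> i l) <= (\<Sum>a\<in>UNIV \<rightarrow>\<^sub>E H. (N a)\<^sup>2 * cross_weight \<eta> L H a)"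
proof -
 let ?G = "UNIV \<rightarrow>\<^sub>E H :: ('d => int) set"
 define w :: "('d => int) => ('d => int) => real" where "w a b = (\<Prod>k\<in>UNIV. spread \<eta> (a k - b k))" for a b
 define M where "M a = real (card {i \<in> I. cell_of (x i) = a})" for a
 have finG: "finite ?G" using H by (intro finite_PiE) auto
 have w0: "0 <= w a b" for a b unfolding w_def by (intro prod_nonneg) auto
 have wsym: "w a b = w b a" for a b unfolding w_def spread_def by (simp add: abs_minus_commute)
 have M0: "0 <= M a" for a by (simp add: M_def)
 have MN: "M a <= N a" if "a \<in> ?G" for a using N[OF that] by (simp add: M_def)
 have img: "(%i. cell_of (x i)) ` I \<subseteq> ?G" using I(2) by auto
 have \<psi>w: "\<psi> i l <= w (cell_of (x i)) (cell_of (x l))" for i l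
  unfolding \<psi>_def w_def cell_of_def by (rule decay_le_spread[OF \<eta>])
 have group: "(\<Sum>l\<in>I. f (cell_of (x l))) = (\<Sum>b\<in>?G. M b * f b)" for f :: "('d => int) => real"
 proof -
  have "(\<Sum>l\<in>I. f (cell_of (x l))) = (\<Sum>b\<in>?G. \<Sum>l\<in>{l \<in> I. cell_of (x l) = b}. f (cell_of (x l)))"
   by (rule sum.group[OF I(1) finG img, symmetric])
  also have "... = (\<Sum>b\<in>?G. M b * f b)" unfolding M_def by (intro sum.cong refl) simp
  finally show ?thesis .
 qed
 have row: "(\<Sum>l\<in>{l \<in> I. crs i l}. \<psi> i l) <= (\<Sum>b\<in>?G. M b * (if separated L (cell_of (x i)) b then w (cell_of (x i)) b else 0))" for i
 proof -
  have "(\<Sum>l\<in>{l \<in> I. crs i l}. \<psi> i l) <= (\<Sum>l\<in>{l \<in> I. crs i l}. w (cell_of (x i)) (cell_of (x l)))"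
   by (intro sum_mono \<psi>w)
  also have "... = (\<Sum>l\<in>I. if separated L (cell_of (x i)) (cell_of (x l)) then w (cell_of (x i)) (cell_of (x l)) else 0)"
   unfolding crs_def using I(1) by (rule sum.inter_filter)
  also have "... = (\<Sum>b\<in>?G. M b * (if separated L (cell_of (x i)) b then w (cell_of (x i)) b else 0))" by (rule group)
  finally show ?thesis .
 qed
 show "(\<Sum>l\<in>{l \<in> I. crs i l}. \<psi> i l) <= A * \<Psi> ^ CARD('d)" if NA: "!!a. a \<in> ?G ==> N a <= A" and i: "i \<in> I" for i
 proof -
  have "(\<Sum>b\<in>?G. M b * (if separated L (cell_of (x i)) b then w (cell_of (x i)) b else 0)) <= (\<Sum>b\<in>?G. A * w (cell_of (x i)) b)"
  proof (rule sum_mono)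
   fix b assume b: "b \<in> ?G"
   show "M b * (if separated L (cell_of (x i)) b then w (cell_of (x i)) b else 0) <= A * w (cell_of (x i)) b"
    using order_trans[OF MN[OF b] NA[OF b]] w0 M0[of b] by (intro mult_mono) auto
  qed
  also have "... = A * (\<Sum>b\<in>?G. w (cell_of (x i)) b)" by (simp add: sum_distrib_left)
  also have "... <= A * \<Psi> ^ CARD('d)"
  proof (rule mult_left_mono)
   show "(\<Sum>b\<in>?G. w (cell_of (x i)) b) <= \<Psi> ^ CARD('d)" unfolding w_def by (rule sum_prod_spread[OF \<Psi> H])
   have "cell_of (x i) \<in> ?G" by (rule I(2)[OF i])
   thus "0 <= A" using order_trans[OF MN NA] M0 order_trans by blast
  qed
  finally show ?thesis using row[of i] by linarith
 qed
 let ?t = "%a b. if separated L a b then w a b else 0"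
 have "(\<Sum>i\<in>I. \<Sum>l\<in>{l \<in> I. crs i l}. \<psi> i l) <= (\<Sum>i\<in>I. \<Sum>b\<in>?G. M b * ?t (cell_of (x i)) b)"
  by (intro sum_mono row)
 also have "... = (\<Sum>a\<in>?G. M a * (\<Sum>b\<in>?G. M b * ?t a b))" by (rule group)
 also have "... <= (\<Sum>a\<in>?G. \<Sum>b\<in>?G. ((M a)\<^sup>2 + (M b)\<^sup>2) / 2 * ?t a b)"
  unfolding sum_distrib_left
 proof (intro sum_mono)
  fix a b
  have "M a * M b <= ((M a)\<^sup>2 + (M b)\<^sup>2) / 2" using sum_squares_bound[of "M a" "M b"] by simp
  hence "M a * M b * ?t a b <= ((M a)\<^sup>2 + (M b)\<^sup>2) / 2 * ?t a b" using w0 by (intro mult_right_mono) auto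
  thus "M a * (M b * ?t a b) <= ((M a)\<^sup>2 + (M b)\<^sup>2) / 2 * ?t a b" by (simp only: mult.assoc)
 qed
 also have "... = (\<Sum>a\<in>?G. \<Sum>b\<in>?G. (M a)\<^sup>2 / 2 * ?t a b) + (\<Sum>a\<in>?G. \<Sum>b\<in>?G. (M b)\<^sup>2 / 2 * ?t a b)"
  by (simp only: add_divide_distrib distrib_right sum.distrib)
 also have "(\<Sum>a\<in>?G. \<Sum>b\<in>?G. (M b)\<^sup>2 / 2 * ?t a b) = (\<Sum>a\<in>?G. \<Sum>b\<in>?G. (M a)\<^sup>2 / 2 * ?t a b)"
 proof (subst sum.swap, intro sum.cong refl)
  fix a b :: "'d => int"
  have "separated L b a \<longleftrightarrow> separated L a b" unfolding separated_def by metis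
  thus "(M a)\<^sup>2 / 2 * ?t b a = (M a)\<^sup>2 / 2 * ?t a b" using wsym by simp
 qed
 also have "(\<Sum>a\<in>?G. \<Sum>b\<in>?G. (M a)\<^sup>2 / 2 * ?t a b) + (\<Sum>a\<in>?G. \<Sum>b\<in>?G. (M a)\<^sup>2 / 2 * ?t a b) =
  (\<Sum>a\<in>?G. \<Sum>b\<in>?G. (M a)\<^sup>2 * ?t a b)"
  by (simp only: sum.distrib[symmetric] distrib_right[symmetric] field_sum_of_halves)
 also have "... = (\<Sum>a\<in>?G. (M a)\<^sup>2 * cross_weight \<eta> L H a)"
  unfolding cross_weight_def w_def[symmetric] sum.inter_filter[OF finG] by (simp only: sum_distrib_left)
 also have "... <= (\<Sum>a\<in>?G. (N a)\<^sup>2 * cross_weight \<eta> L H a)"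
  using MN M0 by (intro sum_mono mult_right_mono power_mono cross_weight_nonneg)
 finally show "(\<Sum>i\<in>I. \<Sum>l\<in>{l \<in> I. crs i l}. \<psi> i l) <= (\<Sum>a\<in>?G. (N a)\<^sup>2 * cross_weight \<eta> L H a)" .
qed

text \<open>Rounded up, so that the grid of unit cells consists of whole blocks of side
  \<open>L\<close>, as \<open>cross_weight_small\<close> requires; the successor leaves room for the
  half-open upper end.\<close>

definition outer_range :: "nat => nat => real => nat" where
 "outer_range D L n = Suc (nat \<lceil>n powr (1 / real D) / (2 * real L)\<rceil>)"

lemma cell_of_volume_box:
 fixes y :: "real ^ 'd"
 assumes "y \<in> volume_box n" "0 < L"
 shows "cell_of y \<in> UNIV \<rightarrow>\<^sub>E {- int (outer_range CARD('d) L n * L)..<int (outer_range CARD('d) L n * L)}"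
proof -
 let ?h = "outer_range CARD('d) L n" and ?s = "n powr (1 / real CARD('d))"
 have "?s / (2 * real L) + 1 <= real ?h" unfolding outer_range_def by linarith
 hence "(?s / (2 * real L) + 1) * L <= real ?h * L" by (intro mult_right_mono) auto
 hence h: "?s / 2 + L <= real (?h * L)" using assms(2) by (simp add: distrib_right)
 have "cell_of y i \<in> {- int (?h * L)..<int (?h * L)}" for i
 proof -
  have "\<bar>y $ i\<bar> <= ?s / 2" using assms(1) by (simp add: volume_box_def)
  hence y: "- (?s / 2) <= y $ i" "y $ i <= ?s / 2" by linarith+
  have "real_of_int (- int (?h * L)) <= y $ i" using y h by simp
  moreover have "y $ i < real_of_int (int (?h * L))" using y h assms(2) by simp
  ultimately show ?thesis unfolding cell_of_def by (simp only: atLeastLessThan_iff le_floor_iff floor_less_iff)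
 qed
 thus ?thesis by auto
qed

lemma eventually_outer_range:
 assumes "0 < L"
 shows "\<forall>\<^sub>F n in at_top. (2 * real (outer_range CARD('d::finite) L n * L)) ^ CARD('d) <= 2 ^ CARD('d) * n"
proof -
 have "\<forall>\<^sub>F n :: real in at_top. 4 * real L <= n powr (1 / real CARD('d))"
  using filterlim_root[of "CARD('d)"] unfolding filterlim_at_top by auto
 thus ?thesis using eventually_gt_at_top[of 0]
 proof eventually_elim
  case (elim n)
  let ?h = "outer_range CARD('d) L n" and ?s = "n powr (1 / real CARD('d))"
  have "real ?h <= ?s / (2 * real L) + 2"
  proof -
   have "0 <= ?s / (2 * real L)" by simp
   thus ?thesis unfolding outer_range_def by linarith
  qed
  hence "2 * (real ?h * L) <= 2 * ((?s / (2 * real L) + 2) * L)" by (intro mult_left_mono mult_right_mono) auto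
  also have "... = ?s + 4 * real L" using assms by (simp add: field_simps)
  also have "... <= 2 * ?s" using elim by simp
  finally have "(2 * real (?h * L)) ^ CARD('d) <= (2 * ?s) ^ CARD('d)" by (intro power_mono) auto
  thus ?case using elim by (simp add: power_mult_distrib root_power)
 qed
qed

context ksrg_model
begin

text \<open>By monotone convergence in the cap \<open>m\<close>, the strict inequality persists for
  some finite cap.\<close>

lemma palm_total_truncate:
 fixes z :: real
 assumes z: "0 <= z" "z <= 1" and H: "ennreal h < palm_total (%k. ennreal (z ^ k))" and h: "0 <= h"
 obtains m H where "h < H" "H <= 1" "palm_total (%k. if k <= m then ennreal (z ^ k) else 0) = ennreal H"
proof -
 let ?F = "%m k. if k <= m then ennreal (z ^ k) else 0"
 let ?C = "%om r. comp_of c (vpos (%i. X i om)) (fst r) (snd r) UNIV Root"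
 let ?g = "%F om r. let C = ?C om r in if finite C then F (card C) else (0 :: ennreal)"
 have mono: "incseq (%m. ?g (?F m) om r)" for om r
  by (rule incseq_SucI) (auto simp: Let_def)
 have meas: "(%r. ?g F om r) \<in> borel_measurable R" if "om \<in> space M" for F om
  using measurable_compose[OF measurable_Pair1'[OF that] measurable_palm_joint[of F]] by simp
 have meas': "(%om. \<integral>\<^sup>+r. ?g F om r \<partial>R) \<in> borel_measurable M" for F
  using labels.borel_measurable_nn_integral[of "%om r. ?g F om r" M] measurable_palm_joint[of F] by (simp add: split_beta')
 have sup: "(SUP m. ?g (?F m) om r) = ?g (%k. ennreal (z ^ k)) om r" for om r
 proof (rule antisym)
  show "(SUP m. ?g (?F m) om r) <= ?g (%k. ennreal (z ^ k)) om r" by (rule SUP_least) (auto simp: Let_def)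
  have "?g (%k. ennreal (z ^ k)) om r = ?g (?F (card (?C om r))) om r" by (simp add: Let_def)
  also have "... <= (SUP m. ?g (?F m) om r)" by (rule SUP_upper) simp
  finally show "?g (%k. ennreal (z ^ k)) om r <= (SUP m. ?g (?F m) om r)" .
 qed
 have "palm_total (%k. ennreal (z ^ k)) = (\<integral>\<^sup>+om. (SUP m. \<integral>\<^sup>+r. ?g (?F m) om r \<partial>R) \<partial>M)"
  unfolding palm_total_def
 proof (rule nn_integral_cong)
  fix om assume w: "om \<in> space M"
  have "incseq (%m r. ?g (?F m) om r)" using mono by (auto simp: mono_def le_fun_def)
  thus "(\<integral>\<^sup>+r. ?g (%k. ennreal (z ^ k)) om r \<partial>R) = (SUP m. \<integral>\<^sup>+r. ?g (?F m) om r \<partial>R)"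
   unfolding sup[symmetric] by (rule nn_integral_monotone_convergence_SUP) (rule meas[OF w])
 qed
 also have "... = (SUP m. palm_total (?F m))"
  unfolding palm_total_def
 proof (rule nn_integral_monotone_convergence_SUP[OF _ meas'])
  show "incseq (%m om. \<integral>\<^sup>+r. ?g (?F m) om r \<partial>R)"
   using mono by (auto simp: mono_def le_fun_def intro!: nn_integral_mono)
 qed
 finally obtain m where m: "ennreal h < palm_total (?F m)" using H by (auto simp: less_SUP_iff)
 have "palm_total (?F m) <= (\<integral>\<^sup>+om. (\<integral>\<^sup>+r. 1 \<partial>R) \<partial>M)"
  unfolding palm_total_def using z by (intro nn_integral_mono) (auto simp: Let_def power_le_one)
 hence le: "palm_total (?F m) <= 1" by (simp add: labels.emeasure_space_1 emeasure_space_1)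
 then obtain H where HH: "palm_total (?F m) = ennreal H" "0 <= H" by (cases "palm_total (?F m)") (auto simp: top_unique)
 thus thesis using that[of H m] m le h by (simp add: ennreal_less_iff)
qed

end

lemma eventually_exp_small:
 fixes a b c B :: real
 assumes "0 < a"
 shows "\<forall>\<^sub>F n in at_top. c * n powr b * exp (- (a * n)) <= n powr (- B)"
 using eventually_exp_powr_small[OF assms zero_less_one, of c b B] eventually_gt_at_top[of 0]
 by eventually_elim simp

context ksrg_bounds
begin

text \<open>If \<open>j\<close> hubs still miss a density above \<open>1 - \<rho>\<close>, at least
  \<open>Suc j\<close> vertices of mark above \<open>n powr (1 - \<epsilon>1)\<close> are needed,
  which has probability about \<open>n powr (- (\<tau> - 2) * Suc j)\<close> up to
  \<open>n powr \<epsilon>\<close>. All other failures are at most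
  \<open>n powr (- B)\<close>.\<close>

lemma prob_large_upper:
 assumes \<rho>: "0 < \<rho>" "\<rho> < 1" and \<epsilon>: "0 < \<epsilon>"
  and H: "ennreal (1 - \<rho>) < palm_total (%k. ennreal (((1 - p) ^ j) ^ k))"
 shows "\<exists>C>0. \<forall>\<^sub>F n in at_top. prob_large \<rho> n <= ennreal (C * n powr (- ((\<tau> - 2) * real (Suc j)) + \<epsilon>))"
proof -
 let ?z = "(1 - p) ^ j" and ?D = "CARD('d)"
 have z: "0 <= ?z" "?z <= 1" using p_pos p_le by (auto intro: power_le_one)
 obtain m H where H: "1 - \<rho> < H" "H <= 1" "palm_total (%k. if k <= m then ennreal (?z ^ k) else 0) = ennreal H"
 proof -
  have "0 <= 1 - \<rho>" using \<rho> by simp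
  from palm_total_truncate[OF z H this] show thesis using that by blast
 qed
 define F where "F k = (if k <= m then ennreal (?z ^ k) else 0)" for k
 have F: "!!k l. k <= l ==> F l <= F k" "!!k. F k <= 1" "palm_total F = ennreal H"
  using z H by (auto simp: F_def[abs_def] intro!: ennreal_leI power_decreasing power_le_one)
 \<comment> \<open>The excess of \<open>H\<close> over \<open>1 - \<rho>\<close> in eighths; four
   are spent on the cell means in \<open>S\<close>, the rest covers the budget
   \<open>num\<close>.\<close>
 define e where "e = (H - (1 - \<rho>)) / 8"
 have "8 * e = H - (1 - \<rho>)" by (simp add: e_def)
 hence e: "0 < e" "e <= 1 / 8" "H = 1 - \<rho> + 8 * e" using H(1,2) \<rho> by auto
 define B where "B = (\<tau> - 2) * real (Suc j)"
 \<comment> \<open>Lowering the hub threshold by \<open>\<epsilon>1\<close> raises the exponent by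
   \<open>real (Suc j) * (\<tau> - 1) * \<epsilon>1\<close>, which must not exceed
   \<open>\<epsilon>\<close>.\<close>
 define \<epsilon>1 where "\<epsilon>1 = min (1 / 2) (\<epsilon> / (real (Suc j) * (\<tau> - 1)))"
 \<comment> \<open>The three bounds serve the decay of the connection probability, the finite mark
   moment, and \<open>q > 0\<close>.\<close>
 define \<eta> where "\<eta> = min \<eta>\<^sub>0 (min ((\<tau> - 2) / 2) (\<epsilon>1 / 2))"
 define \<delta> where "\<delta> = \<epsilon>1 / 8"
 have \<epsilon>1: "0 < \<epsilon>1" "\<epsilon>1 <= 1 / 2" "real (Suc j) * (\<tau> - 1) * \<epsilon>1 <= \<epsilon>"
 proof -
  have "real (Suc j) * (\<tau> - 1) > 0" using tau by simp
  thus "0 < \<epsilon>1" using \<epsilon> by (simp add: \<epsilon>1_def)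
  show "\<epsilon>1 <= 1 / 2" unfolding \<epsilon>1_def by (rule min.cobounded1)
  have "\<epsilon>1 <= \<epsilon> / (real (Suc j) * (\<tau> - 1))" unfolding \<epsilon>1_def by (rule min.cobounded2)
  thus "real (Suc j) * (\<tau> - 1) * \<epsilon>1 <= \<epsilon>"
   using \<open>real (Suc j) * (\<tau> - 1) > 0\<close> by (simp only: pos_le_divide_eq mult.commute)
 qed
 have \<eta>: "0 < \<eta>" "\<eta> <= \<eta>\<^sub>0" "1 + \<eta> < \<tau> - 1" "\<eta> <= \<epsilon>1 / 2"
 proof -
  show "0 < \<eta>" using \<eta>\<^sub>0 tau \<epsilon>1 by (simp add: \<eta>_def)
  show "\<eta> <= \<eta>\<^sub>0" unfolding \<eta>_def by (rule min.cobounded1)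
  have "\<eta> <= min ((\<tau> - 2) / 2) (\<epsilon>1 / 2)" unfolding \<eta>_def by (rule min.cobounded2)
  hence "\<eta> <= (\<tau> - 2) / 2" "\<eta> <= \<epsilon>1 / 2" by simp_all
  have "(\<tau> - 2) / 2 < \<tau> - 2" using tau by simp
  with \<open>\<eta> <= (\<tau> - 2) / 2\<close> have "\<eta> < \<tau> - 2" by (rule le_less_trans)
  thus "1 + \<eta> < \<tau> - 1" by simp
  show "\<eta> <= \<epsilon>1 / 2" by fact
 qed
 have \<delta>: "0 < \<delta>" "\<delta> <= 1 / 16" using \<epsilon>1 by (auto simp: \<delta>_def)
 \<comment> \<open>The exponent of \<open>s / (t powr (1 + \<eta>) * A0)\<close> for
   \<open>s = n powr (1 - \<delta>)\<close>, \<open>t = n powr (1 - \<epsilon>1)\<close> and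
   \<open>A0 = n powr \<delta>\<close>; the choice of \<open>\<eta>\<close> and
   \<open>\<delta>\<close> keeps it at least \<open>\<epsilon>1 / 4\<close>.\<close>
 define q where "q = 1 - 2 * \<delta> - (1 - \<epsilon>1) * (1 + \<eta>)"
 have q: "0 < q"
 proof -
  have "0 <= \<epsilon>1 * \<eta>" using \<epsilon>1 \<eta> by simp
  thus ?thesis using \<eta>(4) \<epsilon>1(1) by (simp add: q_def \<delta>_def algebra_simps)
 qed
 obtain \<Psi> where \<Psi>: "1 <= \<Psi>" "!!F. finite F ==> (\<Sum>k\<in>F. spread \<eta> k) <= \<Psi>" using spread_sum[OF \<eta>(1)] by metis
 define \<Psi>D where "\<Psi>D = \<Psi> ^ ?D"
 have \<Psi>D: "0 < \<Psi>D" using \<Psi> by (simp add: \<Psi>D_def)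
 obtain K1 where K1: "(\<integral>\<^sup>+w. ennreal (if 1 <= w then w powr (1 + \<eta>) else 0) \<partial>\<mu>) = ennreal K1" "0 <= K1"
  using nn_integral_mark_moment[OF \<eta>(1,3)] by (cases "\<integral>\<^sup>+w. ennreal (if 1 <= w then w powr (1 + \<eta>) else 0) \<partial>\<mu>") auto
 define mm where "mm = real m + 1"
 have mm: "1 <= mm" "real m <= mm" by (auto simp: mm_def)
 \<comment> \<open>The decay says nothing about edges between two vertices of mark at least
   \<open>m'\<close>, so these must be rare even after the factor \<open>mm\<close> of spoiled
   vertices. The constant \<open>C\<close> depends on \<open>m'\<close> and is obtained
   afterwards.\<close>
 obtain m' where m': "1 <= m'" "m' powr (- (\<tau> - 1)) <= e / (16 * mm)"
 proof -
  have "((%x :: real. x powr (- (\<tau> - 1))) \<longlongrightarrow> 0) at_top" using tau by real_asymp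
  hence "\<forall>\<^sub>F x in at_top. x powr (- (\<tau> - 1)) <= e / (16 * mm)"
   using e mm by (intro eventually_le_if_tendsto_0) auto
  hence "\<forall>\<^sub>F x in at_top. 1 <= x & x powr (- (\<tau> - 1)) <= e / (16 * mm)"
   using eventually_ge_at_top[of 1] by eventually_elim auto
  thus thesis using that eventually_happens'[OF trivial_limit_at_top_linorder] by blast
 qed
 obtain C where C: "0 <= C" "!!y w y' w'. y ~= y' ==> 1 <= w ==> w <= m' ==> 1 <= w' ==>
    c y w y' w' <= C * w' powr (1 + \<eta>) * max 1 (dist y y') powr (- (real ?D * (1 + \<eta>)))"
  using conn_decay[OF \<eta>(1,2) m'(1)] by blast
 \<comment> \<open>The density allowed for the decay weight between cubes: it enters the budget with
   the factor \<open>mm * (8 * C * K1)\<close> and may cost \<open>e / 4\<close>.\<close>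
 define e3 where "e3 = e / (32 * (C + 1) * (K1 + 1) * mm)"
 have e3: "0 < e3" "mm * (8 * C * K1 * e3) <= e / 4"
 proof -
  show "0 < e3" using e C K1 mm by (auto simp: e3_def intro!: divide_pos_pos mult_pos_pos)
  define Y where "Y = (C + 1) * (K1 + 1)"
  have "C * K1 <= Y" unfolding Y_def using C K1 by (intro mult_mono) auto
  moreover have Y: "Y > 0" unfolding Y_def using C K1 by (intro mult_pos_pos) auto
  ultimately have "e / 4 * (C * K1 / Y) <= e / 4 * 1" using e by (intro mult_left_mono) auto
  moreover have "e3 = e / (32 * Y * mm)" by (simp only: e3_def Y_def mult.assoc)
  hence "mm * (8 * C * K1 * e3) = e / 4 * (C * K1 / Y)" using mm Y by simp
  ultimately show "mm * (8 * C * K1 * e3) <= e / 4" by simp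
 qed
 \<comment> \<open>Half of \<open>e3\<close> pays for twice the mean of the squared counts, the
   other half is the deviation allowed in \<open>B4\<close>.\<close>
 define e2 where "e2 = e3 / (8 * exp 2 * 2 ^ ?D)"
 have e2: "0 < e2" "4 * exp 2 * e2 * 2 ^ ?D = e3 / 2" using e3 by (auto simp: e2_def)
 obtain L where L: "0 < L" "!!h. (\<Sum>a\<in>UNIV \<rightarrow>\<^sub>E {- int (h * L)..<int (h * L)}. cross_weight \<eta> L {- int (h * L)..<int (h * L)} (a :: 'd => int)) <=
   e2 * (2 * real (h * L)) ^ ?D" using cross_weight_small[OF \<eta>(1) e2(1)] by metis
 define V where "V = real L ^ ?D"
 have V: "1 <= V" using L(1) by (simp add: V_def)
 \<comment> \<open>Chosen so that truncating the count of a cube costs exactly \<open>e\<close> in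
   the mean, which is at most \<open>e * V\<close>.\<close>
 define A where "A = 2 * exp (2 * V) / e"
 have A: "0 < A" "2 * exp (2 * V) / A = e" using e by (auto simp: A_def)
 have ev1: "\<forall>\<^sub>F n in at_top. 1 * n powr 0 * exp (- ((e / 2)\<^sup>2 / 4 * n)) <= n powr (- B)"
  using e by (intro eventually_exp_small) auto
 have ev2: "\<forall>\<^sub>F n in at_top. 1 * n powr 0 * exp (- (e * e / A * n)) <= n powr (- B)"
  using e A by (intro eventually_exp_small) auto
 have ev3: "\<forall>\<^sub>F n in at_top. (2 ^ ?D * exp 2) * n powr 1 * exp (- (1 * n powr \<delta>)) <= n powr (- B)"
  using \<delta> by (intro eventually_exp_powr_small) auto
 have ev4: "\<forall>\<^sub>F n in at_top. 1 * n powr 0 * exp (- (e3 / 2 / \<Psi>D * n powr (1 - 2 * \<delta>))) <= n powr (- B)"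
  using \<delta> e3 \<Psi>D by (intro eventually_exp_powr_small) auto
 have ev5: "\<forall>\<^sub>F n in at_top. (real (Suc j) * 3 ^ j) * n powr (real j) * exp (- (e * e / A * n)) <= n powr (- B)"
  using e A by (intro eventually_exp_small) auto
 have ev6: "\<forall>\<^sub>F n in at_top. 2 * n powr 0 * exp (- (1 * n powr (1 - \<delta>))) <= n powr (- B)"
  using \<delta> by (intro eventually_exp_powr_small) auto
 have ev7: "\<forall>\<^sub>F n in at_top. 1 * n powr 0 * exp (- (1 / \<Psi>D * n powr q)) <= n powr (- B)"
  using q \<Psi>D by (intro eventually_exp_powr_small) auto
 have ev8: "\<forall>\<^sub>F n in at_top. mm * (3 + 4 * C) * n powr (1 - \<delta>) <= e / 4 * n"
 proof -
  have "((%n. (mm * (3 + 4 * C)) * n powr (- \<delta>)) \<longlongrightarrow> (mm * (3 + 4 * C)) * 0) at_top"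
   using \<delta> by (intro tendsto_intros tendsto_neg_powr filterlim_ident) auto
  hence "\<forall>\<^sub>F n in at_top. (mm * (3 + 4 * C)) * n powr (- \<delta>) <= e / 4"
   using e by (intro eventually_le_if_tendsto_0) auto
  thus ?thesis using eventually_gt_at_top[of 0]
  proof eventually_elim
   case (elim n)
   have "(mm * (3 + 4 * C)) * n powr (- \<delta>) * n <= e / 4 * n" using elim by (intro mult_right_mono) auto
   moreover have "n powr (- \<delta>) * n = n powr (1 - \<delta>)" using elim by (simp add: powr_diff powr_minus field_simps)
   ultimately show ?case by (simp only: mult.assoc)
  qed
 qed
 have ev9: "\<forall>\<^sub>F n :: real in at_top. real j * A <= e / 4 * n" using e by real_asymp
 have ev10: "\<forall>\<^sub>F n :: real in at_top. real m <= \<rho> * n" using \<rho> by real_asymp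
 have ev11: "\<forall>\<^sub>F n in at_top. real (card (inner_cells L n :: ('d => int) set)) * V <= n &
  (1 - e) * n <= real (card (inner_cells L n :: ('d => int) set)) * V"
  unfolding V_def using e L(1) by (intro eventually_inner_cells) auto
 have ev12: "\<forall>\<^sub>F n in at_top. (2 * real (outer_range ?D L n * L)) ^ ?D <= 2 ^ ?D * n"
  by (rule eventually_outer_range[OF L(1)])
 have ev13: "\<forall>\<^sub>F n :: real in at_top. 1 <= n" by (rule eventually_ge_at_top)
 \<comment> \<open>The 7 counts the four sets of bad locations and the three smaller error terms of
   \<open>prob_large_le\<close>.\<close>
 have "\<forall>\<^sub>F n in at_top. prob_large \<rho> n <= ennreal ((2 ^ Suc j + 7) * n powr (- ((\<tau> - 2) * real (Suc j)) + \<epsilon>))"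
  using ev1 ev2 ev3 ev4 ev5 ev6 ev7 ev8 ev9 ev10 ev11 ev12 ev13
 proof eventually_elim
  case (elim n)
  let ?Q = "inner_cells L n :: ('d => int) set"
  let ?bx = "volume_box n :: (real ^ 'd) set"
  let ?N = "%om. real (card (P ?bx om))"
  let ?Nq = "%q om. real (card (P (cube L q) om))"
  let ?Na = "%a om. real (card (P (cube 1 a) om))"
  define Hn where "Hn = {- int (outer_range ?D L n * L)..<int (outer_range ?D L n * L)}"
  define G where "G = (UNIV \<rightarrow>\<^sub>E Hn :: ('d => int) set)"
  define cw where "cw a = cross_weight \<eta> L Hn a" for a :: "'d => int"
  have n: "0 < n" "1 <= n" using elim(13) by auto
  have finQ: "finite ?Q" by (rule finite_inner_cells)
  have finG: "finite G" unfolding G_def Hn_def by (intro finite_PiE) auto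
  have cardG: "real (card G) <= 2 ^ ?D * n"
  proof -
   have "card G = card Hn ^ ?D" unfolding G_def by (subst card_PiE) auto
   hence "real (card G) = (2 * real (outer_range ?D L n * L)) ^ ?D" by (simp add: Hn_def mult_ac)
   thus ?thesis using elim(12) by simp
  qed
  have cb: "cube L q \<in> sets borel" "bounded (cube L q)" for q :: "'d => int" using L(1) by (auto intro: bounded_cube)
  have cb1: "cube 1 a \<in> sets borel" "bounded (cube 1 a)" for a :: "'d => int" by (auto intro: bounded_cube)
  have bxn: "measure lborel ?bx = n" using n by (simp add: measure_volume_box)
  have cw0: "0 <= cw a" for a unfolding cw_def by (rule cross_weight_nonneg)
  have cw1: "cw a <= \<Psi>D" for a
  proof -
   have "cw a <= (\<Sum>b\<in>G. \<Prod>i\<in>UNIV. spread \<eta> (a i - b i))"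
    unfolding cw_def cross_weight_def G_def[symmetric] using finG by (intro sum_mono2) (auto intro!: prod_nonneg)
   also have "... <= \<Psi>D" unfolding G_def \<Psi>D_def by (rule sum_prod_spread[OF \<Psi>(2)]) (auto simp: Hn_def)
   finally show ?thesis .
  qed
  have cwS: "(\<Sum>a\<in>G. cw a) <= e2 * (2 ^ ?D * n)"
  proof -
   have "(\<Sum>a\<in>G. cw a) <= e2 * (2 * real (outer_range ?D L n * L)) ^ ?D"
    unfolding cw_def G_def Hn_def by (rule L(2))
   also have "... <= e2 * (2 ^ ?D * n)" using elim(12) e2(1) by (intro mult_left_mono) auto
   finally show ?thesis .
  qed
  \<comment> \<open>The bound on the points of a unit cube may grow with \<open>n\<close>, as long
    as the exponents \<open>q\<close> and \<open>1 - 2 * \<delta>\<close> stay positive.\<close>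
  define A0 where "A0 = n powr \<delta>"
  have A0: "0 < A0" using n by (simp add: A0_def)
  define X0 where "X0 = (1 - e) * (card ?Q * (real L ^ ?D * H - 2 * exp (2 * real L ^ ?D) / A)) - e * n"
  define B1 where "B1 = {om \<in> space M. (1 + e / 2) * measure lborel ?bx <= ?N om}"
  define B2 where "B2 = {om \<in> space M. (\<Sum>q\<in>?Q. if ?Nq q om <= A then enn2real (cell_sum F (cube L q) om) else 0) <= X0}"
  define B3 where "B3 a = {om \<in> space M. A0 <= ?Na a om}" for a :: "'d => int"
  define B4 where "B4 = {om \<in> space M. (1 + 1) * (2 * exp 2 * (e2 * (2 ^ ?D * n))) + e3 * n / 2 <=
    (\<Sum>a\<in>G. if ?Na a om <= A0 then (?Na a om)\<^sup>2 * cw a else 0)}"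
  define BB where "BB = B1 \<union> B2 \<union> (\<Union>a\<in>G. B3 a) \<union> B4"
  have mN: "(%om. ?N om) \<in> borel_measurable M" "(%om. ?Nq q om) \<in> borel_measurable M" "(%om. ?Na a om) \<in> borel_measurable M"
   "cell_sum F (cube L q) \<in> borel_measurable M" for q a
   using cb cb1 by (auto intro!: measurable_card_real cell_sum_measurable)
  note [measurable] = mN
  have sB: "B1 \<in> sets M" "B2 \<in> sets M" "B3 a \<in> sets M" "B4 \<in> sets M" for a
   unfolding B1_def B2_def B3_def B4_def by measurable
  have sBB: "BB \<in> sets M" unfolding BB_def using sB finG by auto
  have p1: "prob B1 <= n powr (- B)"
  proof -
   have "prob B1 <= exp (- ((e / 2)\<^sup>2 / 4) * measure lborel ?bx)"
    unfolding B1_def by (rule prob_card_ge) (use e bounded_volume_box in auto)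
   thus ?thesis using elim(1) n unfolding bxn by simp
  qed
  have p2: "prob B2 <= n powr (- B)"
  proof -
   have "prob B2 <= exp (- (e * (e * n) / A))"
    unfolding B2_def X0_def by (rule prob_truncated_cell_sums[OF finQ L(1) F(1,2) _ _ A(1)]) (use F(3) H \<rho> e in auto)
   thus ?thesis using elim(2) n by (simp add: mult.assoc)
  qed
  have p3: "prob (\<Union>a\<in>G. B3 a) <= n powr (- B)"
  proof -
   have "prob (\<Union>a\<in>G. B3 a) <= (\<Sum>a\<in>G. prob (B3 a))"
    using finG sB by (intro finite_measure_subadditive_finite) auto
   also have "... <= (\<Sum>a\<in>G. exp 2 * exp (- A0))"
   proof (rule sum_mono)
    fix a :: "'d => int"
    show "prob (B3 a) <= exp 2 * exp (- A0)"
     using prob_card_large[OF cb1[of a], of A0] unfolding B3_def by (simp add: measure_cube)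
   qed
   also have "... = real (card G) * (exp 2 * exp (- A0))" by simp
   also have "... <= 2 ^ ?D * n * (exp 2 * exp (- A0))" using cardG by (intro mult_right_mono) auto
   also have "... <= n powr (- B)" using elim(3) n by (simp add: A0_def mult_ac)
   finally show ?thesis .
  qed
  have p4: "prob B4 <= n powr (- B)"
  proof -
   have "prob B4 <= exp (- ((e3 * n / 2) / (A0\<^sup>2 * \<Psi>D)))"
    unfolding B4_def by (rule prob_cell_squares[OF finG cw0 cw1 cwS A0 \<Psi>D])
   moreover have "(e3 * n / 2) / (A0\<^sup>2 * \<Psi>D) = e3 / 2 / \<Psi>D * n powr (1 - 2 * \<delta>)"
   proof -
    have "A0\<^sup>2 = n powr (2 * \<delta>)" unfolding A0_def using n by (simp add: power2_eq_square powr_add[symmetric])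
    thus ?thesis using n by (simp add: powr_diff)
   qed
   ultimately show ?thesis using elim(4) n by simp
  qed
  have pBB: "prob BB <= 4 * n powr (- B)"
  proof -
   have "prob BB <= prob B1 + prob B2 + prob (\<Union>a\<in>G. B3 a) + prob B4"
    unfolding BB_def using sB finG by (intro order_trans[OF measure_Un_le] add_mono order_refl) auto
   thus ?thesis using p1 p2 p3 p4 by linarith
  qed
  let ?v = "2 ^ Suc j * n powr (- B + \<epsilon>) + 3 * n powr (- B)"
  have main: "labels.prob {r \<in> space R. large \<rho> n om r} <= ?v"
   if w: "om \<in> space M" "om \<notin> BB" and inj: "inj_on (%i. X i om) (P ?bx om)" for om
  proof -
   let ?I = "P ?bx om"
   let ?Qs = "{q \<in> ?Q. ?Nq q om <= A}"
   let ?crs = "%i l. separated L (cell_of (X i om)) (cell_of (X l om))"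
   let ?s = "n powr (1 - \<delta>)" and ?t = "n powr (1 - \<epsilon>1)"
   have finI: "finite ?I" by (intro finite_pts bounded_volume_box)
   have w1: "om \<notin> B1" and w2: "om \<notin> B2" and w3: "!!a. a \<in> G ==> om \<notin> B3 a" and w4: "om \<notin> B4"
    using w(2) by (auto simp: BB_def)
   have N: "?N om <= (1 + e / 2) * n"
   proof -
    have "\<not> (1 + e / 2) * n <= ?N om" using w1 w(1) unfolding B1_def bxn by blast
    thus ?thesis by linarith
   qed
   have N2: "?N om <= 2 * n" using N e n mult_right_mono[of "1 + e / 2" 2 n] by linarith
   have Na: "?Na a om <= A0" if "a \<in> G" for a
   proof -
    have "\<not> A0 <= ?Na a om" using w3[OF that] w(1) unfolding B3_def by blast
    thus ?thesis by linarith
   qed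
   have cells: "cell_of (X i om) \<in> G" if "i \<in> ?I" for i
    using cell_of_volume_box[of "X i om" n L] that L(1) unfolding G_def Hn_def pts_def by simp
   have card_cell: "real (card {i \<in> ?I. cell_of (X i om) = a}) <= ?Na a om" for a
   proof -
    have "{i \<in> ?I. cell_of (X i om) = a} \<subseteq> P (cube 1 a) om" unfolding pts_def cube_1 by blast
    thus ?thesis using card_mono[OF finite_pts[OF cb1(2)]] by simp
   qed
   have SG: "(\<Sum>i\<in>?I. \<Sum>l\<in>{l \<in> ?I. ?crs i l}. max 1 (dist (X i om) (X l om)) powr (- (real ?D * (1 + \<eta>)))) <= e3 * n"
   proof -
    have "(\<Sum>i\<in>?I. \<Sum>l\<in>{l \<in> ?I. ?crs i l}. max 1 (dist (X i om) (X l om)) powr (- (real ?D * (1 + \<eta>)))) <=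
     (\<Sum>a\<in>UNIV \<rightarrow>\<^sub>E Hn. (?Na a om)\<^sup>2 * cross_weight \<eta> L Hn a)"
     by (rule cross_decay(2)[OF \<eta>(1) \<Psi>(2) finI]) (use cells card_cell in \<open>auto simp: G_def Hn_def\<close>)
    also have "... = (\<Sum>a\<in>G. if ?Na a om <= A0 then (?Na a om)\<^sup>2 * cw a else 0)"
     unfolding G_def[symmetric] cw_def[symmetric] using Na by (intro sum.cong refl) simp
    also have "... <= (1 + 1) * (2 * exp 2 * (e2 * (2 ^ ?D * n))) + e3 * n / 2"
    proof -
     have "\<not> (1 + 1) * (2 * exp 2 * (e2 * (2 ^ ?D * n))) + e3 * n / 2 <= (\<Sum>a\<in>G. if ?Na a om <= A0 then (?Na a om)\<^sup>2 * cw a else 0)"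
      using w4 w(1) unfolding B4_def by blast
     thus ?thesis by linarith
    qed
    also have "(1 + 1) * (2 * exp 2 * (e2 * (2 ^ ?D * n))) = (4 * exp 2 * e2 * 2 ^ ?D) * n" by simp
    also have "... = e3 / 2 * n" unfolding e2(2) ..
    finally show ?thesis by simp
   qed
   have S: "ennreal ((H - 4 * e) * n) <= (\<Sum>q\<in>?Qs. cell_sum F (cube L q) om)"
   proof -
    have cfin: "ennreal (enn2real (cell_sum F (cube L q) om)) = cell_sum F (cube L q) om" for q
     using le_less_trans[OF cell_sum_le_card[OF F(2)] ennreal_less_top] by simp
    have "X0 < (\<Sum>q\<in>?Q. if ?Nq q om <= A then enn2real (cell_sum F (cube L q) om) else 0)"
     using w2 w(1) unfolding B2_def by (simp add: not_le)
    also have "... = (\<Sum>q\<in>?Qs. enn2real (cell_sum F (cube L q) om))" using finQ by (rule sum.inter_filter[symmetric])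
    finally have 1: "X0 < (\<Sum>q\<in>?Qs. enn2real (cell_sum F (cube L q) om))" .
    have "(H - 4 * e) * n <= X0"
    proof -
     have He: "0 <= H - e" using e \<rho> by simp
     have "(1 - e) * n * (H - e) <= real (card ?Q) * V * (H - e)" using elim(11) He by (intro mult_right_mono) auto
     also have "... <= real (card ?Q) * (V * H - e)"
     proof -
      have "e * 1 <= e * V" using V e by (intro mult_left_mono) auto
      hence "V * (H - e) <= V * H - e" by (simp add: algebra_simps)
      hence "real (card ?Q) * (V * (H - e)) <= real (card ?Q) * (V * H - e)" by (intro mult_left_mono) auto
      thus ?thesis by (simp only: mult.assoc)
     qed
     finally have "(1 - e) * ((1 - e) * n * (H - e)) <= (1 - e) * (real (card ?Q) * (V * H - e))" using e by (intro mult_left_mono) auto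
     hence X: "(1 - e) * (1 - e) * (H - e) * n - e * n <= X0"
      unfolding X0_def V_def[symmetric] A(2) by (simp add: mult_ac)
     have "(1 - 2 * e) * (H - e) <= (1 - e) * (1 - e) * (H - e)"
      using He by (intro mult_right_mono) (auto simp: algebra_simps)
     moreover have "H - 3 * e <= (1 - 2 * e) * (H - e)"
     proof -
      have "e * H <= e * 1" using H(2) e by (intro mult_left_mono) auto
      moreover have "0 <= e * e" by simp
      moreover have "(1 - 2 * e) * (H - e) = H - e - 2 * (e * H) + 2 * (e * e)" by (simp add: algebra_simps)
      ultimately show ?thesis by linarith
     qed
     ultimately have "(H - 3 * e) * n <= (1 - e) * (1 - e) * (H - e) * n" using n by (intro mult_right_mono) auto
     thus ?thesis using X by (simp add: algebra_simps)
    qed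
    hence "ennreal ((H - 4 * e) * n) <= ennreal (\<Sum>q\<in>?Qs. enn2real (cell_sum F (cube L q) om))"
     using 1 by (intro ennreal_leI) linarith
    also have "... = (\<Sum>q\<in>?Qs. ennreal (enn2real (cell_sum F (cube L q) om)))" by (rule sum_ennreal[symmetric]) simp
    finally show ?thesis by (simp only: cfin)
   qed
   \<comment> \<open>In units of \<open>n\<close> the left side is at most
     \<open>1 + e / 2 + 3 / 4 * e\<close>; the right side is at least
     \<open>\<rho> + (H - 5 * e) - e / 4 - e = 1 + 7 / 4 * e\<close>.\<close>
   have num: "?N om + m * (2 * (?N om * m' powr (- (\<tau> - 1))) + ?s + 2 * (2 * (C * (2 * (K1 * (e3 * n)) + ?s)) + ?s)) <=
    \<rho> * n + ((1 - e) * ((H - 4 * e) * n - j * A) - e * n)"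
   proof -
    let ?b = "2 * (?N om * m' powr (- (\<tau> - 1))) + ?s + 2 * (2 * (C * (2 * (K1 * (e3 * n)) + ?s)) + ?s)"
    have "0 <= ?b" using C K1 e3 n by (intro add_nonneg_nonneg mult_nonneg_nonneg) auto
    hence "m * ?b <= mm * ?b" using mm by (intro mult_right_mono) auto
    also have "... = mm * (2 * ?N om * m' powr (- (\<tau> - 1))) + mm * (8 * C * K1 * e3) * n + mm * (3 + 4 * C) * ?s"
     by (simp add: algebra_simps)
    also have "... <= e / 4 * n + e / 4 * n + e / 4 * n"
    proof (intro add_mono)
     have "mm * (2 * ?N om * m' powr (- (\<tau> - 1))) <= mm * (2 * (2 * n) * (e / (16 * mm)))"
      using N2 m' mm n by (intro mult_left_mono mult_mono) auto
     also have "... = e / 4 * n" using mm by (simp add: field_simps)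
     finally show "mm * (2 * ?N om * m' powr (- (\<tau> - 1))) <= e / 4 * n" .
     show "mm * (8 * C * K1 * e3) * n <= e / 4 * n" using e3(2) n by (intro mult_right_mono) auto
     show "mm * (3 + 4 * C) * ?s <= e / 4 * n" by (rule elim(8))
    qed
    finally have mb: "m * ?b <= 3 / 4 * (e * n)" by simp
    have "(1 - e) * (real j * A) <= 1 * (real j * A)" using e A by (intro mult_right_mono) auto
    hence jA: "(1 - e) * (real j * A) <= e * n / 4" using elim(9) by simp
    have "e * ((H - 4 * e) * n) <= e * (1 * n)" using H(2) e n by (intro mult_left_mono mult_right_mono) auto
    hence "(1 - e) * ((H - 4 * e) * n) \<ge> (H - 5 * e) * n" by (simp add: algebra_simps)
    hence "(1 - e) * ((H - 4 * e) * n - j * A) \<ge> (H - 5 * e) * n - e * n / 4"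
     using jA by (simp add: right_diff_distrib)
    moreover have "(H - 5 * e) * n = n - \<rho> * n + 3 * (e * n)" unfolding e(3) by (simp add: algebra_simps)
    moreover have "?N om <= n + e * n / 2" using N by (simp add: algebra_simps)
    moreover have "0 <= e * n" using e n by simp
    ultimately show ?thesis using mb by linarith
   qed
   have "labels.prob {r \<in> space R. \<exists>i\<in>?I. \<rho> * n < card (comp_of c (vpos (%i. X i om)) (fst r) (snd r) (Point ` ?I) (Point i))} <=
    (card ?I * ?t powr (- (\<tau> - 1))) ^ Suc j + real (Suc j * Suc (card ?I) ^ j) * exp (- (e * (e * n) / A)) +
    (2 * exp (- ?s) + exp (- (?s / (?t powr (1 + \<eta>) * (A0 * \<Psi>D)))))"
   proof (rule prob_large_le[where Qs="?Qs" and Cq="%q. P (cube L q) om" and crs="?crs" and m=m and S="(H - 4 * e) * n" and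
      C=C and ?K1.0=K1 and SG="e3 * n" and m'=m'])
    show "disjoint_family_on (%q. P (cube L q) om) ?Qs" by (rule disjoint_family_pts_cube)
    show "P (cube L q) om \<subseteq> ?I" if "q \<in> ?Qs" for q
     using cube_subset_volume_box[of q L n] L(1) that by (auto simp: pts_def)
    show "ennreal ((H - 4 * e) * n) <= (\<Sum>q\<in>?Qs. \<Sum>i\<in>P (cube L q) om. comp_mean (%k. if k <= m then ennreal (?z ^ k) else 0)
      (vpos (%i. X i om)) (Point ` P (cube L q) om) (Point i))"
     using S unfolding cell_sum_def F_def[abs_def] .
    show "?crs i l \<longleftrightarrow> ?crs l i" for i l unfolding separated_def by metis
    show "\<not> ?crs i i" for i by (simp add: separated_def)
    show "?crs i l" if "i \<in> P (cube L q) om" "l \<notin> P (cube L q) om" for q i l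
     using that unfolding pts_def cube_def separated_def cell_of_def mem_Collect_eq by metis
    show "1 <= ?t" using n \<epsilon>1 by (intro ge_one_powr_ge_zero) auto
    show "c y w y' w' <= C * w' powr (1 + \<eta>) * max 1 (dist y y') powr (- (real ?D * (1 + \<eta>)))"
     if "y ~= y'" "1 <= w" "w <= m'" "1 <= w'" for y w y' w' by (rule C(2)[OF that])
    show "(\<Sum>l\<in>{l \<in> ?I. ?crs i l}. max 1 (dist (X i om) (X l om)) powr (- (real ?D * (1 + \<eta>)))) <= A0 * \<Psi>D" if i: "i \<in> ?I" for i
     unfolding \<Psi>D_def
     by (rule cross_decay(1)[where N="%a. ?Na a om" and H=Hn, OF \<eta>(1) \<Psi>(2) finI])
      (use cells card_cell Na i in \<open>auto simp: G_def Hn_def\<close>)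
    show "?N om + m * (2 * (?N om * m' powr (- (\<tau> - 1))) + ?s + 2 * (2 * (C * (2 * (K1 * (e3 * n)) + ?s)) + ?s)) <=
     \<rho> * n + ((1 - e) * ((H - 4 * e) * n - j * A) - e * n)" by (rule num)
   qed (use inj finI finQ A e m' C n \<eta> K1 SG A0 \<Psi>D elim(10) in auto)
   also have "... <= 2 ^ Suc j * n powr (- B + \<epsilon>) + n powr (- B) + (n powr (- B) + n powr (- B))"
   proof (intro add_mono)
    have "?t powr (- (\<tau> - 1)) = n powr (- (1 - \<epsilon>1) * (\<tau> - 1))"
     by (simp only: powr_powr mult_minus_left mult_minus_right)
    hence "(card ?I * ?t powr (- (\<tau> - 1))) ^ Suc j <= (2 * n * n powr (- (1 - \<epsilon>1) * (\<tau> - 1))) ^ Suc j"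
     using N2 by (simp only:) (intro power_mono mult_right_mono, auto)
    also have "... = 2 ^ Suc j * (n * n powr (- (1 - \<epsilon>1) * (\<tau> - 1))) ^ Suc j"
     by (simp only: power_mult_distrib mult.assoc)
    also have "n * n powr (- (1 - \<epsilon>1) * (\<tau> - 1)) = n powr (1 + (- (1 - \<epsilon>1) * (\<tau> - 1)))"
     using n by (simp only: powr_add powr_one less_imp_le)
    also have "... ^ Suc j = n powr ((1 + (- (1 - \<epsilon>1) * (\<tau> - 1))) * real (Suc j))"
     using n by (subst powr_realpow[symmetric]) (simp_all only: powr_gt_zero powr_powr)
    also have "2 ^ Suc j * n powr ((1 + (- (1 - \<epsilon>1) * (\<tau> - 1))) * real (Suc j)) <= 2 ^ Suc j * n powr (- B + \<epsilon>)"
    proof (intro mult_left_mono powr_mono)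
     have "(1 + (- (1 - \<epsilon>1) * (\<tau> - 1))) * real (Suc j) = - B + real (Suc j) * (\<tau> - 1) * \<epsilon>1"
      unfolding B_def by (simp add: algebra_simps)
     thus "(1 + (- (1 - \<epsilon>1) * (\<tau> - 1))) * real (Suc j) <= - B + \<epsilon>" using \<epsilon>1(3) by linarith
    qed (use n in auto)
    finally show "(card ?I * ?t powr (- (\<tau> - 1))) ^ Suc j <= 2 ^ Suc j * n powr (- B + \<epsilon>)" .
    have "real (Suc j * Suc (card ?I) ^ j) * exp (- (e * (e * n) / A)) <= (real (Suc j) * (3 * n) ^ j) * exp (- (e * e / A * n))"
     unfolding of_nat_mult of_nat_power using N2 n by (intro mult_mono power_mono) auto
    also have "(3 * n) ^ j = 3 ^ j * n powr real j" using n by (simp add: power_mult_distrib powr_realpow)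
    finally show "real (Suc j * Suc (card ?I) ^ j) * exp (- (e * (e * n) / A)) <= n powr (- B)"
     using elim(5) by (simp only: mult.assoc)
    show "2 * exp (- ?s) <= n powr (- B)" using elim(6) n by simp
    have "?t powr (1 + \<eta>) * (A0 * \<Psi>D) = n powr ((1 - \<epsilon>1) * (1 + \<eta>) + \<delta>) * \<Psi>D"
     unfolding A0_def powr_powr powr_add[of n "(1 - \<epsilon>1) * (1 + \<eta>)" \<delta>] mult.assoc ..
    hence "?s / (?t powr (1 + \<eta>) * (A0 * \<Psi>D)) = 1 / \<Psi>D * (n powr (1 - \<delta>) / n powr ((1 - \<epsilon>1) * (1 + \<eta>) + \<delta>))" by simp
    also have "n powr (1 - \<delta>) / n powr ((1 - \<epsilon>1) * (1 + \<eta>) + \<delta>) = n powr q"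
     unfolding q_def powr_diff[symmetric] by (simp add: algebra_simps)
    finally show "exp (- (?s / (?t powr (1 + \<eta>) * (A0 * \<Psi>D)))) <= n powr (- B)" using elim(7) n by simp
   qed
   also have "... = ?v" by simp
   finally show ?thesis unfolding large_def .
  qed
  have "prob_large \<rho> n <= (\<integral>\<^sup>+om. indicator BB om + ennreal ?v \<partial>M)"
   unfolding prob_large_def
  proof (rule nn_integral_mono_AE)
   have "AE om in M. inj_on (%i. X i om) (P ?bx om)" by (rule AE_distinct_points) (auto simp: bounded_volume_box)
   moreover have "AE om in M. om \<in> space M" by simp
   ultimately show "AE om in M. ennreal (labels.prob {r \<in> space R. large \<rho> n om r}) <= indicator BB om + ennreal ?v"
   proof eventually_elim
    case (elim om)
    show ?case
    proof (cases "om \<in> BB")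
     case True
     have "ennreal (labels.prob {r \<in> space R. large \<rho> n om r}) <= 1"
      using labels.prob_le_1 by (simp add: ennreal_le_1)
     thus ?thesis using True by (simp add: add_increasing2)
    next
     case False
     show ?thesis using ennreal_leI[OF main[OF elim(2) False elim(1)]]
      by (simp only: indicator_simps(2)[OF False] add_0_left)
    qed
   qed
  qed
  also have "... = ennreal (prob BB) + ennreal ?v"
   using sBB by (simp add: nn_integral_add emeasure_eq_measure prob_space del: ennreal_plus)
  also have "... = ennreal (prob BB + ?v)" by (intro ennreal_plus[symmetric]) auto
  also have "... <= ennreal ((2 ^ Suc j + 7) * n powr (- B + \<epsilon>))"
  proof (rule ennreal_leI)
   have "n powr (- B) <= n powr (- B + \<epsilon>)" using n \<epsilon> by (intro powr_mono) auto
   thus "prob BB + ?v <= (2 ^ Suc j + 7) * n powr (- B + \<epsilon>)" using pBB unfolding distrib_right by linarith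
  qed
  finally show ?case unfolding B_def .
 qed
 moreover have "(0 :: real) < 2 ^ Suc j + 7" by (simp add: add_pos_pos)
 ultimately show ?thesis by blast
qed

end

section \<open>The connection probabilities\<close>

lemma kernel_fun_sym: "kernel_fun d K w w' = kernel_fun d K w' w"
 by (cases K) (simp_all add: max.commute min.commute add.commute)

lemma kernel_fun_ge:
 assumes "kernel_sigma K \<ge> 0" "1 <= w" "1 <= w'" "0 < d"
 shows "w <= kernel_fun d K w w'"
proof (cases K)
 case (Kernel_prod \<sigma>)
 have "1 <= min w w' powr \<sigma>" using assms Kernel_prod by (intro ge_one_powr_ge_zero) auto
 hence "max w w' * 1 <= max w w' * min w w' powr \<sigma>" using assms by (intro mult_left_mono) auto
 thus ?thesis using Kernel_prod by simp
next
 case Kernel_sum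
 have "w = (w powr (1 / real d)) ^ d" using root_power[of w d] assms by simp
 also have "... <= (w powr (1 / real d) + w' powr (1 / real d)) ^ d" by (intro power_mono) auto
 finally show ?thesis using Kernel_sum by simp
qed

text \<open>With one mark bounded, both kernels grow at most linearly in the other mark; this is the
  source of \<open>w' powr (1 + \<eta>)\<close> in the decay.\<close>

lemma kernel_fun_le:
 assumes "kernel_sigma K \<ge> 0" "1 <= m" "0 < d"
 obtains B where "0 < B" "!!w w'. 1 <= w ==> w <= m ==> 1 <= w' ==> kernel_fun d K w w' <= B * w'"
proof (cases K)
 case (Kernel_prod \<sigma>)
 show thesis
 proof (rule that)
  show "0 < m * m powr \<sigma>" using assms by simp
  fix w w' :: real assume w: "1 <= w" "w <= m" "1 <= w'"
  have "w <= m * w'" using mult_mono[of w m 1 w'] w by simp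
  moreover have "w' <= m * w'" using mult_right_mono[of 1 m w'] w by simp
  ultimately have "max w w' <= m * w'" by simp
  moreover have "min w w' powr \<sigma> <= m powr \<sigma>" using assms Kernel_prod w by (intro powr_mono2) auto
  ultimately have "max w w' * min w w' powr \<sigma> <= (m * w') * m powr \<sigma>" using w assms by (intro mult_mono) auto
  thus "kernel_fun d K w w' <= m * m powr \<sigma> * w'" using Kernel_prod by (simp add: mult_ac)
 qed
next
 case Kernel_sum
 show thesis
 proof (rule that)
  show "0 < (m powr (1 / real d) + 1) ^ d" by (intro zero_less_power add_nonneg_pos) auto
  fix w w' :: real assume w: "1 <= w" "w <= m" "1 <= w'"
  have 1: "1 <= w' powr (1 / real d)" using w by (intro ge_one_powr_ge_zero) auto
  have "w powr (1 / real d) <= m powr (1 / real d) * 1" using w assms by (auto intro!: powr_mono2)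
  also have "... <= m powr (1 / real d) * w' powr (1 / real d)" using 1 by (intro mult_left_mono) auto
  finally have "w powr (1 / real d) + w' powr (1 / real d) <= (m powr (1 / real d) + 1) * w' powr (1 / real d)"
   by (simp add: distrib_right)
  hence "(w powr (1 / real d) + w' powr (1 / real d)) ^ d <= ((m powr (1 / real d) + 1) * w' powr (1 / real d)) ^ d"
   by (intro power_mono) auto
  thus "kernel_fun d K w w' <= (m powr (1 / real d) + 1) ^ d * w'"
   using Kernel_sum w assms root_power[of w' d] by (simp add: power_mult_distrib)
 qed
qed

lemma kernel_fun_measurable[measurable]:
 assumes [measurable]: "f \<in> borel_measurable N" "g \<in> borel_measurable N"
 shows "(%x. kernel_fun d K (f x) (g x)) \<in> borel_measurable N"
 by (cases K) simp_all

lemma connection_prob_measurable: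
 "(%(y :: real ^ 'd, w, y', w'). connection_prob K p \<alpha> \<beta> y w y' w') \<in> borel_measurable (borel \<Otimes>\<^sub>M borel \<Otimes>\<^sub>M borel \<Otimes>\<^sub>M borel)"
 unfolding connection_prob_def Let_def split_beta' by (cases "\<alpha> = \<infinity>") simp_all

text \<open>For negative marks the real power in \<open>connection_prob\<close> may exceed \<open>1\<close>; almost surely all
 marks are at least \<open>1\<close>, so the marks are cut off below there.\<close>

definition conn :: "kernel => real => ereal => real => real ^ 'd => real => real ^ 'd => real => real" where
 "conn K p \<alpha> \<beta> y w y' w' = connection_prob K p \<alpha> \<beta> y (max 1 w) y' (max 1 w')"

lemma conn_measurable_joint:
 "(%(y :: real ^ 'd, w, y', w'). conn K p \<alpha> \<beta> y w y' w') \<in> borel_measurable (borel \<Otimes>\<^sub>M borel \<Otimes>\<^sub>M borel \<Otimes>\<^sub>M borel)"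
proof -
 have "(%(y, w, y', w'). (y, max 1 w, y', max 1 w')) \<in>
  measurable (borel \<Otimes>\<^sub>M borel \<Otimes>\<^sub>M borel \<Otimes>\<^sub>M borel) ((borel :: (real ^ 'd) measure) \<Otimes>\<^sub>M (borel :: real measure) \<Otimes>\<^sub>M (borel :: (real ^ 'd) measure) \<Otimes>\<^sub>M (borel :: real measure))"
  unfolding split_beta' by measurable
 from measurable_compose[OF this connection_prob_measurable[of K p \<alpha> \<beta>]] show ?thesis
  by (simp add: conn_def split_beta')
qed

lemma conn_sym: "conn K p \<alpha> \<beta> y w y' w' = conn K p \<alpha> \<beta> y' w' y w"
 by (simp add: conn_def connection_prob_def kernel_fun_sym[of _ _ "max 1 w"] dist_commute[of y])

lemma conn_translate: "conn K p \<alpha> \<beta> (y + a) w (y' + a) w' = conn K p \<alpha> \<beta> y w y' w'"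
 by (simp add: conn_def connection_prob_def dist_norm)

text \<open>For the last bound, the truncated base is at most 1, so the exponent
  \<open>\<alpha>\<close> may be lowered to \<open>1 + \<eta>\<close>; at
  \<open>\<alpha> = \<infinity>\<close> the indicator is nonzero only where
  \<open>x >= 1\<close>.\<close>

lemma conn_cases:
 fixes y y' :: "real ^ 'd"
 assumes "0 < \<beta>" "0 < p" "p <= 1" "1 < \<alpha>" "kernel_sigma K \<ge> 0" "1 <= w" "1 <= w'"
 defines "x \<equiv> \<beta> * kernel_fun CARD('d) K w w' / dist y y' ^ CARD('d)"
 shows "conn K p \<alpha> \<beta> y w y' w' <= p"
  and "y ~= y' ==> dist y y' ^ CARD('d) <= \<beta> * kernel_fun CARD('d) K w w' ==> conn K p \<alpha> \<beta> y w y' w' = p"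
  and "y ~= y' ==> 0 < \<eta> ==> ereal (1 + \<eta>) <= \<alpha> ==> conn K p \<alpha> \<beta> y w y' w' <= x powr (1 + \<eta>)"
proof -
 let ?\<kappa> = "kernel_fun CARD('d) K w w'" and ?D = "dist y y' ^ CARD('d)"
 have \<kappa>: "1 <= ?\<kappa>" using kernel_fun_ge[of K w w' "CARD('d)"] assms by auto
 have x0: "0 <= x" using \<kappa> assms(1) by (auto simp: x_def)
 have c: "conn K p \<alpha> \<beta> y w y' w' = (if \<alpha> = \<infinity> then p * (if \<beta> * ?\<kappa> \<ge> ?D then 1 else 0) else p * (min 1 x) powr (real_of_ereal \<alpha>))"
  using assms by (simp add: conn_def connection_prob_def Let_def max_def)
 have a0: "0 <= real_of_ereal \<alpha>" using assms(4) by (cases \<alpha>) auto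
 have le1: "min 1 x powr a <= 1" if "0 <= a" for a using x0 that by (intro powr_le1) auto
 show "conn K p \<alpha> \<beta> y w y' w' <= p"
  unfolding c using le1[OF a0] assms(2) by (auto simp: mult_left_le)
 show "conn K p \<alpha> \<beta> y w y' w' = p" if "y ~= y'" "?D <= \<beta> * ?\<kappa>"
 proof -
  have "0 < ?D" using that by simp
  hence "1 <= x" using that by (simp add: x_def)
  thus ?thesis unfolding c using that by simp
 qed
 show "conn K p \<alpha> \<beta> y w y' w' <= x powr (1 + \<eta>)" if h: "y ~= y'" "0 < \<eta>" "ereal (1 + \<eta>) <= \<alpha>"
 proof (cases "\<alpha> = \<infinity>")
  case True
  show ?thesis
  proof (cases "\<beta> * ?\<kappa> \<ge> ?D")
   case ge: True
   have "0 < ?D" using h by simp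
   hence "1 <= x" using ge by (simp add: x_def)
   hence "1 <= x powr (1 + \<eta>)" using h by (intro ge_one_powr_ge_zero) auto
   thus ?thesis unfolding c using True ge assms(3) by simp
  qed (use True c in simp)
 next
  case False
  then obtain a where a: "\<alpha> = ereal a" "1 + \<eta> <= a" using h assms(4) by (cases \<alpha>) auto
  have "min 1 x powr a <= min 1 x powr (1 + \<eta>)" using x0 a by (intro powr_mono') auto
  also have "... <= x powr (1 + \<eta>)" using x0 h by (intro powr_mono2) auto
  finally have "min 1 x powr a <= x powr (1 + \<eta>)" .
  hence "p * min 1 x powr a <= 1 * x powr (1 + \<eta>)" using assms(2,3) by (intro mult_mono) auto
  thus ?thesis unfolding c using a by simp
 qed
qed

lemma conn_max: "conn K p \<alpha> \<beta> y (max 1 w) y' (max 1 w') = conn K p \<alpha> \<beta> y w y' w'"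
 by (simp add: conn_def)

lemma conn_decay_bound:
 assumes "0 < \<beta>" "0 < p" "p <= 1" "1 < \<alpha>" "kernel_sigma K \<ge> 0"
  and \<eta>: "0 < \<eta>" "ereal (1 + \<eta>) <= \<alpha>" and m: "1 <= m"
 shows "\<exists>C\<ge>0. \<forall>(y :: real ^ 'd) w y' w'. y ~= y' --> 1 <= w --> w <= m --> 1 <= w' -->
  conn K p \<alpha> \<beta> y w y' w' <= C * w' powr (1 + \<eta>) * max 1 (dist y y') powr (- (real CARD('d) * (1 + \<eta>)))"
proof -
 obtain B where B: "0 < B" "!!w w'. 1 <= w ==> w <= m ==> 1 <= w' ==> kernel_fun CARD('d) K w w' <= B * w'"
  using kernel_fun_le[of K m "CARD('d)"] assms by auto
 show ?thesis
 \<comment> \<open>The summand 1 covers distances below 1, where \<open>max 1 (dist y y')\<close> is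
   1 and the trivial bound on a probability is used.\<close>
 proof (intro exI[of _ "1 + (\<beta> * B) powr (1 + \<eta>)"] conjI allI impI)
  fix y y' :: "real ^ 'd" and w w' :: real assume h: "y ~= y'" "1 <= w" "w <= m" "1 <= w'"
  let ?D = "dist y y' ^ CARD('d)"
  note cc = conn_cases[OF assms(1-5) h(2,4), where y=y and y'=y']
  show "conn K p \<alpha> \<beta> y w y' w' <= (1 + (\<beta> * B) powr (1 + \<eta>)) * w' powr (1 + \<eta>) * max 1 (dist y y') powr (- (real CARD('d) * (1 + \<eta>)))"
  proof (cases "1 <= dist y y'")
   case True
   have D: "0 < ?D" using h by simp
   have "0 <= kernel_fun CARD('d) K w w'" using kernel_fun_ge[of K w w' "CARD('d)"] assms h by auto
   have "conn K p \<alpha> \<beta> y w y' w' <= (\<beta> * kernel_fun CARD('d) K w w' / ?D) powr (1 + \<eta>)"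
    using cc(3) h \<eta> by auto
   also have "... <= ((\<beta> * B) * w' / ?D) powr (1 + \<eta>)"
   proof (rule powr_mono2)
    have "\<beta> * kernel_fun CARD('d) K w w' <= \<beta> * (B * w')" using B(2)[OF h(2-4)] assms(1) by (intro mult_left_mono) auto
    thus "\<beta> * kernel_fun CARD('d) K w w' / ?D <= \<beta> * B * w' / ?D" using D by (simp add: divide_right_mono mult.assoc)
   qed (use \<eta> assms(1) D \<open>0 <= kernel_fun CARD('d) K w w'\<close> in auto)
   also have "... = (\<beta> * B) powr (1 + \<eta>) * w' powr (1 + \<eta>) * dist y y' powr (- (real CARD('d) * (1 + \<eta>)))"
   proof -
    have "?D powr (1 + \<eta>) = dist y y' powr (real CARD('d) * (1 + \<eta>))"
     using h by (simp add: powr_realpow[symmetric] powr_powr)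
    moreover have "(\<beta> * B * w' / ?D) powr (1 + \<eta>) = (\<beta> * B) powr (1 + \<eta>) * w' powr (1 + \<eta>) / ?D powr (1 + \<eta>)"
     using assms(1) B(1) h D by (subst powr_divide) (auto simp: powr_mult)
    ultimately show ?thesis by (simp only: powr_minus_divide times_divide_eq_right mult_1_right)
   qed
   also have "... <= (1 + (\<beta> * B) powr (1 + \<eta>)) * w' powr (1 + \<eta>) * dist y y' powr (- (real CARD('d) * (1 + \<eta>)))"
    by (intro mult_right_mono) auto
   finally show ?thesis using True by (simp add: max_def)
  next
   case False
   have "conn K p \<alpha> \<beta> y w y' w' <= 1 * 1" using cc(1) assms(3) by simp
   also have "... <= (1 + (\<beta> * B) powr (1 + \<eta>)) * w' powr (1 + \<eta>)"
    using h \<eta> by (intro mult_mono ge_one_powr_ge_zero) auto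
   finally show ?thesis using False by (simp add: max_def)
  qed
 qed (auto intro: add_nonneg_nonneg)
qed

section \<open>Logarithmic asymptotics\<close>

lemma Liminf_log_prob:
 fixes q :: "real => real"
 assumes C: "0 < C" and q: "\<forall>\<^sub>F n in at_top. C * n powr (- a) <= q n"
 shows "ereal (- a) <= Liminf at_top (%n. log_prob (q n) / ereal (ln n))"
proof -
 have "((%n. ln C / ln n - a) \<longlongrightarrow> - a) at_top" by real_asymp
 hence "Liminf at_top (%n. ereal (ln C / ln n - a)) = ereal (- a)"
  by (intro lim_imp_Liminf) (auto simp: tendsto_ereal)
 hence "ereal (- a) = Liminf at_top (%n. ereal (ln C / ln n - a))" by simp
 also have "... <= Liminf at_top (%n. log_prob (q n) / ereal (ln n))"
 proof (rule Liminf_mono)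
  show "\<forall>\<^sub>F n in at_top. ereal (ln C / ln n - a) <= log_prob (q n) / ereal (ln n)"
   using q eventually_gt_at_top[of 1]
  proof eventually_elim
   case (elim n)
   have pos: "0 < C * n powr (- a)" using C elim by simp
   hence "ln (C * n powr (- a)) <= ln (q n)" using elim by simp
   moreover have "ln (C * n powr (- a)) = ln C - a * ln n" using C elim by (simp add: ln_mult ln_powr)
   ultimately have "(ln C - a * ln n) / ln n <= ln (q n) / ln n" using elim by (intro divide_right_mono) auto
   moreover have "(ln C - a * ln n) / ln n = ln C / ln n - a" using elim by (simp add: field_simps)
   moreover have "0 < q n" using pos elim by linarith
   ultimately show ?case using elim by (simp add: log_prob_def)
  qed
 qed
 finally show ?thesis .
qed

lemma Limsup_log_prob:
 fixes q :: "real => real"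
 assumes C: "0 < C" and q: "\<forall>\<^sub>F n in at_top. q n <= C * n powr b"
 shows "Limsup at_top (%n. log_prob (q n) / ereal (ln n)) <= ereal b"
proof -
 have "((%n. ln C / ln n + b) \<longlongrightarrow> b) at_top" by real_asymp
 hence L: "Limsup at_top (%n. ereal (ln C / ln n + b)) = ereal b"
  by (intro lim_imp_Limsup) (auto simp: tendsto_ereal)
 have "Limsup at_top (%n. log_prob (q n) / ereal (ln n)) <= Limsup at_top (%n. ereal (ln C / ln n + b))"
 proof (rule Limsup_mono)
  show "\<forall>\<^sub>F n in at_top. log_prob (q n) / ereal (ln n) <= ereal (ln C / ln n + b)"
   using q eventually_gt_at_top[of 1]
  proof eventually_elim
   case (elim n)
   show ?case
   proof (cases "0 < q n")
    case True
    have "ln (q n) <= ln (C * n powr b)" using True elim by simp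
    moreover have "ln (C * n powr b) = ln C + b * ln n" using C elim by (simp add: ln_mult ln_powr)
    ultimately have "ln (q n) / ln n <= (ln C + b * ln n) / ln n" using elim by (intro divide_right_mono) auto
    moreover have "(ln C + b * ln n) / ln n = ln C / ln n + b" using elim by (simp add: field_simps)
    ultimately show ?thesis using elim True by (simp add: log_prob_def)
   next
    \<comment> \<open>Here \<open>log_prob\<close> is \<open>-\<infinity>\<close>, and so is the
      quotient, because \<open>ln n > 0\<close>.\<close>
    case False
    have "0 < inverse (ln n)" using elim by simp
    thus ?thesis using False elim by (simp add: log_prob_def divide_ereal_def)
   qed
  qed
 qed
 thus ?thesis unfolding L .
qed

section \<open>The law of the environment\<close>

text \<open>Distribution functions are lower tails; negating the variables turns the given upper
  tails into these.\<close>

lemma (in prob_space) distr_eqI_tail: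
 fixes A B :: "'a => real"
 assumes m: "A \<in> borel_measurable M" "B \<in> borel_measurable M"
  and eq: "!!t. prob {om \<in> space M. A om \<ge> t} = prob {om \<in> space M. B om \<ge> t}"
 shows "distr M borel A = distr M borel B"
proof -
 let ?N = "%A. distr M borel (%om. - A om :: real)"
 have rd: "real_distribution (?N A)" if "A \<in> borel_measurable M" for A
  using that by (intro real_distribution_distr) measurable
 have "cdf (?N A) t = prob {om \<in> space M. A om \<ge> - t}" if A: "A \<in> borel_measurable M" for A t
 proof -
  have "cdf (?N A) t = prob ((%om. - A om) -` {..t} \<inter> space M)"
   unfolding cdf_def using A by (intro measure_distr) auto
  also have "(%om. - A om) -` {..t} \<inter> space M = {om \<in> space M. A om \<ge> - t}" by auto
  finally show ?thesis .
 qed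
 hence "?N A = ?N B" using m eq by (intro cdf_unique rd ext) auto
 hence "distr (?N A) borel uminus = distr (?N B) borel uminus" by simp
 thus ?thesis using m by (simp add: distr_distr comp_def)
qed

locale ksrg_env =
 fixes M :: "'w measure" and X :: "nat => 'w => real ^ 'd" and W :: "vertex => 'w => real"
  and U :: "vertex set => 'w => real" and K :: kernel and p \<beta> \<tau> :: real and \<alpha> :: ereal
 assumes env: "ksrg_environment \<tau> M X W U"
  and \<beta>: "0 < \<beta>" and p: "0 < p" "p <= 1" and \<alpha>: "1 < \<alpha>" and \<tau>: "2 < \<tau>" and \<sigma>: "kernel_sigma K \<ge> 0"
begin

sublocale prob_space M using env by (simp add: ksrg_environment_def)

lemma X_meas[measurable]: "X i \<in> borel_measurable M"
 using env by (simp add: ksrg_environment_def unit_poisson_process_def)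

lemma W_meas[measurable]: "W v \<in> borel_measurable M"
 using env by (simp add: ksrg_environment_def indep_vars_def)

lemma U_meas: "e \<in> vertex_pairs ==> U e \<in> borel_measurable M"
 using env by (simp add: ksrg_environment_def indep_vars_def)

lemma W_tail: "prob {om \<in> space M. W v om \<ge> t} = (if 1 <= t then t powr (- (\<tau> - 1)) else 1)"
proof (cases "1 <= t")
 case False
 have "prob {om \<in> space M. W v om \<ge> 1} = 1" using env by (simp add: ksrg_environment_def)
 moreover have "prob {om \<in> space M. W v om \<ge> 1} <= prob {om \<in> space M. W v om \<ge> t}"
  using False by (intro finite_measure_mono) auto
 ultimately show ?thesis using False prob_le_1[of "{om \<in> space M. W v om \<ge> t}"] by simp
qed (use env in \<open>simp add: ksrg_environment_def\<close>)

definition \<mu> :: "real measure" where "\<mu> = distr M borel (W Root)"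

lemma W_law: "distr M borel (W v) = \<mu>"
 unfolding \<mu>_def by (rule distr_eqI_tail) (simp_all add: W_tail)

lemma \<mu>_tail: "1 <= t ==> measure \<mu> {t..} = t powr (- (\<tau> - 1))"
 unfolding \<mu>_def using W_tail[where v=Root and t=t] by (subst measure_distr) (auto simp: vimage_def Int_def conj_commute)

lemma AE_W: "AE om in M. \<forall>v. 1 <= W v om"
proof -
 have "AE om in M. 1 <= W v om" for v
 proof -
  have "{om \<in> space M. 1 <= W v om} \<in> events" by measurable
  from prob_Collect_eq_1[OF this] show ?thesis using W_tail[where v=v and t=1] by simp
 qed
 thus ?thesis by (simp add: AE_all_countable)
qed

definition Xf :: "nat => 'w => real ^ 'd" where
 "Xf = (SOME X'. poisson_points M X' & (AE om in M. \<forall>i. X' i om = X i om))"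

lemma Xf: "poisson_points M Xf" "AE om in M. \<forall>i. Xf i om = X i om"
proof -
 have "unit_poisson_process M X" using env by (simp add: ksrg_environment_def)
 from locally_finite_version[OF this]
 have "\<exists>X'. poisson_points M X' & (AE om in M. \<forall>i. X' i om = X i om)" by blast
 from someI_ex[OF this] show "poisson_points M Xf" "AE om in M. \<forall>i. Xf i om = X i om"
  unfolding Xf_def by blast+
qed

text \<open>The decay needs \<open>1 + \<eta> <= \<alpha>\<close>, so \<open>\<eta>\<close> may go
  up to \<open>\<alpha> - 1\<close>, or to any positive value when
  \<open>\<alpha> = \<infinity>\<close>. The hub constant is \<open>1 / \<beta>\<close>, as the
  kernel is at least the larger mark.\<close>

sublocale G: ksrg_bounds \<mu> "conn K p \<alpha> \<beta>" p M Xf \<tau> "if \<alpha> = \<infinity> then 1 else real_of_ereal \<alpha> - 1" "1 / \<beta>"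
proof -
 have le: "conn K p \<alpha> \<beta> y w y' w' <= p" for y y' :: "real ^ 'd" and w w'
 proof -
  have "conn K p \<alpha> \<beta> y (max 1 w) y' (max 1 w') <= p"
   by (rule conn_cases(1)[OF \<beta> p \<alpha> \<sigma>]) simp_all
  thus ?thesis unfolding conn_max .
 qed
 have ml: "mark_law \<mu>" by (rule mark_law.intro) (simp_all add: \<mu>_def prob_space_distr W_meas)
 have lg: "label_graph \<mu> (conn K p \<alpha> \<beta> :: real ^ 'd => _) p"
  using ml p le conn_measurable_joint conn_sym conn_translate
  by (intro label_graph.intro label_graph_axioms.intro) auto
 show "ksrg_bounds \<mu> (conn K p \<alpha> \<beta>) p M Xf \<tau> (if \<alpha> = \<infinity> then 1 else real_of_ereal \<alpha> - 1) (1 / \<beta>)"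
 proof (intro ksrg_bounds.intro ksrg_model.intro lg Xf(1) ksrg_bounds_axioms.intro)
  fix y y' :: "real ^ 'd" and w w' :: real
  assume h: "y ~= y'" "1 <= w" "1 <= w'" "1 / \<beta> * dist y y' ^ CARD('d) <= w"
  have "dist y y' ^ CARD('d) <= \<beta> * w" using h(4) \<beta> by (simp add: field_simps)
  also have "... <= \<beta> * kernel_fun CARD('d) K w w'" using kernel_fun_ge[OF \<sigma> h(2,3)] \<beta> by (intro mult_left_mono) auto
  finally show "conn K p \<alpha> \<beta> y w y' w' = p" by (rule conn_cases(2)[OF \<beta> p \<alpha> \<sigma> h(2,3,1)])
 next
  fix \<eta> m :: real
  assume h: "0 < \<eta>" "\<eta> <= (if \<alpha> = \<infinity> then 1 else real_of_ereal \<alpha> - 1)" "1 <= m"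
  have "ereal (1 + \<eta>) <= \<alpha>" using h(2) \<alpha> by (cases \<alpha>) auto
  thus "\<exists>C\<ge>0. \<forall>(y :: real ^ 'd) w y' w'. y ~= y' --> 1 <= w --> w <= m --> 1 <= w' -->
   conn K p \<alpha> \<beta> y w y' w' <= C * w' powr (1 + \<eta>) * max 1 (dist y y') powr (- (real CARD('d) * (1 + \<eta>)))"
   using conn_decay_bound[OF \<beta> p \<alpha> \<sigma> h(1) _ h(3)] by blast
 next
  show "measure \<mu> {t..} = t powr (- (\<tau> - 1))" if "1 <= t" for t by (rule \<mu>_tail[OF that])
  show "0 < 1 / \<beta>" using \<beta> by simp
  show "0 < (if \<alpha> = \<infinity> then 1 else real_of_ereal \<alpha> - 1)" using \<alpha> by (cases \<alpha>) auto
 qed (rule \<tau>)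
qed

abbreviation "\<X> \<equiv> PiM (UNIV :: nat set) (%_. borel :: (real ^ 'd) measure)"
abbreviation "lab om \<equiv> (%v. W v om, \<lambda>e\<in>vertex_pairs. U e om)"

lemma labels_law:
 "distr M (\<X> \<Otimes>\<^sub>M (PiM UNIV (%_. borel) \<Otimes>\<^sub>M PiM vertex_pairs (%_. borel))) (%om. (%i. X i om, lab om)) =
  distr M \<X> (%om i. X i om) \<Otimes>\<^sub>M label_space \<mu>"
proof -
 have iW: "indep_vars (%_. borel) W UNIV" and iU: "indep_vars (%_. borel) U vertex_pairs"
  using env by (auto simp: ksrg_environment_def)
 have lW: "distr M (PiM UNIV (%_. borel)) (%om v. W v om) = PiM UNIV (%_. \<mu>)"
  using indep_vars_iff_distr_eq_PiM'[of UNIV W "%_. borel"] iW by (simp add: W_law W_meas restrict_UNIV)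
 have "distr M borel (U e) = unit_uniform" if "e \<in> vertex_pairs" for e
 proof -
  have "distr M lborel (U e) = unit_uniform" using env that by (simp add: ksrg_environment_def)
  moreover have "distr M lborel (U e) = distr M borel (U e)" by (intro distr_cong) auto
  ultimately show ?thesis by simp
 qed
 hence "PiM vertex_pairs (%e. distr M borel (U e)) = PiM vertex_pairs (%_. unit_uniform)" by (intro PiM_cong refl)
 moreover have "vertex_pairs ~= {}"
 proof -
  have "card {Root, Point 0} = 2" by simp
  thus ?thesis by blast
 qed
 ultimately have lU: "distr M (PiM vertex_pairs (%_. borel)) (%om. \<lambda>e\<in>vertex_pairs. U e om) = PiM vertex_pairs (%_. unit_uniform)"
  using indep_vars_iff_distr_eq_PiM'[of vertex_pairs U "%_. borel"] iU U_meas by simp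
 show ?thesis
  using env unfolding ksrg_environment_def Let_def lW lU label_space_def by blast
qed

lemma sets_label_space: "sets (label_space \<mu>) = sets (PiM UNIV (%_. borel) \<Otimes>\<^sub>M PiM vertex_pairs (%_. borel))"
 unfolding label_space_def by (intro sets_pair_measure_cong sets_PiM_cong refl) (auto simp: \<mu>_def)

text \<open>Independence of locations and labels makes their joint law a product, so the labels can
  be integrated first; the locations are then replaced by the locally finite version, which agrees
  almost surely.\<close>

lemma nn_integral_environment:
 assumes f: "f \<in> borel_measurable (\<X> \<Otimes>\<^sub>M label_space \<mu>)"
 shows "(\<integral>\<^sup>+om. f (%i. X i om, lab om) \<partial>M) = (\<integral>\<^sup>+om. (\<integral>\<^sup>+r. f (%i. Xf i om, r) \<partial>label_space \<mu>) \<partial>M)"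
proof -
 let ?N = "\<X> \<Otimes>\<^sub>M (PiM UNIV (%_. borel) \<Otimes>\<^sub>M PiM vertex_pairs (%_. borel))"
 have f': "f \<in> borel_measurable ?N"
  using f measurable_cong_sets[OF sets_pair_measure_cong[OF refl sets_label_space] refl] by blast
 have mX: "(%om i. X i om) \<in> measurable M \<X>" by (rule measurable_PiM_single') auto
 have mW: "(%om v. W v om) \<in> measurable M (PiM UNIV (%_. borel))" by (rule measurable_PiM_single') auto
 have mU: "(%om. \<lambda>e\<in>vertex_pairs. U e om) \<in> measurable M (PiM vertex_pairs (%_. borel))"
  using U_meas by (rule measurable_restrict)
 have mT: "(%om. (%i. X i om, lab om)) \<in> measurable M ?N" by (intro measurable_Pair mX mW mU)
 have s: "sigma_finite_measure (label_space \<mu>)" by (rule prob_space_imp_sigma_finite) (rule G.labels.prob_space_axioms)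
 have f2: "f \<in> borel_measurable (distr M \<X> (%om i. X i om) \<Otimes>\<^sub>M label_space \<mu>)"
  using f measurable_cong_sets[OF sets_pair_measure_cong[OF sets_distr refl] refl] by blast
 have "(\<integral>\<^sup>+om. f (%i. X i om, lab om) \<partial>M) = integral\<^sup>N (distr M ?N (%om. (%i. X i om, lab om))) f"
  using nn_integral_distr[OF mT, of f] f' by simp
 also have "... = (\<integral>\<^sup>+x. \<integral>\<^sup>+r. f (x, r) \<partial>label_space \<mu> \<partial>distr M \<X> (%om i. X i om))"
  unfolding labels_law by (rule sigma_finite_measure.nn_integral_fst[OF s f2, symmetric])
 also have "... = (\<integral>\<^sup>+om. \<integral>\<^sup>+r. f (%i. X i om, r) \<partial>label_space \<mu> \<partial>M)"
  by (rule nn_integral_distr[OF mX]) (rule sigma_finite_measure.borel_measurable_nn_integral_fst[OF s f2])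
 also have "... = (\<integral>\<^sup>+om. (\<integral>\<^sup>+r. f (%i. Xf i om, r) \<partial>label_space \<mu>) \<partial>M)"
  by (rule nn_integral_cong_AE) (use Xf(2) in \<open>eventually_elim, simp\<close>)
 finally show ?thesis .
qed

abbreviation "comp_at q V v \<equiv> comp_of (conn K p \<alpha> \<beta>) (vpos (fst q)) (fst (snd q)) (snd (snd q)) V v"

lemma measurable_comp_at:
 assumes "!!a. Measurable.pred (\<X> \<Otimes>\<^sub>M label_space \<mu>) (%q. a \<in> V q)"
 shows "Measurable.pred (\<X> \<Otimes>\<^sub>M label_space \<mu>) (%q. b \<in> comp_at q (V q) a)"
proof (rule measurable_comp_of[OF conn_measurable_joint _ _ _ assms])
 show "(%q. fst (snd q) a) \<in> borel_measurable (\<X> \<Otimes>\<^sub>M label_space \<mu>)" for a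
  by (rule measurable_compose[OF measurable_snd G.measurable_mark])
 show "(%q. snd (snd q) e) \<in> borel_measurable (\<X> \<Otimes>\<^sub>M label_space \<mu>)" if "e \<in> vertex_pairs" for e
  by (rule measurable_compose[OF measurable_snd G.measurable_pair_label[OF that]])
 show "(%q. vpos (fst q) a) \<in> borel_measurable (\<X> \<Otimes>\<^sub>M label_space \<mu>)" for a
  by (cases a) auto
qed

lemma measurable_component:
 assumes "!!a. Measurable.pred M (%om. a \<in> V om)"
 shows "Measurable.pred M (%om. b \<in> graph_component (ksrg_edges X W U K p \<alpha> \<beta> (V om) om) a)"
 unfolding ksrg_edges_eq_label_edges location_eq_vpos
proof (rule measurable_comp_of[OF connection_prob_measurable _ _ _ assms])
 show "(%om. vpos (%i. X i om) a) \<in> borel_measurable M" for a by (cases a) auto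
qed (auto intro: U_meas)

text \<open>Marks of at least 1 do not feel the cut-off in \<open>conn\<close>, and an edge joins
  distinct vertices, so its label lies in \<open>vertex_pairs\<close>.\<close>

lemma component_eq:
 assumes "\<forall>v. 1 <= W v om"
 shows "graph_component (ksrg_edges X W U K p \<alpha> \<beta> V om) v = comp_at (%i. X i om, lab om) V v"
proof -
 have "label_edges (connection_prob K p \<alpha> \<beta>) (vpos (%i. X i om)) (%v. W v om) (%e. U e om) V =
  label_edges (conn K p \<alpha> \<beta>) (vpos (%i. X i om)) (%v. W v om) (\<lambda>e\<in>vertex_pairs. U e om) V"
  unfolding label_edges_def using assms by (auto simp: conn_def max_def)
 thus ?thesis by (simp add: ksrg_edges_eq_label_edges location_eq_vpos)
qed

section \<open>The generating function of the root component size\<close>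

abbreviation "RC om \<equiv> root_component X W U K p \<alpha> \<beta> om"
abbreviation "Hc \<equiv> size_gen_fun M X W U K p \<alpha> \<beta>"

lemma measurable_RC: "Measurable.pred M (%om. finite (RC om))" "(%om. card (RC om)) \<in> measurable M (count_space UNIV)"
 using measurable_card_countable(1,2)[OF measurable_component[of "%_. UNIV" _ Root]] by (auto simp: root_component_def)

definition gen :: "real => 'w => real" where
 "gen z om = (if finite (RC om) then z ^ card (RC om) else 0)"

lemma Hc_eq: "Hc z = expectation (gen z)"
 by (simp add: size_gen_fun_def gen_def[abs_def] Let_def)

lemma gen_measurable[measurable]: "gen z \<in> borel_measurable M"
 unfolding gen_def[abs_def] using measurable_RC by measurable

lemma gen_bounds: "0 <= z ==> z <= 1 ==> 0 <= gen z om & gen z om <= 1"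
 by (auto simp: gen_def power_le_one)

lemma gen_integrable: "0 <= z ==> z <= 1 ==> integrable M (gen z)"
 using gen_bounds by (intro integrable_const_bound[of _ 1]) auto

lemma Root_RC: "Root \<in> RC om"
 by (simp add: root_component_def graph_component_self)

lemma Hc_palm:
 assumes "0 <= z" "z <= 1"
 shows "G.palm_total (%k. ennreal (z ^ k)) = ennreal (Hc z)"
proof -
 let ?f = "%q. let C = comp_at q UNIV Root in if finite C then ennreal (z ^ card C) else 0"
 have p: "Measurable.pred (\<X> \<Otimes>\<^sub>M label_space \<mu>) (%q. b \<in> comp_at q UNIV Root)" for b
  by (rule measurable_comp_at) simp
 note [measurable] = measurable_card_countable(1,2)[OF p]
 have f: "?f \<in> borel_measurable (\<X> \<Otimes>\<^sub>M label_space \<mu>)" unfolding Let_def by measurable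
 have "ennreal (Hc z) = (\<integral>\<^sup>+om. ennreal (gen z om) \<partial>M)"
  unfolding Hc_eq using gen_bounds[OF assms] gen_integrable[OF assms] by (intro nn_integral_eq_integral[symmetric]) auto
 also have "... = (\<integral>\<^sup>+om. ?f (%i. X i om, lab om) \<partial>M)"
 proof (rule nn_integral_cong_AE)
  show "AE om in M. ennreal (gen z om) = ?f (%i. X i om, lab om)"
   using AE_W
  proof eventually_elim
   case (elim om)
   show ?case using component_eq[OF elim, of UNIV Root] by (simp add: gen_def root_component_def Let_def)
  qed
 qed
 also have "... = (\<integral>\<^sup>+om. (\<integral>\<^sup>+r. ?f (%i. Xf i om, r) \<partial>label_space \<mu>) \<partial>M)" by (rule nn_integral_environment[OF f])
 finally show ?thesis by (simp add: G.palm_total_def)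
qed

lemma theta_eq: "theta M X W U K p \<alpha> \<beta> = 1 - Hc 1"
proof -
 have "Hc 1 = expectation (indicator {om \<in> space M. finite (RC om)})"
  unfolding Hc_eq by (rule Bochner_Integration.integral_cong) (simp_all add: gen_def)
 also have "... = prob {om \<in> space M. finite (RC om)}" by (simp add: Int_absorb2 Collect_restrict)
 also have "... = 1 - prob {om \<in> space M. \<not> finite (RC om)}"
  using prob_neg[of "%om. finite (RC om)"] measurable_RC(1) by simp
 finally show ?thesis by (simp add: theta_def)
qed

text \<open>The root belongs to its own component, so the size is never 0. The value at
  \<open>z = 0\<close> is the left end for the intermediate value theorem and the case
  \<open>p = 1\<close>.\<close>

lemma Hc_0: "Hc 0 = 0"
proof -
 have "gen 0 om = 0" for om
 proof (cases "finite (RC om)")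
  case True
  hence "card (RC om) ~= 0" using Root_RC[of om] by auto
  thus ?thesis by (simp add: gen_def)
 qed (simp add: gen_def)
 hence "gen 0 = (%_. 0)" by (rule ext)
 thus ?thesis by (simp add: Hc_eq)
qed

lemma Hc_mono: "0 <= z ==> z <= z' ==> z' <= 1 ==> Hc z <= Hc z'"
 unfolding Hc_eq by (intro integral_mono gen_integrable) (auto simp: gen_def intro: power_mono)

text \<open>On finite components the powers differ strictly, because the size is positive; equal
  expectations would make finite components a null event and contradict
  \<open>Hc 1 > 0\<close>.\<close>

lemma Hc_strict_mono:
 assumes "Hc 1 > 0" "0 <= z" "z < z'" "z' <= 1"
 shows "Hc z < Hc z'"
proof (rule ccontr)
 assume "\<not> Hc z < Hc z'"
 hence eq: "Hc z = Hc z'" using Hc_mono[of z z'] assms by simp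
 have int: "integrable M (%om. gen z' om - gen z om)" using assms by (intro Bochner_Integration.integrable_diff gen_integrable) auto
 have nonneg: "0 <= gen z' om - gen z om" for om using assms by (auto simp: gen_def intro: power_mono)
 have "expectation (%om. gen z' om - gen z om) = 0"
  using eq assms gen_integrable by (simp add: Hc_eq)
 hence "AE om in M. gen z' om - gen z om = 0"
  using integral_nonneg_eq_0_iff_AE[OF int] nonneg by simp
 hence "AE om in M. gen 1 om = 0"
 proof eventually_elim
  case (elim om)
  have "z ^ card (RC om) < z' ^ card (RC om)" if "finite (RC om)"
   using Root_RC[of om] that assms by (intro power_strict_mono) (auto simp: card_gt_0_iff)
  thus ?case using elim by (auto simp: gen_def)
 qed
 hence "Hc 1 = expectation (%om. 0)" unfolding Hc_eq by (intro integral_cong_AE) auto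
 thus False using assms(1) by simp
qed

lemma Hc_continuous: "continuous_on {0..1} Hc"
proof (rule continuous_on_sequentiallyI)
 fix u :: "nat => real" and a assume u: "\<forall>n. u n \<in> {0..1}" "a \<in> {0..1}" "u \<longlonglongrightarrow> a"
 show "(%n. Hc (u n)) \<longlonglongrightarrow> Hc a"
  unfolding Hc_eq
 proof (rule integral_dominated_convergence[where w="%_. 1"])
  show "AE om in M. (%n. gen (u n) om) \<longlonglongrightarrow> gen a om"
   using u(3) by (intro AE_I2) (auto simp: gen_def intro: tendsto_power)
  show "AE om in M. norm (gen (u n) om) <= 1" for n
   using gen_bounds[of "u n"] u(1) by (intro AE_I2) auto
 qed auto
qed

lemma Hc_inverse:
 assumes "0 < y" "y < Hc 1"
 defines "z \<equiv> the_inv_into {0<..1} Hc y"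
 shows "0 < z" "z < 1" "Hc z = y"
proof -
 have inj: "inj_on Hc {0<..1}"
 proof (rule linorder_inj_onI)
  fix a b :: real assume "a < b" "a \<in> {0<..1}" "b \<in> {0<..1}"
  thus "Hc a ~= Hc b" using Hc_strict_mono[of a b] assms by auto
 qed auto
 obtain x where x: "0 <= x" "x <= 1" "Hc x = y"
  using IVT'[of Hc 0 y 1] Hc_0 assms Hc_continuous by auto
 have "x ~= 0" "x ~= 1" using x Hc_0 assms by auto
 hence x01: "0 < x" "x < 1" using x by auto
 have "z = x" unfolding z_def using the_inv_into_f_f[OF inj, of x] x x01 by auto
 thus "0 < z" "z < 1" "Hc z = y" using x01 x by auto
qed

abbreviation "q_large \<rho> n \<equiv> prob {om \<in> space M. ereal_of_enat (largest_component_size X W U K p \<alpha> \<beta> n om) > ereal (\<rho> * n)}"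

text \<open>Connects the probability of the statement, given by \<open>SUP\<close> over box vertices
  in the original environment, with the two-stage form for the version \<open>Xf\<close> and the
  cut-off \<open>conn\<close>.\<close>

lemma prob_large_eq:
 assumes "0 <= \<rho>" "0 <= n"
 shows "ennreal (q_large \<rho> n) = G.prob_large \<rho> n"
proof -
 let ?V = "%om. box_vertices X n om"
 let ?C = "%om u. graph_component (ksrg_edges X W U K p \<alpha> \<beta> (?V om) om) u"
 let ?A = "{om \<in> space M. ereal_of_enat (largest_component_size X W U K p \<alpha> \<beta> n om) > ereal (\<rho> * n)}"
 let ?I = "%x :: nat => real ^ 'd. {i. x i \<in> volume_box n}"
 let ?L = "%q. \<exists>i. i \<in> ?I (fst q) & \<rho> * n < card (comp_at q (Point ` ?I (fst q)) (Point i))"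
 have V: "v \<in> ?V om \<longleftrightarrow> (\<exists>i. v = Point i & X i om \<in> volume_box n)" for v om
  by (auto simp: box_vertices_def)
 \<comment> \<open>The supremum over an empty box is 0, which does not exceed
   \<open>\<rho> * n\<close>. Infinite components are kept here and excluded below by local
   finiteness.\<close>
 have ev: "ereal_of_enat (largest_component_size X W U K p \<alpha> \<beta> n om) > ereal (\<rho> * n) \<longleftrightarrow>
  (\<exists>u. u \<in> ?V om & (infinite (?C om u) \<or> \<rho> * n < card (?C om u)))" for om
 proof (cases "?V om = {}")
  case True
  hence "largest_component_size X W U K p \<alpha> \<beta> n om = 0"
   by (simp add: largest_component_size_def bot_enat_def)
  moreover have "\<not> ereal (\<rho> * n) < 0" using mult_nonneg_nonneg[OF assms] by (simp add: not_less)
  ultimately show ?thesis using True by simp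
 next
  case False
  have "ereal (\<rho> * n) < ereal_of_enat (ecard S) \<longleftrightarrow> infinite S \<or> \<rho> * n < card S" for S :: "vertex set"
   by (simp add: ecard_def)
  thus ?thesis
   unfolding largest_component_size_def Let_def ereal_of_enat_SUP[OF False] less_SUP_iff by blast
 qed
 have mV: "Measurable.pred M (%om. a \<in> ?V om)" for a
 proof (cases a)
  case (Point i)
  have "Measurable.pred M (%om. X i om \<in> volume_box n)" by measurable
  thus ?thesis using Point by (simp add: V)
 qed (simp add: V)
 note mC = measurable_card_countable(1,2)[OF measurable_component[OF mV]]
 have mA: "?A \<in> sets M"
  unfolding ev using mV mC by measurable
 have mI: "Measurable.pred (\<X> \<Otimes>\<^sub>M label_space \<mu>) (%q. i \<in> ?I (fst q))" for i
 proof -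
  have "(%q. fst q i) \<in> measurable (\<X> \<Otimes>\<^sub>M label_space \<mu>) borel" by measurable
  thus ?thesis unfolding mem_Collect_eq by measurable
 qed
 have mPI: "Measurable.pred (\<X> \<Otimes>\<^sub>M label_space \<mu>) (%q. a \<in> Point ` ?I (fst q))" for a
  using mI by (cases a) (auto simp: image_iff)
 have mL: "Measurable.pred (\<X> \<Otimes>\<^sub>M label_space \<mu>) ?L"
  using mI measurable_card_countable(2)[OF measurable_comp_at[OF mPI]] by measurable
 let ?f = "%q. indicator {q. ?L q} q :: ennreal"
 have f: "?f \<in> borel_measurable (\<X> \<Otimes>\<^sub>M label_space \<mu>)" using mL by measurable
 have "ennreal (q_large \<rho> n) = (\<integral>\<^sup>+om. indicator ?A om \<partial>M)"
  using mA by (simp add: emeasure_eq_measure)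
 also have "... = (\<integral>\<^sup>+om. ?f (%i. X i om, lab om) \<partial>M)"
 proof (rule nn_integral_cong_AE)
  have "AE om in M. \<forall>i. Xf i om = X i om" by (rule Xf(2))
  thus "AE om in M. indicator ?A om = ?f (%i. X i om, lab om)"
   using AE_W AE_space
  proof eventually_elim
   case (elim om)
   have Veq: "?V om = Point ` ?I (%i. X i om)" by (auto simp: V)
   have "finite {i. Xf i om \<in> volume_box n}"
    using G.locally_finite[OF bounded_volume_box, of n om] by (simp add: pts_def)
   hence "finite (?V om)" unfolding Veq using elim(1) by simp
   moreover have "?C om u \<subseteq> ?V om" if "u \<in> ?V om" for u
    by (rule graph_component_subset[OF _ that]) (auto simp: ksrg_edges_def)
   ultimately have fin: "finite (?C om u)" if "u \<in> ?V om" for u using that finite_subset by blast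
   have "om \<in> ?A \<longleftrightarrow> (\<exists>u. u \<in> ?V om & \<rho> * n < card (?C om u))" using elim(3) fin by (auto simp: ev)
   also have "... \<longleftrightarrow> ?L (%i. X i om, lab om)"
    unfolding component_eq[OF elim(2)] Veq by auto
   finally show ?case by (simp add: indicator_def)
  qed
 qed
 also have "... = (\<integral>\<^sup>+om. (\<integral>\<^sup>+r. ?f (%i. Xf i om, r) \<partial>label_space \<mu>) \<partial>M)" by (rule nn_integral_environment[OF f])
 also have "... = G.prob_large \<rho> n"
  unfolding G.prob_large_def
 proof (rule nn_integral_cong)
  fix om assume "om \<in> space M"
  have x: "(%i. Xf i om) \<in> space \<X>" by (simp add: space_PiM)
  have S: "{r \<in> space (label_space \<mu>). G.large \<rho> n om r} = Pair (%i. Xf i om) -` {q \<in> space (\<X> \<Otimes>\<^sub>M label_space \<mu>). ?L q}"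
   using x by (auto simp: G.large_def pts_def space_pair_measure)
  have S': "{r \<in> space (label_space \<mu>). G.large \<rho> n om r} \<in> sets (label_space \<mu>)"
   unfolding S using mL by (intro sets_Pair1) (simp add: pred_def)
  have "(\<integral>\<^sup>+r. ?f (%i. Xf i om, r) \<partial>label_space \<mu>) = (\<integral>\<^sup>+r. indicator {r \<in> space (label_space \<mu>). G.large \<rho> n om r} r \<partial>label_space \<mu>)"
   by (intro nn_integral_cong) (auto simp: indicator_def G.large_def pts_def)
  also have "... = ennreal (G.labels.prob {r \<in> space (label_space \<mu>). G.large \<rho> n om r})"
   using S' by (simp add: G.labels.emeasure_eq_measure)
  finally show "(\<integral>\<^sup>+r. ?f (%i. Xf i om, r) \<partial>label_space \<mu>) = ennreal (G.labels.prob {r \<in> space (label_space \<mu>). G.large \<rho> n om r})" .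
 qed
 finally show ?thesis .
qed

abbreviation "hb \<equiv> hubs M X W U K p \<alpha> \<beta>"

text \<open>\<open>Suc k\<close> is the least number of hubs whose missed density is at most
  \<open>1 - r\<close>: since \<open>ln (1 - p) < 0\<close>, larger powers of \<open>1 - p\<close>
  correspond to smaller quotients. For \<open>p = 1\<close> a single hub misses nothing.\<close>

lemma hubs_ceiling:
 assumes r: "0 < 1 - r" "1 - r < Hc 1"
 obtains k where "\<lceil>hb r\<rceil> = int (Suc k)" "Hc ((1 - p) ^ Suc k) <= 1 - r" "1 - r < Hc ((1 - p) ^ k)"
proof (cases "p < 1")
 case False
 hence "\<lceil>hb r\<rceil> = int (Suc 0)" by (simp add: hubs_def)
 thus thesis using that[of 0] False p r Hc_0 by simp
next
 case True
 let ?z = "the_inv_into {0<..1} Hc (1 - r)" and ?q = "1 - p"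
 note z = Hc_inverse[OF r]
 have q: "0 < ?q" "?q < 1" using True p by auto
 have hb: "hb r = ln ?z / ln ?q" using True by (simp add: hubs_def)
 have lq: "ln ?q < 0" using q by simp
 have "0 < hb r" unfolding hb using z q by (intro divide_neg_neg) auto
 define k where "k = nat \<lceil>hb r\<rceil> - 1"
 have k: "\<lceil>hb r\<rceil> = int (Suc k)" "real k < hb r" "hb r <= real (Suc k)"
  using \<open>0 < hb r\<close> unfolding k_def by linarith+
 have ln_pow: "ln (?q ^ i) = real i * ln ?q" for i using q by (simp add: ln_realpow)
 show thesis
 proof (rule that[OF k(1)])
  have "real (Suc k) * ln ?q <= ln ?z" using k(3) lq unfolding hb by (simp add: neg_divide_le_eq)
  hence "?q ^ Suc k <= ?z" using z q by (subst ln_le_cancel_iff[symmetric]) (simp_all only: ln_pow zero_less_power)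
  hence "Hc (?q ^ Suc k) <= Hc ?z" using z q by (intro Hc_mono) auto
  thus "Hc (?q ^ Suc k) <= 1 - r" using z by simp
  have "ln ?z < real k * ln ?q" using k(2) lq unfolding hb by (simp add: neg_less_divide_eq)
  hence "?z < ?q ^ k" using z q by (subst ln_less_cancel_iff[symmetric]) (simp_all only: ln_pow zero_less_power)
  moreover have "?q ^ k <= 1" using q by (intro power_le_one) auto
  ultimately have "Hc ?z < Hc (?q ^ k)" using z r by (intro Hc_strict_mono) auto
  thus "1 - r < Hc (?q ^ k)" using z by simp
 qed
qed

text \<open>\<open>prob_large_lower\<close> needs a missed density strictly below
  \<open>1 - \<rho>\<close>, whereas the ceiling gives only the weak bound by \<open>1 - r\<close>;
  strictness comes from \<open>r > \<rho>\<close>.\<close>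

lemma Liminf_rate:
 assumes \<rho>: "theta M X W U K p \<alpha> \<beta> < \<rho>" "0 < \<rho>" and r: "\<rho> < r" "r < 1"
 shows "- ereal (rate \<tau> M X W U K p \<alpha> \<beta> r) <= Liminf at_top (scaled_log_prob M X W U K p \<alpha> \<beta> \<rho>)"
proof -
 have "0 < 1 - r" "1 - r < Hc 1" using \<rho> r theta_eq by auto
 then obtain k where k: "\<lceil>hb r\<rceil> = int (Suc k)" "Hc ((1 - p) ^ Suc k) <= 1 - r" by (rule hubs_ceiling)
 have z: "0 <= (1 - p) ^ Suc k" "(1 - p) ^ Suc k <= 1" using p by (auto intro: power_le_one simp del: power_Suc)
 have "G.palm_total (%i. ennreal (((1 - p) ^ Suc k) ^ i)) < ennreal (1 - \<rho>)"
  unfolding Hc_palm[OF z] using k(2) r by (intro ennreal_lessI) auto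
 then obtain C where C: "0 < C" "\<forall>\<^sub>F n in at_top. ennreal (C * n powr (- ((\<tau> - 2) * real (Suc k)))) <= G.prob_large \<rho> n"
  using G.prob_large_lower[of "Suc k" \<rho>] \<rho> r by auto
 have "\<forall>\<^sub>F n in at_top. C * n powr (- ((\<tau> - 2) * real (Suc k))) <= q_large \<rho> n"
  using C(2) eventually_ge_at_top[of 0]
 proof eventually_elim
  case (elim n)
  hence "ennreal (C * n powr (- ((\<tau> - 2) * real (Suc k)))) <= ennreal (q_large \<rho> n)"
   using prob_large_eq[of \<rho> n] \<rho>(2) by (simp only: less_imp_le)
  thus ?case by (subst (asm) ennreal_le_iff) simp_all
 qed
 from Liminf_log_prob[OF C(1) this] show ?thesis
  unfolding scaled_log_prob_def[abs_def] rate_def k(1) by simp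
qed

text \<open>Here the ceiling gives a strict inequality at \<open>\<rho>\<close> itself:
  \<open>k\<close> hubs miss a density above \<open>1 - \<rho>\<close>, so \<open>Suc k\<close> are
  needed. The loss \<open>e\<close> in the exponent is arbitrary.\<close>

lemma Limsup_rate:
 assumes \<rho>: "theta M X W U K p \<alpha> \<beta> < \<rho>" "0 < \<rho>" "\<rho> < 1"
 shows "Limsup at_top (scaled_log_prob M X W U K p \<alpha> \<beta> \<rho>) <= - ereal (rate \<tau> M X W U K p \<alpha> \<beta> \<rho>)"
proof (rule ereal_le_epsilon2)
 fix e :: real assume e: "0 < e"
 have "0 < 1 - \<rho>" "1 - \<rho> < Hc 1" using \<rho> theta_eq by auto
 then obtain k where k: "\<lceil>hb \<rho>\<rceil> = int (Suc k)" "1 - \<rho> < Hc ((1 - p) ^ k)" by (rule hubs_ceiling)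
 have z: "0 <= (1 - p) ^ k" "(1 - p) ^ k <= 1" using p by (auto intro: power_le_one)
 have "ennreal (1 - \<rho>) < G.palm_total (%i. ennreal (((1 - p) ^ k) ^ i))"
  unfolding Hc_palm[OF z] using k(2) \<rho> by (intro ennreal_lessI) auto
 from G.prob_large_upper[OF \<rho>(2,3) e this]
 obtain C where C: "0 < C" "\<forall>\<^sub>F n in at_top. G.prob_large \<rho> n <= ennreal (C * n powr (- ((\<tau> - 2) * real (Suc k)) + e))" by blast
 have "\<forall>\<^sub>F n in at_top. q_large \<rho> n <= C * n powr (- ((\<tau> - 2) * real (Suc k)) + e)"
  using C(2) eventually_ge_at_top[of 0]
 proof eventually_elim
  case (elim n)
  have "0 <= C * n powr (- ((\<tau> - 2) * real (Suc k)) + e)" using C(1) by simp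
  moreover have "ennreal (q_large \<rho> n) <= ennreal (C * n powr (- ((\<tau> - 2) * real (Suc k)) + e))"
   using elim prob_large_eq[of \<rho> n] \<rho>(2) by (simp only: less_imp_le)
  ultimately show ?case by (simp only: ennreal_le_iff)
 qed
 from Limsup_log_prob[OF C(1) this]
 show "Limsup at_top (scaled_log_prob M X W U K p \<alpha> \<beta> \<rho>) <= - ereal (rate \<tau> M X W U K p \<alpha> \<beta> \<rho>) + ereal e"
  unfolding scaled_log_prob_def[abs_def] rate_def k(1) by simp
qed

end

theorem corollary2p6:
  fixes M :: "'w measure"
    and X :: "nat \<Rightarrow> 'w \<Rightarrow> real ^ 'd"
    and W :: "vertex \<Rightarrow> 'w \<Rightarrow> real"
    and U :: "vertex set \<Rightarrow> 'w \<Rightarrow> real"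
    and K :: kernel
    and p \<beta> \<tau> \<rho> :: real
    and \<alpha> :: ereal
  assumes "ksrg_environment \<tau> M X W U"
    and "\<beta> > 0" and "0 < p" and "p \<le> 1" and "1 < \<alpha>" and "2 < \<tau>" and "kernel_sigma K \<ge> 0"
    and "(ereal \<beta> > beta_c M X W U K p \<alpha> \<and> zeta_long \<alpha> \<tau> (kernel_sigma K) > 0)
         \<or> theta M X W U K p \<alpha> \<beta> = 0"
    and "theta M X W U K p \<alpha> \<beta> < \<rho>" and "\<rho> < 1"
  shows "- (INF r\<in>{\<rho><..<1}. ereal (rate \<tau> M X W U K p \<alpha> \<beta> r))
           \<le> Liminf at_top (\<lambda>n::real. scaled_log_prob M X W U K p \<alpha> \<beta> \<rho> n)
       \<and> Liminf at_top (\<lambda>n::real. scaled_log_prob M X W U K p \<alpha> \<beta> \<rho> n)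
           \<le> Limsup at_top (\<lambda>n::real. scaled_log_prob M X W U K p \<alpha> \<beta> \<rho> n)
       \<and> Limsup at_top (\<lambda>n::real. scaled_log_prob M X W U K p \<alpha> \<beta> \<rho> n)
           \<le> - (INF r\<in>{\<rho>..<1}. ereal (rate \<tau> M X W U K p \<alpha> \<beta> r))"
proof -
 interpret ksrg_env M X W U K p \<beta> \<tau> \<alpha> by standard fact+
 have \<rho>: "0 < \<rho>" using assms(9) by (simp add: theta_def le_less_trans[OF measure_nonneg])
 show ?thesis
 proof (intro conjI)
  show "- (INF r\<in>{\<rho><..<1}. ereal (rate \<tau> M X W U K p \<alpha> \<beta> r)) <= Liminf at_top (scaled_log_prob M X W U K p \<alpha> \<beta> \<rho>)"
  proof (subst ereal_uminus_le_reorder, rule INF_greatest)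
   fix r assume "r \<in> {\<rho><..<1}"
   thus "- Liminf at_top (scaled_log_prob M X W U K p \<alpha> \<beta> \<rho>) <= ereal (rate \<tau> M X W U K p \<alpha> \<beta> r)"
    using Liminf_rate[OF assms(9) \<rho>, of r] by (subst ereal_uminus_le_reorder) auto
  qed
  show "Liminf at_top (scaled_log_prob M X W U K p \<alpha> \<beta> \<rho>) <= Limsup at_top (scaled_log_prob M X W U K p \<alpha> \<beta> \<rho>)"
   by (rule Liminf_le_Limsup) (rule trivial_limit_at_top_linorder)
  \<comment> \<open>The closed end of this range admits \<open>r = \<rho>\<close>, where
    \<open>Limsup_rate\<close> applies directly.\<close>
  have "(INF r\<in>{\<rho>..<1}. ereal (rate \<tau> M X W U K p \<alpha> \<beta> r)) <= ereal (rate \<tau> M X W U K p \<alpha> \<beta> \<rho>)"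
   using assms(10) by (intro INF_lower) auto
  thus "Limsup at_top (scaled_log_prob M X W U K p \<alpha> \<beta> \<rho>) <= - (INF r\<in>{\<rho>..<1}. ereal (rate \<tau> M X W U K p \<alpha> \<beta> r))"
   using Limsup_rate[OF assms(9) \<rho> assms(10)] by (meson ereal_minus_le_minus order_trans)
 qed
qed

end
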